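(* Let $B=C[0,1]$, let $\mathcal{E}:B\langle X,X^*\rangle\to B$ be the $B$-valued distribution specified in the context, and let $\alpha^{(1)}_n,\alpha^{(2)}_n$ be the alternating $B$-valued cumulant maps of $(X,X^* )$ with respect to $\mathcal{E}$. Then, for $b_1\in B$, $$\alpha^{(1)}_1(b_1)=\alpha^{(2)}_1(b_1)=\tau(b_1)1.$$ For $n\in\{2,3,4,5,6,7\}$ and $b_1,\ldots,b_{2n-1}\in B$, $$\alpha^{(1)}_n(b_1,\ldots,b_{2n-1})=\sum_{\pi\in\mathrm{PC}(n)}\Gamma_\pi(1,b_2,b_4,\ldots,b_{2n-2})\,\tau\big(\Lambda_\pi(b_1,b_3,\ldots,b_{2n-3})b_{2n-1}\big),$$ $$\alpha^{(2)}_n(b_1,\ldots,b_{2n-1})=\sum_{\pi\in\mathrm{PC}(n)}\tau\big(\Gamma_\pi(b_1,b_3,\ldots,b_{2n-1})\big)\,\Lambda_\pi(b_2,b_4,\ldots,b_{2n-2}).$$ In particular, $\alpha^{(1)}_n$ and $\alpha^{(2)}_n$ vanish when $n\in\{2,3,5\}$. For $n=8$, with $\pi_4=\{\{1,3\},\{2,4\}\}$ and $b_1,\ldots,b_{15}\in B$, $$\begin{aligned} \alpha^{(1)}_8(b_1,\ldots,b_{15}) &=\sum_{\pi\in\mathrm{PC}(8)}\Gamma_{\pi}(1,b_2,b_4,\ldots,b_{14})\,\tau\big(\Lambda_{\pi}(b_1,b_3,\ldots,b_{13})b_{15}\big)\\ &\quad-\tau(b_2b_6)\,b_4b_8\,\tau(b_{10}b_{14})\,b_{12}\,\tau(\Lambda_{\pi_4}(b_1,b_3,b_5)b_7)\,\tau(\Lambda_{\pi_4}(b_9,b_{11},b_{13})b_{15})\\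 &\quad-\tau(b_2b_6b_{10}b_{14})\,b_4\,\tau(b_8b_{12})\,\tau(\Lambda_{\pi_4}(b_1,b_3,b_5)b_{15})\,\tau(\Lambda_{\pi_4}(b_7,b_9,b_{11})b_{13})\\ &\quad-\tau(b_2b_{14})\,b_4b_8\,\tau(b_6b_{10})\,b_{12}\,\tau(\Lambda_{\pi_4}(b_1,b_3,b_{13})b_{15})\,\tau(\Lambda_{\pi_4}(b_5,b_7,b_9)b_{11})\\ &\quad-\tau(b_2b_6b_{10}b_{14})\,\tau(b_4b_8)\,b_{12}\,\tau(\Lambda_{\pi_4}(b_1,b_{11},b_{13})b_{15})\,\tau(\Lambda_{\pi_4}(b_3,b_5,b_7)b_9), \end{aligned}$$ $$\begin{aligned} \alpha^{(2)}_8(b_1,\ldots,b_{15}) &=\sum_{\pi\in\mathrm{PC}(8)}\tau\big(\Gamma_{\pi}(b_1,b_3,\ldots,b_{15})\big)\,\Lambda_{\pi}(b_2,b_4,\ldots,b_{14})\\ &\quad-\tau(b_1b_5b_9b_{13})\,\tau(b_3b_7)\,\tau(b_{11}b_{15})\,\tau(\Lambda_{\pi_4}(b_2,b_4,b_6)b_8)\,\Lambda_{\pi_4}(b_{10},b_{12},b_{14})\\ &\quad-\tau(b_1b_{13})\,\tau(b_3b_7b_{11}b_{15})\,\tau(b_5b_9)\,\Lambda_{\pi_4}(b_2,b_{12},b_{14})\,\tau(\Lambda_{\pi_4}(b_4,b_6,b_8)b_{10})\\ &\quad-\tau(b_1b_5b_9b_{13})\,\tau(b_3b_{15})\,\tau(b_7b_{11})\,\Lambda_{\pi_4}(b_2,b_4,b_{14})\,\tau(\Lambda_{\pi_4}(b_6,b_8,b_{10})b_{12})\\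 &\quad-\tau(b_1b_5)\,\tau(b_3b_7b_{11}b_{15})\,\tau(b_9b_{13})\,\Lambda_{\pi_4}(b_2,b_4,b_6)\,\tau(\Lambda_{\pi_4}(b_8,b_{10},b_{12})b_{14}). \end{aligned}$$
   Context: Cumulants: write $a_1=X$, $a_2=X^*$. The $B$-valued cumulant maps $\alpha_{(i_1,\ldots,i_m)}:B^{m-1}\to B$ ($m\ge1$, $i_1,\ldots,i_m\in\{1,2\}$) are the multilinear maps determined by the moment-cumulant formula $$\mathcal{E}(a_{i_1}b_1a_{i_2}b_2\cdots b_{m-1}a_{i_m})=\sum_{\pi\in NC(m)}\hat\alpha_{(i_1,\ldots,i_m)}(\pi)[b_1,\ldots,b_{m-1}],$$ where $NC(m)$ is the set of noncrossing partitions of $\{1,\ldots,m\}$ and $\hat\alpha$ is defined recursively by nesting: for the one-block partition, $\hat\alpha_i(1_m)[b_1,\ldots,b_{m-1}]=\alpha_i(b_1,\ldots,b_{m-1})$; otherwise choose an interval block $\{p+1,\ldots,p+q\}$ of $\pi$ ($q<m$), put $c=\alpha_{(i_{p+1},\ldots,i_{p+q})}(b_{p+1},\ldots,b_{p+q-1})$, let $\pi'$ be the remaining partition (relabelled) and $i'$ the remaining indices, and set $\hat\alpha_i(\pi)[b_1,\ldots,b_{m-1}]$ equal to $c\,b_q\,\hat\alpha_{i'}(\pi')[b_{q+1},\ldots,b_{m-1}]$ if $p=0$, to $\hat\alpha_{i'}(\pi')[b_1,\ldots,b_{p-1}]\,b_p\,c$ if $p+q=m$, and to $\hat\alpha_{i'}(\pi')[b_1,\ldots,b_{p-1},b_p\,c\,b_{p+q},b_{p+q+1},\ldots,b_{m-1}]$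 otherwise. Write $\alpha^{(1)}_k=\alpha_{(1,2,1,2,\ldots,1,2)}$ and $\alpha^{(2)}_k=\alpha_{(2,1,2,1,\ldots,2,1)}$ (both of length $2k$). Purely crossing partitions: $\pi\in\mathcal{P}(n)$ is purely crossing if (a) no proper subinterval $\{p+1,\ldots,p+q\}$ of $\{1,\ldots,n\}$ ($0\le p<p+q\le n$, $q<n$) splits $\pi$, i.e. is a union of blocks of $\pi$; and (b) no block of $\pi$ contains neighbors modulo $n$, i.e. $k,k+1$ are in different blocks for $1\le k\le n-1$ and $1,n$ are in different blocks. $\mathrm{PC}(n)$ is the set of purely crossing partitions of $\{1,\ldots,n\}$. R-diagonality: for $\epsilon\in\{1,*\}^n$, $\sigma(\epsilon)$ is the interval partition of $\{1,\ldots,n\}$ whose blocks are the maximal intervals $I$ such that $j,j+1\in I$ implies $\epsilon(j)\ne\epsilon(j+1)$. $X$ is $B$-valued R-diagonal with respect to $\mathcal{E}$ if (1) $\mathcal{E}(Xb_1X^*b_2X\cdots b_{2k-1}X^*b_{2k}X)=0$ for all $k\ge0$, $b_i\in B$; and (2) for all $n\ge1$, $\epsilon\in\{1,*\}^n$, $b_i\in B$, $\mathcal{E}\big(\prod_{I\in\sigma(\epsilon)}(\prod_{j\in I}b_jX^{\epsilon(j)}-\mathcal{E}(\prod_{j\in I}b_jX^{\epsilon(j)}))\big)=0$, products in increasing order of indices. The map $\mathcal{E}$: $B=C[0,1]$, $\tau$ is integration against Lebesgue measure on $[0,1]$, $B\langle X,X^*\rangle$ is the $*$-algebra of polynomials in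 noncommuting variables $X,X^*$ with coefficients in $B$. $\mathcal{E}:B\langle X,X^*\rangle\to B$ is the linear, self-adjoint, $B$-bimodular map that is the identity on $B$, with respect to which $X$ is $B$-valued R-diagonal, and with, for all $n\in\mathbf{N}$ and $b_1,\ldots,b_{2n}\in B$, $$\mathcal{E}(b_1X^*b_2X\cdots b_{2n-1}X^*b_{2n}X)=\sum_{\pi\in\mathcal{P}(n)}b_1\Lambda_\pi(b_3,b_5,\ldots,b_{2n-1})\tau\big(\Gamma_\pi(b_2,b_4,\ldots,b_{2n})\big),$$ $$\mathcal{E}(b_1Xb_2X^*\cdots b_{2n-1}Xb_{2n}X^* )=\sum_{\pi\in\mathcal{P}(n)}\Gamma_\pi(b_1,b_3,\ldots,b_{2n-1})\tau\big(\Lambda_\pi(b_2,b_4,\ldots,b_{2n-2})b_{2n}\big).$$ Here $\mathcal{P}(n)$ is the set of all set partitions of $\{1,\ldots,n\}$; $S_\pi(j)$ is the block of $\pi$ containing $j$. For $g_1,\ldots,g_n\in C[0,1]$, $$\Gamma_\pi(g_1,\ldots,g_n)=\prod_{j\in S_\pi(1)}g_j\prod_{S\in\pi\setminus\{S_\pi(1)\}}\tau\Big(\prod_{j\in S}g_j\Big).$$ Let $J_\pi=\bigcup_{S\in\pi}(S\setminus\{\max S\})$ and $I_\pi(p)=\{j\in\{1,\ldots,p\}: S_\pi(j)\not\subseteq\{1,\ldots,p\}\}$. If $J_\pi=\emptyset$, $\Lambda_\pi(g_1,\ldots,g_{n-1})=\prod_{j=1}^{n-1}g_j$ (equal to $1$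 if $n=1$). Otherwise, for $t\in[0,1]$, $$E(\pi,t)=\Big\{(t_j)_{j\in J_\pi}\in\mathbf{R}^{J_\pi}: \forall p\in\{1,\ldots,n-1\},\ 0<t+\sum_{j\in I_\pi(p)}t_j\le1\Big\},$$ $$\Lambda_\pi(g_1,\ldots,g_{n-1})(t)=\int_{E(\pi,t)}\prod_{p=1}^{n-1}g_p\Big(t+\sum_{j\in I_\pi(p)}t_j\Big)\,d\lambda((t_j)_{j\in J_\pi}),$$ with $\lambda$ the $|J_\pi|$-dimensional Lebesgue measure.
   Formalization: Λ_π is taken as the element of C[0,1] equal to the stated integral for t in (0,1]; at t=0 the literal strict inequality gives a discontinuity (e.g. π={{1},{2,3}}, all g=1: value 0 at t=0, 1 for t>0), so the literal moments would not lie in C[0,1]. *)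

theory Defs
  imports "HOL-Analysis.Analysis"
begin

section \<open>The algebra \<open>B = C[0,1]\<close>\<close>

text \<open>Elements are represented by their extension by zero to the real line.\<close>

typedef C01 = "{f :: real \<Rightarrow> complex. continuous_on {0..1} f \<and> (\<forall>t. t \<notin> {0..1} \<longrightarrow> f t = 0)}"
  morphisms apply_C01 Abs_C01
  by (rule exI[of _ "\<lambda>_. 0"]) auto

setup_lifting type_definition_C01

instantiation C01 :: comm_ring_1
begin

lift_definition zero_C01 :: C01 is "\<lambda>_. 0" by auto
lift_definition one_C01 :: C01 is "\<lambda>t. if t \<in> {0..1} then 1 else 0"
  by (auto intro: continuous_on_eq[OF continuous_on_const])
lift_definition plus_C01 :: "C01 \<Rightarrow> C01 \<Rightarrow> C01" is "\<lambda>f g t. f t + g t"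
  by (auto intro: continuous_intros)
lift_definition minus_C01 :: "C01 \<Rightarrow> C01 \<Rightarrow> C01" is "\<lambda>f g t. f t - g t"
  by (auto intro: continuous_intros)
lift_definition uminus_C01 :: "C01 \<Rightarrow> C01" is "\<lambda>f t. - f t"
  by (auto intro: continuous_intros)
lift_definition times_C01 :: "C01 \<Rightarrow> C01 \<Rightarrow> C01" is "\<lambda>f g t. f t * g t"
  by (auto intro: continuous_intros)

instance
proof
  show "(0::C01) \<noteq> 1" by transfer (metis atLeastAtMost_iff order_refl zero_le_one zero_neq_one)
qed (transfer; force simp: algebra_simps)+

end

lift_definition cscale :: "complex \<Rightarrow> C01 \<Rightarrow> C01" (infixr "*\<^sub>C" 75) is "\<lambda>z f t. z * f t"
  by (auto intro: continuous_intros)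

lift_definition conj_C01 :: "C01 \<Rightarrow> C01" is "\<lambda>f t. cnj (f t)"
  by (auto intro: continuous_intros)

definition tau :: "C01 \<Rightarrow> complex" where
  "tau f = (LINT t:{0..1}|lborel. apply_C01 f t)"


section \<open>The \<open>*\<close>-algebra \<open>B\<langle>X, X\<^sup>*\<rangle>\<close>\<close>

datatype idx = Plain | Star

text \<open>
  The algebra of polynomials in the noncommuting variables \<open>X\<close>, \<open>X\<^sup>*\<close> with coefficients in
  \<open>B\<close> (coefficients do not commute with the variables) is the unital complex algebra freely
  generated by a unital copy of \<open>B\<close> and by \<open>X\<close> and \<open>X\<^sup>*\<close>. It is obtained here from
  formal expressions by dividing out the identities which hold in every such algebra; zero, one,
  negatives and complex scalars come from the copy of \<open>B\<close>.
\<close>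

datatype expr = Coef C01 | Var idx | Add expr expr | Mul expr expr

inductive expr_eq :: "expr \<Rightarrow> expr \<Rightarrow> bool" where
  refl: "expr_eq s s"
| sym: "expr_eq s t \<Longrightarrow> expr_eq t s"
| trans: "expr_eq s t \<Longrightarrow> expr_eq t u \<Longrightarrow> expr_eq s u"
| cong_add: "expr_eq s s' \<Longrightarrow> expr_eq t t' \<Longrightarrow> expr_eq (Add s t) (Add s' t')"
| cong_mul: "expr_eq s s' \<Longrightarrow> expr_eq t t' \<Longrightarrow> expr_eq (Mul s t) (Mul s' t')"
| add_assoc: "expr_eq (Add (Add s t) u) (Add s (Add t u))"
| add_comm: "expr_eq (Add s t) (Add t s)"
| add_zero: "expr_eq (Add (Coef 0) s) s"
| add_neg: "expr_eq (Add (Mul (Coef (- 1)) s) s) (Coef 0)"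
| mul_assoc: "expr_eq (Mul (Mul s t) u) (Mul s (Mul t u))"
| one_mul: "expr_eq (Mul (Coef 1) s) s"
| mul_one: "expr_eq (Mul s (Coef 1)) s"
| distrib_right: "expr_eq (Mul (Add s t) u) (Add (Mul s u) (Mul t u))"
| distrib_left: "expr_eq (Mul s (Add t u)) (Add (Mul s t) (Mul s u))"
| coef_add: "expr_eq (Coef (b + c)) (Add (Coef b) (Coef c))"
| coef_mul: "expr_eq (Coef (b * c)) (Mul (Coef b) (Coef c))"
| scalar_central: "expr_eq (Mul (Coef (z *\<^sub>C 1)) s) (Mul s (Coef (z *\<^sub>C 1)))"

quotient_type ncpoly = expr / expr_eq
proof (rule equivpI)
  show "reflp expr_eq" by (rule reflpI) (rule expr_eq.refl)
  show "symp expr_eq" by (rule sympI) (rule expr_eq.sym)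
  show "transp expr_eq" by (rule transpI) (rule expr_eq.trans)
qed

text \<open>Evaluation at \<open>X = X\<^sup>* = 0\<close>; it is used only to see that \<open>B\<close> embeds.\<close>

primrec const_part :: "expr \<Rightarrow> C01" where
  "const_part (Coef b) = b"
| "const_part (Var _) = 0"
| "const_part (Add s t) = const_part s + const_part t"
| "const_part (Mul s t) = const_part s * const_part t"

lemma expr_eq_const_part: "expr_eq s t \<Longrightarrow> const_part s = const_part t"
  by (induction rule: expr_eq.induct) (auto simp: algebra_simps)

instantiation ncpoly :: ring_1
begin

lift_definition zero_ncpoly :: ncpoly is "Coef 0" .
lift_definition one_ncpoly :: ncpoly is "Coef 1" .
lift_definition plus_ncpoly :: "ncpoly \<Rightarrow> ncpoly \<Rightarrow> ncpoly" is Add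
  by (rule expr_eq.cong_add)
lift_definition times_ncpoly :: "ncpoly \<Rightarrow> ncpoly \<Rightarrow> ncpoly" is Mul
  by (rule expr_eq.cong_mul)
lift_definition uminus_ncpoly :: "ncpoly \<Rightarrow> ncpoly" is "Mul (Coef (- 1))"
  by (intro expr_eq.cong_mul expr_eq.refl)
definition minus_ncpoly :: "ncpoly \<Rightarrow> ncpoly \<Rightarrow> ncpoly" where
  "minus_ncpoly p q = p + - q"

instance
proof
  show "(0::ncpoly) \<noteq> 1" by transfer (metis const_part.simps(1) expr_eq_const_part zero_neq_one)
  show "a - b = a + - b" for a b :: ncpoly by (rule minus_ncpoly_def)
qed (transfer; rule expr_eq.add_assoc expr_eq.add_comm expr_eq.add_zero expr_eq.add_neg
       expr_eq.mul_assoc expr_eq.one_mul expr_eq.mul_one expr_eq.distrib_right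
       expr_eq.distrib_left)+

end

lift_definition coef :: "C01 \<Rightarrow> ncpoly" is Coef .

lemma coef_inject: "coef b = coef c \<longleftrightarrow> b = c"
proof
  assume "coef b = coef c"
  then have "expr_eq (Coef b) (Coef c)"
    by (simp add: coef.abs_eq ncpoly.abs_eq_iff)
  from expr_eq_const_part[OF this] show "b = c" by simp
qed simp

lift_definition gen :: "idx \<Rightarrow> ncpoly" is Var .

fun flip :: "idx \<Rightarrow> idx" where
  "flip Plain = Star"
| "flip Star = Plain"

primrec expr_star :: "expr \<Rightarrow> expr" where
  "expr_star (Coef b) = Coef (conj_C01 b)"
| "expr_star (Var i) = Var (flip i)"
| "expr_star (Add s t) = Add (expr_star s) (expr_star t)"
| "expr_star (Mul s t) = Mul (expr_star t) (expr_star s)"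

lemma conj_C01_simps:
  "conj_C01 0 = 0" "conj_C01 1 = 1" "conj_C01 (- b) = - conj_C01 b"
  "conj_C01 (b + c) = conj_C01 b + conj_C01 c" "conj_C01 (b * c) = conj_C01 c * conj_C01 b"
  "conj_C01 (z *\<^sub>C b) = cnj z *\<^sub>C conj_C01 b"
  by (transfer; force)+

lemma cscale_minus_one: "(- 1) *\<^sub>C 1 = (- 1 :: C01)"
  by transfer auto

lift_definition star :: "ncpoly \<Rightarrow> ncpoly" is expr_star
proof -
  fix s t assume "expr_eq s t"
  then show "expr_eq (expr_star s) (expr_star t)"
  proof (induction rule: expr_eq.induct)
    case (sym s t)
    then show ?case by (blast intro: expr_eq.sym)
  next
    case (trans s t u)
    then show ?case by (blast intro: expr_eq.trans)
  next
    case (add_neg s)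
    have "expr_eq (Mul (expr_star s) (Coef (- 1))) (Mul (Coef (- 1)) (expr_star s))"
      using expr_eq.sym[OF expr_eq.scalar_central[of "- 1"]] by (simp add: cscale_minus_one)
    from expr_eq.trans[OF expr_eq.cong_add[OF this expr_eq.refl] expr_eq.add_neg]
    show ?case by (simp add: conj_C01_simps)
  next
    case (mul_assoc s t u)
    then show ?case by (simp add: expr_eq.sym[OF expr_eq.mul_assoc])
  next
    case (scalar_central z s)
    then show ?case
      by (simp add: conj_C01_simps expr_eq.sym[OF expr_eq.scalar_central])
  qed (simp_all add: conj_C01_simps expr_eq.refl expr_eq.cong_add expr_eq.cong_mul
         expr_eq.add_assoc expr_eq.add_comm expr_eq.add_zero expr_eq.one_mul expr_eq.mul_one
         expr_eq.distrib_right expr_eq.distrib_left expr_eq.coef_add expr_eq.coef_mul)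
qed


section \<open>Partitions\<close>

definition partitions :: "nat \<Rightarrow> nat set set set" where
  "partitions n = {P. partition_on {1..n} P}"

definition noncrossing :: "nat \<Rightarrow> nat set set set" where
  "noncrossing n = {P \<in> partitions n.
     \<not> (\<exists>S\<in>P. \<exists>T\<in>P. S \<noteq> T \<and>
          (\<exists>a b c d. a < b \<and> b < c \<and> c < d \<and> a \<in> S \<and> c \<in> S \<and> b \<in> T \<and> d \<in> T))}"

definition splits :: "nat set \<Rightarrow> nat set set \<Rightarrow> bool" where
  "splits A P \<longleftrightarrow> (\<exists>Q\<subseteq>P. A = \<Union>Q)"

definition purely_crossing :: "nat \<Rightarrow> nat set set set" where
  "purely_crossing n = {P \<in> partitions n.
     (\<forall>p q. p < p + q \<and> p + q \<le> n \<and> q < n \<longrightarrow> \<not> splits {p+1..p+q} P) \<and>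
     (\<forall>S\<in>P. (\<forall>k\<in>{1..n-1}. \<not> (k \<in> S \<and> k + 1 \<in> S)) \<and> \<not> (1 \<in> S \<and> n \<in> S))}"

definition block :: "nat set set \<Rightarrow> nat \<Rightarrow> nat set" where
  "block P j = (THE S. S \<in> P \<and> j \<in> S)"


section \<open>The functions \<open>\<Gamma>\<close> and \<open>\<Lambda>\<close>\<close>

text \<open>A tuple \<open>g\<^sub>1, \<dots>, g\<^sub>n\<close> is given as a list, so that \<open>g\<^sub>j\<close> is \<open>gs ! (j - 1)\<close>.\<close>

definition Gamma_map :: "nat set set \<Rightarrow> C01 list \<Rightarrow> C01" where
  "Gamma_map P gs = (\<Prod>S\<in>P - {block P 1}. tau (\<Prod>j\<in>S. gs ! (j - 1))) *\<^sub>C (\<Prod>j\<in>block P 1. gs ! (j - 1))"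

definition J_set :: "nat set set \<Rightarrow> nat set" where
  "J_set P = (\<Union>S\<in>P. S - {Max S})"

definition I_set :: "nat set set \<Rightarrow> nat \<Rightarrow> nat set" where
  "I_set P p = {j \<in> {1..p}. \<not> block P j \<subseteq> {1..p}}"

definition E_region :: "nat \<Rightarrow> nat set set \<Rightarrow> real \<Rightarrow> (nat \<Rightarrow> real) set" where
  "E_region n P t = {x \<in> J_set P \<rightarrow>\<^sub>E UNIV.
     \<forall>p\<in>{1..n-1}. 0 < t + (\<Sum>j\<in>I_set P p. x j) \<and> t + (\<Sum>j\<in>I_set P p. x j) \<le> 1}"

definition Lambda_integral :: "nat set set \<Rightarrow> C01 list \<Rightarrow> real \<Rightarrow> complex" where
  "Lambda_integral P gs t = (let n = length gs + 1 in
     LINT x:E_region n P t|(\<Pi>\<^sub>M j\<in>J_set P. lborel).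
       (\<Prod>p\<in>{1..n-1}. apply_C01 (gs ! (p - 1)) (t + (\<Sum>j\<in>I_set P p. x j))))"

text \<open>
  If \<open>I_set P p = {}\<close> for some \<open>p < n\<close>, as for \<open>P = {{1}, {2, 3}}\<close>, then the region is empty at
  \<open>t = 0\<close>, and there the integral need not be the limit of its values for \<open>t > 0\<close>. The integral
  thus defines an element of \<open>C[0,1]\<close> only through its values on the half-open interval
  \<open>(0,1]\<close>, on which it is continuous with a limit at \<open>0\<close>.
\<close>

definition Lambda_map :: "nat set set \<Rightarrow> C01 list \<Rightarrow> C01" where
  "Lambda_map P gs = (if J_set P = {} then prod_list gs
     else (THE f. \<forall>t\<in>{0<..1}. apply_C01 f t = Lambda_integral P gs t))"


section \<open>R-diagonality\<close>

text \<open>\<open>word \<epsilon> b js\<close> is the product of the \<open>b\<^sub>j X\<^bsup>\<epsilon>(j)\<^esup>\<close> over the list \<open>js\<close>.\<close>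

definition word :: "(nat \<Rightarrow> idx) \<Rightarrow> (nat \<Rightarrow> C01) \<Rightarrow> nat list \<Rightarrow> ncpoly" where
  "word \<epsilon> b js = prod_list (map (\<lambda>j. coef (b j) * gen (\<epsilon> j)) js)"

definition alternating :: "idx \<Rightarrow> nat \<Rightarrow> idx" where
  "alternating i j = (if odd j then i else flip i)"

definition alternating_interval :: "nat \<Rightarrow> (nat \<Rightarrow> idx) \<Rightarrow> nat set \<Rightarrow> bool" where
  "alternating_interval n \<epsilon> I \<longleftrightarrow>
     (\<exists>p q. 1 \<le> p \<and> p \<le> q \<and> q \<le> n \<and> I = {p..q}) \<and>
     (\<forall>j. j \<in> I \<and> j + 1 \<in> I \<longrightarrow> \<epsilon> j \<noteq> \<epsilon> (j + 1))"

definition sigma_blocks :: "nat \<Rightarrow> (nat \<Rightarrow> idx) \<Rightarrow> nat set set" where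
  "sigma_blocks n \<epsilon> = {I. alternating_interval n \<epsilon> I \<and>
     (\<forall>I'. alternating_interval n \<epsilon> I' \<and> I \<subseteq> I' \<longrightarrow> I' = I)}"

definition R_diagonal :: "(ncpoly \<Rightarrow> C01) \<Rightarrow> bool" where
  "R_diagonal E \<longleftrightarrow>
     (\<forall>k b. E (gen Plain * word (alternating Star) b [1..<2*k+1]) = 0) \<and>
     (\<forall>n\<ge>1. \<forall>\<epsilon> b.
        E (prod_list (map (\<lambda>I. let w = word \<epsilon> b (sorted_list_of_set I) in w - coef (E w))
             (sorted_key_list_of_set Min (sigma_blocks n \<epsilon>)))) = 0)"


section \<open>The distribution\<close>

definition is_distribution :: "(ncpoly \<Rightarrow> C01) \<Rightarrow> bool" where
  "is_distribution E \<longleftrightarrow>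
     (\<forall>p q. E (p + q) = E p + E q) \<and>
     (\<forall>z p. E (coef (z *\<^sub>C 1) * p) = z *\<^sub>C E p) \<and>
     (\<forall>p. E (star p) = conj_C01 (E p)) \<and>
     (\<forall>b p c. E (coef b * p * coef c) = b * E p * c) \<and>
     (\<forall>b. E (coef b) = b) \<and>
     R_diagonal E \<and>
     (\<forall>n\<ge>1. \<forall>b.
        E (word (alternating Star) b [1..<2*n+1]) =
          (\<Sum>P\<in>partitions n. tau (Gamma_map P (map (\<lambda>k. b (2*k)) [1..<n+1])) *\<^sub>C
             (b 1 * Lambda_map P (map (\<lambda>k. b (2*k+1)) [1..<n])))) \<and>
     (\<forall>n\<ge>1. \<forall>b.
        E (word (alternating Plain) b [1..<2*n+1]) =
          (\<Sum>P\<in>partitions n. tau (Lambda_map P (map (\<lambda>k. b (2*k)) [1..<n]) * b (2*n)) *\<^sub>C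
             Gamma_map P (map (\<lambda>k. b (2*k-1)) [1..<n+1])))"


section \<open>Cumulants\<close>

text \<open>
  The maps \<open>\<alpha>\<^sub>(\<^sub>i\<^sub>1\<^sub>,\<^sub>\<dots>\<^sub>,\<^sub>i\<^sub>m\<^sub>)\<close> are given as \<open>\<alpha> [i\<^sub>1, \<dots>, i\<^sub>m]\<close>, applied to the list
  \<open>[b\<^sub>1, \<dots>, b\<^sub>m\<^sub>-\<^sub>1]\<close>, with \<open>Plain\<close> for the index 1 and \<open>Star\<close> for the index 2.
\<close>

type_synonym cumulant_family = "idx list \<Rightarrow> C01 list \<Rightarrow> C01"

definition interval_block :: "nat \<Rightarrow> nat set set \<Rightarrow> nat \<times> nat \<Rightarrow> bool" where
  "interval_block m P = (\<lambda>(p, q). 0 < q \<and> q < m \<and> p + q \<le> m \<and> {p+1..p+q} \<in> P)"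

lemma interval_block_SOME:
  assumes "\<exists>pq. interval_block m P pq" and "pq = (SOME pq. interval_block m P pq)"
  shows "0 < snd pq \<and> fst pq + snd pq \<le> m"
proof -
  have "interval_block m P pq"
    unfolding assms(2) by (rule someI_ex[OF assms(1)])
  then show ?thesis by (simp add: interval_block_def split_beta)
qed

definition remove_interval :: "nat set set \<Rightarrow> nat \<Rightarrow> nat \<Rightarrow> nat set set" where
  "remove_interval P p q = (\<lambda>S. (\<lambda>j. if j \<le> p then j else j - q) ` S) ` (P - {{p+1..p+q}})"

text \<open>
  The first two cases exclude each other, and a noncrossing partition falls under one of them.
  The value for a noncrossing partition does not depend on the chosen interval block.
\<close>

function nest :: "cumulant_family \<Rightarrow> idx list \<Rightarrow> nat set set \<Rightarrow> C01 list \<Rightarrow> C01" where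
  "nest \<alpha> ix P bs =
    (if P = {{1..length ix}} then \<alpha> ix bs
     else if \<exists>pq. interval_block (length ix) P pq then
       (let m = length ix;
            pq = (SOME pq. interval_block (length ix) P pq);
            p = fst pq; q = snd pq;
            c = \<alpha> (take q (drop p ix)) (take (q - 1) (drop p bs));
            P' = remove_interval P p q;
            ix' = take p ix @ drop (p + q) ix;
            b = (\<lambda>k. bs ! (k - 1))
        in if p = 0 then c * b q * nest \<alpha> ix' P' (drop q bs)
           else if p + q = m then nest \<alpha> ix' P' (take (p - 1) bs) * b p * c
           else nest \<alpha> ix' P' (take (p - 1) bs @ [b p * c * b (p + q)] @ drop (p + q) bs))
     else 0)"
  by pat_completeness (elim Pair_inject, hypsubst, rule HOL.refl)
termination
proof (relation "Wellfounded.measure (\<lambda>(\<alpha>, ix, P, bs). length ix)", goal_cases)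
  case 1
  then show ?case by simp
next
  case (2 \<alpha> ix P bs m pq p q c P' ix')
  show ?case using interval_block_SOME[OF 2(2,4)] 2(5,6) by (auto simp: 2(9))
next
  case (3 \<alpha> ix P bs m pq p q c P' ix')
  show ?case using interval_block_SOME[OF 3(2,4)] 3(5,6) by (auto simp: 3(9))
next
  case (4 \<alpha> ix P bs m pq p q c P' ix')
  show ?case using interval_block_SOME[OF 4(2,4)] 4(5,6) by (auto simp: 4(9))
qed

declare nest.simps [simp del]

definition multilinear :: "nat \<Rightarrow> (C01 list \<Rightarrow> C01) \<Rightarrow> bool" where
  "multilinear n f \<longleftrightarrow> (\<forall>bs k. length bs = n \<and> k < n \<longrightarrow>
     (\<forall>u v. f (bs[k := u + v]) = f (bs[k := u]) + f (bs[k := v])) \<and>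
     (\<forall>z u. f (bs[k := z *\<^sub>C u]) = z *\<^sub>C f (bs[k := u])))"

definition is_cumulant_family :: "(ncpoly \<Rightarrow> C01) \<Rightarrow> cumulant_family \<Rightarrow> bool" where
  "is_cumulant_family E \<alpha> \<longleftrightarrow>
     (\<forall>ix. ix \<noteq> [] \<longrightarrow> multilinear (length ix - 1) (\<alpha> ix)) \<and>
     (\<forall>ix bs. ix \<noteq> [] \<and> length bs = length ix - 1 \<longrightarrow>
        E (gen (hd ix) * prod_list (map2 (\<lambda>b i. coef b * gen i) bs (tl ix))) =
          (\<Sum>P\<in>noncrossing (length ix). nest \<alpha> ix P bs))"

definition alternating_cumulant :: "cumulant_family \<Rightarrow> idx \<Rightarrow> nat \<Rightarrow> (nat \<Rightarrow> C01) \<Rightarrow> C01" where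
  "alternating_cumulant \<alpha> i n b = \<alpha> (map (alternating i) [1..<2*n+1]) (map b [1..<2*n])"

abbreviation alpha1 :: "cumulant_family \<Rightarrow> nat \<Rightarrow> (nat \<Rightarrow> C01) \<Rightarrow> C01" where
  "alpha1 \<alpha> \<equiv> alternating_cumulant \<alpha> Plain"

abbreviation alpha2 :: "cumulant_family \<Rightarrow> nat \<Rightarrow> (nat \<Rightarrow> C01) \<Rightarrow> C01" where
  "alpha2 \<alpha> \<equiv> alternating_cumulant \<alpha> Star"

definition pi4 :: "nat set set" where
  "pi4 = {{1, 3}, {2, 4}}"

end

theory Submission
  imports Defs
begin

text \<open>
  The moments of the given distribution are sums over all set partitions, and the cumulants turn
  out to be the sums of the same terms over those set partitions which are irreducible in the
  following sense. A set partition of \<open>{1..n}\<close> is regarded as an equivalence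
  relation on every second point of a cycle of \<open>2 * n\<close> points, the points lying
  between the letters of an alternating word of length \<open>2 * n\<close>. An arc between two
  points is closed (\<open>closes\<close>) if every solution of a certain linear system takes
  equal values at its ends. The closed arcs obey exchange rules (\<open>arcs\<close>), and from
  these alone it follows that they cut the word along a noncrossing partition of its letters
  (\<open>atoms_noncrossing\<close>). The set partition is irreducible if that noncrossing
  partition has one block, that is, if only the whole word is cut out by an arc.

  The analytic part says that the summand of a set partition factors at a closed arc in the way
  in which nested cumulants are built. Directly in terms of the integrals which define
  \<open>\<Lambda>\<close> this would be a laborious change of variables. Instead, the summand
  is the limit of normalised sums over the integer points of the linear system, which also
  describes the expected entries of products of random Vandermonde matrices
  (\<open>grid_limit_partition_term\<close>). For every grid size these sums factor exactly at a
  closed arc, for a simple reason: a solution is a pair of solutions for the two parts which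
  agree at the ends of the arc (\<open>solves_split\<close>, \<open>full_sum_split\<close>).
  Limits along grids are unique, so the factorisation is inherited by the limit
  (\<open>closed_arc.rel_term_left\<close>, \<open>closed_arc.rel_term_right\<close>,
  \<open>closed_arc.rel_term_mid\<close>).

  R-diagonality kills the moments of odd alternating words, hence their cumulants
  (\<open>odd_cumulant\<close>), so only noncrossing partitions into blocks of even length
  count. For these, induction on the length identifies the nested cumulant with the sum over all
  set partitions that are cut along the given noncrossing partition (\<open>nest_even\<close>),
  and subtracting from the moment leaves the irreducible set partitions
  (\<open>even_cumulant\<close>). This describes the cumulants of every order.

  It remains to compare irreducible with purely crossing partitions. Pure crossing forbids all
  closed arcs except those between two points of the partitioned parity that are neither too
  short nor too long. Such an arc decomposes the partition into two purely crossing parts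
  (\<open>closed_arc.pure_parts\<close>), each of size at least four because
  \<open>PC(2)\<close> and \<open>PC(3)\<close> are empty. Up to size seven there is no room for
  this, and the two notions agree. In size eight both parts must be the crossing
  \<open>pi4\<close>, and there are four places at which to insert it into itself; these four
  terms, evaluated by the factorisation rules, are the corrections.
\<close>

section \<open>Noncrossing partitions from families of arcs\<close>

text \<open>
  The letters \<open>1, \<dots>, m\<close> of a word sit between the points \<open>0, \<dots>,
  m\<close>, and \<open>C u v\<close> says that the subword of the letters \<open>u+1, \<dots>,
  v\<close> is cut out by an arc from \<open>u\<close> to \<open>v\<close>. The exchange rules
  are those which hold when an arc stands for the equality of two quantities attached to its end
  points: arcs can be concatenated, subtracted from each other, and two crossing arcs identify
  all four end points.
\<close>

locale arcs =
  fixes m :: nat and C :: "nat \<Rightarrow> nat \<Rightarrow> bool"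
  assumes arc_less: "C u v \<Longrightarrow> u < v" and arc_le: "C u v \<Longrightarrow> v \<le> m"
    and arc_full: "0 < m \<Longrightarrow> C 0 m"
    and arc_join: "C u v \<Longrightarrow> C v w \<Longrightarrow> C u w"
    and arc_left: "C u w \<Longrightarrow> C u v \<Longrightarrow> v < w \<Longrightarrow> C v w"
    and arc_right: "C u w \<Longrightarrow> C v w \<Longrightarrow> u < v \<Longrightarrow> C u v"
    and arc_cross: "C u v \<Longrightarrow> C u' v' \<Longrightarrow> u < u' \<Longrightarrow> u' < v \<Longrightarrow> v < v' \<Longrightarrow> C u u'"

definition unsep :: "nat \<Rightarrow> (nat \<Rightarrow> nat \<Rightarrow> bool) \<Rightarrow> (nat \<times> nat) set" where
  "unsep m C = {(x, y). x \<in> {1..m} \<and> y \<in> {1..m} \<and> (\<forall>u v. C u v \<longrightarrow> (x \<in> {u<..v} \<longleftrightarrow> y \<in> {u<..v}))}"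

definition atoms :: "nat \<Rightarrow> (nat \<Rightarrow> nat \<Rightarrow> bool) \<Rightarrow> nat set set" where
  "atoms m C = {1..m} // unsep m C"

lemma equiv_unsep: "equiv {1..m} (unsep m C)"
  by (auto simp: equiv_def refl_on_def sym_def trans_def unsep_def)

lemma partition_on_atoms: "partition_on {1..m} (atoms m C)"
  unfolding atoms_def by (rule partition_on_quotient[OF equiv_unsep])

lemma atoms_iff:
  assumes "S \<in> atoms m C" "x \<in> S"
  shows "y \<in> S \<longleftrightarrow> (x, y) \<in> unsep m C"
proof -
  obtain z where z: "S = unsep m C `` {z}" using assms(1) by (auto simp: atoms_def elim: quotientE)
  then have "(z, x) \<in> unsep m C" using assms(2) by simp
  then have "unsep m C `` {z} = unsep m C `` {x}" by (rule equiv_class_eq[OF equiv_unsep])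
  then show ?thesis using z by simp
qed

lemma noncrossingD:
  assumes "P \<in> noncrossing m" "S \<in> P" "T \<in> P" "a < b" "b < c" "c < d"
    "a \<in> S" "c \<in> S" "b \<in> T" "d \<in> T"
  shows "S = T"
  using assms unfolding noncrossing_def by blast

text \<open>
  A window which separates two atoms contains one of them and misses the other, but an interval
  that contains \<open>a\<close> and \<open>c\<close> also contains the point \<open>b\<close>
  between them.
\<close>

lemma atoms_noncrossing: "atoms m C \<in> noncrossing m"
proof -
  have False if S: "S \<in> atoms m C" and T: "T \<in> atoms m C" and "S \<noteq> T"
    and lt: "a < b" "b < c" "c < d" and el: "a \<in> S" "c \<in> S" "b \<in> T" "d \<in> T" for S T a b c d
  proof -
    have ac: "(a, c) \<in> unsep m C" and bd: "(b, d) \<in> unsep m C"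
      using atoms_iff S T el by blast+
    have "(a, b) \<notin> unsep m C"
      using atoms_iff[OF S el(1)] el(3) S T \<open>S \<noteq> T\<close> partition_on_atoms[of m C]
      by (metis disjnt_iff pairwiseD partition_on_def disjoint_def disjoint_iff)
    moreover have "a \<in> {1..m}" "b \<in> {1..m}" using ac bd by (auto simp: unsep_def)
    ultimately obtain u v where uv: "C u v" "(a \<in> {u<..v}) \<noteq> (b \<in> {u<..v})"
      unfolding unsep_def by auto
    have "(a \<in> {u<..v}) = (c \<in> {u<..v})" "(b \<in> {u<..v}) = (d \<in> {u<..v})"
      using ac bd uv(1) unfolding unsep_def by auto
    then show False using uv(2) lt by auto
  qed
  then show ?thesis
    unfolding noncrossing_def partitions_def using partition_on_atoms[of m C] by blast
qed

text \<open>
  An interval atom is cut off from its neighbours by arcs, and the exchange rules assemble from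
  these a single arc around exactly the atom. This is what turns a block of a noncrossing
  partition, a purely combinatorial datum, into a subword at which sums can be factored.
\<close>

lemma (in arcs) arc_of_interval_atom:
  assumes W: "{p+1..p+q} \<in> atoms m C" and q: "0 < q"
  shows "C p (p + q)"
proof -
  have pin: "p+1 \<in> {p+1..p+q}" using q by simp
  have unsep_in: "(p+1, y) \<in> unsep m C \<longleftrightarrow> y \<in> {p+1..p+q}" for y
    using atoms_iff[OF W pin] by simp
  have ends: "(p+1, p+q) \<in> unsep m C" using unsep_in q by simp
  then have pqm: "p + q \<le> m" and m0: "0 < m" by (auto simp: unsep_def)
  have whole: "{u<..v} \<inter> {p+1..p+q} = {} \<or> u \<le> p \<and> p + q \<le> v" if "C u v" for u v
  proof -
    have "p+1 \<in> {u<..v} \<longleftrightarrow> y \<in> {u<..v}" if "y \<in> {p+1..p+q}" for y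
      using unsep_in[of y] that \<open>C u v\<close> by (auto simp: unsep_def)
    moreover have "p+q \<in> {p+1..p+q}" using q by simp
    ultimately show ?thesis using q by (cases "p+1 \<in> {u<..v}") (fastforce, blast)
  qed
  \<comment> \<open>The full arc covers the atom. A covering arc of least length must start at
    \<open>p\<close> and end at \<open>p+q\<close>: otherwise an arc separating the atom from the
    letter next to it shortens the covering arc by an exchange rule.\<close>
  define cand where "cand = {(u, v). C u v \<and> u \<le> p \<and> p + q \<le> v}"
  have "(0, m) \<in> cand" using arc_full m0 pqm by (auto simp: cand_def)
  then obtain uv where uvc: "uv \<in> cand"
    and min: "\<And>z. z \<in> cand \<Longrightarrow> snd uv - fst uv \<le> snd z - fst z"
    using ex_has_least_nat[of "\<lambda>z. z \<in> cand" "(0,m)" "\<lambda>z. snd z - fst z"] by blast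
  obtain u v where uv: "uv = (u, v)" by (cases uv)
  have C: "C u v" "u \<le> p" "p + q \<le> v" using uvc uv by (auto simp: cand_def)
  have min': "v - u \<le> v' - u'" if "C u' v'" "u' \<le> p" "p + q \<le> v'" for u' v'
    using min[of "(u', v')"] that uv by (auto simp: cand_def)
  have vm: "v \<le> m" using arc_le C by blast
  have "u = p"
  proof (rule ccontr)
    assume "u \<noteq> p"
    then have up: "u < p" using C by simp
    then have "u + 1 \<notin> {p+1..p+q}" by simp
    then have "(p+1, u+1) \<notin> unsep m C" using unsep_in by blast
    moreover have "u + 1 \<in> {1..m}" "p + 1 \<in> {1..m}" using up pqm q by auto
    ultimately obtain u' v' where s: "C u' v'" "(p+1 \<in> {u'<..v'}) \<noteq> (u+1 \<in> {u'<..v'})"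
      unfolding unsep_def by auto
    show False
    proof (cases "p+1 \<in> {u'<..v'}")
      case True
      with s whole[OF s(1)] pin up q have u': "u < u'" "u' \<le> p" "p + q \<le> v'" by auto
      show False
      proof (cases "v' \<le> v")
        case True
        then show False using min'[OF s(1)] u' C by linarith
      next
        case False
        then have "C u u'" using arc_cross[OF C(1) s(1)] u' C q by simp
        then have "C u' v" using arc_left[OF C(1), of u'] u' q C(3) by simp
        from min'[OF this] show False using u' C by linarith
      qed
    next
      case False
      with s have u': "u' \<le> u" "u < v'" by auto
      with False up have v': "v' \<le> p" by auto
      have "C u v'"
      proof (cases "u' = u")
        case False
        with u' have lt: "u' < u" by simp
        have "v' < v" using v' C q by simp
        then have "C u' u" using arc_cross[OF s(1) C(1) lt] u' by simp
        then show ?thesis using arc_left[OF s(1), of u] u' by simp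
      qed (use s in simp)
      then have "C v' v" using arc_left[OF C(1), of v'] C(3) v' q by simp
      from min'[OF this] show False using v' C u' by linarith
    qed
  qed
  moreover have "v = p + q"
  proof (rule ccontr)
    assume "v \<noteq> p + q"
    then have pv: "p + q < v" using C by simp
    then have "v \<notin> {p+1..p+q}" by simp
    then have "(p+1, v) \<notin> unsep m C" using unsep_in by blast
    moreover have "v \<in> {1..m}" "p + 1 \<in> {1..m}" using pv vm pqm q by auto
    ultimately obtain u' v' where s: "C u' v'" "(p+1 \<in> {u'<..v'}) \<noteq> (v \<in> {u'<..v'})"
      unfolding unsep_def by auto
    show False
    proof (cases "p+1 \<in> {u'<..v'}")
      case True
      with s whole[OF s(1)] pin pv have u': "v' < v" "u' \<le> p" "p + q \<le> v'" by auto
      have "u' < u" using \<open>u = p\<close> min'[OF s(1) u'(2,3)] u' C(2) q by linarith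
      then have "C u' u" using arc_cross[OF s(1) C(1)] u' \<open>u = p\<close> q by simp
      then have "C u v'" using arc_left[OF s(1), of u] u' \<open>u = p\<close> q by simp
      from min'[OF this C(2) u'(3)] show False using u' arc_less[OF s(1)] \<open>u' < u\<close> \<open>u = p\<close> q by linarith
    next
      case False
      with s have u': "u' < v" "v \<le> v'" by auto
      with False C q have u'': "p < u'" using pv by auto
      then have u3: "p + q \<le> u'" using whole[OF s(1)] u' pv by force
      have "C u u'"
      proof (cases "v' = v")
        case True
        then show ?thesis using arc_right[OF C(1), of u'] s(1) u'' \<open>u = p\<close> by simp
      next
        case False
        then show ?thesis using arc_cross[OF C(1) s(1)] u' u'' \<open>u = p\<close> by simp
      qed
      from min'[OF this C(2) u3] show False using u' C u'' by linarith
    qed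
  qed
  ultimately show ?thesis using C by simp
qed

lemma atoms_trivial_iff:
  assumes "arcs m C" and m: "0 < m"
  shows "atoms m C = {{1..m}} \<longleftrightarrow> (\<forall>u v. C u v \<longrightarrow> u = 0 \<and> v = m)"
proof
  assume A: "atoms m C = {{1..m}}"
  show "\<forall>u v. C u v \<longrightarrow> u = 0 \<and> v = m"
  proof (intro allI impI)
    fix u v assume C: "C u v"
    then have uv: "u < v" "v \<le> m" using arcs.arc_less arcs.arc_le assms by blast+
    have all: "(x, y) \<in> unsep m C" if "x \<in> {1..m}" "y \<in> {1..m}" for x y
      using atoms_iff[of "{1..m}" m C x y] A that by simp
    have "(1, v) \<in> unsep m C" "(m, v) \<in> unsep m C" using uv by (auto intro!: all)
    then have "(1 \<in> {u<..v}) = (v \<in> {u<..v})" "(m \<in> {u<..v}) = (v \<in> {u<..v})"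
      using C unfolding unsep_def by blast+
    then show "u = 0 \<and> v = m" using uv by auto
  qed
next
  assume H: "\<forall>u v. C u v \<longrightarrow> u = 0 \<and> v = m"
  have "x \<in> {u<..v} \<longleftrightarrow> y \<in> {u<..v}" if "C u v" "x \<in> {1..m}" "y \<in> {1..m}" for u v x y
    using H[rule_format, OF that(1)] that(2,3) by auto
  then have "unsep m C = {1..m} \<times> {1..m}" unfolding unsep_def by blast
  then have "atoms m C \<subseteq> {{1..m}}" by (auto simp: atoms_def quotient_def)
  moreover have "atoms m C \<noteq> {}" using m by (auto simp: atoms_def quotient_def)
  ultimately show "atoms m C = {{1..m}}" by blast
qed

section \<open>Interval blocks and their removal\<close>

lemma partition_on_eq_iff_rel:
  assumes "partition_on A P" "partition_on A Q"
    and "\<And>x y. x \<in> A \<Longrightarrow> y \<in> A \<Longrightarrow> (\<exists>S\<in>P. x \<in> S \<and> y \<in> S) \<longleftrightarrow> (\<exists>S\<in>Q. x \<in> S \<and> y \<in> S)"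
  shows "P = Q"
proof -
  have gen: "P \<subseteq> Q" if P: "partition_on A P" and Q: "partition_on A Q"
    and r: "\<And>x y. x \<in> A \<Longrightarrow> y \<in> A \<Longrightarrow> (\<exists>S\<in>P. x \<in> S \<and> y \<in> S) \<longleftrightarrow> (\<exists>S\<in>Q. x \<in> S \<and> y \<in> S)" for P Q
  proof
    fix S assume S: "S \<in> P"
    then have "S \<noteq> {}" "S \<subseteq> A" using P by (auto simp: partition_on_def)
    then obtain x where x: "x \<in> S" "x \<in> A" by blast
    then obtain T where T: "T \<in> Q" "x \<in> T" using r[of x x] S by blast
    then have TA: "T \<subseteq> A" using Q by (auto simp: partition_on_def)
    have u1: "U = S" if "U \<in> P" "x \<in> U" for U
      using P S x that by (auto simp: partition_on_def disjoint_def)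
    have u2: "U = T" if "U \<in> Q" "x \<in> U" for U
      using Q T x that by (auto simp: partition_on_def disjoint_def)
    have "y \<in> S \<longleftrightarrow> y \<in> T" if "y \<in> A" for y
    proof
      assume "y \<in> S"
      then obtain U where "U \<in> Q" "x \<in> U" "y \<in> U" using r[OF x(2) \<open>y \<in> A\<close>] S x by auto
      then show "y \<in> T" using u2 by simp
    next
      assume "y \<in> T"
      then obtain U where "U \<in> P" "x \<in> U" "y \<in> U" using r[OF x(2) \<open>y \<in> A\<close>] T by auto
      then show "y \<in> S" using u1 by simp
    qed
    then have "S = T" using \<open>S \<subseteq> A\<close> TA by blast
    then show "S \<in> Q" using T by simp
  qed
  show ?thesis
    by (rule subset_antisym; rule gen; (fact assms | simp only: assms(3)))
qed

definition collapse :: "nat \<Rightarrow> nat \<Rightarrow> nat \<Rightarrow> nat" where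
  "collapse p q j = (if j \<le> p then j else j - q)"

definition expand :: "nat \<Rightarrow> nat \<Rightarrow> nat \<Rightarrow> nat" where
  "expand p q j = (if j \<le> p then j else j + q)"

lemma remove_interval_alt: "remove_interval P p q = (`) (collapse p q) ` (P - {{p+1..p+q}})"
  by (simp add: remove_interval_def collapse_def[abs_def])

lemma collapse_inj: "inj_on (collapse p q) (- {p+1..p+q})"
  by (auto simp: inj_on_def collapse_def split: if_splits)

lemma expand_collapse: "j \<notin> {p+1..p+q} \<Longrightarrow> expand p q (collapse p q j) = j"
  by (auto simp: expand_def collapse_def)

lemma collapse_expand: "collapse p q (expand p q j) = j"
  by (auto simp: expand_def collapse_def)

lemma expand_out: "expand p q j \<notin> {p+1..p+q}"
  by (auto simp: expand_def)

lemma remove_interval_inj: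
  assumes "partition_on A P" "partition_on A Q" "{p+1..p+q} \<in> P" "{p+1..p+q} \<in> Q"
    and "remove_interval P p q = remove_interval Q p q"
  shows "P = Q"
proof -
  let ?W = "{p+1..p+q}"
  have sub: "R - {?W} \<subseteq> Pow (- ?W)" if "partition_on A R" "?W \<in> R" for R
    using that by (auto simp: partition_on_def disjoint_def)
  have "inj_on ((`) (collapse p q)) (Pow (- ?W))"
    by (rule inj_on_image_Pow[OF collapse_inj])
  then have "P - {?W} = Q - {?W}"
    using assms(5) sub[OF assms(1,3)] sub[OF assms(2,4)]
    unfolding remove_interval_alt by (metis inj_on_image_eq_iff)
  then show ?thesis using assms(3,4) by blast
qed

lemma remove_interval_partition:
  assumes P: "partition_on {1..m} P" and W: "{p+1..p+q} \<in> P" and pq: "p + q \<le> m"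
  shows "partition_on {1..m-q} (remove_interval P p q)"
    and "\<And>x y. x \<in> {1..m-q} \<Longrightarrow> y \<in> {1..m-q} \<Longrightarrow>
      (\<exists>S\<in>remove_interval P p q. x \<in> S \<and> y \<in> S) \<longleftrightarrow> (\<exists>S\<in>P. expand p q x \<in> S \<and> expand p q y \<in> S)"
proof -
  let ?W = "{p+1..p+q}"
  have sub: "S \<subseteq> - ?W" if "S \<in> P - {?W}" for S
    using that P W by (auto simp: partition_on_def disjoint_def)
  have part': "partition_on ({1..m} - ?W) (P - {?W})"
  proof -
    have "\<Union>(P - {?W}) = {1..m} - ?W"
      using P W sub unfolding partition_on_def by blast
    then show ?thesis using P by (auto simp: partition_on_def disjoint_def)
  qed
  have inj: "inj_on (collapse p q) ({1..m} - ?W)"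
    by (rule inj_on_subset[OF collapse_inj]) auto
  have img: "collapse p q ` ({1..m} - ?W) = {1..m-q}"
  proof
    show "collapse p q ` ({1..m} - ?W) \<subseteq> {1..m-q}"
      using pq by (auto simp: collapse_def split: if_splits)
    show "{1..m-q} \<subseteq> collapse p q ` ({1..m} - ?W)"
    proof
      fix x assume "x \<in> {1..m-q}"
      then have "expand p q x \<in> {1..m} - ?W" by (auto simp: expand_def)
      then show "x \<in> collapse p q ` ({1..m} - ?W)"
        by (metis collapse_expand imageI)
    qed
  qed
  have "(`) (collapse p q) ` (P - {?W}) - {{}} = (`) (collapse p q) ` (P - {?W})"
    using part' by (auto simp: partition_on_def)
  with partition_on_inj_image[OF part' inj] show "partition_on {1..m-q} (remove_interval P p q)"
    unfolding remove_interval_alt img by simp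
  fix x y assume "x \<in> {1..m-q}" "y \<in> {1..m-q}"
  have mem: "x \<in> collapse p q ` S \<longleftrightarrow> expand p q x \<in> S" if "S \<in> P - {?W}" for S x
  proof
    assume "x \<in> collapse p q ` S"
    then obtain z where z: "z \<in> S" "x = collapse p q z" by auto
    then have "z \<notin> ?W" using sub[OF that] by blast
    then show "expand p q x \<in> S" using z expand_collapse by simp
  next
    assume "expand p q x \<in> S"
    then show "x \<in> collapse p q ` S" using imageI[of "expand p q x" S "collapse p q"] by (simp add: collapse_expand)
  qed
  show "(\<exists>S\<in>remove_interval P p q. x \<in> S \<and> y \<in> S) \<longleftrightarrow> (\<exists>S\<in>P. expand p q x \<in> S \<and> expand p q y \<in> S)"
    unfolding remove_interval_alt using mem expand_out[of p q x] by (auto; blast)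
qed

lemma remove_interval_noncrossing:
  assumes P: "P \<in> noncrossing m" and W: "{p+1..p+q} \<in> P" and pq: "p + q \<le> m"
  shows "remove_interval P p q \<in> noncrossing (m - q)"
proof -
  let ?W = "{p+1..p+q}"
  have part: "partition_on {1..m} P" using P by (simp add: noncrossing_def partitions_def)
  have sub: "S \<subseteq> - ?W" if "S \<in> P - {?W}" for S
    using that part W by (auto simp: partition_on_def disjoint_def)
  have mem: "x \<in> collapse p q ` S \<Longrightarrow> expand p q x \<in> S" if "S \<in> P - {?W}" for S x
    using sub[OF that] expand_collapse[of _ p q] by fastforce
  have mono: "x < y \<Longrightarrow> expand p q x < expand p q y" for x y
    by (auto simp: expand_def)
  have False if "S \<in> remove_interval P p q" "T \<in> remove_interval P p q" "S \<noteq> T"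
      "a < b" "b < c" "c < d" "a \<in> S" "c \<in> S" "b \<in> T" "d \<in> T" for S T a b c d
  proof -
    from that obtain S' T' where S': "S' \<in> P - {?W}" "S = collapse p q ` S'"
      and T': "T' \<in> P - {?W}" "T = collapse p q ` T'"
      unfolding remove_interval_alt by auto
    have "S' = T'"
      by (rule noncrossingD[OF P, of S' T' "expand p q a" "expand p q b" "expand p q c" "expand p q d"])
        (use mem S' T' mono that in auto)
    then show False using that S' T' by auto
  qed
  then show ?thesis
    using remove_interval_partition(1)[OF part W pq]
    unfolding noncrossing_def partitions_def by blast
qed

text \<open>
  The nesting recursion starts from an interval block, so that it never reaches its default
  value \<open>0\<close> on a noncrossing partition.
\<close>

lemma noncrossing_has_interval_block:
  assumes P: "P \<in> noncrossing m" and ne: "P \<noteq> {{1..m}}" and m: "0 < m"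
  shows "\<exists>pq. interval_block m P pq"
proof -
  have part: "partition_on {1..m} P" using P by (simp add: noncrossing_def partitions_def)
  have fin: "finite S" "S \<noteq> {}" "S \<subseteq> {1..m}" if "S \<in> P" for S
  proof -
    show "S \<noteq> {}" "S \<subseteq> {1..m}" using part that by (auto simp: partition_on_def)
    then show "finite S" by (auto intro: finite_subset)
  qed
  have "P \<noteq> {}" using part m by (auto simp: partition_on_def)
  \<comment> \<open>A block of least extent is an interval: a point missing from it lies in a
    block which, by noncrossing, is enclosed and thus of smaller extent.\<close>
  then obtain S where S: "S \<in> P" and min: "\<And>T. T \<in> P \<Longrightarrow> Max S - Min S \<le> Max T - Min T"
    using ex_has_least_nat[of "\<lambda>S. S \<in> P" _ "\<lambda>S. Max S - Min S"] by blast
  have int: "S = {Min S..Max S}"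
  proof
    show "S \<subseteq> {Min S..Max S}" using fin[OF S] by auto
    show "{Min S..Max S} \<subseteq> S"
    proof
      fix x assume x: "x \<in> {Min S..Max S}"
      show "x \<in> S"
      proof (rule ccontr)
        assume nx: "x \<notin> S"
        have mm: "Min S \<in> S" "Max S \<in> S" using fin[OF S] by auto
        with x nx have lt: "Min S < x" "x < Max S" by (auto simp: le_less)
        have "x \<in> {1..m}" using x mm fin[OF S] by (meson atLeastAtMost_iff le_trans subsetD)
        then obtain T where T: "T \<in> P" "x \<in> T" using part unfolding partition_on_def by blast
        then have "T \<noteq> S" using nx by auto
        then have disj: "T \<inter> S = {}" using part S T by (auto simp: partition_on_def disjoint_def)
        have "Min S < y \<and> y < Max S" if y: "y \<in> T" for y
        proof (rule ccontr)
          assume "\<not> ?thesis"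
          moreover have "y \<noteq> Min S" "y \<noteq> Max S" using disj mm y by auto
          ultimately consider "y < Min S" | "Max S < y" by linarith
          then show False
          proof cases
            case 1
            then show False
              using noncrossingD[OF P T(1) S, of y "Min S" x "Max S"] T y mm lt \<open>T \<noteq> S\<close> by simp
          next
            case 2
            then show False
              using noncrossingD[OF P S T(1), of "Min S" x "Max S" y] T y mm lt \<open>T \<noteq> S\<close> by simp
          qed
        qed
        moreover have "Min T \<in> T" "Max T \<in> T" using fin[OF T(1)] by auto
        ultimately have "Max T - Min T < Max S - Min S"
          by (metis Min_le Max_ge diff_less_mono2 diff_le_mono dual_order.strict_trans2 fin(1) T(1) less_le_trans diff_less_mono order.strict_trans le_less_trans)
        then show False using min[OF T(1)] by simp
      qed
    qed
  qed
  define p q where "p = Min S - 1" and "q = Max S + 1 - Min S"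
  have mm: "Min S \<in> S" "Max S \<in> S" using fin[OF S] by auto
  then have b: "1 \<le> Min S" "Min S \<le> Max S" "Max S \<le> m" using fin[OF S] by auto
  have "{p+1..p+q} = S" using int b unfolding p_def q_def by simp
  moreover have "q < m"
  proof (rule ccontr)
    assume "\<not> q < m"
    then have "Min S = 1" "Max S = m" using b unfolding q_def by auto
    then have Sm: "S = {1..m}" using int by simp
    have "T = S" if "T \<in> P" for T
    proof -
      have "T \<inter> S \<noteq> {}" using fin[OF that] Sm by blast
      then show ?thesis using part that S by (auto simp: partition_on_def disjoint_def)
    qed
    then show False using ne S Sm by blast
  qed
  ultimately have "interval_block m P (p, q)"
    using S b unfolding interval_block_def p_def q_def by auto
  then show ?thesis by blast
qed

text \<open>
  If no arc lies properly inside the window of an arc, then the window is an atom; the arcs of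
  the word with this window deleted, here called \<open>C1\<close>, see the remaining atoms and
  nothing else.
\<close>

lemma (in arcs) atoms_remove_interval:
  assumes pq: "C p (p + q)" and q: "0 < q" "q < m"
    and C1: "\<And>u v. u < v \<Longrightarrow> v \<le> m - q \<Longrightarrow> C1 u v \<longleftrightarrow> C (if u < p then u else u + q) (if v \<le> p then v else v + q)"
    and C1': "\<And>u v. C1 u v \<Longrightarrow> u < v \<and> v \<le> m - q"
    and irr: "\<And>u v. p \<le> u \<Longrightarrow> v \<le> p + q \<Longrightarrow> C u v \<Longrightarrow> u = p \<and> v = p + q"
  shows "{p+1..p+q} \<in> atoms m C" and "remove_interval (atoms m C) p q = atoms (m - q) C1"
proof -
  have pqm: "p + q \<le> m" using arc_le[OF pq] .
  have cases: "u \<le> p \<and> v \<le> p \<or> p + q \<le> u \<or> u \<le> p \<and> p + q \<le> v" if "C u v" for u v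
  proof (rule ccontr)
    assume n: "\<not> ?thesis"
    have lt: "u < v" using arc_less[OF that] .
    show False
    proof (cases "u < p")
      case True
      then have "p < v" "v < p + q" using n by auto
      then have "C u p" using arc_cross[OF that pq] True by simp
      then have "C p v" using arc_left[OF that] \<open>p < v\<close> by simp
      then show False using irr[of p v] \<open>v < p + q\<close> by simp
    next
      case False
      show False
      proof (cases "v \<le> p + q")
        case True
        then show False using irr[of u v] False that n by auto
      next
        case vF: False
        have "p < u" "u < p + q" using n vF False by auto
        then have "C p u" using arc_cross[OF pq that] vF by simp
        then show False using irr[of p u] \<open>u < p + q\<close> by simp
      qed
    qed
  qed
  have un_in: "(p+1, y) \<in> unsep m C \<longleftrightarrow> y \<in> {p+1..p+q}" for y
  proof
    assume "(p+1, y) \<in> unsep m C"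
    then have "(p+1 \<in> {p<..p+q}) = (y \<in> {p<..p+q})" using pq unfolding unsep_def by blast
    then show "y \<in> {p+1..p+q}" using q by auto
  next
    assume y: "y \<in> {p+1..p+q}"
    have "(p+1 \<in> {u<..v}) = (y \<in> {u<..v})" if "C u v" for u v
      using cases[OF that] y by auto
    then show "(p+1, y) \<in> unsep m C" using y pqm q by (auto simp: unsep_def)
  qed
  have "unsep m C `` {p+1} = {p+1..p+q}"
    by (intro set_eqI) (simp only: Image_singleton_iff un_in)
  moreover have "unsep m C `` {p+1} \<in> {1..m} // unsep m C" using pqm q by (intro quotientI) simp
  ultimately show W: "{p+1..p+q} \<in> atoms m C"
    unfolding atoms_def by simp
  show "remove_interval (atoms m C) p q = atoms (m - q) C1"
  proof (rule partition_on_eq_iff_rel)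
    show "partition_on {1..m - q} (remove_interval (atoms m C) p q)"
      by (rule remove_interval_partition(1)[OF partition_on_atoms W pqm])
    show "partition_on {1..m - q} (atoms (m - q) C1)" by (rule partition_on_atoms)
    fix x y assume x: "x \<in> {1..m-q}" and y: "y \<in> {1..m-q}"
    have atoms_ex: "(\<exists>S\<in>atoms k D. x \<in> S \<and> y \<in> S) \<longleftrightarrow> (x, y) \<in> unsep k D" for k D x y
    proof
      assume "(x, y) \<in> unsep k D"
      then have "x \<in> {1..k}" by (auto simp: unsep_def)
      moreover have "x \<in> unsep k D `` {x}" by (rule equiv_class_self[OF equiv_unsep \<open>x \<in> {1..k}\<close>])
      moreover have "y \<in> unsep k D `` {x}" using \<open>(x, y) \<in> unsep k D\<close> by simp
      ultimately show "\<exists>S\<in>atoms k D. x \<in> S \<and> y \<in> S"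
        unfolding atoms_def by (blast intro: quotientI)
    qed (use atoms_iff in blast)
    have ex: "expand p q x \<in> {1..m}" "expand p q y \<in> {1..m}" using x y pqm by (auto simp: expand_def)
    have "(expand p q x, expand p q y) \<in> unsep m C \<longleftrightarrow> (x, y) \<in> unsep (m - q) C1"
    proof
      assume L: "(expand p q x, expand p q y) \<in> unsep m C"
      have "(x \<in> {u<..v}) = (y \<in> {u<..v})" if c: "C1 u v" for u v
      proof -
        define u' v' where "u' = (if u < p then u else u + q)" and "v' = (if v \<le> p then v else v + q)"
        have "C u' v'" using C1[of u v] C1'[OF c] c unfolding u'_def v'_def by blast
        then have "(expand p q x \<in> {u'<..v'}) = (expand p q y \<in> {u'<..v'})"
          using L unfolding unsep_def by blast
        moreover have "expand p q z \<in> {u'<..v'} \<longleftrightarrow> z \<in> {u<..v}" for z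
          using C1'[OF c] by (auto simp: u'_def v'_def expand_def split: if_splits)
        ultimately show ?thesis by simp
      qed
      then show "(x, y) \<in> unsep (m - q) C1" using x y by (simp add: unsep_def)
    next
      assume R: "(x, y) \<in> unsep (m - q) C1"
      have "(expand p q x \<in> {u<..v}) = (expand p q y \<in> {u<..v})" if c: "C u v" for u v
      proof -
        have lt: "u < v" "v \<le> m" using arc_less arc_le c by blast+
        consider "v \<le> p" | "p + q \<le> u" | "u = p" "v = p + q" | "u \<le> p" "p + q \<le> v" "u = p \<longrightarrow> v \<noteq> p + q"
          using cases[OF c] by blast
        then show ?thesis
        proof cases
          case 1
          then have "C1 u v" using C1[of u v] lt c q pqm by simp
          then have "(x \<in> {u<..v}) = (y \<in> {u<..v})" using R unfolding unsep_def by blast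
          then show ?thesis using 1 by (auto simp: expand_def)
        next
          case 2
          then have "C1 (u - q) (v - q)" using C1[of "u-q" "v-q"] lt c q pqm by auto
          then have "(x \<in> {u-q<..v-q}) = (y \<in> {u-q<..v-q})" using R unfolding unsep_def by blast
          then show ?thesis using 2 q by (auto simp: expand_def)
        next
          case 3
          then show ?thesis by (auto simp: expand_def)
        next
          case 4
          have "C1 u (v - q)"
          proof (cases "u = p")
            case True
            then have "p + q < v" using 4 by simp
            then have "C (p + q) v" using arc_left[of p v "p+q"] c pq True by simp
            then show ?thesis using C1[of u "v-q"] True \<open>p + q < v\<close> lt by auto
          next
            case False
            show ?thesis
            proof (cases "v = p + q")
              case True
              then have "C u p" using arc_right[of u v p] c pq False 4 by simp
              then show ?thesis using C1[of u "v-q"] True False 4 lt pqm by auto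
            qed (use C1[of u "v-q"] False 4 c lt in auto)
          qed
          then have "(x \<in> {u<..v-q}) = (y \<in> {u<..v-q})" using R unfolding unsep_def by blast
          then show ?thesis using 4 q by (auto simp: expand_def)
        qed
      qed
      then show "(expand p q x, expand p q y) \<in> unsep m C" using ex by (simp add: unsep_def)
    qed
    then show "(\<exists>S\<in>remove_interval (atoms m C) p q. x \<in> S \<and> y \<in> S) \<longleftrightarrow> (\<exists>S\<in>atoms (m - q) C1. x \<in> S \<and> y \<in> S)"
      using remove_interval_partition(2)[OF partition_on_atoms W pqm x y] atoms_ex by simp
  qed
qed

lemma (in arcs) arcs_inside_atom:
  assumes W: "{p+1..p+q} \<in> atoms m C" and q: "0 < q"
    and uv: "p \<le> u" "v \<le> p + q" "C u v"
  shows "u = p \<and> v = p + q"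
proof -
  have "u < v" using arc_less uv by blast
  have v: "v \<in> {p+1..p+q}" using uv \<open>u < v\<close> by simp
  have "(v, p+1) \<in> unsep m C" "(v, p+q) \<in> unsep m C"
    by (rule atoms_iff[OF W v, THEN iffD1], use q in simp)+
  then have "(v \<in> {u<..v}) = (p+1 \<in> {u<..v})" "(v \<in> {u<..v}) = (p+q \<in> {u<..v})"
    using uv(3) unfolding unsep_def by blast+
  then show ?thesis using uv \<open>u < v\<close> by auto
qed

text \<open>
  The recursive description of the atoms which matches the recursion for nested cumulants: the
  window of an interval block must be irreducible, and the word without the window must have the
  partition without the block.
\<close>

lemma (in arcs) atoms_eq_iff_remove:
  assumes P: "partition_on {1..m} P" "{p+1..p+q} \<in> P" and pq: "C p (p + q)" and q: "0 < q" "q < m"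
    and C1: "\<And>u v. u < v \<Longrightarrow> v \<le> m - q \<Longrightarrow> C1 u v \<longleftrightarrow> C (if u < p then u else u + q) (if v \<le> p then v else v + q)"
    and C1': "\<And>u v. C1 u v \<Longrightarrow> u < v \<and> v \<le> m - q"
    and C2: "\<And>u v. u < v \<Longrightarrow> v \<le> q \<Longrightarrow> C2 u v \<longleftrightarrow> C (p + u) (p + v)"
    and C2': "\<And>u v. C2 u v \<Longrightarrow> u < v \<and> v \<le> q"
  shows "atoms m C = P \<longleftrightarrow>
    (\<forall>u v. C2 u v \<longrightarrow> u = 0 \<and> v = q) \<and> atoms (m - q) C1 = remove_interval P p q"
proof -
  have irr_iff: "(\<forall>u v. C2 u v \<longrightarrow> u = 0 \<and> v = q) \<longleftrightarrow>
      (\<forall>u v. p \<le> u \<longrightarrow> v \<le> p + q \<longrightarrow> C u v \<longrightarrow> u = p \<and> v = p + q)"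
  proof
    assume L: "\<forall>u v. C2 u v \<longrightarrow> u = 0 \<and> v = q"
    show "\<forall>u v. p \<le> u \<longrightarrow> v \<le> p + q \<longrightarrow> C u v \<longrightarrow> u = p \<and> v = p + q"
    proof (intro allI impI)
      fix u v assume uv: "p \<le> u" "v \<le> p + q" "C u v"
      have "C2 (u - p) (v - p)" using C2[of "u-p" "v-p"] uv arc_less[OF uv(3)] by auto
      then have "u - p = 0 \<and> v - p = q" using L by blast
      then show "u = p \<and> v = p + q" using uv arc_less[OF uv(3)] by auto
    qed
  next
    assume R: "\<forall>u v. p \<le> u \<longrightarrow> v \<le> p + q \<longrightarrow> C u v \<longrightarrow> u = p \<and> v = p + q"
    show "\<forall>u v. C2 u v \<longrightarrow> u = 0 \<and> v = q"
    proof (intro allI impI)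
      fix u v assume uv: "C2 u v"
      then show "u = 0 \<and> v = q" using C2'[OF uv] C2[of u v] R[rule_format, of "p+u" "p+v"] by simp
    qed
  qed
  show ?thesis
  proof
    assume eq: "atoms m C = P"
    then have W: "{p+1..p+q} \<in> atoms m C" using P by simp
    have irr: "\<And>u v. p \<le> u \<Longrightarrow> v \<le> p + q \<Longrightarrow> C u v \<Longrightarrow> u = p \<and> v = p + q"
      using arcs_inside_atom[OF W q(1)] by blast
    show "(\<forall>u v. C2 u v \<longrightarrow> u = 0 \<and> v = q) \<and> atoms (m - q) C1 = remove_interval P p q"
      unfolding irr_iff
      using atoms_remove_interval(2)[OF pq q C1 C1' irr] irr unfolding eq by simp
  next
    assume R: "(\<forall>u v. C2 u v \<longrightarrow> u = 0 \<and> v = q) \<and> atoms (m - q) C1 = remove_interval P p q"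
    then have irr: "\<And>u v. p \<le> u \<Longrightarrow> v \<le> p + q \<Longrightarrow> C u v \<Longrightarrow> u = p \<and> v = p + q"
      using iffD1[OF irr_iff conjunct1[OF R]] by simp
    have "remove_interval (atoms m C) p q = atoms (m - q) C1"
      by (rule atoms_remove_interval(2)[OF pq q]) (fact C1 C1' irr)+
    also have "\<dots> = remove_interval P p q" using R by (rule conjunct2)
    finally show "atoms m C = P"
      using remove_interval_inj[OF partition_on_atoms P(1) atoms_remove_interval(1)[OF pq q C1 C1' irr] P(2)]
      by blast
  qed
qed

section \<open>Arcs closed by a relation on the slots\<close>

text \<open>
  For the alternating word \<open>a\<^sub>1 b\<^sub>1 a\<^sub>2 \<dots>
  b\<^sub>m\<^sub>-\<^sub>1 a\<^sub>m\<close> the coefficient \<open>b\<^sub>k\<close> sits at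
  the point \<open>k\<close>, and the points are read modulo \<open>m\<close>. In terms of
  Vandermonde matrices the points of one parity carry row indices; these are the slots, and they
  are what a partition of \<open>{1..n}\<close> partitions. The points of the other parity carry
  column indices.
\<close>

definition slots :: "nat \<Rightarrow> nat \<Rightarrow> nat set" where
  "slots e m = {k. k < m \<and> k mod 2 = e}"

text \<open>
  An arc of even length is closed if every solution of the linear system of the partition takes
  equal values at its ends. The combinatorial criterion: a slot \<open>u\<close> must be related
  to the other end point, and the only block which may leave the window \<open>{u..<v}\<close>
  is the block of \<open>u\<close>. If \<open>u\<close> is not a slot, then \<open>(i, u) \<in>
  r\<close> is impossible, and no block at all leaves the window.
\<close>

definition closes :: "nat \<Rightarrow> (nat \<times> nat) set \<Rightarrow> nat \<Rightarrow> nat \<Rightarrow> bool" where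
  "closes m r u v \<longleftrightarrow> u < v \<and> v \<le> m \<and> even (v - u) \<and> ((u, u) \<in> r \<longrightarrow> (u, v mod m) \<in> r) \<and>
     (\<forall>i j. (i, j) \<in> r \<longrightarrow> i \<in> {u..<v} \<longrightarrow> j \<notin> {u..<v} \<longrightarrow> (i, u) \<in> r)"

definition skip :: "nat \<Rightarrow> nat \<Rightarrow> nat \<Rightarrow> nat" where
  "skip p q j = (if j < p then j else j + q)"

definition inner :: "(nat \<times> nat) set \<Rightarrow> nat \<Rightarrow> nat \<Rightarrow> (nat \<times> nat) set" where
  "inner r p q = {(i, j). i < q \<and> j < q \<and> (p + i, p + j) \<in> r}"

definition outer :: "(nat \<times> nat) set \<Rightarrow> nat \<Rightarrow> nat \<Rightarrow> (nat \<times> nat) set" where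
  "outer r p q = {(i, j). (skip p q i, skip p q j) \<in> r}"

lemma slot_parity_shift:
  assumes "e < 2"
  shows "k mod 2 = (e + p) mod 2 \<longleftrightarrow> (p + k) mod 2 = (e::nat)"
proof -
  have "e = 0 \<or> e = 1" using assms by auto
  then show ?thesis by (elim disjE) (simp_all, presburger+)
qed

locale slot_rel =
  fixes e m :: nat and r :: "(nat \<times> nat) set"
  assumes equiv_r: "equiv (slots e m) r" and even_m: "even m" and e2: "e < 2"
begin

lemma sym_r: "(i, j) \<in> r \<Longrightarrow> (j, i) \<in> r"
  using equiv_r by (auto simp: equiv_def dest: symD)

lemma trans_r: "(i, j) \<in> r \<Longrightarrow> (j, k) \<in> r \<Longrightarrow> (i, k) \<in> r"
  using equiv_r by (auto simp: equiv_def dest: transD)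

lemma mem_r: "(i, j) \<in> r \<Longrightarrow> i < m \<and> i mod 2 = e \<and> j < m \<and> j mod 2 = e"
  using equiv_r by (auto simp: equiv_def slots_def)

lemma refl_r: "(i, i) \<in> r \<longleftrightarrow> i < m \<and> i mod 2 = e"
  using equiv_r mem_r by (auto simp: equiv_def slots_def dest: refl_onD)

lemma closesD:
  assumes "closes m r u v"
  shows "u < v" "v \<le> m" "even (v - u)" "(u, u) \<in> r \<Longrightarrow> (u, v mod m) \<in> r"
    and "\<And>i j. (i, j) \<in> r \<Longrightarrow> u \<le> i \<Longrightarrow> i < v \<Longrightarrow> j < u \<or> v \<le> j \<Longrightarrow> (i, u) \<in> r"
  using assms by (auto simp: closes_def)

lemma closesI:
  assumes "u < v" "v \<le> m" "even (v - u)" "(u, u) \<in> r \<Longrightarrow> (u, v mod m) \<in> r"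
    and "\<And>i j. (i, j) \<in> r \<Longrightarrow> u \<le> i \<Longrightarrow> i < v \<Longrightarrow> j < u \<or> v \<le> j \<Longrightarrow> (i, u) \<in> r"
  shows "closes m r u v"
  using assms unfolding closes_def by (auto simp: not_le not_less)

lemma theta_shift:
  assumes "(u, u) \<in> r" "even (v - u)" "u < v" "v < m"
  shows "(v, v) \<in> r"
proof -
  have "v mod 2 = u mod 2" using assms(2,3)
    by presburger
  then show ?thesis using assms refl_r by metis
qed

lemma theta_shift':
  assumes "(v, v) \<in> r" "even (v - u)" "u < v"
  shows "(u, u) \<in> r"
proof -
  have "v mod 2 = u mod 2" using assms(2,3)
    by presburger
  then show ?thesis using assms refl_r by (metis less_trans)
qed

sublocale arcs m "closes m r"
proof
  show "u < v" "v \<le> m" if "closes m r u v" for u v using closesD[OF that] by auto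
  show "closes m r 0 m" if "0 < m"
    using that even_m mem_r by (intro closesI) (auto, fastforce)
  show "closes m r u w" if a: "closes m r u v" and b: "closes m r v w" for u v w
  proof (rule closesI)
    note A = closesD[OF a] and B = closesD[OF b]
    have v: "v mod m = v" using A B by simp
    have uv: "(u, v) \<in> r" if "(u, u) \<in> r" using A(4)[OF that] v by simp
    show "u < w" "w \<le> m" using A B by auto
    show "even (w - u)" using A(1,3) B(1,3) by presburger
    show "(u, w mod m) \<in> r" if "(u, u) \<in> r"
      using uv[OF that] B(4) trans_r sym_r by blast
    fix i j assume ij: "(i, j) \<in> r" "u \<le> i" "i < w" "j < u \<or> w \<le> j"
    show "(i, u) \<in> r"
    proof (cases "i < v")
      case True
      then show ?thesis using A(5)[OF ij(1,2)] ij B(1) by auto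
    next
      case False
      then have iv: "(i, v) \<in> r" using B(5)[OF ij(1)] ij A(1) by auto
      then have "(v, v) \<in> r" using sym_r trans_r by blast
      then have "(u, u) \<in> r" using theta_shift'[OF _ A(3,1)] by blast
      then show ?thesis using uv iv sym_r trans_r by blast
    qed
  qed
  show "closes m r v w" if a: "closes m r u w" and b: "closes m r u v" and vw: "v < w" for u v w
  proof (rule closesI)
    note A = closesD[OF a] and B = closesD[OF b]
    have v: "v mod m = v" using A vw by simp
    have uv: "(u, v) \<in> r" if "(u, u) \<in> r" using B(4)[OF that] v by simp
    have vu: "(u, u) \<in> r" if "(v, v) \<in> r" using theta_shift'[OF that B(3,1)] .
    show "v < w" "w \<le> m" using vw A by auto
    show "even (w - v)" using A(1,3) B(1,3) vw by presburger
    show "(v, w mod m) \<in> r" if "(v, v) \<in> r"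
      using uv vu that A(4) trans_r sym_r by blast
    fix i j assume ij: "(i, j) \<in> r" "v \<le> i" "i < w" "j < v \<or> w \<le> j"
    have "(i, u) \<in> r"
    proof (cases "u \<le> j \<and> j < v")
      case True
      then have "(j, u) \<in> r" using B(5)[OF sym_r[OF ij(1)]] ij by auto
      then show ?thesis using ij trans_r by blast
    next
      case False
      then show ?thesis using A(5)[OF ij(1)] ij B(1) by auto
    qed
    moreover from this have "(u, u) \<in> r" using sym_r trans_r by blast
    ultimately show "(i, v) \<in> r" using uv trans_r by blast
  qed
  show "closes m r u v" if a: "closes m r u w" and b: "closes m r v w" and uv: "u < v" for u v w
  proof (rule closesI)
    note A = closesD[OF a] and B = closesD[OF b]
    have v: "v mod m = v" using B by simp
    have vu: "(u, u) \<in> r" if "(v, v) \<in> r" by (rule theta_shift'[OF that]) (use A B uv in presburger)+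
    have vv: "(v, v) \<in> r" if "(u, u) \<in> r" by (rule theta_shift[OF that]) (use A B uv in presburger)+
    have uv': "(u, v) \<in> r" if "(u, u) \<in> r" using A(4)[OF that] B(4)[OF vv[OF that]] sym_r trans_r by blast
    show "u < v" "v \<le> m" using uv B by auto
    show "even (v - u)" using A(1,3) B(1,3) uv by presburger
    show "(u, v mod m) \<in> r" if "(u, u) \<in> r" using uv'[OF that] v by simp
    fix i j assume ij: "(i, j) \<in> r" "u \<le> i" "i < v" "j < u \<or> v \<le> j"
    show "(i, u) \<in> r"
    proof (cases "v \<le> j \<and> j < w")
      case True
      then have "(j, v) \<in> r" using B(5)[OF sym_r[OF ij(1)]] ij by auto
      moreover from this have "(v, v) \<in> r" using sym_r trans_r by blast
      ultimately show ?thesis using vu uv' ij sym_r trans_r by blast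
    next
      case False
      then show ?thesis using A(5)[OF ij(1)] ij B(1) by auto
    qed
  qed
  show "closes m r u u'" if a: "closes m r u v" and b: "closes m r u' v'"
    and lt: "u < u'" "u' < v" "v < v'" for u v u' v'
  proof -
    note A = closesD[OF a] and B = closesD[OF b]
    have vm: "v mod m = v" using lt B by simp
    have uu': "(u', u) \<in> r" if "(u, u) \<in> r"
    proof -
      have uv: "(u, v) \<in> r" using A(4)[OF that] vm by simp
      then have "(v, u') \<in> r" using B(5)[OF sym_r[OF uv]] lt by simp
      then show ?thesis using uv sym_r trans_r by blast
    qed
    have u'u: "(u, u) \<in> r" if t: "(u', u') \<in> r"
    proof (cases "v' = m")
      case False
      then have "(u', v') \<in> r" using B(2,4) t by auto
      then have "(u', u) \<in> r" using A(5)[of u' v'] lt by auto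
      then show ?thesis using sym_r trans_r by blast
    next
      case True
      then have "(u', 0) \<in> r" using B(4) t by simp
      show ?thesis
      proof (cases "u = 0")
        case True
        then show ?thesis using \<open>(u', 0) \<in> r\<close> sym_r trans_r by blast
      next
        case False
        then have "(u', u) \<in> r" using A(5)[of u' 0] \<open>(u', 0) \<in> r\<close> lt by auto
        then show ?thesis using sym_r trans_r by blast
      qed
    qed
    show ?thesis
    proof (rule closesI)
      show "u < u'" "u' \<le> m" using lt B by auto
      show "even (u' - u)"
      proof (cases "(u, u) \<in> r")
        case True
        then have "u' mod 2 = u mod 2" using mem_r[OF uu'] by simp
        then show ?thesis by presburger
      next
        case False
        then have "(u', u') \<notin> r" using u'u by blast
        then have "u' mod 2 \<noteq> e" "u mod 2 \<noteq> e" using False refl_r lt B by auto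
        moreover have "k mod 2 = 1 - e" if "k mod 2 \<noteq> e" for k :: nat
          using that e2 mod_less_divisor[of 2 k] by linarith
        ultimately have "u' mod 2 = u mod 2" by metis
        then show ?thesis by presburger
      qed
      have "u' mod m = u'" using lt B by simp
      then show "(u, u' mod m) \<in> r" if "(u, u) \<in> r" using uu'[OF that] sym_r by simp
      fix i j assume ij: "(i, j) \<in> r" "u \<le> i" "i < u'" "j < u \<or> u' \<le> j"
      show "(i, u) \<in> r"
      proof (cases "u' \<le> j \<and> j < v'")
        case True
        then have "(j, u') \<in> r" using B(5)[OF sym_r[OF ij(1)]] ij by auto
        moreover from this have "(u', u') \<in> r" using sym_r trans_r by blast
        ultimately show ?thesis using uu' u'u ij trans_r by blast
      next
        case False
        then show ?thesis using A(5)[OF ij(1)] ij lt by auto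
      qed
    qed
  qed
qed

lemma theta_partner: "closes m r p (p + q) \<Longrightarrow> (p, p) \<in> r \<Longrightarrow> (p, (p + q) mod m) \<in> r"
  using closesD(4) .

lemma slot_rel_inner:
  assumes "p + q \<le> m" "even q"
  shows "slot_rel ((e + p) mod 2) q (inner r p q)"
proof
  have par: "k mod 2 = (e + p) mod 2 \<longleftrightarrow> (p + k) mod 2 = e" for k
    by (rule slot_parity_shift[OF e2])
  show "equiv (slots ((e + p) mod 2) q) (inner r p q)"
  proof (intro equivI)
    show "inner r p q \<subseteq> slots ((e + p) mod 2) q \<times> slots ((e + p) mod 2) q"
    proof
      fix z assume "z \<in> inner r p q"
      then obtain i j where z: "z = (i, j)" "i < q" "j < q" "(p + i, p + j) \<in> r"
        by (auto simp: inner_def)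
      then show "z \<in> slots ((e + p) mod 2) q \<times> slots ((e + p) mod 2) q"
        using mem_r[OF z(4)] by (simp add: slots_def par)
    qed
    show "refl_on (slots ((e + p) mod 2) q) (inner r p q)"
      using assms by (auto simp: refl_on_def inner_def slots_def par refl_r)
    show "sym (inner r p q)" using sym_r by (auto simp: sym_def inner_def)
    show "trans (inner r p q)" using trans_r unfolding trans_def inner_def by blast
  qed
qed (use assms in auto)

text \<open>
  The point \<open>p\<close> itself belongs to the outer word only through its partner \<open>p
  + q\<close>, which \<open>skip\<close> uses as its representative.
\<close>

lemma slot_rel_outer:
  assumes "p + q \<le> m" "even q"
  shows "slot_rel e (m - q) (outer r p q)"
proof
  have par: "skip p q k mod 2 = k mod 2" for k using assms(2) by (auto simp: skip_def)
  have lt: "skip p q k < m \<longleftrightarrow> k < m - q" for k using assms(1) by (auto simp: skip_def)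
  show "equiv (slots e (m - q)) (outer r p q)"
  proof (intro equivI)
    show "outer r p q \<subseteq> slots e (m - q) \<times> slots e (m - q)"
    proof
      fix z assume "z \<in> outer r p q"
      then obtain i j where z: "z = (i, j)" "(skip p q i, skip p q j) \<in> r"
        by (auto simp: outer_def)
      then show "z \<in> slots e (m - q) \<times> slots e (m - q)"
        using mem_r[OF z(2)] by (simp add: slots_def par lt)
    qed
    show "refl_on (slots e (m - q)) (outer r p q)"
      by (auto simp: refl_on_def outer_def slots_def par refl_r lt)
    show "sym (outer r p q)" using sym_r by (auto simp: sym_def outer_def)
    show "trans (outer r p q)" using trans_r unfolding trans_def outer_def by blast
  qed
qed (use assms even_m e2 in auto)

text \<open>
  A block which leaves a window inside the arc either stays inside the arc or is the block of
  \<open>p\<close>, and closedness of the arc lets \<open>p\<close> stand for its other end.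
\<close>

lemma closes_inner:
  assumes c: "closes m r p (p + q)" and uv: "u < v" "v \<le> q"
  shows "closes q (inner r p q) u v \<longleftrightarrow> closes m r (p + u) (p + v)"
proof -
  note P = closesD[OF c]
  have q: "even q" using P(3) by simp
  interpret I: slot_rel "(e + p) mod 2" q "inner r p q" by (rule slot_rel_inner[OF P(2) q])
  have in_iff: "(i, j) \<in> inner r p q \<longleftrightarrow> i < q \<and> j < q \<and> (p + i, p + j) \<in> r" for i j
    by (simp add: inner_def)
  show ?thesis
  proof
    assume "closes q (inner r p q) u v"
    note A = I.closesD[OF this]
    show "closes m r (p + u) (p + v)"
    proof (rule closesI)
      show "p + u < p + v" "p + v \<le> m" "even (p + v - (p + u))" using uv P A by auto
      show "(p + u, (p + v) mod m) \<in> r" if "(p + u, p + u) \<in> r"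
      proof -
        have "(u, v mod q) \<in> inner r p q" using A(4) that uv by (simp add: in_iff)
        then have *: "(p + u, p + v mod q) \<in> r" by (simp add: in_iff)
        show ?thesis
        proof (cases "v = q")
          case True
          then have "(p + u, p) \<in> r" using * by simp
          then show ?thesis using theta_partner[OF c] True trans_r sym_r by blast
        next
          case False
          then show ?thesis using * uv P by simp
        qed
      qed
      fix i j assume ij: "(i, j) \<in> r" "p + u \<le> i" "i < p + v" "j < p + u \<or> p + v \<le> j"
      define i' where "i' = i - p"
      have i': "i = p + i'" "u \<le> i'" "i' < v" using ij by (auto simp: i'_def)
      show "(i, p + u) \<in> r"
      proof (cases "p \<le> j \<and> j < p + q")
        case True
        then have "(i', j - p) \<in> inner r p q" using ij i' uv by (auto simp: in_iff)
        moreover have "j - p < u \<or> v \<le> j - p" using ij(4) True by linarith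
        ultimately have "(i', u) \<in> inner r p q" using A(5)[of i' "j - p"] i' by blast
        then show ?thesis using i' by (simp add: in_iff)
      next
        case False
        then have ip: "(i, p) \<in> r" using P(5)[OF ij(1)] i' uv by auto
        show ?thesis
        proof (cases "u = 0")
          case False
          have "(i', 0) \<in> inner r p q" using ip i' uv by (auto simp: in_iff)
          then have "(i', u) \<in> inner r p q" using A(5) i' False by auto
          then show ?thesis using i' by (simp add: in_iff)
        qed (use ip in simp)
      qed
    qed
  next
    assume "closes m r (p + u) (p + v)"
    note A = closesD[OF this]
    show "closes q (inner r p q) u v"
    proof (rule I.closesI)
      show "u < v" "v \<le> q" "even (v - u)" using uv A(3) by auto
      show "(u, v mod q) \<in> inner r p q" if "(u, u) \<in> inner r p q"
      proof -
        have t: "(p + u, p + u) \<in> r" using that by (simp add: in_iff)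
        then have *: "(p + u, (p + v) mod m) \<in> r" using A(4) by simp
        show ?thesis
        proof (cases "v = q")
          case True
          have "(p, p) \<in> r"
          proof (cases "u = 0")
            case False
            have "even u" using \<open>v = q\<close> A(3) q uv by presburger
            then show ?thesis using theta_shift'[OF t, of p] False by simp
          qed (use t in simp)
          then have "(p, (p + q) mod m) \<in> r" using theta_partner[OF c] by blast
          then have "(p + u, p) \<in> r" using * True trans_r sym_r by blast
          then show ?thesis using True uv by (simp add: in_iff)
        next
          case False
          then show ?thesis using * uv P by (simp add: in_iff)
        qed
      qed
      fix i j assume ij: "(i, j) \<in> inner r p q" "u \<le> i" "i < v" "j < u \<or> v \<le> j"
      then have "(p + i, p + u) \<in> r" using A(5)[of "p + i" "p + j"] by (auto simp: in_iff)
      then show "(i, u) \<in> inner r p q" using ij uv by (simp add: in_iff)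
    qed
  qed
qed

text \<open>
  The only block that leaves the deleted window is the block of \<open>p\<close>, and it is
  represented in the outer word by \<open>p + q\<close>. This explains the asymmetry between the
  two ends of an outer arc at \<open>p\<close>: a left end stands for \<open>p + q\<close>, a
  right end for \<open>p\<close>.
\<close>

lemma closes_outer:
  assumes c: "closes m r p (p + q)" and qm: "q < m" and uv: "u < v" "v \<le> m - q"
  shows "closes (m - q) (outer r p q) u v \<longleftrightarrow>
    closes m r (if u < p then u else u + q) (if v \<le> p then v else v + q)"
proof -
  note P = closesD[OF c]
  have q: "even q" "0 < q" using P(1,3) by auto
  interpret O: slot_rel e "m - q" "outer r p q" by (rule slot_rel_outer[OF P(2) q(1)])
  have out_iff: "(i, j) \<in> outer r p q \<longleftrightarrow> (skip p q i, skip p q j) \<in> r" for i j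
    by (simp add: outer_def)
  define u' v' where "u' = (if u < p then u else u + q)" and "v' = (if v \<le> p then v else v + q)"
  have u'_skip: "u' = skip p q u" by (simp add: u'_def skip_def)
  have u'v': "u' < v'" "v' \<le> m" using uv P(2) by (auto simp: u'_def v'_def)
  have even': "even (v' - u') \<longleftrightarrow> even (v - u)"
    using uv q(1) by (auto simp: u'_def v'_def)
  have between: "u' \<le> skip p q i \<and> skip p q i < v' \<longleftrightarrow> u \<le> i \<and> i < v" for i
    using uv q by (auto simp: u'_def v'_def skip_def)
  have target: "(skip p q (v mod (m - q)), v' mod m) \<in> r" if "even (v - u)" "(u', u') \<in> r"
  proof -
    have par: "v' mod 2 = e" using that even' u'v' refl_r[of u'] by presburger
    have "v' = m \<Longrightarrow> 0 = e" using par even_m by auto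
    have pt: "(p, (p + q) mod m) \<in> r" if "p mod 2 = e" "p < m"
      using theta_partner[OF c] refl_r that by blast
    consider "v < m - q" "v = p" | "v < m - q" "v \<noteq> p" | "v = m - q" "v \<le> p" | "v = m - q" "p < v"
      using uv by linarith
    then show ?thesis
    proof cases
      case 1
      then have "(p, p + q) \<in> r" using pt par P by (auto simp: v'_def)
      then show ?thesis using 1 by (auto simp: skip_def v'_def sym_r)
    next
      case 2
      then have "v' < m" "skip p q v = v'" by (auto simp: v'_def skip_def)
      then show ?thesis using 2 par refl_r by simp
    next
      case 3
      then have p: "p = m - q" "0 < p" "p + q = m" using P uv by auto
      then have "(p, 0) \<in> r" using pt par 3 qm q by (auto simp: v'_def)
      then show ?thesis using 3 p q qm sym_r by (simp add: skip_def v'_def)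
    next
      case 4
      then have v'm: "v' = m" using P by (auto simp: v'_def)
      then have e0: "e = 0" using par even_m by simp
      show ?thesis
      proof (cases "p = 0")
        case True
        then have "(0, q) \<in> r" using pt e0 qm by auto
        then show ?thesis using 4 v'm True by (auto simp: skip_def sym_r)
      next
        case False
        then show ?thesis using 4 v'm e0 refl_r qm by (auto simp: skip_def)
      qed
    qed
  qed
  show ?thesis unfolding u'_def[symmetric] v'_def[symmetric]
  proof
    assume "closes (m - q) (outer r p q) u v"
    note A = O.closesD[OF this]
    show "closes m r u' v'"
    proof (rule closesI)
      show "u' < v'" "v' \<le> m" "even (v' - u')" using u'v' even' A(3) by auto
      show "(u', v' mod m) \<in> r" if "(u', u') \<in> r"
        using A(4) target[OF A(3) that] that trans_r unfolding out_iff u'_skip by blast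
      fix i j assume ij: "(i, j) \<in> r" "u' \<le> i" "i < v'" "j < u' \<or> v' \<le> j"
      have mem: "i < m" "j < m" using mem_r ij by auto
      have outside: "\<exists>k'. k = skip p q k'" if "k < p \<or> p + q \<le> k" for k
        using that by (intro exI[of _ "if k < p then k else k - q"]) (auto simp: skip_def)
      have "\<exists>i'. u \<le> i' \<and> i' < v \<and> (i, skip p q i') \<in> r"
      proof (cases "i < p \<or> p + q \<le> i")
        case True
        then obtain i' where "i = skip p q i'" using outside by blast
        then show ?thesis using between[of i'] ij sym_r trans_r by blast
      next
        case False
        then have uu: "u < p" "p < v" using ij by (auto simp: u'_def v'_def split: if_splits)
        then have "p < m - q" using uv by simp
        have "j < p \<or> p + q \<le> j" using uu ij by (auto simp: u'_def v'_def)
        then have "(i, p) \<in> r" using P(5)[OF ij(1)] False by auto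
        moreover from this have "(p, p + q) \<in> r"
          using theta_partner[OF c] sym_r trans_r \<open>p < m - q\<close> by (metis less_diff_conv mod_less)
        ultimately have "(i, skip p q p) \<in> r" using trans_r by (simp add: skip_def)
        then show ?thesis using uu by (intro exI[of _ p]) simp
      qed
      then obtain i' where i': "u \<le> i'" "i' < v" "(i, skip p q i') \<in> r" by blast
      show "(i, u') \<in> r"
      proof (cases "j < p \<or> p + q \<le> j")
        case True
        then obtain j' where j': "j = skip p q j'" using outside by blast
        then have "(i', j') \<in> outer r p q" using i' ij sym_r trans_r unfolding out_iff by blast
        moreover have "\<not> (u \<le> j' \<and> j' < v)" using between[of j'] j' ij by auto
        ultimately have "(i', u) \<in> outer r p q" using A(5) i' by auto
        then show ?thesis using i' trans_r unfolding out_iff u'_skip by blast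
      next
        case False
        have iw: "i < p \<or> p + q \<le> i" using False ij by (auto simp: u'_def v'_def split: if_splits)
        then have jp: "(j, p) \<in> r" using P(5)[OF sym_r[OF ij(1)]] False by auto
        then have pp: "(p, (p + q) mod m) \<in> r" using theta_partner[OF c] sym_r trans_r by blast
        have ipq: "(i', p) \<in> outer r p q" if "p < m - q"
        proof -
          have "(i, skip p q p) \<in> r"
            using trans_r[OF trans_r[OF ij(1) jp] pp] that by (simp add: skip_def)
          then show ?thesis using i' sym_r trans_r unfolding out_iff by blast
        qed
        show ?thesis
        proof (cases "p < m - q")
          case True
          show ?thesis
          proof (cases "u = p")
            case True
            then show ?thesis using ipq \<open>p < m - q\<close> i' trans_r unfolding out_iff u'_skip by blast
          next
            case False
            then have "\<not> (u \<le> p \<and> p < v)" using ij \<open>\<not> (j < p \<or> p + q \<le> j)\<close> by (auto simp: u'_def v'_def)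
            then have "(i', u) \<in> outer r p q" using A(5) i' ipq[OF True] by auto
            then show ?thesis using i' trans_r unfolding out_iff u'_skip by blast
          qed
        next
          case pF: False
          then have p: "p + q = m" "0 < p" using P qm by auto
          then have "(i, 0) \<in> r" using trans_r[OF trans_r[OF ij(1) jp] pp] by simp
          then have "(skip p q i', 0) \<in> r" using trans_r[OF sym_r[OF i'(3)]] by blast
          then have i0: "(i', 0) \<in> outer r p q" using p unfolding out_iff by (simp add: skip_def)
          show ?thesis
          proof (cases "u = 0")
            case True
            then show ?thesis using i0 i' trans_r unfolding out_iff u'_skip by blast
          next
            case False
            then have "(i', u) \<in> outer r p q" using A(5) i' i0 by auto
            then show ?thesis using i' trans_r unfolding out_iff u'_skip by blast
          qed
        qed
      qed
    qed
  next
    assume "closes m r u' v'"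
    note A = closesD[OF this]
    show "closes (m - q) (outer r p q) u v"
    proof (rule O.closesI)
      show "u < v" "v \<le> m - q" "even (v - u)" using uv even' A(3) by auto
      show "(u, v mod (m - q)) \<in> outer r p q" if "(u, u) \<in> outer r p q"
        using target[OF \<open>even (v - u)\<close>] A(4) that sym_r trans_r unfolding out_iff u'_skip by blast
      fix i j assume ij: "(i, j) \<in> outer r p q" "u \<le> i" "i < v" "j < u \<or> v \<le> j"
      then show "(i, u) \<in> outer r p q"
        using A(5)[of "skip p q i" "skip p q j"] between[of i] between[of j]
        unfolding out_iff u'_skip by auto
    qed
  qed
qed

end

definition unskip :: "nat \<Rightarrow> nat \<Rightarrow> nat \<Rightarrow> nat" where
  "unskip p q x = (if x < p then x else x - q)"

text \<open>
  The inverse of passing to inner and outer relation: the two share the identified end points of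
  the arc, which are the point \<open>0\<close> of the inner word and the point \<open>p mod (m
  - q)\<close> of the outer word, and the blocks of these points are merged.
\<close>

definition glue :: "nat \<Rightarrow> nat \<Rightarrow> nat \<Rightarrow> (nat \<times> nat) set \<Rightarrow> (nat \<times> nat) set \<Rightarrow> (nat \<times> nat) set" where
  "glue m p q r1 r2 = {(x, y). x < m \<and> y < m \<and>
     (if x \<in> {p..<p+q}
      then (if y \<in> {p..<p+q} then (x - p, y - p) \<in> r2
            else (x - p, 0) \<in> r2 \<and> (unskip p q y, p mod (m - q)) \<in> r1)
      else (if y \<in> {p..<p+q} then (y - p, 0) \<in> r2 \<and> (unskip p q x, p mod (m - q)) \<in> r1
            else (unskip p q x, unskip p q y) \<in> r1))}"

lemma (in slot_rel) glue_outer_inner: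
  assumes c: "closes m r p (p + q)" and qm: "q < m"
  shows "glue m p q (outer r p q) (inner r p q) = r"
proof -
  note P = closesD[OF c]
  have h: "skip p q (p mod (m - q)) = (p + q) mod m"
  proof (cases "p < m - q")
    case False
    then have "p = m - q" "p + q = m" using P by auto
    then show ?thesis using qm by (simp add: skip_def)
  qed (use P in \<open>auto simp: skip_def\<close>)
  have sk: "skip p q (unskip p q x) = x" if "x \<notin> {p..<p+q}" for x
    using that by (auto simp: skip_def unskip_def)
  have inn: "(x - p, y - p) \<in> inner r p q \<longleftrightarrow> (x, y) \<in> r"
    if "x \<in> {p..<p+q}" "y \<in> {p..<p+q}" for x y
    using that by (auto simp: inner_def)
  have inn0: "(x - p, 0) \<in> inner r p q \<longleftrightarrow> (x, p) \<in> r" if "x \<in> {p..<p+q}" for x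
    using inn[OF that, of p] P(1) by simp
  have out: "(unskip p q x, unskip p q y) \<in> outer r p q \<longleftrightarrow> (x, y) \<in> r"
    if "x \<notin> {p..<p+q}" "y \<notin> {p..<p+q}" for x y
    using sk[OF that(1)] sk[OF that(2)] by (simp add: outer_def)
  have outh: "(unskip p q x, p mod (m - q)) \<in> outer r p q \<longleftrightarrow> (x, (p + q) mod m) \<in> r"
    if "x \<notin> {p..<p+q}" for x
    using sk[OF that(1)] h by (simp add: outer_def)
  have cross: "(x, y) \<in> r \<longleftrightarrow> (x, p) \<in> r \<and> (y, (p + q) mod m) \<in> r"
    if x: "x \<in> {p..<p+q}" and y: "y \<notin> {p..<p+q}" for x y
  proof
    assume xy: "(x, y) \<in> r"
    then have "(x, p) \<in> r" using P(5)[OF xy] x y by auto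
    then show "(x, p) \<in> r \<and> (y, (p + q) mod m) \<in> r"
      using xy theta_partner[OF c] sym_r trans_r by blast
  next
    assume "(x, p) \<in> r \<and> (y, (p + q) mod m) \<in> r"
    then show "(x, y) \<in> r" using theta_partner[OF c] sym_r trans_r by blast
  qed
  have cross': "(x, y) \<in> r \<longleftrightarrow> (y, p) \<in> r \<and> (x, (p + q) mod m) \<in> r"
    if x: "x \<notin> {p..<p+q}" and y: "y \<in> {p..<p+q}" for x y
    using cross[OF y x] sym_r by blast
  show ?thesis
  proof (rule set_eqI)
    fix z :: "nat \<times> nat"
    obtain x y where z: "z = (x, y)" by (cases z)
    consider "x \<in> {p..<p+q}" "y \<in> {p..<p+q}" | "x \<notin> {p..<p+q}" "y \<notin> {p..<p+q}"
      | "x \<in> {p..<p+q}" "y \<notin> {p..<p+q}" | "x \<notin> {p..<p+q}" "y \<in> {p..<p+q}" by blast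
    then have "(x, y) \<in> glue m p q (outer r p q) (inner r p q) \<longleftrightarrow> (x, y) \<in> r"
    proof cases
      case 1
      then show ?thesis using mem_r[of x y] inn[OF 1] unfolding glue_def by auto
    next
      case 2
      then show ?thesis using mem_r[of x y] out[OF 2] unfolding glue_def by auto
    next
      case 3
      then show ?thesis using mem_r[of x y] cross[OF 3] inn0[OF 3(1)] outh[OF 3(2)]
        unfolding glue_def by auto
    next
      case 4
      then show ?thesis using mem_r[of x y] cross'[OF 4] inn0[OF 4(2)] outh[OF 4(1)]
        unfolding glue_def by auto
    qed
    then show "z \<in> glue m p q (outer r p q) (inner r p q) \<longleftrightarrow> z \<in> r" unfolding z .
  qed
qed

lemma glue_props:
  assumes "slot_rel e (m - q) r1" "slot_rel ((e + p) mod 2) q r2" "e < 2" "even m"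
    and pq: "p + q \<le> m" "0 < q" "q < m"
  shows "slot_rel e m (glue m p q r1 r2)" "closes m (glue m p q r1 r2) p (p + q)"
    and "outer (glue m p q r1 r2) p q = r1" "inner (glue m p q r1 r2) p q = r2"
proof -
  interpret O: slot_rel e "m - q" r1 by fact
  interpret I: slot_rel "(e + p) mod 2" q r2 by fact
  let ?W = "{p..<p+q}"
  define uns where "uns = unskip p q"
  define h where "h = p mod (m - q)"
  have g: "(x, y) \<in> glue m p q r1 r2 \<longleftrightarrow> x < m \<and> y < m \<and>
       (x \<in> ?W \<and> y \<in> ?W \<and> (x - p, y - p) \<in> r2 \<or>
        x \<notin> ?W \<and> y \<notin> ?W \<and> (uns x, uns y) \<in> r1 \<or>
        x \<in> ?W \<and> y \<notin> ?W \<and> (x - p, 0) \<in> r2 \<and> (uns y, h) \<in> r1 \<or>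
        x \<notin> ?W \<and> y \<in> ?W \<and> (y - p, 0) \<in> r2 \<and> (uns x, h) \<in> r1)" for x y
    unfolding glue_def uns_def h_def
    by (cases "x \<in> ?W"; cases "y \<in> ?W") (simp_all only: mem_Collect_eq case_prod_conv if_True if_False not_False_eq_True simp_thms)
  have parI: "k mod 2 = (e + p) mod 2 \<longleftrightarrow> (p + k) mod 2 = e" for k
    by (rule slot_parity_shift[OF O.e2])
  have parO: "uns x mod 2 = x mod 2" if "x \<notin> ?W" for x
  proof (cases "x < p")
    case False
    then have "x = (x - q) + q" using that by simp
    then have "x mod 2 = (x - q) mod 2" using I.even_m by (metis even_add mod2_eq_if)
    then show ?thesis using False by (simp add: uns_def unskip_def)
  qed (simp add: uns_def unskip_def)
  have ltO: "uns x < m - q \<longleftrightarrow> x < m" if "x \<notin> ?W" for x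
    using that pq by (auto simp: uns_def unskip_def)
  have reflO: "(uns x, uns x) \<in> r1 \<longleftrightarrow> x < m \<and> x mod 2 = e" if "x \<notin> ?W" for x
    using O.refl_r parO[OF that] ltO[OF that] by simp
  have reflI: "(x - p, x - p) \<in> r2 \<longleftrightarrow> x mod 2 = e" if "x \<in> ?W" for x
    using I.refl_r[of "x - p"] that parI[of "x - p"] by auto
  have hth: "(h, h) \<in> r1" if "(k, 0) \<in> r2" for k
  proof -
    have "0 mod 2 = (e + p) mod 2" using I.mem_r[OF that] by blast
    then have pe: "p mod 2 = e" using parI[of 0] by simp
    have "h < m - q" using pq by (simp add: h_def)
    moreover have "h mod 2 = e"
      using pe pq O.even_m unfolding h_def by (metis mod_mod_cancel)
    ultimately show ?thesis using O.refl_r by simp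
  qed
  have sym: "(x, y) \<in> glue m p q r1 r2 \<Longrightarrow> (y, x) \<in> glue m p q r1 r2" for x y
    unfolding g using I.sym_r O.sym_r by blast
  have symt: "(x, y) \<in> glue m p q r1 r2 \<Longrightarrow> (x, x) \<in> glue m p q r1 r2" for x y
    unfolding g using I.sym_r O.sym_r I.trans_r O.trans_r by blast
  have memW: "(x, y) \<in> glue m p q r1 r2 \<Longrightarrow> x < m \<and> x mod 2 = e" for x y
    using symt[of x y] reflO[of x] reflI[of x] unfolding g by blast
  show sl: "slot_rel e m (glue m p q r1 r2)"
  proof
    show "equiv (slots e m) (glue m p q r1 r2)"
    proof (intro equivI)
      show "glue m p q r1 r2 \<subseteq> slots e m \<times> slots e m"
      proof
        fix z assume "z \<in> glue m p q r1 r2"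
        then obtain x y where z: "z = (x, y)" "(x, y) \<in> glue m p q r1 r2" by (cases z) auto
        then show "z \<in> slots e m \<times> slots e m"
          using memW[OF z(2)] memW[OF sym[OF z(2)]] by (simp add: slots_def)
      qed
      show "refl_on (slots e m) (glue m p q r1 r2)"
        unfolding refl_on_def slots_def g using reflO reflI by blast
      show "sym (glue m p q r1 r2)" using sym by (auto intro: symI)
      show "trans (glue m p q r1 r2)"
      proof (rule transI)
        fix x y z assume xy: "(x, y) \<in> glue m p q r1 r2" and yz: "(y, z) \<in> glue m p q r1 r2"
        show "(x, z) \<in> glue m p q r1 r2"
        proof -
          have X: "x < m" and Z: "z < m" using xy yz unfolding g by blast+
          have hh: "(uns a, h) \<in> r1 \<Longrightarrow> (uns b, h) \<in> r1 \<Longrightarrow> (uns a, uns b) \<in> r1" for a b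
            using O.sym_r O.trans_r by blast
          have ww: "(a - p, 0) \<in> r2 \<Longrightarrow> (b - p, 0) \<in> r2 \<Longrightarrow> (a - p, b - p) \<in> r2" for a b
            using I.sym_r I.trans_r by blast
          have wx: "(a, b) \<in> r2 \<Longrightarrow> (b, 0) \<in> r2 \<Longrightarrow> (a, 0) \<in> r2"
            and wy: "(b, a) \<in> r2 \<Longrightarrow> (b, 0) \<in> r2 \<Longrightarrow> (a, 0) \<in> r2" for a b
            using I.sym_r I.trans_r by blast+
          have hx: "(a, b) \<in> r1 \<Longrightarrow> (b, h) \<in> r1 \<Longrightarrow> (a, h) \<in> r1"
            and hy: "(b, a) \<in> r1 \<Longrightarrow> (b, h) \<in> r1 \<Longrightarrow> (a, h) \<in> r1" for a b
            using O.sym_r O.trans_r by blast+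
          show ?thesis
          proof (cases "x \<in> ?W"; cases "y \<in> ?W"; cases "z \<in> ?W")
            assume c: "x \<in> ?W" "y \<in> ?W" "z \<in> ?W"
            then have "(x - p, y - p) \<in> r2" "(y - p, z - p) \<in> r2" using xy yz unfolding g by blast+
            then show ?thesis unfolding g using X Z c I.trans_r by blast
          next
            assume c: "x \<in> ?W" "y \<in> ?W" "z \<notin> ?W"
            then have "(x - p, y - p) \<in> r2" "(y - p, 0) \<in> r2" "(uns z, h) \<in> r1" using xy yz unfolding g by blast+
            then show ?thesis unfolding g using X Z c wx by blast
          next
            assume c: "x \<in> ?W" "y \<notin> ?W" "z \<in> ?W"
            then have "(x - p, 0) \<in> r2" "(z - p, 0) \<in> r2" using xy yz unfolding g by blast+
            then show ?thesis unfolding g using X Z c ww by blast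
          next
            assume c: "x \<in> ?W" "y \<notin> ?W" "z \<notin> ?W"
            then have "(x - p, 0) \<in> r2" "(uns y, h) \<in> r1" "(uns y, uns z) \<in> r1" using xy yz unfolding g by blast+
            then show ?thesis unfolding g using X Z c hy by blast
          next
            assume c: "x \<notin> ?W" "y \<in> ?W" "z \<in> ?W"
            then have "(y - p, 0) \<in> r2" "(uns x, h) \<in> r1" "(y - p, z - p) \<in> r2" using xy yz unfolding g by blast+
            then show ?thesis unfolding g using X Z c wy by blast
          next
            assume c: "x \<notin> ?W" "y \<in> ?W" "z \<notin> ?W"
            then have "(uns x, h) \<in> r1" "(uns z, h) \<in> r1" using xy yz unfolding g by blast+
            then show ?thesis unfolding g using X Z c hh by blast
          next
            assume c: "x \<notin> ?W" "y \<notin> ?W" "z \<in> ?W"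
            then have "(uns x, uns y) \<in> r1" "(z - p, 0) \<in> r2" "(uns y, h) \<in> r1" using xy yz unfolding g by blast+
            then show ?thesis unfolding g using X Z c hx by blast
          next
            assume c: "x \<notin> ?W" "y \<notin> ?W" "z \<notin> ?W"
            then have "(uns x, uns y) \<in> r1" "(uns y, uns z) \<in> r1" using xy yz unfolding g by blast+
            then show ?thesis unfolding g using X Z c O.trans_r by blast
          qed
        qed
      qed
    qed
  qed (use assms in auto)
  interpret G: slot_rel e m "glue m p q r1 r2" by (rule sl)
  show "closes m (glue m p q r1 r2) p (p + q)"
  proof (rule G.closesI)
    show "p < p + q" "p + q \<le> m" "even (p + q - p)" using pq I.even_m by auto
    show "(p, (p + q) mod m) \<in> glue m p q r1 r2" if "(p, p) \<in> glue m p q r1 r2"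
    proof -
      have 00: "(0, 0) \<in> r2" using that pq unfolding g by simp
      have "(p + q) mod m \<notin> ?W" "uns ((p + q) mod m) = h"
      proof (atomize (full), cases "p + q = m")
        case True
        then have "p = m - q" by simp
        then show "(p + q) mod m \<notin> ?W \<and> uns ((p + q) mod m) = h"
          using True pq by (simp add: uns_def unskip_def h_def)
      next
        case False
        then have "p < m - q" "(p + q) mod m = p + q" using pq by auto
        then show "(p + q) mod m \<notin> ?W \<and> uns ((p + q) mod m) = h"
          by (simp add: uns_def unskip_def h_def)
      qed
      then show ?thesis unfolding g using 00 hth[OF 00] pq by simp
    qed
    fix i j assume "(i, j) \<in> glue m p q r1 r2" "p \<le> i" "i < p + q" "j < p \<or> p + q \<le> j"
    then show "(i, p) \<in> glue m p q r1 r2" unfolding g using pq by auto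
  qed
  have uns_skip: "uns (skip p q x) = x" "skip p q x \<notin> ?W" for x
    using pq by (auto simp: uns_def unskip_def skip_def)
  have sm: "skip p q x < m \<longleftrightarrow> x < m - q" for x using pq by (auto simp: skip_def)
  have "(x, y) \<in> outer (glue m p q r1 r2) p q \<longleftrightarrow> (x, y) \<in> r1" for x y
    by (simp only: outer_def mem_Collect_eq case_prod_conv g uns_skip if_False simp_thms sm)
      (use O.mem_r[of x y] in blast)
  then show "outer (glue m p q r1 r2) p q = r1" by (auto simp: set_eq_iff)
  have "(x, y) \<in> inner (glue m p q r1 r2) p q \<longleftrightarrow> (x, y) \<in> r2" for x y
  proof -
    have "(p + x, p + y) \<in> glue m p q r1 r2 \<longleftrightarrow> (x, y) \<in> r2" if "x < q" "y < q"
      using that pq unfolding g by simp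
    then show ?thesis unfolding inner_def using I.mem_r[of x y] by blast
  qed
  then show "inner (glue m p q r1 r2) p q = r2" by (auto simp: set_eq_iff)
qed

section \<open>The linear system of a relation and its grid sums\<close>

text \<open>
  For a Vandermonde matrix with entries \<open>\<zeta>\<^sub>i\<^sup>j / \<surd>N\<close> and
  independent uniform phases \<open>\<zeta>\<^sub>i\<close>, an entry of an alternating product
  of \<open>X\<close> and \<open>X\<^sup>*\<close> is a sum over row and column indices
  \<open>y\<close>. At a slot \<open>j\<close> the two adjacent factors contribute the power of
  \<open>\<zeta>\<close> with exponent \<open>y (j+1) - y (j-1)\<close>, so that the expectation
  is nonzero exactly if for each block of slots with equal row indices the exponents sum to
  zero. The relation \<open>r\<close> prescribes the blocks.
\<close>

definition invariant :: "(nat \<times> nat) set \<Rightarrow> (nat \<Rightarrow> 'a) \<Rightarrow> bool" where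
  "invariant r f \<longleftrightarrow> (\<forall>i j. (i, j) \<in> r \<longrightarrow> f i = f j)"

text \<open>
  Pairing the increments at the slots with a test function \<open>\<omega>\<close>. Requiring
  that the pairing vanishes for all \<open>\<omega>\<close> constant on blocks is the same as
  requiring zero increment for each block; test functions are easier to cut into an inner and an
  outer part than blocks are.
\<close>

definition bracket :: "nat \<Rightarrow> nat \<Rightarrow> (nat \<Rightarrow> int) \<Rightarrow> (nat \<Rightarrow> nat) \<Rightarrow> int" where
  "bracket e m \<omega> y =
     (\<Sum>j\<in>slots e m. \<omega> j * (int (y ((j + 1) mod m)) - int (y ((j + m - 1) mod m))))"

definition solves :: "nat \<Rightarrow> nat \<Rightarrow> (nat \<times> nat) set \<Rightarrow> (nat \<Rightarrow> nat) \<Rightarrow> bool" where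
  "solves e m r y \<longleftrightarrow> invariant r y \<and> (\<forall>\<omega>. invariant r \<omega> \<longrightarrow> bracket e m \<omega> y = 0)"

lemma finite_slots [simp]: "finite (slots e m)"
  by (simp add: slots_def)

lemma slots_mod_shift:
  assumes "even m" "e < 2"
  shows "bij_betw (\<lambda>j. (j + 1) mod m) (slots e m) (slots (1 - e) m)"
    and "bij_betw (\<lambda>j. (j + m - 1) mod m) (slots e m) (slots (1 - e) m)"
proof -
  have e: "e = 0 \<or> e = 1" using assms by auto
  have suc: "(j + 1) mod m \<in> slots (1 - e') m" if "j \<in> slots e' m" "e' = 0 \<or> e' = 1" for j e'
  proof -
    have "0 < m" using that by (auto simp: slots_def)
    moreover have "(j + 1) mod m mod 2 = (j + 1) mod 2" using assms(1) by (metis mod_mod_cancel)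
    moreover have "(j + 1) mod 2 = 1 - e'"
      using that by (auto simp: slots_def mod_Suc)
    ultimately show ?thesis by (simp add: slots_def)
  qed
  have pre: "(j + m - 1) mod m \<in> slots (1 - e') m" if "j \<in> slots e' m" "e' = 0 \<or> e' = 1" for j e'
  proof -
    have "0 < m" using that by (auto simp: slots_def)
    moreover have "(j + m - 1) mod m mod 2 = (j + m - 1) mod 2" using assms(1) by (metis mod_mod_cancel)
    moreover have "(j + m - 1) mod 2 = (j + 1) mod 2"
    proof -
      obtain k where "m = 2 * k" "0 < k" using assms(1) \<open>0 < m\<close> by auto
      then have "j + m - 1 = 2 * (k - 1) + (j + 1)" by simp
      then show ?thesis by (simp only: mod_mult_self4)
    qed
    moreover have "(j + 1) mod 2 = 1 - e'"
      using that by (auto simp: slots_def mod_Suc)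
    ultimately show ?thesis by (simp add: slots_def)
  qed
  have inv1: "((j + 1) mod m + m - 1) mod m = j" if "j < m" for j
    using that by (cases "j + 1 = m") auto
  have inv2: "((j + m - 1) mod m + 1) mod m = j" if "j < m" for j
  proof (cases j)
    case 0
    then show ?thesis using that by (cases m) auto
  next
    case (Suc i)
    then have "j + m - 1 = m + i" by simp
    then have "(j + m - 1) mod m = i" using that Suc by simp
    then show ?thesis using Suc that by simp
  qed
  have lt: "j \<in> slots e' m \<Longrightarrow> j < m" for j e' by (simp add: slots_def)
  have e': "1 - e = 0 \<or> 1 - e = 1" "1 - (1 - e) = e" using e by auto
  show "bij_betw (\<lambda>j. (j + 1) mod m) (slots e m) (slots (1 - e) m)"
  proof (rule bij_betw_byWitness[where f' = "\<lambda>j. (j + m - 1) mod m"])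
    show "\<forall>a\<in>slots e m. ((a + 1) mod m + m - 1) mod m = a" using inv1 lt by blast
    show "\<forall>a\<in>slots (1 - e) m. ((a + m - 1) mod m + 1) mod m = a" using inv2 lt by blast
    show "(\<lambda>j. (j + 1) mod m) ` slots e m \<subseteq> slots (1 - e) m" using suc[OF _ e] by blast
    show "(\<lambda>j. (j + m - 1) mod m) ` slots (1 - e) m \<subseteq> slots e m" using pre[OF _ e'(1)] e'(2) by force
  qed
  show "bij_betw (\<lambda>j. (j + m - 1) mod m) (slots e m) (slots (1 - e) m)"
  proof (rule bij_betw_byWitness[where f' = "\<lambda>j. (j + 1) mod m"])
    show "\<forall>a\<in>slots e m. ((a + m - 1) mod m + 1) mod m = a" using inv2 lt by blast
    show "\<forall>a\<in>slots (1 - e) m. ((a + 1) mod m + m - 1) mod m = a" using inv1 lt by blast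
    show "(\<lambda>j. (j + m - 1) mod m) ` slots e m \<subseteq> slots (1 - e) m" using pre[OF _ e] by blast
    show "(\<lambda>j. (j + 1) mod m) ` slots (1 - e) m \<subseteq> slots e m" using suc[OF _ e'(1)] e'(2) by force
  qed
qed

lemma bracket_const:
  assumes "even m" "e < 2"
  shows "bracket e m (\<lambda>_. c) y = 0"
proof -
  have "(\<Sum>j\<in>slots e m. int (y ((j + 1) mod m))) = (\<Sum>k\<in>slots (1 - e) m. int (y k))"
    by (rule sum.reindex_bij_betw[OF slots_mod_shift(1)[OF assms]])
  moreover have "(\<Sum>j\<in>slots e m. int (y ((j + m - 1) mod m))) = (\<Sum>k\<in>slots (1 - e) m. int (y k))"
    by (rule sum.reindex_bij_betw[OF slots_mod_shift(2)[OF assms]])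
  ultimately show ?thesis
    unfolding bracket_def by (simp add: sum_distrib_left[symmetric] sum_subtractf)
qed

lemma slots_split:
  assumes "even q" "p + q \<le> m" "e < 2"
  shows "slots e m = (+) p ` slots ((e + p) mod 2) q \<union> skip p q ` slots e (m - q)"
    and "(+) p ` slots ((e + p) mod 2) q \<inter> skip p q ` slots e (m - q) = {}"
    and "inj_on ((+) p) A" "inj_on (skip p q) A"
proof -
  have par: "skip p q k mod 2 = k mod 2" for k using assms(1) by (auto simp: skip_def)
  have parI: "k mod 2 = (e + p) mod 2 \<longleftrightarrow> (p + k) mod 2 = e" for k
    by (rule slot_parity_shift[OF assms(3)])
  show "slots e m = (+) p ` slots ((e + p) mod 2) q \<union> skip p q ` slots e (m - q)"
  proof (intro set_eqI iffI)
    fix x assume x: "x \<in> slots e m"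
    show "x \<in> (+) p ` slots ((e + p) mod 2) q \<union> skip p q ` slots e (m - q)"
    proof (cases "p \<le> x \<and> x < p + q")
      case True
      then have "x = p + (x - p)" "x - p \<in> slots ((e + p) mod 2) q"
        using x parI[of "x - p"] by (auto simp: slots_def)
      then show ?thesis by blast
    next
      case False
      then have u: "skip p q (unskip p q x) = x" by (auto simp: skip_def unskip_def)
      then have "unskip p q x mod 2 = e" using par[of "unskip p q x"] x by (simp add: slots_def)
      moreover have "unskip p q x < m - q" using False x assms(2) by (auto simp: unskip_def slots_def)
      ultimately show ?thesis using u by (metis (mono_tags, lifting) UnI2 imageI mem_Collect_eq slots_def)
    qed
  next
    fix x assume "x \<in> (+) p ` slots ((e + p) mod 2) q \<union> skip p q ` slots e (m - q)"
    then show "x \<in> slots e m"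
      using parI assms(1,2) by (auto simp: slots_def skip_def mod_eq_dvd_iff_nat)
  qed
  show "(+) p ` slots ((e + p) mod 2) q \<inter> skip p q ` slots e (m - q) = {}"
    by (auto simp: slots_def skip_def)
  show "inj_on ((+) p) A" by simp
  show "inj_on (skip p q) A" by (auto simp: inj_on_def skip_def split: if_splits)
qed

text \<open>
  The slots split into those inside and outside of the window, and only the increments next to
  its two ends feel the cut; these agree because \<open>y\<close>, and \<open>\<omega>\<close>
  if the ends are slots, take equal values there.
\<close>

lemma bracket_split:
  assumes "even m" "even q" "0 < q" "q < m" "p + q \<le> m" "e < 2"
    and yp: "y p = y ((p + q) mod m)" and wp: "p mod 2 = e \<Longrightarrow> \<omega> p = \<omega> ((p + q) mod m)"
  shows "bracket e m \<omega> y =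
    bracket ((e + p) mod 2) q (\<lambda>l. \<omega> (p + l)) (\<lambda>l. y (p + l)) +
    bracket e (m - q) (\<lambda>j. \<omega> (skip p q j)) (\<lambda>j. y (skip p q j))"
proof -
  define T where "T = (\<lambda>j. \<omega> j * (int (y ((j + 1) mod m)) - int (y ((j + m - 1) mod m))))"
  define h where "h = p mod (m - q)"
  define \<delta> where "\<delta> = \<omega> p * (int (y (p + q - 1)) - int (y ((p + m - 1) mod m)))"
  have wrap: "p < m - q \<or> p = m - q \<and> 0 < p" using assms by linarith
  have sh: "skip p q h = (p + q) mod m"
    using wrap assms(5) by (auto simp: h_def skip_def)
  have inT: "T (p + l) = \<omega> (p + l) * (int (y (p + (l + 1) mod q)) - int (y (p + (l + q - 1) mod q)))
      + (if l = 0 then \<delta> else 0)" if l: "l < q" for l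
  proof -
    have s: "y ((p + l + 1) mod m) = y (p + (l + 1) mod q)"
      using l yp assms(5) by (cases "l + 1 = q") auto
    have pr: "(p + l + m - 1) mod m = p + (l + q - 1) mod q" if "0 < l"
    proof -
      have "p + l + m - 1 = m + (p + l - 1)" "l + q - 1 = q + (l - 1)" using that by auto
      moreover have "(b + a) mod b = a" if "a < b" for a b :: nat using that by simp
      then have "(m + (p + l - 1)) mod m = p + l - 1" "(q + (l - 1)) mod q = l - 1"
        using l that assms(5) by (metis add_less_cancel_left diff_le_self less_le_trans le_less_trans, metis diff_le_self le_less_trans)
      ultimately show ?thesis using that by simp
    qed
    show ?thesis
    proof (cases "l = 0")
      case True
      then have "(l + q - 1) mod q = q - 1" using assms(3) by simp
      then show ?thesis using True s assms(3) unfolding T_def \<delta>_def by (simp add: algebra_simps)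
    next
      case False
      then show ?thesis using s pr unfolding T_def by simp
    qed
  qed
  have outT: "T (skip p q j) = \<omega> (skip p q j) * (int (y (skip p q ((j + 1) mod (m - q))))
       - int (y (skip p q ((j + (m - q) - 1) mod (m - q)))))
      + (if j = h then \<omega> ((p + q) mod m) * (int (y ((p + m - 1) mod m)) - int (y (p + q - 1))) else 0)"
    if j: "j < m - q" for j
  proof -
    have s: "y ((skip p q j + 1) mod m) = y (skip p q ((j + 1) mod (m - q)))"
    proof -
      consider "j + 1 < p" | "j + 1 = p" "p < m - q" | "j + 1 = p" "p = m - q"
        | "p \<le> j" "j + 1 < m - q" | "p \<le> j" "j + 1 = m - q" using j wrap by linarith
      then show ?thesis
      proof cases
        case 1
        then show ?thesis using wrap by (auto simp: skip_def)
      next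
        case 2
        then show ?thesis using yp assms(5) by (auto simp: skip_def)
      next
        case 3
        then have "p + q = m" by simp
        moreover have "(skip p q j + 1) mod m = p" "(j + 1) mod (m - q) = 0"
          using 3 assms(3,4) by (auto simp: skip_def)
        ultimately show ?thesis using yp 3 wrap by (simp add: skip_def)
      next
        case 4
        then show ?thesis by (auto simp: skip_def)
      next
        case 5
        then have "skip p q j + 1 = m" using assms(4) by (simp add: skip_def)
        then have a: "(skip p q j + 1) mod m = 0" by simp
        show ?thesis
        proof (cases "p = 0")
          case True
          then show ?thesis using a 5 yp assms(4) by (simp add: skip_def)
        next
          case False
          then show ?thesis using a 5 by (simp add: skip_def)
        qed
      qed
    qed
    have pr: "(skip p q j + m - 1) mod m = skip p q ((j + (m - q) - 1) mod (m - q))" if "j \<noteq> h"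
    proof (cases "j = 0")
      case True
      then have "p < m - q" "0 < p" using that wrap by (auto simp: h_def intro: ccontr)
      moreover have "(m - 1) mod m = m - 1" "(m - q - 1) mod (m - q) = m - q - 1"
        using assms(4) by auto
      ultimately show ?thesis using True assms(4) by (auto simp: skip_def)
    next
      case False
      then have a: "(j + (m - q) - 1) mod (m - q) = j - 1"
      proof -
        have "j + (m - q) - 1 = (m - q) + (j - 1)" using False by simp
        moreover have "j - 1 < m - q" using j by simp
        then have "((m - q) + (j - 1)) mod (m - q) = j - 1" by (simp only: mod_add_self1 mod_less)
        ultimately show ?thesis by (simp only:)
      qed
      have jp: "j \<noteq> p" using that j by (auto simp: h_def)
      have "skip p q j + m - 1 = m + (skip p q j - 1)" using False by (auto simp: skip_def)
      moreover have "skip p q j - 1 < m" using j by (auto simp: skip_def)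
      ultimately have "(skip p q j + m - 1) mod m = skip p q j - 1"
        by (simp only: mod_add_self1 mod_less)
      then show ?thesis using a jp False by (auto simp: skip_def)
    qed
    have prh: "(skip p q j + m - 1) mod m = p + q - 1"
      "skip p q ((j + (m - q) - 1) mod (m - q)) = (p + m - 1) mod m" if jh: "j = h"
    proof -
      show "(skip p q j + m - 1) mod m = p + q - 1"
      proof (cases "p + q = m")
        case True
        then show ?thesis using jh sh assms(3) by simp
      next
        case False
        then have "skip p q j + m - 1 = m + (p + q - 1)" using jh sh assms(3,5) by simp
        then show ?thesis using assms(5) False by simp
      qed
      show "skip p q ((j + (m - q) - 1) mod (m - q)) = (p + m - 1) mod m"
      proof (cases "p = 0")
        case True
        then have "j = 0" using jh by (simp add: h_def)
        then show ?thesis using True assms(3,4) by (simp add: skip_def)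
      next
        case False
        then have "p + m - 1 = m + (p - 1)" by simp
        moreover have "p - 1 < m" using assms(3,5) by simp
        ultimately have a: "(p + m - 1) mod m = p - 1" by (simp only: mod_add_self1 mod_less)
        have "(j + (m - q) - 1) mod (m - q) = p - 1"
        proof (cases "p = m - q")
          case True
          then have "j = 0" using jh by (simp add: h_def)
          then show ?thesis using True False by simp
        next
          case pF: False
          then have "j = p" using jh wrap by (simp add: h_def)
          then have "j + (m - q) - 1 = (m - q) + (p - 1)" using False by simp
          moreover have "p - 1 < m - q" using wrap by linarith
          ultimately show ?thesis by (simp only: mod_add_self1 mod_less)
        qed
        then show ?thesis using a False by (simp add: skip_def)
      qed
    qed
    show ?thesis
    proof (cases "j = h")
      case True
      then show ?thesis unfolding T_def s prh[OF True] using sh by (simp add: algebra_simps)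
    next
      case False
      then show ?thesis unfolding T_def s pr[OF False] by simp
    qed
  qed
  have "bracket e m \<omega> y = (\<Sum>j\<in>slots e m. T j)"
    by (simp add: bracket_def T_def)
  also have "\<dots> = (\<Sum>j\<in>(+) p ` slots ((e + p) mod 2) q. T j) + (\<Sum>j\<in>skip p q ` slots e (m - q). T j)"
    using slots_split[OF assms(2,5,6)] by (simp add: sum.union_disjoint)
  also have "\<dots> = (\<Sum>l\<in>slots ((e + p) mod 2) q. T (p + l)) + (\<Sum>j\<in>slots e (m - q). T (skip p q j))"
    by (simp add: sum.reindex slots_split(4)[OF assms(2,5,6)])
  also have "(\<Sum>l\<in>slots ((e + p) mod 2) q. T (p + l)) =
      bracket ((e + p) mod 2) q (\<lambda>l. \<omega> (p + l)) (\<lambda>l. y (p + l)) + (if p mod 2 = e then \<delta> else 0)"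
  proof -
    have "0 \<in> slots ((e + p) mod 2) q \<longleftrightarrow> p mod 2 = e"
      using slot_parity_shift[OF assms(6), of 0 p] assms(3) by (simp add: slots_def)
    moreover have "(\<Sum>l\<in>slots ((e + p) mod 2) q. T (p + l)) =
      bracket ((e + p) mod 2) q (\<lambda>l. \<omega> (p + l)) (\<lambda>l. y (p + l)) +
      (\<Sum>l\<in>slots ((e + p) mod 2) q. if l = 0 then \<delta> else 0)"
      unfolding bracket_def sum.distrib[symmetric]
      by (rule sum.cong[OF HOL.refl], rule inT) (simp add: slots_def)
    ultimately show ?thesis by (simp add: sum.delta')
  qed
  also have "(\<Sum>j\<in>slots e (m - q). T (skip p q j)) =
      bracket e (m - q) (\<lambda>j. \<omega> (skip p q j)) (\<lambda>j. y (skip p q j)) + (if p mod 2 = e then - \<delta> else 0)"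
  proof -
    have "h mod 2 = p mod 2" unfolding h_def using assms(1,2) by (metis even_diff_nat mod_mod_cancel even_iff_mod_2_eq_zero dvd_diff_nat)
    then have "h \<in> slots e (m - q) \<longleftrightarrow> p mod 2 = e"
      using assms(4) by (simp add: slots_def h_def)
    moreover have "(\<Sum>j\<in>slots e (m - q). T (skip p q j)) =
      bracket e (m - q) (\<lambda>j. \<omega> (skip p q j)) (\<lambda>j. y (skip p q j)) +
      (\<Sum>j\<in>slots e (m - q). if j = h then \<omega> ((p + q) mod m) * (int (y ((p + m - 1) mod m)) - int (y (p + q - 1))) else 0)"
      unfolding bracket_def sum.distrib[symmetric]
      by (rule sum.cong[OF HOL.refl], rule outT) (simp add: slots_def)
    ultimately show ?thesis using wp by (simp add: sum.delta' \<delta>_def algebra_simps)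
  qed
  finally show ?thesis by simp
qed

lemma bracket_window:
  assumes "even q" "p + q \<le> m" "e < 2" "p mod 2 \<noteq> e"
  shows "bracket e m (\<lambda>j. if j \<in> {p..<p+q} then 1 else 0) y = int (y ((p + q) mod m)) - int (y (p mod m))"
proof -
  obtain k where k: "q = 2 * k" using assms(1) by blast
  have e: "e = 0 \<or> e = 1" using assms(3) by auto
  define f where "f = (\<lambda>i. int (y ((p + 2 * i) mod m)))"
  have "bracket e m (\<lambda>j. if j \<in> {p..<p+q} then 1 else 0) y =
     (\<Sum>j\<in>slots e m \<inter> {p..<p+q}. int (y ((j + 1) mod m)) - int (y ((j + m - 1) mod m)))"
    unfolding bracket_def by (simp add: sum.inter_restrict if_distrib[of "\<lambda>c. c * _"] cong: if_cong)
  also have "\<dots> = (\<Sum>i<k. f (Suc i) - f i)"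
  proof (rule sum.reindex_bij_witness[where i = "\<lambda>i. p + 2 * i + 1" and j = "\<lambda>j. (j - p - 1) div 2"])
    fix j assume j: "j \<in> slots e m \<inter> {p..<p+q}"
    then have "j mod 2 = e" "p \<le> j" "j < p + q" by (auto simp: slots_def)
    then have "odd (j - p)" using e assms(4) by presburger
    then obtain i where "j - p = 2 * i + 1" by (rule oddE)
    then have i: "j = p + 2 * i + 1" "i < k" using \<open>p \<le> j\<close> \<open>j < p + q\<close> k by auto
    then show "p + 2 * ((j - p - 1) div 2) + 1 = j" "(j - p - 1) div 2 \<in> {..<k}" by auto
    have "j + m - 1 = m + (p + 2 * i)" using i by simp
    then show "f (Suc ((j - p - 1) div 2)) - f ((j - p - 1) div 2) = int (y ((j + 1) mod m)) - int (y ((j + m - 1) mod m))"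
      using i by (simp add: f_def add.commute)
  next
    fix i assume "i \<in> {..<k}"
    then show "(p + 2 * i + 1 - p - 1) div 2 = i" "p + 2 * i + 1 \<in> slots e m \<inter> {p..<p+q}"
      using e assms(2,4) k by (auto simp: slots_def) presburger+
  qed
  also have "\<dots> = f k - f 0" by (rule sum_lessThan_telescope)
  finally show ?thesis by (simp add: f_def k)
qed

lemma invariant_inner: "invariant r f \<Longrightarrow> invariant (inner r p q) (\<lambda>l. f (p + l))"
  by (auto simp: invariant_def inner_def)

lemma invariant_outer: "invariant r f \<Longrightarrow> invariant (outer r p q) (\<lambda>j. f (skip p q j))"
  by (auto simp: invariant_def outer_def)

text \<open>
  This is why the arcs of \<open>closes\<close> are the right ones. If the ends are slots,
  equality of \<open>y\<close> at them is part of the invariance. Otherwise the indicator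
  function of the window is an admissible test function, and its bracket is the difference of
  \<open>y\<close> at the ends. Once the ends agree, the brackets split, and invariant functions
  on the two parts glue.
\<close>

lemma (in slot_rel) solves_split:
  assumes c: "closes m r p (p + q)" and qm: "q < m"
  shows "solves e m r y \<longleftrightarrow> y p = y ((p + q) mod m) \<and>
    solves ((e + p) mod 2) q (inner r p q) (\<lambda>l. y (p + l)) \<and>
    solves e (m - q) (outer r p q) (\<lambda>j. y (skip p q j))"
proof -
  note P = closesD[OF c]
  have q: "even q" "0 < q" using P(1,3) by auto
  have pm: "p < m" using P by simp
  define h where "h = p mod (m - q)"
  have wrap: "p < m - q \<or> p = m - q \<and> 0 < p" using P(2) qm by linarith
  have sh: "skip p q h = (p + q) mod m"
    using wrap P(2) by (auto simp: h_def skip_def)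
  have theta: "(p, (p + q) mod m) \<in> r" if "p mod 2 = e"
    using theta_partner[OF c] refl_r pm that by blast
  have ext: "invariant r f"
    if fin: "invariant (inner r p q) f2" and fout: "invariant (outer r p q) f1"
      and match: "p mod 2 = e \<Longrightarrow> f2 0 = f1 h"
      and f: "\<And>l. l < q \<Longrightarrow> f (p + l) = f2 l" "\<And>j. j < m - q \<Longrightarrow> f (skip p q j) = f1 j" for f f1 f2 :: "nat \<Rightarrow> 'b"
  proof -
    have rep_in: "\<exists>l<q. x = p + l" if "p \<le> x" "x < p + q" for x
      using that by (intro exI[of _ "x - p"]) auto
    have rep_out: "\<exists>j<m-q. x = skip p q j" if "x < p \<or> p + q \<le> x" "x < m" for x
      using that P(2) by (intro exI[of _ "unskip p q x"]) (auto simp: skip_def unskip_def)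
    have cross: "f x = f y" if xy: "(x, y) \<in> r" "p \<le> x" "x < p + q" "y < p \<or> p + q \<le> y" for x y
    proof -
      have xp: "(x, p) \<in> r" using P(5)[OF xy] .
      then have pe: "p mod 2 = e" using mem_r by blast
      have ph: "(y, skip p q h) \<in> r"
        using trans_r[OF sym_r[OF xy(1)] trans_r[OF xp theta[OF pe]]] sh by simp
      obtain l where l: "l < q" "x = p + l" using rep_in xy by blast
      obtain j where j: "j < m - q" "y = skip p q j" using rep_out xy mem_r by blast
      have "(l, 0) \<in> inner r p q" using xp l q by (simp add: inner_def)
      then have "f2 l = f2 0" using fin by (auto simp: invariant_def)
      moreover have "f1 j = f1 h" using fout ph j by (auto simp: invariant_def outer_def)
      ultimately show ?thesis using f l j match[OF pe] by simp
    qed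
    show ?thesis unfolding invariant_def
    proof (intro allI impI)
      fix x y assume xy: "(x, y) \<in> r"
      have xm: "x < m" "y < m" using mem_r xy by auto
      consider "p \<le> x" "x < p + q" "p \<le> y" "y < p + q" | "x < p \<or> p + q \<le> x" "y < p \<or> p + q \<le> y"
        | "p \<le> x" "x < p + q" "y < p \<or> p + q \<le> y" | "x < p \<or> p + q \<le> x" "p \<le> y" "y < p + q" by linarith
      then show "f x = f y"
      proof cases
        case 1
        then obtain l k where "l < q" "x = p + l" "k < q" "y = p + k" using rep_in by blast
        then show ?thesis using fin f xy by (auto simp: invariant_def inner_def)
      next
        case 2
        then obtain l k where "l < m - q" "x = skip p q l" "k < m - q" "y = skip p q k"
          using rep_out xm by blast
        then show ?thesis using fout f xy by (auto simp: invariant_def outer_def)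
      next
        case 3
        then show ?thesis using cross xy by blast
      next
        case 4
        then show ?thesis using cross[OF sym_r[OF xy]] by simp
      qed
    qed
  qed
  have split: "bracket e m \<omega> y =
    bracket ((e + p) mod 2) q (\<lambda>l. \<omega> (p + l)) (\<lambda>l. y (p + l)) +
    bracket e (m - q) (\<lambda>j. \<omega> (skip p q j)) (\<lambda>j. y (skip p q j))"
    if "y p = y ((p + q) mod m)" "invariant r \<omega>" for \<omega>
    by (rule bracket_split[OF even_m q qm P(2) e2 that(1)]) (use that(2) theta in \<open>auto simp: invariant_def\<close>)
  have cong: "bracket e' k \<omega> z = bracket e' k \<omega>' z" if "\<And>j. j < k \<Longrightarrow> \<omega> j = \<omega>' j" for e' k \<omega> \<omega>' z
    unfolding bracket_def by (rule sum.cong) (use that in \<open>auto simp: slots_def\<close>)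
  have build: "\<exists>\<omega>. invariant r \<omega> \<and> (\<forall>l<q. \<omega> (p + l) = w2 l) \<and> (\<forall>j<m-q. \<omega> (skip p q j) = w1 j)"
    if "invariant (inner r p q) w2" "invariant (outer r p q) w1" "p mod 2 = e \<Longrightarrow> w2 0 = w1 h" for w1 w2 :: "nat \<Rightarrow> int"
  proof -
    define \<omega> where "\<omega> = (\<lambda>x. if x \<in> {p..<p+q} then w2 (x - p) else w1 (unskip p q x))"
    have a: "\<omega> (p + l) = w2 l" if "l < q" for l using that by (simp add: \<omega>_def)
    have b: "\<omega> (skip p q j) = w1 j" for j by (auto simp: \<omega>_def skip_def unskip_def)
    have "invariant r \<omega>" by (rule ext[OF that]) (use a b in auto)
    then show ?thesis using a b by blast
  qed
  have evm: "even (m - q)" using even_m q by simp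
  show ?thesis
  proof
    assume S: "solves e m r y"
    then have ry: "invariant r y" and br: "\<And>\<omega>. invariant r \<omega> \<Longrightarrow> bracket e m \<omega> y = 0"
      by (auto simp: solves_def)
    have yp: "y p = y ((p + q) mod m)"
    proof (cases "p mod 2 = e")
      case True
      then show ?thesis using theta ry by (auto simp: invariant_def)
    next
      case False
      have "invariant r (\<lambda>j. if j \<in> {p..<p+q} then 1 else 0 :: int)"
      proof -
        have "(i \<in> {p..<p+q}) = (j \<in> {p..<p+q})" if ij: "(i, j) \<in> r" for i j
          using P(5)[OF ij] P(5)[OF sym_r[OF ij]] mem_r False by fastforce
        then show ?thesis by (simp add: invariant_def)
      qed
      from br[OF this] show ?thesis using bracket_window[OF q(1) P(2) e2 False, of y] pm by simp
    qed
    have "bracket ((e + p) mod 2) q w (\<lambda>l. y (p + l)) = 0" if w: "invariant (inner r p q) w" for w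
    proof -
      obtain \<omega> where \<omega>: "invariant r \<omega>" "\<forall>l<q. \<omega> (p + l) = w l" "\<forall>j<m-q. \<omega> (skip p q j) = w 0"
        using build[OF w, of "\<lambda>_. w 0"] by (auto simp: invariant_def)
      have "bracket e (m - q) (\<lambda>j. \<omega> (skip p q j)) (\<lambda>j. y (skip p q j)) = 0"
        using cong[of "m - q" "\<lambda>j. \<omega> (skip p q j)" "\<lambda>_. w 0" e] \<omega>(3) bracket_const[OF evm e2] by simp
      then show ?thesis using split[OF yp \<omega>(1)] br[OF \<omega>(1)] cong[of q "\<lambda>l. \<omega> (p + l)" w] \<omega>(2) by simp
    qed
    moreover have "bracket e (m - q) w (\<lambda>j. y (skip p q j)) = 0" if w: "invariant (outer r p q) w" for w
    proof -
      obtain \<omega> where \<omega>: "invariant r \<omega>" "\<forall>l<q. \<omega> (p + l) = w h" "\<forall>j<m-q. \<omega> (skip p q j) = w j"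
        using build[OF _ w, of "\<lambda>_. w h"] by (auto simp: invariant_def)
      have "bracket ((e + p) mod 2) q (\<lambda>l. \<omega> (p + l)) (\<lambda>l. y (p + l)) = 0"
        using cong[of q "\<lambda>l. \<omega> (p + l)" "\<lambda>_. w h" "(e + p) mod 2"] \<omega>(2) bracket_const[OF q(1)] by simp
      then show ?thesis using split[OF yp \<omega>(1)] br[OF \<omega>(1)] cong[of "m - q" "\<lambda>j. \<omega> (skip p q j)" w] \<omega>(3) by simp
    qed
    ultimately show "y p = y ((p + q) mod m) \<and>
      solves ((e + p) mod 2) q (inner r p q) (\<lambda>l. y (p + l)) \<and>
      solves e (m - q) (outer r p q) (\<lambda>j. y (skip p q j))"
      using yp ry invariant_inner invariant_outer unfolding solves_def by blast
  next
    assume R: "y p = y ((p + q) mod m) \<and>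
      solves ((e + p) mod 2) q (inner r p q) (\<lambda>l. y (p + l)) \<and>
      solves e (m - q) (outer r p q) (\<lambda>j. y (skip p q j))"
    have "invariant r y"
      by (rule ext[of "\<lambda>l. y (p + l)" "\<lambda>j. y (skip p q j)"]) (use R sh in \<open>auto simp: solves_def\<close>)
    moreover have "bracket e m \<omega> y = 0" if "invariant r \<omega>" for \<omega>
      using split[OF _ that] R invariant_inner[OF that, of p q] invariant_outer[OF that, of p q]
      by (simp add: solves_def)
    ultimately show "solves e m r y" by (simp add: solves_def)
  qed
qed

lemma solves_cong:
  assumes "\<And>k. k < m \<Longrightarrow> y k = z k" "\<And>i j. (i, j) \<in> r \<Longrightarrow> i < m \<and> j < m"
  shows "solves e m r y \<longleftrightarrow> solves e m r z"
proof -
  have "bracket e m \<omega> y = bracket e m \<omega> z" for \<omega>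
    unfolding bracket_def
  proof (rule sum.cong[OF HOL.refl])
    fix j assume "j \<in> slots e m"
    then have "0 < m" by (auto simp: slots_def)
    then show "\<omega> j * (int (y ((j + 1) mod m)) - int (y ((j + m - 1) mod m))) =
        \<omega> j * (int (z ((j + 1) mod m)) - int (z ((j + m - 1) mod m)))"
      using assms(1) by simp
  qed
  moreover have "invariant r y \<longleftrightarrow> invariant r z"
    using assms unfolding invariant_def by metis
  ultimately show ?thesis by (simp add: solves_def)
qed

text \<open>
  In contrast to \<open>grid_sum\<close>, all points of the cycle are treated alike here, which
  allows for one argument wherever the arc lies; grid sums are recovered by a point mass as the
  weight at \<open>0\<close>.
\<close>

definition full_sum :: "nat \<Rightarrow> nat \<Rightarrow> nat \<Rightarrow> (nat \<times> nat) set \<Rightarrow> (nat \<Rightarrow> nat \<Rightarrow> complex) \<Rightarrow> complex" where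
  "full_sum N e m r \<phi> = (\<Sum>y | y \<in> {..<m} \<rightarrow>\<^sub>E {1..N} \<and> solves e m r y. \<Prod>k<m. \<phi> k (y k))"

definition grid_sum :: "nat \<Rightarrow> nat \<Rightarrow> nat \<Rightarrow> (nat \<times> nat) set \<Rightarrow> (nat \<Rightarrow> nat \<Rightarrow> complex) \<Rightarrow> nat \<Rightarrow> complex" where
  "grid_sum N e m r \<phi> v =
     (\<Sum>y | y \<in> {..<m} \<rightarrow>\<^sub>E {1..N} \<and> solves e m r y \<and> y 0 = v. \<Prod>k=1..<m. \<phi> k (y k))"

lemma finite_grid_functions [simp]: "finite {y \<in> {..<m::nat} \<rightarrow>\<^sub>E {1..N::nat}. P y}"
  by (rule finite_subset[of _ "{..<m} \<rightarrow>\<^sub>E {1..N}"]) (auto intro: finite_PiE)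

lemma full_sum_point:
  assumes "0 < m" and "\<And>k. 0 < k \<Longrightarrow> k < m \<Longrightarrow> \<phi>' k = \<phi> k" and "\<And>w. \<phi>' 0 w = (if w = v then c else 0)"
  shows "full_sum N e m r \<phi>' = c * grid_sum N e m r \<phi> v"
proof -
  have "full_sum N e m r \<phi>' = (\<Sum>y | y \<in> {..<m} \<rightarrow>\<^sub>E {1..N} \<and> solves e m r y.
      if y 0 = v then c * (\<Prod>k=1..<m. \<phi> k (y k)) else 0)"
    unfolding full_sum_def
  proof (rule sum.cong[OF HOL.refl])
    fix y
    have "(\<Prod>k<m. \<phi>' k (y k)) = \<phi>' 0 (y 0) * (\<Prod>k=1..<m. \<phi>' k (y k))"
    proof -
      have "{..<m} = insert 0 {1..<m}" using assms(1) by auto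
      then show ?thesis by simp
    qed
    also have "(\<Prod>k=1..<m. \<phi>' k (y k)) = (\<Prod>k=1..<m. \<phi> k (y k))"
      by (rule prod.cong) (use assms(2) in auto)
    finally show "(\<Prod>k<m. \<phi>' k (y k)) = (if y 0 = v then c * (\<Prod>k=1..<m. \<phi> k (y k)) else 0)"
      using assms(3) by simp
  qed
  also have "\<dots> = (\<Sum>y | (y \<in> {..<m} \<rightarrow>\<^sub>E {1..N} \<and> solves e m r y) \<and> y 0 = v. c * (\<Prod>k=1..<m. \<phi> k (y k)))"
    by (subst sum.inter_filter[symmetric]) (use finite_grid_functions[of m N "solves e m r"] in \<open>auto intro!: sum.cong\<close>)
  also have "\<dots> = c * grid_sum N e m r \<phi> v"
    unfolding grid_sum_def sum_distrib_left by (simp add: conj_assoc)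
  finally show ?thesis .
qed

text \<open>
  Solutions correspond to pairs of an outer and an inner solution which agree at the identified
  end points, so that the inner sum, with its base value fixed, becomes part of the weight at
  that point.
\<close>

lemma (in slot_rel) full_sum_split:
  fixes N :: nat and \<phi> :: "nat \<Rightarrow> nat \<Rightarrow> complex"
  assumes c: "closes m r p (p + q)" and qm: "q < m"
  defines "h \<equiv> p mod (m - q)"
  defines "\<phi>' \<equiv> (\<lambda>j. if j = h then (\<lambda>v. \<phi> p v * grid_sum N ((e + p) mod 2) q (inner r p q) (\<lambda>l. \<phi> (p + l)) v
        * \<phi> ((p + q) mod m) v) else \<phi> (skip p q j))"
  shows "full_sum N e m r \<phi> = full_sum N e (m - q) (outer r p q) \<phi>'"
proof -
  note P = closesD[OF c]
  have q: "even q" "0 < q" using P(1,3) by auto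
  have wrap: "p < m - q \<or> p = m - q \<and> 0 < p" using P(2) qm by linarith
  have hlt: "h < m - q" using qm by (simp add: h_def)
  have sh: "skip p q h = (p + q) mod m"
    using wrap P(2) by (auto simp: h_def skip_def)
  let ?e = "(e + p) mod 2"
  interpret I: slot_rel ?e q "inner r p q" by (rule slot_rel_inner[OF P(2) q(1)])
  interpret O: slot_rel e "m - q" "outer r p q" by (rule slot_rel_outer[OF P(2) q(1)])
  define D where "D = {y. y \<in> {..<m} \<rightarrow>\<^sub>E {1..N} \<and> solves e m r y}"
  define D1 where "D1 = {y. y \<in> {..<m-q} \<rightarrow>\<^sub>E {1..N} \<and> solves e (m - q) (outer r p q) y}"
  define D2 where "D2 = (\<lambda>v. {y. y \<in> {..<q} \<rightarrow>\<^sub>E {1..N} \<and> solves ?e q (inner r p q) y \<and> y 0 = v})"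
  define fro where "fro = (\<lambda>y. (restrict (\<lambda>j. y (skip p q j)) {..<m-q}, restrict (\<lambda>l. y (p + l)) {..<q}) :: (nat \<Rightarrow> nat) \<times> (nat \<Rightarrow> nat))"
  define tog where "tog = (\<lambda>(y1, y2). restrict (\<lambda>x. if x \<in> {p..<p+q} then y2 (x - p) else y1 (unskip p q x)) {..<m} :: nat \<Rightarrow> nat)"
  have skip_lt: "skip p q j < m" if "j < m - q" for j using that by (auto simp: skip_def)
  have skip_out: "skip p q j \<notin> {p..<p+q}" for j by (auto simp: skip_def)
  have unskip_skip: "unskip p q (skip p q j) = j" for j by (auto simp: skip_def unskip_def)
  have skip_unskip: "skip p q (unskip p q x) = x" if "x \<notin> {p..<p+q}" for x
    using that by (auto simp: skip_def unskip_def)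
  have unskip_lt: "unskip p q x < m - q" if "x \<notin> {p..<p+q}" "x < m" for x
    using that P(2) by (auto simp: unskip_def)
  have tog_skip: "tog (y1, y2) (skip p q j) = y1 j" if "j < m - q" for y1 y2 j
    using skip_lt[OF that] skip_out[of j] unskip_skip[of j]
    by (simp add: tog_def del: atLeastLessThan_iff)
  have tog_in: "tog (y1, y2) (p + l) = y2 l" if "l < q" for y1 y2 l
    using that P(2) by (simp add: tog_def)
  have split: "solves e m r y \<longleftrightarrow> y p = y ((p + q) mod m) \<and>
    solves ?e q (inner r p q) (restrict (\<lambda>l. y (p + l)) {..<q}) \<and>
    solves e (m - q) (outer r p q) (restrict (\<lambda>j. y (skip p q j)) {..<m-q})" for y
    unfolding solves_split[OF c qm]
    using solves_cong[of q "\<lambda>l. y (p + l)" "restrict (\<lambda>l. y (p + l)) {..<q}" "inner r p q" ?e]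
      solves_cong[of "m - q" "\<lambda>j. y (skip p q j)" "restrict (\<lambda>j. y (skip p q j)) {..<m-q}" "outer r p q" e]
      I.mem_r O.mem_r by auto
  have "full_sum N e m r \<phi> = (\<Sum>y\<in>D. \<Prod>k<m. \<phi> k (y k))"
    by (simp add: full_sum_def D_def)
  also have "\<dots> = (\<Sum>z\<in>(SIGMA y1:D1. D2 (y1 h)).
      (\<Prod>l<q. \<phi> (p + l) (snd z l)) * (\<Prod>j<m-q. \<phi> (skip p q j) (fst z j)))"
  proof (rule sum.reindex_bij_witness[where i = tog and j = fro])
    fix y assume y: "y \<in> D"
    then have yE: "y \<in> {..<m} \<rightarrow>\<^sub>E {1..N}" and ys: "solves e m r y" by (auto simp: D_def)
    show "tog (fro y) = y"
    proof
      fix x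
      show "tog (fro y) x = y x"
      proof (cases "x < m")
        case True
        then show ?thesis
          using skip_unskip[of x] unskip_lt[of x] by (auto simp: tog_def fro_def)
      next
        case False
        then show ?thesis using yE by (auto simp: tog_def fro_def PiE_def extensional_def)
      qed
    qed
    have "fst (fro y) \<in> D1" using yE ys split[of y] skip_lt unfolding fro_def D1_def by (auto simp: PiE_def Pi_def)
    moreover have "snd (fro y) \<in> D2 (fst (fro y) h)"
      using yE ys split[of y] P(2) hlt sh q(2) unfolding fro_def D2_def by (auto simp: PiE_def Pi_def)
    ultimately show "fro y \<in> (SIGMA y1:D1. D2 (y1 h))" by (cases "fro y") auto
    have img: "{..<m} = (+) p ` {..<q} \<union> skip p q ` {..<m-q}"
    proof (intro set_eqI iffI)
      fix x assume "x \<in> {..<m}"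
      then show "x \<in> (+) p ` {..<q} \<union> skip p q ` {..<m-q}"
      proof (cases "x \<in> {p..<p+q}")
        case True
        then have "x = p + (x - p)" "x - p < q" by auto
        then show ?thesis by blast
      next
        case False
        then show ?thesis using skip_unskip[of x] unskip_lt[of x] \<open>x \<in> {..<m}\<close> by (metis UnI2 imageI lessThan_iff)
      qed
    next
      fix x assume "x \<in> (+) p ` {..<q} \<union> skip p q ` {..<m-q}"
      then show "x \<in> {..<m}" using skip_lt P(2) by auto
    qed
    have disj: "(+) p ` {..<q} \<inter> skip p q ` {..<m-q} = {}"
      by (auto simp: skip_def split: if_splits)
    have "(\<Prod>k<m. \<phi> k (y k)) = (\<Prod>k\<in>(+) p ` {..<q}. \<phi> k (y k)) * (\<Prod>k\<in>skip p q ` {..<m-q}. \<phi> k (y k))"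
      unfolding img by (rule prod.union_disjoint) (use disj in auto)
    also have "(\<Prod>k\<in>(+) p ` {..<q}. \<phi> k (y k)) = (\<Prod>l<q. \<phi> (p + l) (snd (fro y) l))"
      by (subst prod.reindex) (auto simp: fro_def)
    also have "(\<Prod>k\<in>skip p q ` {..<m-q}. \<phi> k (y k)) = (\<Prod>j<m-q. \<phi> (skip p q j) (fst (fro y) j))"
      by (subst prod.reindex) (auto simp: fro_def inj_on_def skip_def split: if_splits)
    finally show "(\<Prod>l<q. \<phi> (p + l) (snd (fro y) l)) * (\<Prod>j<m-q. \<phi> (skip p q j) (fst (fro y) j)) = (\<Prod>k<m. \<phi> k (y k))"
      by simp
  next
    fix z assume z: "z \<in> (SIGMA y1:D1. D2 (y1 h))"
    obtain y1 y2 where zz: "z = (y1, y2)" by (cases z)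
    then have y1: "y1 \<in> {..<m-q} \<rightarrow>\<^sub>E {1..N}" "solves e (m - q) (outer r p q) y1"
      and y2: "y2 \<in> {..<q} \<rightarrow>\<^sub>E {1..N}" "solves ?e q (inner r p q) y2" "y2 0 = y1 h"
      using z by (auto simp: D1_def D2_def)
    have f1: "restrict (\<lambda>j. tog z (skip p q j)) {..<m-q} = y1"
    proof
      fix x show "restrict (\<lambda>j. tog z (skip p q j)) {..<m-q} x = y1 x"
        using y1(1) tog_skip[of x y1 y2] zz by (auto simp: PiE_def extensional_def)
    qed
    have f2: "restrict (\<lambda>l. tog z (p + l)) {..<q} = y2"
    proof
      fix x show "restrict (\<lambda>l. tog z (p + l)) {..<q} x = y2 x"
        using y2(1) tog_in[of x y1 y2] zz by (auto simp: PiE_def extensional_def)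
    qed
    show "fro (tog z) = z" unfolding fro_def f1 f2 by (rule zz[symmetric])
    have "tog z \<in> {..<m} \<rightarrow>\<^sub>E {1..N}"
    proof (rule PiE_I)
      fix x assume x: "x \<in> {..<m}"
      show "tog z x \<in> {1..N}"
      proof (cases "x \<in> {p..<p+q}")
        case True
        then have "tog z x = y2 (x - p)" "x - p < q" using x zz by (auto simp: tog_def)
        then show ?thesis using PiE_mem[OF y2(1), of "x - p"] by simp
      next
        case False
        then have "tog z x = y1 (unskip p q x)" using x zz by (auto simp: tog_def)
        then show ?thesis using PiE_mem[OF y1(1), of "unskip p q x"] unskip_lt[OF False] x by simp
      qed
    qed (auto simp: tog_def zz)
    moreover have "tog z p = tog z ((p + q) mod m)"
      using tog_in[of 0 y1 y2] tog_skip[OF hlt, of y1 y2] y2(3) zz sh q(2) by simp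
    then have "solves e m r (tog z)" using split[of "tog z"] f1 f2 y1 y2 by simp
    ultimately show "tog z \<in> D" by (simp add: D_def)
  qed
  also have "\<dots> = (\<Sum>y1\<in>D1. \<Sum>y2\<in>D2 (y1 h).
      (\<Prod>l<q. \<phi> (p + l) (y2 l)) * (\<Prod>j<m-q. \<phi> (skip p q j) (y1 j)))"
  proof -
    have fin: "finite D1" "\<And>v. finite (D2 v)" unfolding D1_def D2_def by (rule finite_grid_functions)+
    show ?thesis by (subst sum.Sigma) (use fin in \<open>simp_all add: split_beta\<close>)
  qed
  also have "\<dots> = (\<Sum>y1\<in>D1. \<Prod>j<m-q. \<phi>' j (y1 j))"
  proof (rule sum.cong[OF HOL.refl])
    fix y1 assume "y1 \<in> D1"
    have "(\<Sum>y2\<in>D2 (y1 h). (\<Prod>l<q. \<phi> (p + l) (y2 l)) * (\<Prod>j<m-q. \<phi> (skip p q j) (y1 j)))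
      = (\<Sum>y2\<in>D2 (y1 h). \<phi> p (y1 h) * (\<Prod>l=1..<q. \<phi> (p + l) (y2 l))) * (\<Prod>j<m-q. \<phi> (skip p q j) (y1 j))"
      unfolding sum_distrib_right
    proof (rule sum.cong[OF HOL.refl])
      fix y2 assume y2: "y2 \<in> D2 (y1 h)"
      have "{..<q} = insert 0 {1..<q}" using q(2) by auto
      then have "(\<Prod>l<q. \<phi> (p + l) (y2 l)) = \<phi> p (y2 0) * (\<Prod>l=1..<q. \<phi> (p + l) (y2 l))" by simp
      then show "(\<Prod>l<q. \<phi> (p + l) (y2 l)) * (\<Prod>j<m-q. \<phi> (skip p q j) (y1 j)) =
         \<phi> p (y1 h) * (\<Prod>l=1..<q. \<phi> (p + l) (y2 l)) * (\<Prod>j<m-q. \<phi> (skip p q j) (y1 j))"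
        using y2 by (simp add: D2_def)
    qed
    also have "(\<Sum>y2\<in>D2 (y1 h). \<phi> p (y1 h) * (\<Prod>l=1..<q. \<phi> (p + l) (y2 l))) =
       \<phi> p (y1 h) * grid_sum N ?e q (inner r p q) (\<lambda>l. \<phi> (p + l)) (y1 h)"
      by (simp add: grid_sum_def D2_def sum_distrib_left)
    also have "\<phi> p (y1 h) * grid_sum N ?e q (inner r p q) (\<lambda>l. \<phi> (p + l)) (y1 h) *
       (\<Prod>j<m-q. \<phi> (skip p q j) (y1 j)) = \<phi>' h (y1 h) * (\<Prod>j\<in>{..<m-q} - {h}. \<phi>' j (y1 j))"
    proof -
      have "(\<Prod>j<m-q. \<phi> (skip p q j) (y1 j)) =
         \<phi> (skip p q h) (y1 h) * (\<Prod>j\<in>{..<m-q} - {h}. \<phi> (skip p q j) (y1 j))"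
        by (rule prod.remove) (use hlt in auto)
      moreover have "(\<Prod>j\<in>{..<m-q} - {h}. \<phi> (skip p q j) (y1 j)) = (\<Prod>j\<in>{..<m-q} - {h}. \<phi>' j (y1 j))"
        by (rule prod.cong) (auto simp: \<phi>'_def)
      moreover have "\<phi>' h (y1 h) = \<phi> p (y1 h) * grid_sum N ?e q (inner r p q) (\<lambda>l. \<phi> (p + l)) (y1 h)
          * \<phi> (skip p q h) (y1 h)"
        unfolding \<phi>'_def sh by simp
      ultimately show ?thesis by (simp only: mult.assoc)
    qed
    also have "\<dots> = (\<Prod>j<m-q. \<phi>' j (y1 j))"
      by (rule prod.remove[symmetric]) (use hlt in auto)
    finally show "(\<Sum>y2\<in>D2 (y1 h). (\<Prod>l<q. \<phi> (p + l) (y2 l)) * (\<Prod>j<m-q. \<phi> (skip p q j) (y1 j))) = (\<Prod>j<m-q. \<phi>' j (y1 j))" .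
  qed
  also have "\<dots> = full_sum N e (m - q) (outer r p q) \<phi>'"
    by (simp add: full_sum_def D1_def)
  finally show ?thesis .
qed

text \<open>
  The discrete counterpart of nesting: the inner sum is multiplied by the weights at both ends
  of the arc and inserted into the outer sum. It is an exact identity for every grid size.
\<close>

lemma (in slot_rel) grid_sum_split:
  assumes c: "closes m r p (p + q)" and p: "0 < p" and pq: "p + q < m"
  shows "grid_sum N e m r \<phi> v = grid_sum N e (m - q) (outer r p q)
    (\<lambda>j. if j = p then (\<lambda>v. \<phi> p v * grid_sum N ((e + p) mod 2) q (inner r p q) (\<lambda>l. \<phi> (p + l)) v * \<phi> (p + q) v)
         else \<phi> (skip p q j)) v"
proof -
  let ?\<delta> = "\<lambda>w. if w = v then 1 else 0 :: complex"
  let ?\<phi> = "\<phi>(0 := ?\<delta>)"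
  have h: "p mod (m - q) = p" "(p + q) mod m = p + q" using pq by auto
  have e0: "e = 0 \<or> e = 1" using e2 by auto
  have gs: "grid_sum N e' q r' (\<lambda>l. ?\<phi> (p + l)) w = grid_sum N e' q r' (\<lambda>l. \<phi> (p + l)) w" for w e' q r'
    unfolding grid_sum_def by (intro sum.cong HOL.refl prod.cong) (use p in auto)
  have qm: "q < m" using pq by simp
  have "grid_sum N e m r \<phi> v = full_sum N e m r ?\<phi>"
    using full_sum_point[of m ?\<phi> \<phi> v 1] pq by simp
  also have "\<dots> = full_sum N e (m - q) (outer r p q)
    (\<lambda>j. if j = p then (\<lambda>v. ?\<phi> p v * grid_sum N ((e + p) mod 2) q (inner r p q) (\<lambda>l. ?\<phi> (p + l)) v * ?\<phi> (p + q) v)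
         else ?\<phi> (skip p q j))"
    using full_sum_split[OF c qm, of N ?\<phi>] unfolding h .
  also have "\<dots> = 1 * grid_sum N e (m - q) (outer r p q)
    (\<lambda>j. if j = p then (\<lambda>v. \<phi> p v * grid_sum N ((e + p) mod 2) q (inner r p q) (\<lambda>l. \<phi> (p + l)) v * \<phi> (p + q) v)
         else \<phi> (skip p q j)) v"
    unfolding gs by (rule full_sum_point) (use p pq in \<open>auto simp: skip_def\<close>)
  finally show ?thesis by simp
qed

lemma (in slot_rel) grid_sum_split_left:
  assumes c: "closes m r 0 q" and qm: "q < m"
  shows "grid_sum N e m r \<phi> v = grid_sum N e q (inner r 0 q) \<phi> v * \<phi> q v *
    grid_sum N e (m - q) (outer r 0 q) (\<lambda>j. \<phi> (j + q)) v"
proof -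
  let ?\<delta> = "\<lambda>w. if w = v then 1 else 0 :: complex"
  let ?\<phi> = "\<phi>(0 := ?\<delta>)"
  have q: "0 < q" using closesD(1)[OF c] .
  have e: "(e + 0) mod 2 = e" using e2 by simp
  have h: "(0 + q) mod m = q" using qm by simp
  have gs: "grid_sum N e q (inner r 0 q) (\<lambda>l. ?\<phi> (0 + l)) w = grid_sum N e q (inner r 0 q) \<phi> w" for w
    unfolding grid_sum_def by (intro sum.cong HOL.refl prod.cong) auto
  have "grid_sum N e m r \<phi> v = full_sum N e m r ?\<phi>"
    using full_sum_point[of m ?\<phi> \<phi> v 1] qm by simp
  also have "\<dots> = (grid_sum N e q (inner r 0 q) \<phi> v * \<phi> q v) * grid_sum N e (m - q) (outer r 0 q) (\<lambda>j. \<phi> (j + q)) v"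
  proof -
    have "full_sum N e m r ?\<phi> = full_sum N e (m - q) (outer r 0 q)
      (\<lambda>j. if j = 0 then (\<lambda>w. ?\<phi> 0 w * grid_sum N e q (inner r 0 q) (\<lambda>l. ?\<phi> (0 + l)) w * ?\<phi> q w)
         else ?\<phi> (skip 0 q j))"
      using full_sum_split[of 0 q N ?\<phi>] c qm unfolding e h by simp
    also have "\<dots> = (grid_sum N e q (inner r 0 q) \<phi> v * \<phi> q v) * grid_sum N e (m - q) (outer r 0 q) (\<lambda>j. \<phi> (j + q)) v"
      unfolding gs by (rule full_sum_point) (use q qm in \<open>auto simp: skip_def\<close>)
    finally show ?thesis .
  qed
  finally show ?thesis .
qed

lemma (in slot_rel) grid_sum_split_right:
  assumes c: "closes m r p m" and p: "0 < p"
  shows "grid_sum N e m r \<phi> v = grid_sum N e p (outer r p (m - p)) \<phi> v * \<phi> p v *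
    grid_sum N ((e + p) mod 2) (m - p) (inner r p (m - p)) (\<lambda>l. \<phi> (p + l)) v"
proof -
  let ?\<delta> = "\<lambda>w. if w = v then 1 else 0 :: complex"
  let ?\<phi> = "\<phi>(0 := ?\<delta>)"
  have pm: "p < m" using closesD(1)[OF c] .
  have c': "closes m r p (p + (m - p))" using c pm by simp
  have gs: "grid_sum N e' q r' (\<lambda>l. ?\<phi> (p + l)) w = grid_sum N e' q r' (\<lambda>l. \<phi> (p + l)) w" for w e' q r'
    unfolding grid_sum_def by (intro sum.cong HOL.refl prod.cong) (use p in auto)
  have "grid_sum N e m r \<phi> v = full_sum N e m r ?\<phi>"
    using full_sum_point[of m ?\<phi> \<phi> v 1] pm by simp
  also have "\<dots> = (\<phi> p v * grid_sum N ((e + p) mod 2) (m - p) (inner r p (m - p)) (\<lambda>l. \<phi> (p + l)) v) *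
      grid_sum N e (m - (m - p)) (outer r p (m - p)) \<phi> v"
  proof -
    have h: "p mod (m - (m - p)) = 0" "(p + (m - p)) mod m = 0" "m - p < m" using p pm by auto
    have "full_sum N e m r ?\<phi> = full_sum N e (m - (m - p)) (outer r p (m - p))
      (\<lambda>j. if j = 0 then (\<lambda>w. ?\<phi> p w * grid_sum N ((e + p) mod 2) (m - p) (inner r p (m - p)) (\<lambda>l. ?\<phi> (p + l)) w * ?\<phi> 0 w)
         else ?\<phi> (skip p (m - p) j))"
      using full_sum_split[OF c' h(3), of N ?\<phi>] unfolding h .
    also have "\<dots> = (\<phi> p v * grid_sum N ((e + p) mod 2) (m - p) (inner r p (m - p)) (\<lambda>l. \<phi> (p + l)) v) *
      grid_sum N e (m - (m - p)) (outer r p (m - p)) \<phi> v"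
      unfolding gs by (rule full_sum_point) (use p pm in \<open>auto simp: skip_def\<close>)
    finally show ?thesis .
  qed
  finally show ?thesis using pm by (simp add: mult_ac)
qed

section \<open>Limits along grids\<close>

text \<open>
  Convergence of functions on the grids \<open>{1/N, \<dots>, 1}\<close> to a continuous
  function, in the form of continuous convergence together with a uniform bound. In contrast to
  uniform convergence this notion is tested along sequences, as dominated convergence provides
  them.
\<close>

definition grid_limit :: "(nat \<Rightarrow> nat \<Rightarrow> complex) \<Rightarrow> C01 \<Rightarrow> bool" where
  "grid_limit \<phi> f \<longleftrightarrow> (\<exists>B. \<forall>N. \<forall>v\<in>{1..Suc N}. norm (\<phi> N v) \<le> B) \<and>
     (\<forall>v t. (\<forall>N. v N \<in> {1..Suc N}) \<longrightarrow> (\<lambda>N. real (v N) / real (Suc N)) \<longlonglongrightarrow> t \<longrightarrow>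
        (\<lambda>N. \<phi> N (v N)) \<longlonglongrightarrow> apply_C01 f t)"

lemma continuous_apply_C01: "continuous_on {0..1} (apply_C01 f)"
  using apply_C01[of f] by simp

lemma apply_C01_outside: "t \<notin> {0..1} \<Longrightarrow> apply_C01 f t = 0"
  using apply_C01[of f] by simp

lemma apply_C01_measurable [measurable]: "apply_C01 f \<in> borel_measurable borel"
proof -
  have "(\<lambda>t. if t \<in> {0..1} then apply_C01 f t else 0) \<in> borel_measurable borel"
    by (intro borel_measurable_continuous_on_if continuous_apply_C01) auto
  moreover have "(\<lambda>t. if t \<in> {0..1} then apply_C01 f t else 0) = apply_C01 f"
    using apply_C01_outside by (auto simp: fun_eq_iff)
  ultimately show ?thesis by simp
qed

lemma apply_C01_bounded: "\<exists>B. \<forall>t. norm (apply_C01 f t) \<le> B"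
proof -
  have "compact (apply_C01 f ` {0..1})"
    by (rule compact_continuous_image[OF continuous_apply_C01]) simp
  then obtain B where B: "\<And>z. z \<in> apply_C01 f ` {0..1} \<Longrightarrow> norm z \<le> B"
    using compact_imp_bounded bounded_iff by metis
  have "norm (apply_C01 f t) \<le> max B 0" for t
    by (cases "t \<in> {0..1}") (use B apply_C01_outside[of t f] in \<open>auto simp: le_max_iff_disj\<close>)
  then show ?thesis by blast
qed

lemma C01_eqI:
  assumes "\<And>t. t \<in> {0..1} \<Longrightarrow> apply_C01 f t = apply_C01 g t"
  shows "f = g"
proof -
  have "apply_C01 f t = apply_C01 g t" for t
    by (cases "t \<in> {0..1}") (use assms apply_C01_outside in auto)
  then show ?thesis by (simp add: apply_C01_inject[symmetric] fun_eq_iff)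
qed

lemma apply_C01_simps [simp]:
  "apply_C01 (f + g) t = apply_C01 f t + apply_C01 g t"
  "apply_C01 (f * g) t = apply_C01 f t * apply_C01 g t"
  "apply_C01 (z *\<^sub>C f) t = z * apply_C01 f t"
  "apply_C01 0 t = 0"
  by (simp_all add: plus_C01.rep_eq times_C01.rep_eq cscale.rep_eq zero_C01.rep_eq)

lemma apply_C01_one: "t \<in> {0..1} \<Longrightarrow> apply_C01 1 t = 1"
  by (simp add: one_C01.rep_eq)

lemma apply_C01_prod_list: "t \<in> {0..1} \<Longrightarrow> apply_C01 (prod_list gs) t = (\<Prod>g\<leftarrow>gs. apply_C01 g t)"
  by (induction gs) (auto simp: apply_C01_one)

lemma apply_C01_tendsto:
  assumes "\<And>n. s n \<in> {0..1}" "s \<longlonglongrightarrow> t"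
  shows "(\<lambda>n. apply_C01 f (s n)) \<longlonglongrightarrow> apply_C01 f t"
proof -
  have "t \<in> {0..1}" using closed_sequentially[OF closed_atLeastAtMost] assms by blast
  then show ?thesis
    using continuous_apply_C01[unfolded continuous_on_sequentially] assms by (auto simp: o_def)
qed

lemma grid_point: "v \<in> {1..Suc N} \<Longrightarrow> real v / real (Suc N) \<in> {0..1}"
  by auto

lemma grid_limit_sample: "grid_limit (\<lambda>N v. apply_C01 f (real v / real (Suc N))) f"
  unfolding grid_limit_def
proof (intro conjI allI impI)
  show "\<exists>B. \<forall>N. \<forall>v\<in>{1..Suc N}. norm (apply_C01 f (real v / real (Suc N))) \<le> B"
    using apply_C01_bounded[of f] by blast
  fix v t assume "\<forall>N. v N \<in> {1..Suc N}" "(\<lambda>N. real (v N) / real (Suc N)) \<longlonglongrightarrow> t"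
  then show "(\<lambda>N. apply_C01 f (real (v N) / real (Suc N))) \<longlonglongrightarrow> apply_C01 f t"
    by (intro apply_C01_tendsto) (use grid_point in blast)+
qed

lemma grid_limit_lim:
  assumes "grid_limit \<phi> f" "\<And>N. v N \<in> {1..Suc N}" "(\<lambda>N. real (v N) / real (Suc N)) \<longlonglongrightarrow> t"
  shows "(\<lambda>N. \<phi> N (v N)) \<longlonglongrightarrow> apply_C01 f t"
  using assms unfolding grid_limit_def by blast

lemma grid_limit_bound:
  assumes "grid_limit \<phi> f"
  obtains B where "0 \<le> B" "\<And>N v. v \<in> {1..Suc N} \<Longrightarrow> norm (\<phi> N v) \<le> B"
proof -
  from assms obtain B where B: "\<And>N v. v \<in> {1..Suc N} \<Longrightarrow> norm (\<phi> N v) \<le> B"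
    unfolding grid_limit_def by blast
  have "0 \<le> B" by (rule order_trans[OF norm_ge_zero B[of 1 0]]) simp
  then show ?thesis using that B by blast
qed

lemma grid_limitI:
  assumes "\<And>N v. v \<in> {1..Suc N} \<Longrightarrow> norm (\<phi> N v) \<le> B"
    and "\<And>v t. (\<And>N. v N \<in> {1..Suc N}) \<Longrightarrow> (\<lambda>N. real (v N) / real (Suc N)) \<longlonglongrightarrow> t \<Longrightarrow> t \<in> {0..1} \<Longrightarrow>
        (\<lambda>N. \<phi> N (v N)) \<longlonglongrightarrow> apply_C01 f t"
  shows "grid_limit \<phi> f"
  unfolding grid_limit_def
proof (intro conjI allI impI)
  show "\<exists>B. \<forall>N. \<forall>v\<in>{1..Suc N}. norm (\<phi> N v) \<le> B" using assms(1) by blast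
  fix v t assume v: "\<forall>N. v N \<in> {1..Suc N}" and t: "(\<lambda>N. real (v N) / real (Suc N)) \<longlonglongrightarrow> t"
  have g: "real (v N) / real (Suc N) \<in> {0..1}" for N using grid_point v by blast
  have "t \<in> {0..1}" by (rule closed_sequentially[OF closed_atLeastAtMost g t])
  then show "(\<lambda>N. \<phi> N (v N)) \<longlonglongrightarrow> apply_C01 f t" using assms(2) v t by blast
qed

lemma grid_point_approx:
  assumes "t \<in> {0..1}"
  obtains v where "\<And>N. v N \<in> {1..Suc N}" "(\<lambda>N. real (v N) / real (Suc N)) \<longlonglongrightarrow> t"
proof
  define v where "v = (\<lambda>N. max 1 (nat \<lceil>t * real (Suc N)\<rceil>))"
  have le: "nat \<lceil>t * real (Suc N)\<rceil> \<le> Suc N" for N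
  proof -
    have "t * real (Suc N) \<le> 1 * real (Suc N)" by (rule mult_right_mono) (use assms in auto)
    then have "\<lceil>t * real (Suc N)\<rceil> \<le> int (Suc N)" by (simp add: ceiling_le_iff del: of_nat_Suc)
    then show ?thesis by (simp add: nat_le_iff del: of_nat_Suc)
  qed
  then show "v N \<in> {1..Suc N}" for N by (simp add: v_def)
  have near: "\<bar>real (v N) - t * real (Suc N)\<bar> \<le> 1" for N
  proof -
    define a where "a = t * real (Suc N)"
    have a: "0 \<le> a" "a \<le> of_int \<lceil>a\<rceil>" "of_int \<lceil>a\<rceil> < a + 1"
      using assms by (simp_all add: a_def) linarith+
    then have r: "real (nat \<lceil>a\<rceil>) = of_int \<lceil>a\<rceil>" by simp
    show ?thesis
    proof (cases "1 \<le> nat \<lceil>a\<rceil>")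
      case True
      then have "v N = nat \<lceil>a\<rceil>" by (simp add: v_def a_def)
      then show ?thesis using a r by (simp add: a_def[symmetric] del: of_nat_Suc)
    next
      case False
      then have "nat \<lceil>a\<rceil> = 0" by linarith
      moreover from this have "v N = 1" unfolding v_def a_def by simp
      ultimately have "v N = 1" "nat \<lceil>a\<rceil> = 0" by auto
      then show ?thesis using a r by (simp add: a_def[symmetric] del: of_nat_Suc)
    qed
  qed
  show "(\<lambda>N. real (v N) / real (Suc N)) \<longlonglongrightarrow> t"
  proof (rule LIMSEQ_I)
    have "\<bar>real (v N) / real (Suc N) - t\<bar> \<le> inverse (real (Suc N))" for N
    proof -
      have "real (v N) / real (Suc N) - t = (real (v N) - t * real (Suc N)) / real (Suc N)"
        by (simp add: field_simps)
      then show ?thesis using near[of N] by (simp add: abs_divide divide_simps)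
    qed
    moreover fix r :: real assume "0 < r"
    then obtain n0 where "inverse (real (Suc n0)) < r" using reals_Archimedean by blast
    moreover have "inverse (real (Suc n)) \<le> inverse (real (Suc n0))" if "n \<ge> n0" for n
      using that by simp
    ultimately show "\<exists>n0. \<forall>n\<ge>n0. norm (real (v n) / real (Suc n) - t) < r"
      unfolding real_norm_def by (meson le_less_trans order_trans)
  qed
qed

lemma LIMSEQ_offset_aux:
  fixes S Z :: "nat \<Rightarrow> real"
  assumes "S \<longlonglongrightarrow> s" "\<And>n. \<bar>Z n - S n\<bar> \<le> inverse (real (Suc n))"
  shows "Z \<longlonglongrightarrow> s"
proof -
  have "(\<lambda>n. Z n - S n) \<longlonglongrightarrow> 0"
    by (rule Lim_null_comparison[OF _ LIMSEQ_inverse_real_of_nat]) (use assms(2) in simp)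
  from tendsto_add[OF this assms(1)] show ?thesis by simp
qed

text \<open>
  Every exact identity between grid sums passes to the limit by this lemma.
\<close>

lemma grid_limit_unique:
  assumes "grid_limit \<phi> f" "grid_limit \<psi> g"
    and "\<And>N v. v \<in> {1..Suc N} \<Longrightarrow> \<phi> N v = \<psi> N v"
  shows "f = g"
proof (rule C01_eqI)
  fix t :: real assume "t \<in> {0..1}"
  then obtain v where v: "\<And>N. v N \<in> {1..Suc N}" "(\<lambda>N. real (v N) / real (Suc N)) \<longlonglongrightarrow> t"
    using grid_point_approx by blast
  have "(\<lambda>N. \<phi> N (v N)) = (\<lambda>N. \<psi> N (v N))" using assms(3) v(1) by auto
  then show "apply_C01 f t = apply_C01 g t"
    using LIMSEQ_unique[OF grid_limit_lim[OF assms(1) v]] grid_limit_lim[OF assms(2) v] by simp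
qed

lemma grid_limit_mult:
  assumes "grid_limit \<phi> f" "grid_limit \<psi> g"
  shows "grid_limit (\<lambda>N v. \<phi> N v * \<psi> N v) (f * g)"
proof -
  obtain A where A: "0 \<le> A" "\<And>N v. v \<in> {1..Suc N} \<Longrightarrow> norm (\<phi> N v) \<le> A"
    using grid_limit_bound[OF assms(1)] by blast
  obtain B where B: "0 \<le> B" "\<And>N v. v \<in> {1..Suc N} \<Longrightarrow> norm (\<psi> N v) \<le> B"
    using grid_limit_bound[OF assms(2)] by blast
  show ?thesis
    by (rule grid_limitI[where B = "A * B"])
      (auto simp: norm_mult intro!: mult_mono A B tendsto_mult grid_limit_lim[OF assms(1)] grid_limit_lim[OF assms(2)])
qed

lemma grid_limit_add:
  assumes "grid_limit \<phi> f" "grid_limit \<psi> g"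
  shows "grid_limit (\<lambda>N v. \<phi> N v + \<psi> N v) (f + g)"
proof -
  obtain A where A: "0 \<le> A" "\<And>N v. v \<in> {1..Suc N} \<Longrightarrow> norm (\<phi> N v) \<le> A"
    using grid_limit_bound[OF assms(1)] by blast
  obtain B where B: "0 \<le> B" "\<And>N v. v \<in> {1..Suc N} \<Longrightarrow> norm (\<psi> N v) \<le> B"
    using grid_limit_bound[OF assms(2)] by blast
  show ?thesis
    by (rule grid_limitI[where B = "A + B"])
      (auto intro!: norm_triangle_mono A B tendsto_add grid_limit_lim[OF assms(1)] grid_limit_lim[OF assms(2)])
qed

lemma grid_limit_scalar:
  assumes "c \<longlonglongrightarrow> z" "grid_limit \<phi> f"
  shows "grid_limit (\<lambda>N v. c N * \<phi> N v) (z *\<^sub>C f)"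
proof -
  obtain A where A: "0 \<le> A" "\<And>N v. v \<in> {1..Suc N} \<Longrightarrow> norm (\<phi> N v) \<le> A"
    using grid_limit_bound[OF assms(2)] by blast
  have "Bseq c" using assms(1) convergentI convergent_imp_Bseq by blast
  then obtain B where B: "0 < B" "\<And>N. norm (c N) \<le> B" by (auto simp: Bseq_def)
  show ?thesis
    by (rule grid_limitI[where B = "B * A"])
      (use B in \<open>auto simp: norm_mult intro!: mult_mono A tendsto_mult assms(1) grid_limit_lim[OF assms(2)]\<close>)
qed

lemma grid_limit_one: "grid_limit (\<lambda>N v. 1) 1"
  by (rule grid_limitI[where B = 1]) (auto simp: apply_C01_one)

lemma grid_limit_zero: "grid_limit (\<lambda>N v. 0) 0"
  by (rule grid_limitI[where B = 0]) auto

lemma grid_limit_prod: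
  assumes "finite A" "\<And>a. a \<in> A \<Longrightarrow> grid_limit (\<phi> a) (f a)"
  shows "grid_limit (\<lambda>N v. \<Prod>a\<in>A. \<phi> a N v) (\<Prod>a\<in>A. f a)"
  using assms by (induction A rule: finite_induct) (auto intro: grid_limit_mult grid_limit_one)

lemma grid_limit_sum:
  assumes "finite A" "\<And>a. a \<in> A \<Longrightarrow> grid_limit (\<phi> a) (f a)"
  shows "grid_limit (\<lambda>N v. \<Sum>a\<in>A. \<phi> a N v) (\<Sum>a\<in>A. f a)"
  using assms by (induction A rule: finite_induct) (auto intro: grid_limit_add grid_limit_zero)

abbreviation leb :: "nat set \<Rightarrow> (nat \<Rightarrow> real) measure" where
  "leb J \<equiv> \<Pi>\<^sub>M j\<in>J. lborel"

interpretation lebP: product_sigma_finite "\<lambda>_::nat. lborel :: real measure"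
  by unfold_locales

lemma component_leb: "j \<in> K \<Longrightarrow> (\<lambda>x. x j) \<in> borel_measurable (leb K)"
  using measurable_component_singleton[of j K "\<lambda>_. lborel"] by simp

text \<open>
  The coefficient functions are discontinuous at \<open>0\<close> and \<open>1\<close> only,
  after extension by zero, and the path \<open>t + (\<Sum>j\<in>I. x j)\<close> avoids both
  values almost surely as soon as it moves.
\<close>

lemma AE_sum_neq:
  assumes "finite J" "I \<subseteq> J" "I \<noteq> {}"
  shows "AE x in leb J. t + (\<Sum>j\<in>I. x j) \<noteq> (c::real)"
proof -
  obtain i where i: "i \<in> I" using assms by blast
  define J' where "J' = J - {i}"
  have J: "J = insert i J'" "i \<notin> J'" "finite J'" using i assms by (auto simp: J'_def)
  have fI: "finite I" using assms finite_subset by blast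
  have sub: "I - {i} \<subseteq> J'" using assms by (auto simp: J'_def)
  have meas: "(\<lambda>x. t + (\<Sum>j\<in>I. x j)) \<in> borel_measurable (leb J)"
    using assms(2) by (intro borel_measurable_add borel_measurable_sum component_leb) auto
  define S where "S = {x \<in> space (leb J). t + (\<Sum>j\<in>I. x j) = c}"
  have S: "S \<in> sets (leb J)" unfolding S_def using meas by measurable
  have "emeasure (leb J) S = (\<integral>\<^sup>+x. indicator S x \<partial>leb (insert i J'))"
    using S J by simp
  also have "\<dots> = (\<integral>\<^sup>+x. (\<integral>\<^sup>+y. indicator S (x(i := y)) \<partial>lborel) \<partial>leb J')"
    by (rule lebP.product_nn_integral_insert[OF J(3,2)]) (use S J in simp)
  also have "\<dots> = (\<integral>\<^sup>+x. 0 \<partial>leb J')"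
  proof (rule nn_integral_cong)
    fix x assume "x \<in> space (leb J')"
    have "(\<integral>\<^sup>+y. indicator S (x(i := y)) \<partial>lborel) \<le> (\<integral>\<^sup>+y. indicator {c - t - (\<Sum>j\<in>I-{i}. x j)} y \<partial>lborel)"
    proof (rule nn_integral_mono)
      fix y
      have "(\<Sum>j\<in>I. (x(i := y)) j) = y + (\<Sum>j\<in>I-{i}. x j)"
        using i fI by (subst sum.remove[of I i]) (auto intro!: sum.cong)
      then show "indicator S (x(i := y)) \<le> (indicator {c - t - (\<Sum>j\<in>I-{i}. x j)} y :: ennreal)"
        by (auto simp: indicator_def S_def)
    qed
    also have "\<dots> = 0" by simp
    finally show "(\<integral>\<^sup>+y. indicator S (x(i := y)) \<partial>lborel) = 0" by simp
  qed
  finally have "emeasure (leb J) S = 0" by simp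
  then show ?thesis by (intro AE_I[of _ _ S]) (use S in \<open>auto simp: S_def\<close>)
qed

lemma sum_component_leb:
  fixes t :: real and Y :: "real \<Rightarrow> real"
  assumes "I \<subseteq> J" "Y \<in> borel_measurable borel"
  shows "(\<lambda>x. t + (\<Sum>j\<in>I. Y (x j))) \<in> borel_measurable (leb J)"
proof -
  have "(\<lambda>x. Y (x j)) \<in> borel_measurable (leb J)" if "j \<in> I" for j
    using that assms(1) by (intro measurable_compose[OF component_leb assms(2)]) auto
  then show ?thesis by (rule borel_measurable_add[OF borel_measurable_const borel_measurable_sum])
qed

lemma emeasure_leb_box:
  assumes "finite J" "\<And>j. j \<in> J \<Longrightarrow> A j \<in> sets borel"
  shows "emeasure (leb J) (Pi\<^sub>E J A) = (\<Prod>j\<in>J. emeasure lborel (A j))"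
    and "Pi\<^sub>E J A \<in> sets (leb J)"
  using assms by (auto intro!: lebP.emeasure_PiM sets_PiM_I_finite)

text \<open>
  Dominated convergence for path integrals. The hypothesis \<open>steps\<close> says that each
  coordinate is the increment of the path between two of its points, or between the base point
  and one of its points. Since the integrand forces the points into a bounded interval, it
  forces every coordinate into one as well, which yields the dominating function.
\<close>

lemma loop_integral_tendsto:
  fixes g :: "'p \<Rightarrow> nat \<Rightarrow> real \<Rightarrow> complex" and f :: "'p \<Rightarrow> real \<Rightarrow> complex"
  assumes fin: "finite J" "finite Q" and I: "\<And>p. p \<in> Q \<Longrightarrow> I p \<subseteq> J"
    and steps: "\<And>j. j \<in> J \<Longrightarrow> \<exists>p\<in>Q. j \<in> I p \<and> (I p = {j} \<or> (\<exists>p'\<in>Q. I p' = I p - {j}))"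
    and Y: "\<And>n. Y n \<in> borel_measurable borel" "\<And>n y. \<bar>Y n y - y\<bar> \<le> 1" "\<And>y. (\<lambda>n. Y n y) \<longlonglongrightarrow> y"
    and T: "\<And>n. T n \<in> {0..1}" "T \<longlonglongrightarrow> t"
    and g: "\<And>p n. p \<in> Q \<Longrightarrow> g p n \<in> borel_measurable borel"
      "\<And>p n s. p \<in> Q \<Longrightarrow> norm (g p n s) \<le> B" "\<And>p n s. p \<in> Q \<Longrightarrow> s \<notin> {0..2} \<Longrightarrow> g p n s = 0"
    and f: "\<And>p. p \<in> Q \<Longrightarrow> f p \<in> borel_measurable borel"
    and lim: "\<And>p s S. p \<in> Q \<Longrightarrow> S \<longlonglongrightarrow> s \<Longrightarrow> s \<noteq> 0 \<Longrightarrow> s \<noteq> 1 \<Longrightarrow> (\<lambda>n. g p n (S n)) \<longlonglongrightarrow> f p s"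
    and lim0: "\<And>p. p \<in> Q \<Longrightarrow> I p = {} \<Longrightarrow> (\<lambda>n. g p n (T n)) \<longlonglongrightarrow> f p t"
  shows "(\<lambda>n. LINT x|leb J. (\<Prod>p\<in>Q. g p n (T n + (\<Sum>j\<in>I p. Y n (x j))))) \<longlonglongrightarrow>
      (LINT x|leb J. (\<Prod>p\<in>Q. f p (t + (\<Sum>j\<in>I p. x j))))"
    and "norm (LINT x|leb J. (\<Prod>p\<in>Q. g p n (T n + (\<Sum>j\<in>I p. Y n (x j))))) \<le> 6 ^ card J * B ^ card Q"
proof -
  \<comment> \<open>If a coordinate is outside \<open>[-3,3]\<close>, then its image under
    \<open>Y n\<close> is larger than \<open>2\<close> in absolute value, so the two points of the
    path that differ by it cannot both be in \<open>[0,2]\<close>.\<close>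
  define box where "box = Pi\<^sub>E J (\<lambda>_. {-3..3::real})"
  define w where "w = (\<lambda>x. indicator box x * B ^ card Q)"
  have em: "emeasure (leb J) box = ennreal (6 ^ card J)" and box: "box \<in> sets (leb J)"
    unfolding box_def using emeasure_leb_box[OF fin(1), of "\<lambda>_. {-3..3}"]
    by (simp_all add: ennreal_power[symmetric])
  have fem: "emeasure (leb J) box < \<infinity>" unfolding em by simp
  have w: "integrable (leb J) w" unfolding w_def using box fem by (intro integrable_mult_left) (simp add: integrable_indicator_iff)
  have iw: "(LINT x|leb J. w x) = 6 ^ card J * B ^ card Q"
  proof -
    have "measure (leb J) box = 6 ^ card J"
      unfolding measure_def em by simp
    then show ?thesis unfolding w_def using box by simp
  qed
  have bound: "norm (\<Prod>p\<in>Q. g p n (T n + (\<Sum>j\<in>I p. Y n (x j)))) \<le> w x" if x: "x \<in> space (leb J)" for n x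
  proof (cases "x \<in> box")
    case True
    have "norm (\<Prod>p\<in>Q. g p n (T n + (\<Sum>j\<in>I p. Y n (x j)))) \<le> (\<Prod>p\<in>Q. B)"
      unfolding prod_norm[symmetric] by (intro prod_mono) (use g(2) in auto)
    then show ?thesis using True by (simp add: w_def)
  next
    case False
    then obtain j where j: "j \<in> J" "x j \<notin> {-3..3}"
      using x unfolding box_def space_PiM PiE_iff by blast
    then have yj: "\<bar>Y n (x j)\<bar> > 2" using Y(2)[of n "x j"] by auto
    from steps[OF j(1)] obtain p where p: "p \<in> Q" "j \<in> I p" and
      alt: "I p = {j} \<or> (\<exists>p'\<in>Q. I p' = I p - {j})" by blast
    have fI: "finite (I p)" using I[OF p(1)] fin finite_subset by blast
    have sp: "T n + (\<Sum>i\<in>I p. Y n (x i)) = Y n (x j) + (T n + (\<Sum>i\<in>I p - {j}. Y n (x i)))"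
      using p fI by (simp add: sum.remove[of _ j])
    have "\<exists>p\<in>Q. T n + (\<Sum>i\<in>I p. Y n (x i)) \<notin> {0..2}"
    proof (rule ccontr)
      assume "\<not> ?thesis"
      then have all: "\<And>p. p \<in> Q \<Longrightarrow> T n + (\<Sum>i\<in>I p. Y n (x i)) \<in> {0..2}" by blast
      have "T n + (\<Sum>i\<in>I p - {j}. Y n (x i)) \<in> {0..2}"
        using alt
      proof
        assume "I p = {j}"
        then show ?thesis using T(1)[of n] by simp
      next
        assume "\<exists>p'\<in>Q. I p' = I p - {j}"
        then show ?thesis using all by metis
      qed
      then show False using all[OF p(1)] sp yj by auto
    qed
    then have "(\<Prod>p\<in>Q. g p n (T n + (\<Sum>j\<in>I p. Y n (x j)))) = 0"
      using g(3) fin(2) by (auto simp: prod_zero_iff)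
    then show ?thesis using False by (simp add: w_def)
  qed
  have meas: "(\<lambda>x. \<Prod>p\<in>Q. g p n (T n + (\<Sum>j\<in>I p. Y n (x j)))) \<in> borel_measurable (leb J)" for n
    by (intro borel_measurable_prod measurable_compose[OF sum_component_leb[OF I Y(1)] g(1)])
  have measf: "(\<lambda>x. \<Prod>p\<in>Q. f p (t + (\<Sum>j\<in>I p. x j))) \<in> borel_measurable (leb J)"
    using sum_component_leb[OF I, of _ "\<lambda>y. y" t] f
    by (intro borel_measurable_prod measurable_compose[OF _ f]) auto
  have ae: "AE x in leb J. \<forall>p\<in>Q. I p \<noteq> {} \<longrightarrow> t + (\<Sum>j\<in>I p. x j) \<noteq> 0 \<and> t + (\<Sum>j\<in>I p. x j) \<noteq> 1"
  proof (rule AE_finite_allI[OF fin(2)])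
    fix p assume "p \<in> Q"
    show "AE x in leb J. I p \<noteq> {} \<longrightarrow> t + (\<Sum>j\<in>I p. x j) \<noteq> 0 \<and> t + (\<Sum>j\<in>I p. x j) \<noteq> 1"
      using AE_sum_neq[OF fin(1) I[OF \<open>p \<in> Q\<close>]] by (cases "I p = {}") auto
  qed
  show "(\<lambda>n. LINT x|leb J. (\<Prod>p\<in>Q. g p n (T n + (\<Sum>j\<in>I p. Y n (x j))))) \<longlonglongrightarrow>
      (LINT x|leb J. (\<Prod>p\<in>Q. f p (t + (\<Sum>j\<in>I p. x j))))"
  proof (rule integral_dominated_convergence[where w = w])
    show "AE x in leb J. (\<lambda>n. \<Prod>p\<in>Q. g p n (T n + (\<Sum>j\<in>I p. Y n (x j)))) \<longlonglongrightarrow>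
      (\<Prod>p\<in>Q. f p (t + (\<Sum>j\<in>I p. x j)))"
      using ae
    proof (rule eventually_mono)
      fix x :: "nat \<Rightarrow> real"
      assume x: "\<forall>p\<in>Q. I p \<noteq> {} \<longrightarrow> t + (\<Sum>j\<in>I p. x j) \<noteq> 0 \<and> t + (\<Sum>j\<in>I p. x j) \<noteq> 1"
      show "(\<lambda>n. \<Prod>p\<in>Q. g p n (T n + (\<Sum>j\<in>I p. Y n (x j)))) \<longlonglongrightarrow> (\<Prod>p\<in>Q. f p (t + (\<Sum>j\<in>I p. x j)))"
      proof (rule tendsto_prod)
        fix p assume p: "p \<in> Q"
        show "(\<lambda>n. g p n (T n + (\<Sum>j\<in>I p. Y n (x j)))) \<longlonglongrightarrow> f p (t + (\<Sum>j\<in>I p. x j))"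
        proof (cases "I p = {}")
          case True
          then show ?thesis using lim0[OF p True] by simp
        next
          case False
          then show ?thesis using x p
            by (intro lim[OF p] tendsto_add[OF T(2)] tendsto_sum Y(3)) auto
        qed
      qed
    qed
    show "AE x in leb J. norm (\<Prod>p\<in>Q. g p n (T n + (\<Sum>j\<in>I p. Y n (x j)))) \<le> w x" for n
      using bound by (intro AE_I2)
  qed (use w meas measf in auto)
  have "norm (LINT x|leb J. (\<Prod>p\<in>Q. g p n (T n + (\<Sum>j\<in>I p. Y n (x j))))) \<le> (LINT x|leb J. w x)"
  proof (rule order_trans[OF integral_norm_bound])
    have "integrable (leb J) (\<lambda>x. \<Prod>p\<in>Q. g p n (T n + (\<Sum>j\<in>I p. Y n (x j))))"
      by (rule Bochner_Integration.integrable_bound[OF w meas])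
        (use order_trans[OF bound abs_ge_self] in \<open>auto intro!: AE_I2\<close>)
    then show "(LINT x|leb J. norm (\<Prod>p\<in>Q. g p n (T n + (\<Sum>j\<in>I p. Y n (x j))))) \<le> (LINT x|leb J. w x)"
      by (intro integral_mono_AE w AE_I2 bound integrable_norm)
  qed
  then show "norm (LINT x|leb J. (\<Prod>p\<in>Q. g p n (T n + (\<Sum>j\<in>I p. Y n (x j))))) \<le> 6 ^ card J * B ^ card Q"
    unfolding iw .
qed

definition grid_ext :: "(nat \<Rightarrow> complex) \<Rightarrow> nat \<Rightarrow> int \<Rightarrow> complex" where
  "grid_ext h N z = (if 1 \<le> z \<and> z \<le> int N then h (nat z) else 0)"

lemma grid_ext_tendsto:
  assumes \<phi>: "grid_limit \<phi> f" and S: "S \<longlonglongrightarrow> s" "s \<noteq> 0" "s \<noteq> 1"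
  shows "(\<lambda>n. grid_ext (\<phi> n) (Suc n) \<lfloor>S n * real (Suc n)\<rfloor>) \<longlonglongrightarrow> apply_C01 f s"
proof -
  define z where "z = (\<lambda>n. \<lfloor>S n * real (Suc n)\<rfloor>)"
  have z: "(\<lambda>n. of_int (z n) / real (Suc n)) \<longlonglongrightarrow> s"
  proof (rule LIMSEQ_offset_aux)
    show "(\<lambda>n. S n) \<longlonglongrightarrow> s" by fact
    fix n
    have "\<bar>of_int (z n) / real (Suc n) - S n\<bar> = \<bar>of_int (z n) - S n * real (Suc n)\<bar> / real (Suc n)"
      by (simp add: field_simps abs_divide)
    also have "\<dots> \<le> 1 / real (Suc n)"
      unfolding z_def by (intro divide_right_mono) linarith+
    finally show "\<bar>of_int (z n) / real (Suc n) - S n\<bar> \<le> inverse (real (Suc n))" by (simp add: field_simps)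
  qed
  consider "s < 0 \<or> 1 < s" | "0 < s" "s < 1" using S by linarith
  then show ?thesis
  proof cases
    case 1
    have "eventually (\<lambda>n. grid_ext (\<phi> n) (Suc n) (z n) = 0) sequentially"
      using 1
    proof
      assume "s < 0"
      from order_tendstoD(2)[OF z this] show ?thesis
        by (rule eventually_mono) (auto simp: grid_ext_def divide_simps)
    next
      assume "1 < s"
      from order_tendstoD(1)[OF z this] show ?thesis
        by (rule eventually_mono) (auto simp: grid_ext_def divide_simps)
    qed
    then have "(\<lambda>n. grid_ext (\<phi> n) (Suc n) (z n)) \<longlonglongrightarrow> 0" by (rule tendsto_eventually)
    moreover have "apply_C01 f s = 0" using 1 by (intro apply_C01_outside) auto
    ultimately show ?thesis by (simp add: z_def)
  next
    case 2
    define v where "v = (\<lambda>n. if 1 \<le> z n \<and> z n \<le> int (Suc n) then nat (z n) else 1)"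
    have v: "v n \<in> {1..Suc n}" for n by (auto simp: v_def)
    have ev: "eventually (\<lambda>n. 1 \<le> z n \<and> z n \<le> int (Suc n)) sequentially"
      using order_tendstoD(1)[OF z 2(1)] order_tendstoD(2)[OF z 2(2)]
    proof eventually_elim
      case (elim n)
      then have "0 < real_of_int (z n)" "real_of_int (z n) < real (Suc n)"
        by (simp_all add: zero_less_divide_iff divide_less_eq)
      then show ?case by linarith
    qed
    have "(\<lambda>n. real (v n) / real (Suc n)) \<longlonglongrightarrow> s"
      by (rule Lim_transform_eventually[OF z], rule eventually_mono[OF ev]) (auto simp: v_def)
    then have "(\<lambda>n. \<phi> n (v n)) \<longlonglongrightarrow> apply_C01 f s" by (rule grid_limit_lim[OF \<phi> v])
    moreover have "eventually (\<lambda>n. \<phi> n (v n) = grid_ext (\<phi> n) (Suc n) (z n)) sequentially"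
      by (rule eventually_mono[OF ev]) (auto simp: v_def grid_ext_def)
    ultimately show ?thesis unfolding z_def by (rule Lim_transform_eventually)
  qed
qed

text \<open>
  The integrand is constant on the cubes of side \<open>1/N\<close>.
\<close>

lemma integral_ceiling_grid:
  fixes G :: "(nat \<Rightarrow> int) \<Rightarrow> complex"
  assumes J: "finite J" and N: "0 < N" and F: "finite F" "F \<subseteq> J \<rightarrow>\<^sub>E UNIV"
    and G: "\<And>z. z \<in> J \<rightarrow>\<^sub>E UNIV \<Longrightarrow> z \<notin> F \<Longrightarrow> G z = 0"
  shows "(LINT x|leb J. G (\<lambda>j\<in>J. \<lceil>real N * x j\<rceil>)) = (\<Sum>z\<in>F. G z) / of_nat N ^ card J"
proof -
  define box where "box = (\<lambda>z::nat \<Rightarrow> int. Pi\<^sub>E J (\<lambda>j. {(of_int (z j) - 1) / real N <.. of_int (z j) / real N}))"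
  have mem: "x \<in> box z \<longleftrightarrow> (\<lambda>j\<in>J. \<lceil>real N * x j\<rceil>) = z" if x: "x \<in> space (leb J)" and z: "z \<in> J \<rightarrow>\<^sub>E UNIV" for x z
  proof -
    have "x \<in> box z \<longleftrightarrow> (\<forall>j\<in>J. \<lceil>real N * x j\<rceil> = z j)"
      using x N by (auto simp: box_def space_PiM PiE_iff ceiling_eq_iff divide_less_eq le_divide_eq mult.commute)
    also have "\<dots> \<longleftrightarrow> (\<lambda>j\<in>J. \<lceil>real N * x j\<rceil>) = z"
      using z by (auto simp: fun_eq_iff PiE_iff extensional_def)
    finally show ?thesis .
  qed
  have em: "emeasure (leb J) (box z) = ennreal ((1 / real N) ^ card J)" and bs: "box z \<in> sets (leb J)" for z
  proof -
    have "emeasure (leb J) (box z) = (\<Prod>j\<in>J. emeasure lborel {(of_int (z j) - 1) / real N <.. of_int (z j) / real N})"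
      unfolding box_def by (rule emeasure_leb_box(1)[OF J]) simp
    also have "\<dots> = (\<Prod>j\<in>J. ennreal (1 / real N))"
      by (rule prod.cong) (use N in \<open>auto simp: divide_right_mono diff_divide_distrib\<close>)
    finally show "emeasure (leb J) (box z) = ennreal ((1 / real N) ^ card J)"
      by (simp add: ennreal_power)
    show "box z \<in> sets (leb J)" unfolding box_def by (rule emeasure_leb_box(2)[OF J]) simp
  qed
  have me: "measure (leb J) (box z) = (1 / real N) ^ card J" for z
    unfolding measure_def em by simp
  have fe: "emeasure (leb J) (box z) < \<infinity>" for z
    unfolding em by simp
  have "(LINT x|leb J. G (\<lambda>j\<in>J. \<lceil>real N * x j\<rceil>)) = (LINT x|leb J. (\<Sum>z\<in>F. indicator (box z) x *\<^sub>R G z))"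
  proof (rule Bochner_Integration.integral_cong[OF HOL.refl])
    fix x assume x: "x \<in> space (leb J)"
    define z0 where "z0 = (\<lambda>j\<in>J. \<lceil>real N * x j\<rceil>)"
    have z0: "z0 \<in> J \<rightarrow>\<^sub>E UNIV" by (simp add: z0_def)
    have "(\<Sum>z\<in>F. indicator (box z) x *\<^sub>R G z) = (\<Sum>z\<in>F. if z = z0 then G z0 else 0)"
    proof (rule sum.cong[OF HOL.refl])
      fix z assume "z \<in> F"
      then have "z \<in> J \<rightarrow>\<^sub>E UNIV" using F by blast
      from mem[OF x this] show "indicator (box z) x *\<^sub>R G z = (if z = z0 then G z0 else 0)"
        by (auto simp: z0_def)
    qed
    also have "\<dots> = G z0" using F(1) G[OF z0] by simp
    finally show "G (\<lambda>j\<in>J. \<lceil>real N * x j\<rceil>) = (\<Sum>z\<in>F. indicator (box z) x *\<^sub>R G z)"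
      by (simp add: z0_def)
  qed
  also have "\<dots> = (\<Sum>z\<in>F. LINT x|leb J. indicator (box z) x *\<^sub>R G z)"
    by (rule Bochner_Integration.integral_sum) (use bs fe in \<open>auto intro!: integrable_scaleR_left simp: integrable_indicator_iff\<close>)
  also have "\<dots> = (\<Sum>z\<in>F. measure (leb J) (box z) *\<^sub>R G z)"
    by (rule sum.cong) (use bs fe in \<open>auto simp: integrable_indicator_iff\<close>)
  also have "\<dots> = (\<Sum>z\<in>F. G z) / of_nat N ^ card J"
    unfolding me by (simp add: sum_divide_distrib scaleR_conv_of_real power_divide field_simps)
  finally show ?thesis .
qed

definition ceil_step :: "nat \<Rightarrow> real \<Rightarrow> real" where
  "ceil_step n y = of_int \<lceil>real (Suc n) * y\<rceil> / real (Suc n)"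

lemma ceil_step_near: "\<bar>ceil_step n y - y\<bar> \<le> inverse (real (Suc n))"
proof -
  have "\<bar>ceil_step n y - y\<bar> = \<bar>of_int \<lceil>real (Suc n) * y\<rceil> - real (Suc n) * y\<bar> / real (Suc n)"
    by (simp add: ceil_step_def field_simps abs_divide)
  also have "\<dots> \<le> 1 / real (Suc n)" by (intro divide_right_mono) linarith+
  finally show ?thesis by (simp add: field_simps)
qed

lemma ceil_step_props:
  "ceil_step n \<in> borel_measurable borel" "\<bar>ceil_step n y - y\<bar> \<le> 1" "(\<lambda>n. ceil_step n y) \<longlonglongrightarrow> y"
proof -
  have "(\<lambda>y. real_of_int \<lceil>real (Suc n) * y\<rceil> / real (Suc n)) \<in> borel_measurable borel" by measurable
  then show "ceil_step n \<in> borel_measurable borel" unfolding ceil_step_def[abs_def] .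
  have "inverse (real (Suc n)) \<le> 1" by (simp add: field_simps)
  then show "\<bar>ceil_step n y - y\<bar> \<le> 1" using ceil_step_near[of n y] by linarith
  show "(\<lambda>n. ceil_step n y) \<longlonglongrightarrow> y"
    by (rule LIMSEQ_offset_aux[OF tendsto_const ceil_step_near])
qed

section \<open>Loop sums and their integrals\<close>

text \<open>
  The number of grid paths with base value \<open>v\<close> whose increments \<open>z j\<close>
  are free for \<open>j \<in> J\<close>, weighted by the values \<open>h\<close> along the path:
  the Riemann sum of the integral in the definition of \<open>\<Lambda>\<close>.
\<close>

definition loop_sum :: "nat set \<Rightarrow> 'p set \<Rightarrow> ('p \<Rightarrow> nat set) \<Rightarrow> nat \<Rightarrow> ('p \<Rightarrow> nat \<Rightarrow> complex) \<Rightarrow> nat \<Rightarrow> complex" where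
  "loop_sum J Q I N h v =
     (\<Sum>z\<in>J \<rightarrow>\<^sub>E {- int N..int N}. \<Prod>p\<in>Q. grid_ext (h p) N (int v + (\<Sum>j\<in>I p. z j)))"

lemma loop_sum_integral:
  assumes fin: "finite J" "finite Q" and I: "\<And>p. p \<in> Q \<Longrightarrow> I p \<subseteq> J"
    and steps: "\<And>j. j \<in> J \<Longrightarrow> \<exists>p\<in>Q. j \<in> I p \<and> (I p = {j} \<or> (\<exists>p'\<in>Q. I p' = I p - {j}))"
    and v: "v \<le> Suc n"
  shows "(LINT x|leb J. (\<Prod>p\<in>Q. grid_ext (h p) (Suc n)
      \<lfloor>(real v / real (Suc n) + (\<Sum>j\<in>I p. ceil_step n (x j))) * real (Suc n)\<rfloor>)) =
    loop_sum J Q I (Suc n) h v / of_nat (Suc n) ^ card J"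
proof -
  define G where "G = (\<lambda>z::nat \<Rightarrow> int. \<Prod>p\<in>Q. grid_ext (h p) (Suc n) (int v + (\<Sum>j\<in>I p. z j)))"
  have "\<lfloor>(real v / real (Suc n) + (\<Sum>j\<in>I p. ceil_step n (x j))) * real (Suc n)\<rfloor> =
      int v + (\<Sum>j\<in>I p. (\<lambda>j\<in>J. \<lceil>real (Suc n) * x j\<rceil>) j)" if "p \<in> Q" for p x
  proof -
    have "(\<Sum>j\<in>I p. ceil_step n (x j)) * real (Suc n) = (\<Sum>j\<in>I p. real_of_int \<lceil>real (Suc n) * x j\<rceil>)"
      by (simp add: ceil_step_def sum_divide_distrib[symmetric] del: of_nat_Suc)
    also have "\<dots> = (\<Sum>j\<in>I p. real_of_int ((\<lambda>j\<in>J. \<lceil>real (Suc n) * x j\<rceil>) j))"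
      by (rule sum.cong) (use I[OF that] in auto)
    finally have sm: "(\<Sum>j\<in>I p. ceil_step n (x j)) * real (Suc n) =
      (\<Sum>j\<in>I p. real_of_int ((\<lambda>j\<in>J. \<lceil>real (Suc n) * x j\<rceil>) j))" .
    then have "(real v / real (Suc n) + (\<Sum>j\<in>I p. ceil_step n (x j))) * real (Suc n) =
      of_int (int v + (\<Sum>j\<in>I p. (\<lambda>j\<in>J. \<lceil>real (Suc n) * x j\<rceil>) j))"
    proof -
      have "(real v / real (Suc n) + c) * real (Suc n) = real v + c * real (Suc n)" for c :: real
        by (simp add: ring_distribs del: of_nat_Suc)
      then show ?thesis using sm
        by (simp only: of_int_add of_int_of_nat_eq of_int_sum)
    qed
    then show ?thesis by (simp only: floor_of_int)
  qed
  then have "(LINT x|leb J. (\<Prod>p\<in>Q. grid_ext (h p) (Suc n)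
      \<lfloor>(real v / real (Suc n) + (\<Sum>j\<in>I p. ceil_step n (x j))) * real (Suc n)\<rfloor>)) =
    (LINT x|leb J. G (\<lambda>j\<in>J. \<lceil>real (Suc n) * x j\<rceil>))"
    unfolding G_def by (intro Bochner_Integration.integral_cong HOL.refl prod.cong) simp
  also have "\<dots> = (\<Sum>z\<in>J \<rightarrow>\<^sub>E {- int (Suc n)..int (Suc n)}. G z) / of_nat (Suc n) ^ card J"
  proof (rule integral_ceiling_grid[OF fin(1)])
    show "finite (J \<rightarrow>\<^sub>E {- int (Suc n)..int (Suc n)})" using fin(1) by (intro finite_PiE) auto
    show "G z = 0" if z: "z \<in> J \<rightarrow>\<^sub>E UNIV" "z \<notin> J \<rightarrow>\<^sub>E {- int (Suc n)..int (Suc n)}" for z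
    proof -
      obtain j where j: "j \<in> J" "z j \<notin> {- int (Suc n)..int (Suc n)}" using z unfolding PiE_iff by blast
      from steps[OF j(1)] obtain p where p: "p \<in> Q" "j \<in> I p" and
        alt: "I p = {j} \<or> (\<exists>p'\<in>Q. I p' = I p - {j})" by blast
      have fI: "finite (I p)" using I[OF p(1)] fin finite_subset by blast
      have sp: "int v + (\<Sum>i\<in>I p. z i) = z j + (int v + (\<Sum>i\<in>I p - {j}. z i))"
        using p fI by (simp add: sum.remove[of _ j])
      have "\<exists>p\<in>Q. int v + (\<Sum>i\<in>I p. z i) \<notin> {1..int (Suc n)}"
      proof (rule ccontr)
        assume "\<not> ?thesis"
        then have all: "\<And>p. p \<in> Q \<Longrightarrow> int v + (\<Sum>i\<in>I p. z i) \<in> {1..int (Suc n)}" by blast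
        have "int v + (\<Sum>i\<in>I p - {j}. z i) \<in> {0..int (Suc n)}"
          using alt
        proof
          assume "I p = {j}"
          then show ?thesis using v by simp
        next
          assume "\<exists>p'\<in>Q. I p' = I p - {j}"
          then obtain p' where "p' \<in> Q" "I p' = I p - {j}" by blast
          then show ?thesis using all[of p'] by simp
        qed
        then show False using all[OF p(1)] sp j(2) by auto
      qed
      then show "G z = 0" unfolding G_def using fin(2) by (auto simp: prod_zero_iff grid_ext_def)
    qed
  qed auto
  also have "(\<Sum>z\<in>J \<rightarrow>\<^sub>E {- int (Suc n)..int (Suc n)}. G z) = loop_sum J Q I (Suc n) h v"
    by (simp add: loop_sum_def G_def)
  finally show ?thesis .
qed

text \<open>
  A loop sum is the integral of a step function, and the increments are recovered from the real
  coordinates by rounding up, which moves a point of the path by a bounded multiple of the mesh.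
\<close>

lemma loop_sum_tendsto:
  fixes \<phi> :: "'p \<Rightarrow> nat \<Rightarrow> nat \<Rightarrow> complex"
  assumes fin: "finite J" "finite Q" and I: "\<And>p. p \<in> Q \<Longrightarrow> I p \<subseteq> J"
    and steps: "\<And>j. j \<in> J \<Longrightarrow> \<exists>p\<in>Q. j \<in> I p \<and> (I p = {j} \<or> (\<exists>p'\<in>Q. I p' = I p - {j}))"
    and \<phi>: "\<And>p. p \<in> Q \<Longrightarrow> grid_limit (\<phi> p) (f p)"
    and v: "\<And>n. v n \<le> Suc n" "\<And>n p. p \<in> Q \<Longrightarrow> I p = {} \<Longrightarrow> 1 \<le> v n"
    and t: "(\<lambda>n. real (v n) / real (Suc n)) \<longlonglongrightarrow> t"
    and B: "\<And>p n w. p \<in> Q \<Longrightarrow> w \<in> {1..Suc n} \<Longrightarrow> norm (\<phi> p n w) \<le> B" "0 \<le> B"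
  shows "(\<lambda>n. loop_sum J Q I (Suc n) (\<lambda>p. \<phi> p n) (v n) / of_nat (Suc n) ^ card J) \<longlonglongrightarrow>
      (LINT x|leb J. (\<Prod>p\<in>Q. apply_C01 (f p) (t + (\<Sum>j\<in>I p. x j))))"
    and "norm (loop_sum J Q I (Suc n) (\<lambda>p. \<phi> p n) (v n) / of_nat (Suc n) ^ card J) \<le> 6 ^ card J * B ^ card Q"
proof -
  define g where "g = (\<lambda>p n s. grid_ext (\<phi> p n) (Suc n) \<lfloor>s * real (Suc n)\<rfloor>)"
  define T where "T = (\<lambda>n. real (v n) / real (Suc n))"
  have eq: "loop_sum J Q I (Suc n) (\<lambda>p. \<phi> p n) (v n) / of_nat (Suc n) ^ card J =
     (LINT x|leb J. (\<Prod>p\<in>Q. g p n (T n + (\<Sum>j\<in>I p. ceil_step n (x j)))))" for n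
    unfolding g_def T_def by (rule loop_sum_integral[OF fin I steps v(1), symmetric])
  have T: "T n \<in> {0..1}" for n using v(1)[of n] by (auto simp: T_def)
  have gm: "g p n \<in> borel_measurable borel" for p n
    unfolding g_def by (rule measurable_compose[of _ borel "count_space UNIV"]) simp_all
  have gB: "norm (g p n s) \<le> B" if "p \<in> Q" for p n s
  proof (cases "1 \<le> \<lfloor>s * real (Suc n)\<rfloor> \<and> \<lfloor>s * real (Suc n)\<rfloor> \<le> int (Suc n)")
    case True
    moreover have "nat z \<in> {1..Suc n}" if "1 \<le> z \<and> z \<le> int (Suc n)" for z using that by auto
    ultimately have "nat \<lfloor>s * real (Suc n)\<rfloor> \<in> {1..Suc n}" by blast
    then show ?thesis using B(1)[OF that] True by (simp add: g_def grid_ext_def)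
  next
    case False
    then show ?thesis using B(2) by (auto simp: g_def grid_ext_def)
  qed
  have g0: "g p n s = 0" if "s \<notin> {0..2}" for p n s
  proof (rule ccontr)
    assume "g p n s \<noteq> 0"
    then have "1 \<le> \<lfloor>s * real (Suc n)\<rfloor>" "\<lfloor>s * real (Suc n)\<rfloor> \<le> int (Suc n)"
      by (auto simp: g_def grid_ext_def split: if_splits)
    then have a: "1 \<le> s * real (Suc n)" "s * real (Suc n) < real (Suc n) + 1" by linarith+
    have "0 < s * real (Suc n)" using a by linarith
    then have "0 < s" by (simp add: zero_less_mult_iff)
    moreover have "s < 2"
    proof -
      have "s * real (Suc n) < 2 * real (Suc n)" using a(2) by simp
      then show ?thesis by (rule mult_right_less_imp_less) simp
    qed
    ultimately show False using that by simp
  qed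
  have lim: "(\<lambda>n. g p n (S n)) \<longlonglongrightarrow> apply_C01 (f p) s" if "p \<in> Q" "S \<longlonglongrightarrow> s" "s \<noteq> 0" "s \<noteq> 1" for p s S
    unfolding g_def by (rule grid_ext_tendsto[OF \<phi>[OF that(1)] that(2-4)])
  have lim0: "(\<lambda>n. g p n (T n)) \<longlonglongrightarrow> apply_C01 (f p) t" if p: "p \<in> Q" "I p = {}" for p
  proof -
    have r: "v n \<in> {1..Suc n}" for n using v p by simp
    have "g p n (T n) = \<phi> p n (v n)" for n
    proof -
      have "T n * real (Suc n) = of_int (int (v n))" by (simp add: T_def del: of_nat_Suc)
      then have fl: "\<lfloor>T n * real (Suc n)\<rfloor> = int (v n)" by (simp only: floor_of_int)
      have "g p n (T n) = grid_ext (\<phi> p n) (Suc n) (int (v n))" by (simp only: g_def fl)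
      then show ?thesis using r[of n] by (simp add: grid_ext_def)
    qed
    then show ?thesis using grid_limit_lim[OF \<phi>[OF p(1)] r t] by simp
  qed
  have tT: "T \<longlonglongrightarrow> t" using t unfolding T_def .
  note main = loop_integral_tendsto[OF fin I steps ceil_step_props T tT gm gB g0 apply_C01_measurable lim lim0]
  show "(\<lambda>n. loop_sum J Q I (Suc n) (\<lambda>p. \<phi> p n) (v n) / of_nat (Suc n) ^ card J) \<longlonglongrightarrow>
      (LINT x|leb J. (\<Prod>p\<in>Q. apply_C01 (f p) (t + (\<Sum>j\<in>I p. x j))))"
    unfolding eq by (rule main(1))
  show "norm (loop_sum J Q I (Suc n) (\<lambda>p. \<phi> p n) (v n) / of_nat (Suc n) ^ card J) \<le> 6 ^ card J * B ^ card Q"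
    unfolding eq by (rule main(2))
qed

lemma integral_leb_singleton_tau: "(LINT x|leb {0}. apply_C01 f (x 0)) = tau f"
proof -
  have "(LINT x|leb {0}. apply_C01 f (x 0)) = (LINT x|lborel. apply_C01 f x)"
    by (rule lebP.product_integral_singleton) simp
  also have "\<dots> = tau f"
    unfolding tau_def set_lebesgue_integral_def
    by (rule Bochner_Integration.integral_cong) (use apply_C01_outside in \<open>auto simp: indicator_def\<close>)
  finally show ?thesis .
qed

text \<open>
  Averages over the grid are loop sums with a single free increment.
\<close>

lemma grid_limit_tau:
  assumes "grid_limit \<phi> f"
  shows "(\<lambda>n. (\<Sum>v=1..Suc n. \<phi> n v) / of_nat (Suc n)) \<longlonglongrightarrow> tau f"
proof -
  obtain B where B: "0 \<le> B" "\<And>N v. v \<in> {1..Suc N} \<Longrightarrow> norm (\<phi> N v) \<le> B"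
    using grid_limit_bound[OF assms] by blast
  have "(\<lambda>n. loop_sum {0} {()} (\<lambda>_. {0}) (Suc n) (\<lambda>p. \<phi> n) 0 / of_nat (Suc n) ^ card {0::nat}) \<longlonglongrightarrow>
      (LINT x|leb {0}. (\<Prod>p\<in>{()}. apply_C01 f (0 + (\<Sum>j\<in>{0}. x j))))"
    by (rule loop_sum_tendsto(1)[where \<phi> = "\<lambda>_. \<phi>" and f = "\<lambda>_. f"]) (use assms B in auto)
  moreover have "loop_sum {0} {()} (\<lambda>_. {0}) (Suc n) (\<lambda>p. \<phi> n) 0 = (\<Sum>v=1..Suc n. \<phi> n v)" for n
  proof -
    have "loop_sum {0} {()} (\<lambda>_. {0}) (Suc n) (\<lambda>p. \<phi> n) 0 =
      (\<Sum>z\<in>{0::nat} \<rightarrow>\<^sub>E {- int (Suc n)..int (Suc n)}. grid_ext (\<phi> n) (Suc n) (z 0))"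
      by (simp add: loop_sum_def)
    also have "\<dots> = (\<Sum>k\<in>{- int (Suc n)..int (Suc n)}. grid_ext (\<phi> n) (Suc n) k)"
      by (rule sum.reindex_bij_witness[where j = "\<lambda>z. z 0" and i = "\<lambda>k. \<lambda>j\<in>{0}. k"])
        (auto simp: PiE_iff extensional_def fun_eq_iff)
    also have "\<dots> = (\<Sum>k\<in>{1..int (Suc n)}. grid_ext (\<phi> n) (Suc n) k)"
      by (rule sum.mono_neutral_right) (auto simp: grid_ext_def)
    also have "\<dots> = (\<Sum>v=1..Suc n. \<phi> n v)"
      by (rule sum.reindex_bij_witness[where j = nat and i = int]) (auto simp: grid_ext_def)
    finally show ?thesis .
  qed
  ultimately show ?thesis by (simp add: integral_leb_singleton_tau)
qed

lemma partitionsD: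
  assumes "P \<in> partitions n"
  shows "S \<in> P \<Longrightarrow> S \<subseteq> {1..n}" "S \<in> P \<Longrightarrow> finite S" "S \<in> P \<Longrightarrow> S \<noteq> {}"
    "S \<in> P \<Longrightarrow> T \<in> P \<Longrightarrow> j \<in> S \<Longrightarrow> j \<in> T \<Longrightarrow> S = T" "j \<in> {1..n} \<Longrightarrow> \<exists>S\<in>P. j \<in> S" "finite P"
proof -
  have p: "partition_on {1..n} P" using assms by (simp add: partitions_def)
  show a: "S \<in> P \<Longrightarrow> S \<subseteq> {1..n}" using p by (auto simp: partition_on_def)
  then show "S \<in> P \<Longrightarrow> finite S" using finite_subset by blast
  show "S \<in> P \<Longrightarrow> S \<noteq> {}" using p by (auto simp: partition_on_def)
  show "S \<in> P \<Longrightarrow> T \<in> P \<Longrightarrow> j \<in> S \<Longrightarrow> j \<in> T \<Longrightarrow> S = T"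
    using p by (auto simp: partition_on_def disjoint_def)
  show "j \<in> {1..n} \<Longrightarrow> \<exists>S\<in>P. j \<in> S" using p unfolding partition_on_def by blast
  show "finite P" by (rule finite_elements[OF _ p]) simp
qed

lemma finite_partitions [simp]: "finite (partitions n)"
proof (rule finite_subset)
  show "partitions n \<subseteq> Pow (Pow {1..n})" unfolding partitions_def partition_on_def by blast
qed simp

lemma block_eq:
  assumes "P \<in> partitions n" "S \<in> P" "j \<in> S"
  shows "block P j = S"
  unfolding block_def
proof (rule the_equality)
  show "S \<in> P \<and> j \<in> S" using assms by blast
  show "T = S" if "T \<in> P \<and> j \<in> T" for T
    using partitionsD(4)[OF assms(1), of T S j] that assms by blast
qed

lemma block_in:
  assumes "P \<in> partitions n" "j \<in> {1..n}"
  shows "block P j \<in> P" "j \<in> block P j"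
proof -
  obtain S where "S \<in> P" "j \<in> S" using partitionsD(5)[OF assms] by blast
  then show "block P j \<in> P" "j \<in> block P j" using block_eq[OF assms(1)] by simp_all
qed

lemma J_set_iff:
  assumes P: "P \<in> partitions n"
  shows "j \<in> J_set P \<longleftrightarrow> j \<in> {1..n} \<and> \<not> block P j \<subseteq> {1..j}"
proof
  assume "j \<in> J_set P"
  then obtain S where S: "S \<in> P" "j \<in> S" "j \<noteq> Max S" by (auto simp: J_set_def)
  have "Max S \<in> S" "j \<le> Max S" using partitionsD(2,3)[OF P S(1)] S by auto
  then have "\<not> S \<subseteq> {1..j}" using S(3) by auto
  then show "j \<in> {1..n} \<and> \<not> block P j \<subseteq> {1..j}"
    using subsetD[OF partitionsD(1)[OF P S(1)] S(2)] block_eq[OF P S(1,2)] by simp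
next
  assume a: "j \<in> {1..n} \<and> \<not> block P j \<subseteq> {1..j}"
  then have b: "block P j \<in> P" "j \<in> block P j" using block_in[OF P] by auto
  have "j \<noteq> Max (block P j)"
  proof
    assume "j = Max (block P j)"
    then have "x \<le> j" if "x \<in> block P j" for x
      using Max_ge[OF partitionsD(2)[OF P b(1)] that] by simp
    then have "block P j \<subseteq> {1..j}" using partitionsD(1)[OF P b(1)] by fastforce
    then show False using a by blast
  qed
  then show "j \<in> J_set P" using b by (auto simp: J_set_def)
qed

lemma I_set_sub_J_set:
  assumes P: "P \<in> partitions n" and p: "p \<le> n"
  shows "I_set P p \<subseteq> J_set P"
proof
  fix j assume "j \<in> I_set P p"
  then have j: "j \<in> {1..p}" "\<not> block P j \<subseteq> {1..p}" by (simp_all add: I_set_def)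
  then have "{1..j} \<subseteq> {1..p}" by auto
  then have "\<not> block P j \<subseteq> {1..j}" using j(2) by blast
  then show "j \<in> J_set P" using j(1) p J_set_iff[OF P, of j] by simp
qed

lemma finite_J_set: "P \<in> partitions n \<Longrightarrow> finite (J_set P)"
  by (rule finite_subset[of _ "{1..n}"]) (auto simp: J_set_iff)

text \<open>
  An element \<open>j\<close> which is not the maximum of its block enters the index set of the
  path at time \<open>j\<close>, so it is the increment between the points \<open>j - 1\<close>
  and \<open>j\<close> of the path.
\<close>

lemma I_set_steps:
  assumes P: "P \<in> partitions n" and j: "j \<in> J_set P"
  shows "\<exists>p\<in>{1..n-1}. j \<in> I_set P p \<and> (I_set P p = {j} \<or> (\<exists>p'\<in>{1..n-1}. I_set P p' = I_set P p - {j}))"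
proof -
  have jn: "j \<in> {1..n}" "\<not> block P j \<subseteq> {1..j}" using j J_set_iff[OF P] by auto
  have "block P j \<subseteq> {1..n}" using block_in[OF P jn(1)] partitionsD(1)[OF P] by blast
  then have jn': "j \<in> {1..n-1}" using jn by (cases "j = n") auto
  have mem: "j \<in> I_set P j" using jn by (simp add: I_set_def)
  have prev: "I_set P (j - 1) = I_set P j - {j}"
  proof (intro set_eqI iffI)
    fix i assume "i \<in> I_set P (j - 1)"
    then have i: "1 \<le> i" "i < j" "\<not> block P i \<subseteq> {1..j-1}" by (auto simp: I_set_def)
    have "\<not> block P i \<subseteq> {1..j}"
    proof
      assume sub: "block P i \<subseteq> {1..j}"
      have in1: "i \<in> {1..n}" using i jn by auto
      have "j \<in> block P i" using sub i(3) by (force simp: subset_iff le_less)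
      then have "block P j = block P i" using block_eq[OF P block_in(1)[OF P in1]] by blast
      then show False using sub jn by simp
    qed
    then show "i \<in> I_set P j - {j}" using i by (auto simp: I_set_def)
  next
    fix i assume "i \<in> I_set P j - {j}"
    then show "i \<in> I_set P (j - 1)" by (auto simp: I_set_def subset_iff)
  qed
  show ?thesis
  proof (cases "j = 1")
    case True
    then have "I_set P j = {j}" using mem by (auto simp: I_set_def)
    then show ?thesis using jn' mem by blast
  next
    case False
    then have "j - 1 \<in> {1..n-1}" using jn' by auto
    then show ?thesis using jn' mem prev by blast
  qed
qed

lemma C01_eq_on_open:
  assumes "\<And>t. t \<in> {0<..1} \<Longrightarrow> apply_C01 f t = apply_C01 g t"
  shows "f = g"
proof (rule C01_eqI)
  fix t :: real assume t: "t \<in> {0..1}"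
  define s where "s = (\<lambda>n. max t (inverse (real (Suc n))))"
  have s: "s n \<in> {0<..1}" "s n \<in> {0..1}" for n
  proof -
    have "inverse (real (Suc n)) \<le> 1" "0 < inverse (real (Suc n))" by (simp_all add: field_simps)
    then show "s n \<in> {0<..1}" "s n \<in> {0..1}" using t unfolding s_def by (auto simp: less_max_iff_disj le_max_iff_disj)
  qed
  have "(\<lambda>n. max t (inverse (real (Suc n)))) \<longlonglongrightarrow> max t 0"
    by (intro tendsto_max tendsto_const LIMSEQ_inverse_real_of_nat)
  then have lim: "s \<longlonglongrightarrow> t" using t by (simp add: s_def)
  have "(\<lambda>n. apply_C01 f (s n)) = (\<lambda>n. apply_C01 g (s n))" using assms s by auto
  then show "apply_C01 f t = apply_C01 g t"
    using LIMSEQ_unique[OF apply_C01_tendsto[OF s(2) lim, of f]] apply_C01_tendsto[OF s(2) lim, of g] by simp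
qed

lemma integral_leb_empty: "(LINT x|leb {}. (h x :: complex)) = h (\<lambda>_. undefined)"
  by (simp add: PiM_empty lebesgue_integral_count_space_finite)

text \<open>
  The integral is continuous on all of \<open>[0,1]\<close> if the constraint on the path is
  expressed through the zero extension of the coefficients. It differs from the integral over
  the region only for paths which touch \<open>0\<close>: on a null set if \<open>t > 0\<close>,
  because a point of the path either moves or equals \<open>t\<close>.
\<close>

lemma Lambda_map_apply:
  assumes P: "P \<in> partitions n" and len: "length gs = n - 1" and n: "1 \<le> n" and t: "t \<in> {0..1}"
  shows "apply_C01 (Lambda_map P gs) t =
    (LINT x|leb (J_set P). (\<Prod>p\<in>{1..n-1}. apply_C01 (gs ! (p - 1)) (t + (\<Sum>j\<in>I_set P p. x j))))"
proof (cases "J_set P = {}")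
  case True
  have I: "I_set P p = {}" if "p \<in> {1..n-1}" for p
    using I_set_sub_J_set[OF P, of p] that True by auto
  have "apply_C01 (prod_list gs) t = (\<Prod>p\<in>{1..n-1}. apply_C01 (gs ! (p - 1)) t)"
  proof -
    have "(\<Prod>g\<leftarrow>gs. apply_C01 g t) = (\<Prod>i<n-1. apply_C01 (gs ! i) t)"
      unfolding prod.list_conv_set_nth by (simp add: len atLeast0LessThan)
    also have "\<dots> = (\<Prod>p\<in>{1..n-1}. apply_C01 (gs ! (p - 1)) t)"
      by (rule prod.reindex_bij_witness[where i = "\<lambda>p. p - 1" and j = Suc]) auto
    finally show ?thesis using apply_C01_prod_list[OF t] by simp
  qed
  moreover have "(LINT x|leb {}. (\<Prod>p\<in>{1..n-1}. apply_C01 (gs ! (p - 1)) (t + (\<Sum>j\<in>I_set P p. x j)))) =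
      (\<Prod>p\<in>{1..n-1}. apply_C01 (gs ! (p - 1)) (t + (\<Sum>j\<in>I_set P p. undefined)))"
    by (rule integral_leb_empty)
  ultimately show ?thesis using True I by (simp add: Lambda_map_def)
next
  case False
  let ?J = "J_set P" and ?Q = "{1..n-1}"
  have sub: "I_set P p \<subseteq> ?J" if "p \<in> ?Q" for p by (rule I_set_sub_J_set[OF P]) (use that in auto)
  define h where "h = (\<lambda>t. if t \<in> {0..1::real} then
    (LINT x|leb ?J. (\<Prod>p\<in>?Q. apply_C01 (gs ! (p - 1)) (t + (\<Sum>j\<in>I_set P p. x j)))) else 0)"
  have hlim: "(\<lambda>k. h (T k)) \<longlonglongrightarrow> h s" if T: "\<And>k. T k \<in> {0..1}" "T \<longlonglongrightarrow> s" for T s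
  proof -
    have s: "s \<in> {0..1}" using closed_sequentially[OF closed_atLeastAtMost T] .
    have "\<exists>B. \<forall>p\<in>?Q. \<forall>s. norm (apply_C01 (gs ! (p - 1)) s) \<le> B"
    proof -
      obtain b where b: "\<And>p s. norm (apply_C01 (gs ! (p - 1)) s) \<le> b p"
        using choice[of "\<lambda>p B. \<forall>s. norm (apply_C01 (gs ! (p - 1)) s) \<le> B"] apply_C01_bounded by blast
      have "b p \<le> (\<Sum>p\<in>?Q. \<bar>b p\<bar>)" if "p \<in> ?Q" for p
        using member_le_sum[of p ?Q "\<lambda>p. \<bar>b p\<bar>"] that by auto
      then show ?thesis using b order_trans by blast
    qed
    then obtain B where B: "\<And>p s. p \<in> ?Q \<Longrightarrow> norm (apply_C01 (gs ! (p - 1)) s) \<le> B" by blast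
    have off: "(\<lambda>k. apply_C01 g (S k)) \<longlonglongrightarrow> apply_C01 g u" if S: "S \<longlonglongrightarrow> u" "u \<noteq> 0" "u \<noteq> 1" for S u g
    proof -
      have "isCont (apply_C01 g) u"
      proof (cases "u \<in> {0<..<1}")
        case True
        then show ?thesis
          using continuous_on_subset[OF continuous_apply_C01, of "{0<..<1}" g] continuous_on_eq_continuous_at[of "{0<..<1}" "apply_C01 g"]
          by force
      next
        case False
        then have u: "u \<in> - {0..1}" using S by auto
        have "continuous_on (- {0..1}) (apply_C01 g)"
          by (rule continuous_on_eq[of _ "\<lambda>_. 0"]) (use apply_C01_outside in auto)
        moreover have "open (- {0..1::real})" by (simp add: open_Compl)
        ultimately show ?thesis using u continuous_on_eq_continuous_at by blast
      qed
      then show ?thesis using S(1) isCont_tendsto_compose by blast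
    qed
    have "(\<lambda>k. LINT x|leb ?J. (\<Prod>p\<in>?Q. apply_C01 (gs ! (p - 1)) (T k + (\<Sum>j\<in>I_set P p. x j)))) \<longlonglongrightarrow>
      (LINT x|leb ?J. (\<Prod>p\<in>?Q. apply_C01 (gs ! (p - 1)) (s + (\<Sum>j\<in>I_set P p. x j))))"
      by (rule loop_integral_tendsto(1)[where Y = "\<lambda>_ y. y" and g = "\<lambda>p _. apply_C01 (gs ! (p - 1))" and B = B
            and I = "I_set P" and J = "J_set P" and Q = "{1..n-1}"])
        (use finite_J_set[OF P] sub I_set_steps[OF P] T B off apply_C01_outside apply_C01_tendsto[OF T] in auto)
    then show ?thesis using T(1) s by (simp add: h_def)
  qed
  have "continuous_on {0..1} h"
    unfolding continuous_on_sequentially o_def using hlim by blast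
  then have ap: "apply_C01 (Abs_C01 h) = h"
    by (intro Abs_C01_inverse) (auto simp: h_def)
  have hL: "h u = Lambda_integral P gs u" if u: "u \<in> {0<..1}" for u
  proof -
    let ?s = "\<lambda>x p. u + (\<Sum>j\<in>I_set P p. x j)"
    have n': "length gs + 1 = n" using len n by simp
    have meas_s: "(\<lambda>x. ?s x p) \<in> borel_measurable (leb ?J)" if "p \<in> ?Q" for p
      using sum_component_leb[OF sub[OF that], of "\<lambda>y. y" u] by simp
    have meas: "(\<lambda>x. \<Prod>p\<in>?Q. apply_C01 (gs ! (p - 1)) (?s x p)) \<in> borel_measurable (leb ?J)"
      by (intro borel_measurable_prod measurable_compose[OF meas_s apply_C01_measurable])
    have E: "E_region n P u \<in> sets (leb ?J)"
    proof -
      have eq: "E_region n P u = {x \<in> space (leb ?J). \<forall>p\<in>?Q. 0 < ?s x p \<and> ?s x p \<le> 1}"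
        by (auto simp: E_region_def space_PiM)
      have "{x \<in> space (leb ?J). 0 < ?s x p \<and> ?s x p \<le> 1} \<in> sets (leb ?J)" if "p \<in> ?Q" for p
        using meas_s[OF that] by measurable
      then show ?thesis unfolding eq by (intro sets.sets_Collect_finite_All) auto
    qed
    have ae: "AE x in leb ?J. \<forall>p\<in>?Q. I_set P p \<noteq> {} \<longrightarrow> ?s x p \<noteq> 0"
    proof (rule AE_finite_allI)
      fix p assume "p \<in> ?Q"
      show "AE x in leb ?J. I_set P p \<noteq> {} \<longrightarrow> ?s x p \<noteq> 0"
        using AE_sum_neq[OF finite_J_set[OF P] sub[OF \<open>p \<in> ?Q\<close>]] by (cases "I_set P p = {}") auto
    qed simp
    have "(LINT x|leb ?J. (\<Prod>p\<in>?Q. apply_C01 (gs ! (p - 1)) (?s x p))) =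
      (LINT x|leb ?J. indicator (E_region n P u) x *\<^sub>R (\<Prod>p\<in>?Q. apply_C01 (gs ! (p - 1)) (?s x p)))"
    proof (rule integral_cong_AE)
      show "AE x in leb ?J. (\<Prod>p\<in>?Q. apply_C01 (gs ! (p - 1)) (?s x p)) =
        indicator (E_region n P u) x *\<^sub>R (\<Prod>p\<in>?Q. apply_C01 (gs ! (p - 1)) (?s x p))"
        using ae AE_space
      proof eventually_elim
        case (elim x)
        show ?case
        proof (cases "x \<in> E_region n P u")
          case False
          then obtain p where p: "p \<in> ?Q" "\<not> (0 < ?s x p \<and> ?s x p \<le> 1)"
            using elim(2) by (auto simp: E_region_def space_PiM)
          then have "I_set P p \<noteq> {}" using u by auto
          then have "?s x p \<noteq> 0" using elim(1) p(1) by blast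
          then have "?s x p \<notin> {0..1}" using p(2) by auto
          then have "apply_C01 (gs ! (p - 1)) (?s x p) = 0" by (rule apply_C01_outside)
          then have "(\<Prod>p\<in>?Q. apply_C01 (gs ! (p - 1)) (?s x p)) = 0"
            using p(1) by (intro prod_zero) auto
          then show ?thesis by (simp only: scaleR_zero_right)
        qed simp
      qed
    qed (use meas E in auto)
    then show ?thesis
      using u unfolding h_def Lambda_integral_def set_lebesgue_integral_def Let_def n' by simp
  qed
  have "Lambda_map P gs = Abs_C01 h"
    unfolding Lambda_map_def using False
  proof (simp, intro the_equality ballI)
    show "apply_C01 (Abs_C01 h) t = Lambda_integral P gs t" if "t \<in> {0<..1}" for t
      using hL[OF that] ap by simp
    fix f assume "\<forall>t\<in>{0<..1}. apply_C01 f t = Lambda_integral P gs t"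
    then show "f = Abs_C01 h" by (intro C01_eq_on_open) (use hL ap in auto)
  qed
  then show ?thesis using ap t by (simp add: h_def)
qed

lemma grid_limit_Lambda:
  assumes P: "P \<in> partitions n" and len: "length gs = n - 1" and n: "1 \<le> n"
    and \<phi>: "\<And>p. p \<in> {1..n-1} \<Longrightarrow> grid_limit (\<phi> p) (gs ! (p - 1))"
  shows "grid_limit (\<lambda>N v. loop_sum (J_set P) {1..n-1} (I_set P) (Suc N) (\<lambda>p. \<phi> p N) v / of_nat (Suc N) ^ card (J_set P))
     (Lambda_map P gs)"
proof -
  have sub: "I_set P p \<subseteq> J_set P" if "p \<in> {1..n-1}" for p by (rule I_set_sub_J_set[OF P]) (use that in auto)
  have "\<exists>b. \<forall>p\<in>{1..n-1}. (\<forall>N. \<forall>v\<in>{1..Suc N}. norm (\<phi> p N v) \<le> b p)"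
    using \<phi> unfolding grid_limit_def by (intro bchoice) blast
  then obtain b where b: "\<And>p N v. p \<in> {1..n-1} \<Longrightarrow> v \<in> {1..Suc N} \<Longrightarrow> norm (\<phi> p N v) \<le> b p" by blast
  define B where "B = (\<Sum>p\<in>{1..n-1}. \<bar>b p\<bar>)"
  have B: "norm (\<phi> p N v) \<le> B" if "p \<in> {1..n-1}" "v \<in> {1..Suc N}" for p N v
    using b[OF that] member_le_sum[of p "{1..n-1}" "\<lambda>p. \<bar>b p\<bar>"] that by (auto simp: B_def)
  have B0: "0 \<le> B" by (simp add: B_def sum_nonneg)
  note lim = loop_sum_tendsto[OF finite_J_set[OF P] finite_atLeastAtMost sub I_set_steps[OF P],
      where \<phi> = \<phi> and f = "\<lambda>p. gs ! (p - 1)" and B = B, OF _ _ \<phi> _ _ _ B B0]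
  show ?thesis
  proof (rule grid_limitI)
    fix N v assume v: "v \<in> {1..Suc N}"
    show "norm (loop_sum (J_set P) {1..n-1} (I_set P) (Suc N) (\<lambda>p. \<phi> p N) v / of_nat (Suc N) ^ card (J_set P))
      \<le> 6 ^ card (J_set P) * B ^ card {1..n-1}"
    proof -
      define w where "w = (\<lambda>k. if k = N then v else Suc k)"
      have "(\<lambda>k. real (w k) / real (Suc k)) \<longlonglongrightarrow> 1"
      proof (rule tendsto_eventually)
        show "eventually (\<lambda>k. real (w k) / real (Suc k) = 1) sequentially"
          using eventually_gt_at_top[of N] by eventually_elim (simp add: w_def del: of_nat_Suc)
      qed
      then have "norm (loop_sum (J_set P) {1..n-1} (I_set P) (Suc N) (\<lambda>p. \<phi> p N) (w N) / of_nat (Suc N) ^ card (J_set P))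
        \<le> 6 ^ card (J_set P) * B ^ card {1..n-1}"
        by (intro lim(2)) (use v in \<open>auto simp: w_def\<close>)
      then show ?thesis by (simp add: w_def)
    qed
  next
    fix v t assume v: "\<And>N. v N \<in> {1..Suc N}" "(\<lambda>N. real (v N) / real (Suc N)) \<longlonglongrightarrow> t" "t \<in> {0..1}"
    show "(\<lambda>N. loop_sum (J_set P) {1..n-1} (I_set P) (Suc N) (\<lambda>p. \<phi> p N) (v N) / of_nat (Suc N) ^ card (J_set P))
        \<longlonglongrightarrow> apply_C01 (Lambda_map P gs) t"
      unfolding Lambda_map_apply[OF P len n v(3)]
      using v by (intro lim(1)) auto
  qed
qed

section \<open>The grid sum of a set partition\<close>

definition slot_rel_of :: "nat \<Rightarrow> nat set set \<Rightarrow> (nat \<times> nat) set" where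
  "slot_rel_of e P = {(x, y). \<exists>S\<in>P. \<exists>a\<in>S. \<exists>b\<in>S. x = 2 * a - 2 + e \<and> y = 2 * b - 2 + e}"

lemma theta_slot_inj: "1 \<le> a \<Longrightarrow> 1 \<le> b \<Longrightarrow> 2 * a - 2 + e = 2 * b - 2 + e \<longleftrightarrow> a = (b::nat)"
  by auto

lemma slot_rel_of_iff:
  assumes P: "P \<in> partitions n" and "a \<in> {1..n}" "b \<in> {1..n}"
  shows "(2 * a - 2 + e, 2 * b - 2 + e) \<in> slot_rel_of e P \<longleftrightarrow> (\<exists>S\<in>P. a \<in> S \<and> b \<in> S)"
proof
  assume "(2 * a - 2 + e, 2 * b - 2 + e) \<in> slot_rel_of e P"
  then obtain S a' b' where S: "S \<in> P" "a' \<in> S" "b' \<in> S"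
    "2 * a - 2 + e = 2 * a' - 2 + e" "2 * b - 2 + e = 2 * b' - 2 + e"
    unfolding slot_rel_of_def by blast
  then have "a' \<in> {1..n}" "b' \<in> {1..n}" using partitionsD(1)[OF P S(1)] by auto
  then have "a = a'" "b = b'" using S(4,5) assms theta_slot_inj[of a a' e] theta_slot_inj[of b b' e] by auto
  then show "\<exists>S\<in>P. a \<in> S \<and> b \<in> S" using S by blast
qed (auto simp: slot_rel_of_def)

lemma slots_theta:
  assumes "e < 2"
  shows "slots e (2 * n) = (\<lambda>j. 2 * j - 2 + e) ` {1..n}"
proof (intro set_eqI iffI)
  fix x assume "x \<in> slots e (2 * n)"
  then have x: "x < 2 * n" "x mod 2 = e" by (auto simp: slots_def)
  define k where "k = x div 2"
  have "x = 2 * k + e" using x(2) mult_div_mod_eq[of 2 x] by (simp add: k_def)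
  then have "x = 2 * (k + 1) - 2 + e" "k + 1 \<in> {1..n}" using x(1) by auto
  then show "x \<in> (\<lambda>j. 2 * j - 2 + e) ` {1..n}" by blast
next
  fix x assume "x \<in> (\<lambda>j. 2 * j - 2 + e) ` {1..n}"
  then obtain j where j: "j \<in> {1..n}" "x = 2 * j - 2 + e" by blast
  then obtain k where "j = k + 1" "k < n" by (cases j) auto
  then show "x \<in> slots e (2 * n)" using j assms by (auto simp: slots_def)
qed

lemma slot_rel_slot_rel_of:
  assumes P: "P \<in> partitions n" and e: "e < 2"
  shows "slot_rel e (2 * n) (slot_rel_of e P)"
proof
  have mem: "\<exists>a b. a \<in> {1..n} \<and> b \<in> {1..n} \<and> x = 2 * a - 2 + e \<and> y = 2 * b - 2 + e \<and> (\<exists>S\<in>P. a \<in> S \<and> b \<in> S)"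
    if "(x, y) \<in> slot_rel_of e P" for x y
    using that partitionsD(1)[OF P] unfolding slot_rel_of_def by blast
  show "equiv (slots e (2 * n)) (slot_rel_of e P)"
  proof (intro equivI)
    show "slot_rel_of e P \<subseteq> slots e (2 * n) \<times> slots e (2 * n)"
      unfolding slots_theta[OF e] by (rule subrelI) (use mem in blast)
    show "refl_on (slots e (2 * n)) (slot_rel_of e P)"
    proof (rule refl_onI)
      fix x assume "x \<in> slots e (2 * n)"
      then obtain j where j: "j \<in> {1..n}" "x = 2 * j - 2 + e" unfolding slots_theta[OF e] by blast
      then show "(x, x) \<in> slot_rel_of e P"
        using slot_rel_of_iff[OF P j(1) j(1), of e] partitionsD(5)[OF P j(1)] by simp
    qed
    show "sym (slot_rel_of e P)" unfolding sym_def slot_rel_of_def by blast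
    show "trans (slot_rel_of e P)"
    proof (rule transI)
      fix x y z assume xy: "(x, y) \<in> slot_rel_of e P" and yz: "(y, z) \<in> slot_rel_of e P"
      obtain a b S where 1: "a \<in> {1..n}" "b \<in> {1..n}" "x = 2 * a - 2 + e" "y = 2 * b - 2 + e" "S \<in> P" "a \<in> S" "b \<in> S"
        using mem[OF xy] by blast
      obtain b' c T where 2: "b' \<in> {1..n}" "c \<in> {1..n}" "y = 2 * b' - 2 + e" "z = 2 * c - 2 + e" "T \<in> P" "b' \<in> T" "c \<in> T"
        using mem[OF yz] by blast
      have "b = b'" using theta_slot_inj[of b b' e] 1 2 by auto
      then have "S = T" using partitionsD(4)[OF P 1(5) 2(5)] 1 2 by blast
      then show "(x, z) \<in> slot_rel_of e P" using 1 2 unfolding slot_rel_of_def by blast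
    qed
  qed
qed (use e in auto)

lemma bij_slot_rel_of:
  assumes e: "e < 2"
  shows "bij_betw (slot_rel_of e) (partitions n) {r. slot_rel e (2 * n) r}"
proof (rule bij_betw_imageI)
  show "inj_on (slot_rel_of e) (partitions n)"
  proof (rule inj_onI)
    fix P Q assume P: "P \<in> partitions n" and Q: "Q \<in> partitions n" and eq: "slot_rel_of e P = slot_rel_of e Q"
    show "P = Q"
    proof (rule partition_on_eq_iff_rel[of "{1..n}"])
      show "partition_on {1..n} P" "partition_on {1..n} Q" using P Q by (simp_all add: partitions_def)
      show "(\<exists>S\<in>P. a \<in> S \<and> b \<in> S) \<longleftrightarrow> (\<exists>S\<in>Q. a \<in> S \<and> b \<in> S)" if "a \<in> {1..n}" "b \<in> {1..n}" for a b
        unfolding slot_rel_of_iff[OF P that, of e, symmetric] slot_rel_of_iff[OF Q that, of e, symmetric] eq ..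
    qed
  qed
  show "slot_rel_of e ` partitions n = {r. slot_rel e (2 * n) r}"
  proof (intro set_eqI iffI)
    fix r assume "r \<in> {r. slot_rel e (2 * n) r}"
    then interpret R: slot_rel e "2 * n" r by simp
    define \<theta> where "\<theta> = (\<lambda>j. 2 * j - 2 + e)"
    define q where "q = {(a, b). a \<in> {1..n} \<and> b \<in> {1..n} \<and> (\<theta> a, \<theta> b) \<in> r}"
    have rin: "\<theta> a \<in> slots e (2 * n)" if "a \<in> {1..n}" for a
      using slots_theta[OF e] that unfolding \<theta>_def by blast
    have eq: "equiv {1..n} q"
    proof (intro equivI)
      show "refl_on {1..n} q" using R.refl_r rin unfolding refl_on_def q_def slots_def by auto
      show "sym q" using R.sym_r unfolding sym_def q_def by blast
      show "trans q" using R.trans_r unfolding trans_def q_def by blast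
    qed (auto simp: q_def)
    define P where "P = {1..n} // q"
    have P: "P \<in> partitions n" unfolding partitions_def P_def using partition_on_quotient[OF eq] by simp
    have blk: "(\<exists>S\<in>P. a \<in> S \<and> b \<in> S) \<longleftrightarrow> (a, b) \<in> q" for a b
    proof
      assume "\<exists>S\<in>P. a \<in> S \<and> b \<in> S"
      then obtain z where "a \<in> q `` {z}" "b \<in> q `` {z}" unfolding P_def by (auto elim!: quotientE)
      then show "(a, b) \<in> q" using eq unfolding equiv_def by (meson Image_singleton_iff symD transD)
    next
      assume ab: "(a, b) \<in> q"
      then have a: "a \<in> {1..n}" by (simp add: q_def)
      then have "q `` {a} \<in> P" "a \<in> q `` {a}" unfolding P_def using equiv_class_self[OF eq a] by (auto intro: quotientI)
      then show "\<exists>S\<in>P. a \<in> S \<and> b \<in> S" using ab by blast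
    qed
    have "slot_rel_of e P = r"
    proof (rule set_eqI)
      fix z :: "nat \<times> nat"
      obtain x y where z: "z = (x, y)" by (cases z)
      show "z \<in> slot_rel_of e P \<longleftrightarrow> z \<in> r"
      proof
        assume "z \<in> slot_rel_of e P"
        then obtain a b where "x = \<theta> a" "y = \<theta> b" "(a, b) \<in> q" unfolding z slot_rel_of_def \<theta>_def using blk by blast
        then show "z \<in> r" using z by (simp add: q_def)
      next
        assume zr: "z \<in> r"
        then have "x \<in> slots e (2 * n)" "y \<in> slots e (2 * n)" using R.mem_r[of x y] z by (auto simp: slots_def)
        then obtain a b where ab: "a \<in> {1..n}" "b \<in> {1..n}" "x = \<theta> a" "y = \<theta> b"
          unfolding slots_theta[OF e] \<theta>_def by blast
        then have "(a, b) \<in> q" using zr z by (simp add: q_def)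
        then show "z \<in> slot_rel_of e P" using blk[of a b] ab slot_rel_of_iff[OF P ab(1,2), of e] z unfolding \<theta>_def by blast
      qed
    qed
    then show "r \<in> slot_rel_of e ` partitions n" using P by blast
  qed (use slot_rel_slot_rel_of[OF _ e] in auto)
qed

definition pred_cyc :: "nat \<Rightarrow> nat \<Rightarrow> nat" where
  "pred_cyc n j = (if j = 1 then n else j - 1)"

definition loops :: "nat \<Rightarrow> nat \<Rightarrow> nat set set \<Rightarrow> (nat \<Rightarrow> nat) set" where
  "loops N n P = {s. s \<in> {1..n} \<rightarrow>\<^sub>E {1..N} \<and> (\<forall>S\<in>P. (\<Sum>j\<in>S. int (s j) - int (s (pred_cyc n j))) = 0)}"

definition colourings :: "nat \<Rightarrow> nat \<Rightarrow> nat set set \<Rightarrow> (nat \<Rightarrow> nat) set" where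
  "colourings N n P = {c. c \<in> {1..n} \<rightarrow>\<^sub>E {1..N} \<and> (\<forall>S\<in>P. \<forall>a\<in>S. \<forall>b\<in>S. c a = c b)}"

lemma sum_partition:
  assumes P: "P \<in> partitions n"
  shows "(\<Sum>j\<in>{1..n}. f j) = (\<Sum>S\<in>P. \<Sum>j\<in>S. f j :: 'a::comm_monoid_add)"
proof -
  have "{1..n} = \<Union>P" using P by (simp add: partitions_def partition_on_def)
  also have "(\<Sum>j\<in>\<Union>P. f j) = (\<Sum>S\<in>P. \<Sum>j\<in>S. f j)"
    by (rule sum.Union_disjoint[unfolded comp_def]) (use partitionsD(2,4)[OF P] in blast)+
  finally show ?thesis .
qed

text \<open>
  Testing with the indicator functions of blocks. The points of parity \<open>e\<close> carry a
  colouring that is constant on blocks, and the points of the other parity carry a loop with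
  total increment zero over each block. Note that the point before the first one is, cyclically,
  the last one.
\<close>

lemma solves_iff:
  assumes P: "P \<in> partitions n" and e: "e < 2"
  shows "solves e (2 * n) (slot_rel_of e P) y \<longleftrightarrow>
    (\<forall>S\<in>P. \<forall>a\<in>S. \<forall>b\<in>S. y (2 * a - 2 + e) = y (2 * b - 2 + e)) \<and>
    (\<forall>S\<in>P. (\<Sum>j\<in>S. int (y ((2 * j - 1 + e) mod (2 * n))) - int (y ((2 * pred_cyc n j - 1 + e) mod (2 * n)))) = 0)"
proof -
  define \<theta> where "\<theta> = (\<lambda>j. 2 * j - 2 + e)"
  define d where "d = (\<lambda>j. int (y ((2 * j - 1 + e) mod (2 * n))) - int (y ((2 * pred_cyc n j - 1 + e) mod (2 * n))))"
  have inj: "inj_on \<theta> {1..n}" unfolding \<theta>_def using theta_slot_inj by (auto simp: inj_on_def)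
  have br: "bracket e (2 * n) \<omega> y = (\<Sum>S\<in>P. \<Sum>j\<in>S. \<omega> (\<theta> j) * d j)" for \<omega>
  proof -
    have "bracket e (2 * n) \<omega> y = (\<Sum>j\<in>{1..n}. \<omega> (\<theta> j) * d j)"
      unfolding bracket_def slots_theta[OF e] \<theta>_def[symmetric] sum.reindex[OF inj] o_def
    proof (rule sum.cong[OF HOL.refl])
      fix j assume j: "j \<in> {1..n}"
      have s: "\<theta> j + 1 = 2 * j - 1 + e" using j by (auto simp: \<theta>_def)
      have p: "(\<theta> j + 2 * n - 1) mod (2 * n) = (2 * pred_cyc n j - 1 + e) mod (2 * n)"
      proof (cases "j = 1")
        case True
        then show ?thesis using j by (simp add: \<theta>_def pred_cyc_def add.commute)
      next
        case False
        then have "\<theta> j + 2 * n - 1 = 2 * n + (2 * pred_cyc n j - 1 + e)" using j by (auto simp: \<theta>_def pred_cyc_def)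
        then show ?thesis by (simp only: mod_add_self1)
      qed
      show "\<omega> (\<theta> j) * (int (y ((\<theta> j + 1) mod (2 * n))) - int (y ((\<theta> j + 2 * n - 1) mod (2 * n)))) = \<omega> (\<theta> j) * d j"
        unfolding d_def s p ..
    qed
    then show ?thesis using sum_partition[OF P] by simp
  qed
  have inv: "invariant (slot_rel_of e P) f \<longleftrightarrow> (\<forall>S\<in>P. \<forall>a\<in>S. \<forall>b\<in>S. f (\<theta> a) = f (\<theta> b))" for f :: "nat \<Rightarrow> 'a"
    unfolding invariant_def slot_rel_of_def \<theta>_def by blast
  have "(\<forall>\<omega>. invariant (slot_rel_of e P) \<omega> \<longrightarrow> bracket e (2 * n) \<omega> y = 0) \<longleftrightarrow> (\<forall>S\<in>P. (\<Sum>j\<in>S. d j) = 0)"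
  proof
    assume L: "\<forall>\<omega>. invariant (slot_rel_of e P) \<omega> \<longrightarrow> bracket e (2 * n) \<omega> y = 0"
    show "\<forall>S\<in>P. (\<Sum>j\<in>S. d j) = 0"
    proof
      fix S assume S: "S \<in> P"
      define \<omega> where "\<omega> = (\<lambda>k. if k \<in> \<theta> ` S then 1 else 0 :: int)"
      have w: "\<omega> (\<theta> a) = (if T = S then 1 else 0)" if "T \<in> P" "a \<in> T" for T a
      proof -
        have "\<theta> a \<in> \<theta> ` S \<longleftrightarrow> a \<in> S"
          using inj partitionsD(1)[OF P S] partitionsD(1)[OF P that(1)] that(2) by (auto dest: inj_onD)
        also have "\<dots> \<longleftrightarrow> T = S" using partitionsD(4)[OF P that(1) S that(2)] that by blast
        finally show ?thesis by (simp add: \<omega>_def)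
      qed
      have "invariant (slot_rel_of e P) \<omega>" unfolding inv using w by auto
      then have "0 = (\<Sum>T\<in>P. \<Sum>j\<in>T. \<omega> (\<theta> j) * d j)" using L br by simp
      also have "\<dots> = (\<Sum>T\<in>P. if T = S then (\<Sum>j\<in>S. d j) else 0)"
        by (rule sum.cong) (auto simp: w)
      also have "\<dots> = (\<Sum>j\<in>S. d j)" using S partitionsD(6)[OF P] by simp
      finally show "(\<Sum>j\<in>S. d j) = 0" by simp
    qed
  next
    assume R: "\<forall>S\<in>P. (\<Sum>j\<in>S. d j) = 0"
    show "\<forall>\<omega>. invariant (slot_rel_of e P) \<omega> \<longrightarrow> bracket e (2 * n) \<omega> y = 0"
    proof (intro allI impI)
      fix \<omega> :: "nat \<Rightarrow> int" assume w: "invariant (slot_rel_of e P) \<omega>"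
      have "(\<Sum>j\<in>S. \<omega> (\<theta> j) * d j) = 0" if S: "S \<in> P" for S
      proof -
        obtain a where a: "a \<in> S" using partitionsD(3)[OF P S] by blast
        have "(\<Sum>j\<in>S. \<omega> (\<theta> j) * d j) = (\<Sum>j\<in>S. \<omega> (\<theta> a) * d j)"
        proof (rule sum.cong[OF HOL.refl])
          fix j assume "j \<in> S"
          then have "\<omega> (\<theta> j) = \<omega> (\<theta> a)" using w[unfolded inv] S a by blast
          then show "\<omega> (\<theta> j) * d j = \<omega> (\<theta> a) * d j" by simp
        qed
        then show ?thesis using R S by (simp add: sum_distrib_left[symmetric])
      qed
      then show "bracket e (2 * n) \<omega> y = 0" unfolding br by simp
    qed
  qed
  then show ?thesis unfolding solves_def inv d_def \<theta>_def by simp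
qed

text \<open>
  Colourings and loops do not interact; this is the source of the factors
  \<open>\<Gamma>\<close> and \<open>\<Lambda>\<close>.
\<close>

lemma full_sum_factor:
  assumes P: "P \<in> partitions n" and e: "e < 2" and n: "1 \<le> n"
  shows "full_sum N e (2 * n) (slot_rel_of e P) \<phi> =
    (\<Sum>c\<in>colourings N n P. \<Prod>j=1..n. \<phi> (2 * j - 2 + e) (c j)) *
    (\<Sum>s\<in>loops N n P. \<Prod>j=1..n. \<phi> ((2 * j - 1 + e) mod (2 * n)) (s j))"
proof -
  define \<theta> where "\<theta> = (\<lambda>j. 2 * j - 2 + e)"
  define \<sigma> where "\<sigma> = (\<lambda>j. (2 * j - 1 + e) mod (2 * n))"
  define fro where "fro = (\<lambda>y. (restrict (\<lambda>j. y (\<theta> j)) {1..n}, restrict (\<lambda>j. y (\<sigma> j)) {1..n}) :: (nat \<Rightarrow> nat) \<times> (nat \<Rightarrow> nat))"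
  define tog where "tog = (\<lambda>(c, s). restrict (\<lambda>x. if x mod 2 = e then c (x div 2 + 1) else s (if x = 0 then n else (x + 1) div 2)) {..<2*n} :: nat \<Rightarrow> nat)"
  have e01: "e = 0 \<or> e = 1" using e by auto
  have \<theta>: "\<theta> j < 2 * n" "\<theta> j mod 2 = e" "\<theta> j div 2 + 1 = j" if j: "j \<in> {1..n}" for j
  proof -
    obtain k where k: "j = k + 1" "k < n" using j by (cases j) auto
    then have "\<theta> j = 2 * k + e" by (simp add: \<theta>_def)
    then show "\<theta> j < 2 * n" "\<theta> j mod 2 = e" "\<theta> j div 2 + 1 = j" using k e01 by auto
  qed
  have \<sigma>: "\<sigma> j < 2 * n" "\<sigma> j mod 2 \<noteq> e" "(if \<sigma> j = 0 then n else (\<sigma> j + 1) div 2) = j" if j: "j \<in> {1..n}" for j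
  proof -
    obtain k where k: "j = k + 1" "k < n" using j by (cases j) auto
    have s: "\<sigma> j = (if e = 1 \<and> j = n then 0 else 2 * k + 1 + e)"
      using k e01 by (auto simp: \<sigma>_def)
    show "\<sigma> j < 2 * n" using n by (simp add: \<sigma>_def)
    show "\<sigma> j mod 2 \<noteq> e" using s e01 by auto
    show "(if \<sigma> j = 0 then n else (\<sigma> j + 1) div 2) = j" using s k e01 by auto
  qed
  have back\<theta>: "\<theta> (x div 2 + 1) = x" "x div 2 + 1 \<in> {1..n}" if "x < 2 * n" "x mod 2 = e" for x
  proof -
    have "x = 2 * (x div 2) + e" using that(2) mult_div_mod_eq[of 2 x] by simp
    then show "\<theta> (x div 2 + 1) = x" "x div 2 + 1 \<in> {1..n}" using that(1) by (auto simp: \<theta>_def)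
  qed
  have back\<sigma>: "\<sigma> (if x = 0 then n else (x + 1) div 2) = x" "(if x = 0 then n else (x + 1) div 2) \<in> {1..n}"
    if x: "x < 2 * n" "x mod 2 \<noteq> e" for x
  proof -
    have "x mod 2 = 1 - e" using x(2) e01 by auto
    then obtain k where k: "x = 2 * k + (1 - e)" using mult_div_mod_eq[of 2 x] by metis
    show "\<sigma> (if x = 0 then n else (x + 1) div 2) = x" "(if x = 0 then n else (x + 1) div 2) \<in> {1..n}"
      using k x(1) e01 n by (auto simp: \<sigma>_def)
  qed
  have set_split: "{..<2*n} = \<theta> ` {1..n} \<union> \<sigma> ` {1..n}" "\<theta> ` {1..n} \<inter> \<sigma> ` {1..n} = {}"
  proof -
    show "{..<2*n} = \<theta> ` {1..n} \<union> \<sigma> ` {1..n}"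
    proof (intro set_eqI iffI)
      fix x assume "x \<in> {..<2*n}"
      then show "x \<in> \<theta> ` {1..n} \<union> \<sigma> ` {1..n}"
        using back\<theta>[of x] back\<sigma>[of x] by (cases "x mod 2 = e") (metis UnI1 imageI lessThan_iff, metis UnI2 imageI lessThan_iff)
    qed (use \<theta>(1) \<sigma>(1) in auto)
    show "\<theta> ` {1..n} \<inter> \<sigma> ` {1..n} = {}" using \<theta>(2) \<sigma>(2) by fastforce
  qed
  have inj: "inj_on \<theta> {1..n}" "inj_on \<sigma> {1..n}" using \<theta>(3) \<sigma>(3) by (metis inj_onI)+
  have tog\<theta>: "tog (c, s) (\<theta> j) = c j" and tog\<sigma>: "tog (c, s) (\<sigma> j) = s j" if "j \<in> {1..n}" for c s j
    using \<theta>[OF that] \<sigma>[OF that] by (simp_all add: tog_def)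
  have sol: "solves e (2 * n) (slot_rel_of e P) y \<longleftrightarrow>
     (\<forall>S\<in>P. \<forall>a\<in>S. \<forall>b\<in>S. y (\<theta> a) = y (\<theta> b)) \<and>
     (\<forall>S\<in>P. (\<Sum>j\<in>S. int (y (\<sigma> j)) - int (y (\<sigma> (pred_cyc n j)))) = 0)" for y
    unfolding \<theta>_def \<sigma>_def by (rule solves_iff[OF P e])
  have Sn: "j \<in> {1..n}" "pred_cyc n j \<in> {1..n}" if "S \<in> P" "j \<in> S" for S j
    using subsetD[OF partitionsD(1)[OF P that(1)] that(2)] by (auto simp: pred_cyc_def)
  have "full_sum N e (2 * n) (slot_rel_of e P) \<phi> = (\<Sum>z\<in>colourings N n P \<times> loops N n P.
     (\<Prod>j=1..n. \<phi> (\<theta> j) (fst z j)) * (\<Prod>j=1..n. \<phi> (\<sigma> j) (snd z j)))"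
    unfolding full_sum_def
  proof (rule sum.reindex_bij_witness[where j = fro and i = tog])
    fix y assume "y \<in> {y. y \<in> {..<2*n} \<rightarrow>\<^sub>E {1..N} \<and> solves e (2 * n) (slot_rel_of e P) y}"
    then have yE: "y \<in> {..<2*n} \<rightarrow>\<^sub>E {1..N}" and ys: "solves e (2 * n) (slot_rel_of e P) y" by auto
    show "tog (fro y) = y"
    proof
      fix x show "tog (fro y) x = y x"
      proof (cases "x < 2 * n")
        case True
        then show ?thesis using back\<theta>[of x] back\<sigma>[of x] by (cases "x mod 2 = e") (simp_all add: tog_def fro_def)
      next
        case False
        then show ?thesis using yE by (simp add: tog_def fro_def PiE_def extensional_def)
      qed
    qed
    have "fst (fro y) \<in> colourings N n P"
    proof -
      have val: "fst (fro y) j = y (\<theta> j)" if "j \<in> {1..n}" for j using that by (simp add: fro_def)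
      have "fst (fro y) a = fst (fro y) b" if "S \<in> P" "a \<in> S" "b \<in> S" for S a b
      proof -
        have "y (\<theta> a) = y (\<theta> b)" using ys sol[of y] that by blast
        then show ?thesis using val[OF Sn(1)[OF that(1,2)]] val[OF Sn(1)[OF that(1,3)]] by simp
      qed
      moreover have "fst (fro y) \<in> {1..n} \<rightarrow>\<^sub>E {1..N}"
      proof (rule PiE_I)
        fix j assume j: "j \<in> {1..n}"
        then show "fst (fro y) j \<in> {1..N}" using PiE_mem[OF yE, of "\<theta> j"] \<theta>(1)[OF j] val[OF j] by simp
      qed (simp only: fro_def fst_conv restrict_apply if_False)
      ultimately show ?thesis unfolding colourings_def by blast
    qed
    moreover have "snd (fro y) \<in> loops N n P"
    proof -
      have val: "snd (fro y) j = y (\<sigma> j)" if "j \<in> {1..n}" for j using that by (simp add: fro_def)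
      have "(\<Sum>j\<in>S. int (snd (fro y) j) - int (snd (fro y) (pred_cyc n j))) = 0" if S: "S \<in> P" for S
      proof -
        have "(\<Sum>j\<in>S. int (snd (fro y) j) - int (snd (fro y) (pred_cyc n j))) =
          (\<Sum>j\<in>S. int (y (\<sigma> j)) - int (y (\<sigma> (pred_cyc n j))))"
          by (rule sum.cong[OF HOL.refl]) (simp only: val Sn[OF S])
        also have "\<dots> = 0" using ys sol[of y] S by blast
        finally show ?thesis .
      qed
      moreover have "snd (fro y) \<in> {1..n} \<rightarrow>\<^sub>E {1..N}"
      proof (rule PiE_I)
        fix j assume j: "j \<in> {1..n}"
        then show "snd (fro y) j \<in> {1..N}" using PiE_mem[OF yE, of "\<sigma> j"] \<sigma>(1)[OF j] val[OF j] by simp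
      qed (simp only: fro_def snd_conv restrict_apply if_False)
      ultimately show ?thesis unfolding loops_def by blast
    qed
    ultimately show "fro y \<in> colourings N n P \<times> loops N n P" by (cases "fro y") simp
    have "(\<Prod>k<2*n. \<phi> k (y k)) = (\<Prod>k\<in>\<theta> ` {1..n}. \<phi> k (y k)) * (\<Prod>k\<in>\<sigma> ` {1..n}. \<phi> k (y k))"
      unfolding set_split(1) by (rule prod.union_disjoint) (use set_split(2) in auto)
    moreover have "(\<Prod>j=1..n. \<phi> (\<theta> j) (fst (fro y) j)) = (\<Prod>k\<in>\<theta> ` {1..n}. \<phi> k (y k))"
      unfolding prod.reindex[OF inj(1)] by (rule prod.cong) (auto simp: fro_def)
    moreover have "(\<Prod>j=1..n. \<phi> (\<sigma> j) (snd (fro y) j)) = (\<Prod>k\<in>\<sigma> ` {1..n}. \<phi> k (y k))"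
      unfolding prod.reindex[OF inj(2)] by (rule prod.cong) (auto simp: fro_def)
    ultimately show "(\<Prod>j=1..n. \<phi> (\<theta> j) (fst (fro y) j)) * (\<Prod>j=1..n. \<phi> (\<sigma> j) (snd (fro y) j)) = (\<Prod>k<2*n. \<phi> k (y k))"
      by simp
  next
    fix z assume z: "z \<in> colourings N n P \<times> loops N n P"
    obtain c s where zz: "z = (c, s)" by (cases z)
    have c: "c \<in> {1..n} \<rightarrow>\<^sub>E {1..N}" "\<And>S a b. S \<in> P \<Longrightarrow> a \<in> S \<Longrightarrow> b \<in> S \<Longrightarrow> c a = c b"
      and s: "s \<in> {1..n} \<rightarrow>\<^sub>E {1..N}" "\<And>S. S \<in> P \<Longrightarrow> (\<Sum>j\<in>S. int (s j) - int (s (pred_cyc n j))) = 0"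
      using z unfolding zz colourings_def loops_def by blast+
    have "restrict (\<lambda>j. tog z (\<theta> j)) {1..n} = c"
    proof
      fix x show "restrict (\<lambda>j. tog z (\<theta> j)) {1..n} x = c x"
        using PiE_arb[OF c(1), of x] tog\<theta>[of x c s] by (cases "x \<in> {1..n}") (simp_all add: zz)
    qed
    moreover have "restrict (\<lambda>j. tog z (\<sigma> j)) {1..n} = s"
    proof
      fix x show "restrict (\<lambda>j. tog z (\<sigma> j)) {1..n} x = s x"
        using PiE_arb[OF s(1), of x] tog\<sigma>[of x c s] by (cases "x \<in> {1..n}") (simp_all add: zz)
    qed
    ultimately show "fro (tog z) = z" by (simp add: fro_def zz)
    have "tog z \<in> {..<2*n} \<rightarrow>\<^sub>E {1..N}"
    proof (rule PiE_I)
      fix x assume x: "x \<in> {..<2*n}"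
      show "tog z x \<in> {1..N}"
      proof (cases "x mod 2 = e")
        case True
        then have "tog z x = c (x div 2 + 1)" using x by (simp add: tog_def zz)
        then show ?thesis using PiE_mem[OF c(1) back\<theta>(2)[of x]] x True by simp
      next
        case False
        then have "tog z x = s (if x = 0 then n else (x + 1) div 2)" using x by (simp add: tog_def zz)
        then show ?thesis using PiE_mem[OF s(1) back\<sigma>(2)[of x]] x False by simp
      qed
    qed (simp add: tog_def zz)
    moreover have "solves e (2 * n) (slot_rel_of e P) (tog z)"
    proof -
      have "tog z (\<theta> a) = tog z (\<theta> b)" if "S \<in> P" "a \<in> S" "b \<in> S" for S a b
        using tog\<theta>[OF Sn(1)[OF that(1,2)]] tog\<theta>[OF Sn(1)[OF that(1,3)]] c(2)[OF that] by (simp add: zz)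
      moreover have "(\<Sum>j\<in>S. int (tog z (\<sigma> j)) - int (tog z (\<sigma> (pred_cyc n j)))) = 0" if S: "S \<in> P" for S
      proof -
        have "(\<Sum>j\<in>S. int (tog z (\<sigma> j)) - int (tog z (\<sigma> (pred_cyc n j)))) = (\<Sum>j\<in>S. int (s j) - int (s (pred_cyc n j)))"
          by (rule sum.cong) (use tog\<sigma> Sn[OF S] in \<open>simp_all add: zz\<close>)
        then show ?thesis using s(2)[OF S] by simp
      qed
      ultimately show ?thesis using sol[of "tog z"] by blast
    qed
    ultimately show "tog z \<in> {y. y \<in> {..<2*n} \<rightarrow>\<^sub>E {1..N} \<and> solves e (2 * n) (slot_rel_of e P) y}" by simp
  qed
  also have "\<dots> = (\<Sum>c\<in>colourings N n P. \<Prod>j=1..n. \<phi> (\<theta> j) (c j)) * (\<Sum>s\<in>loops N n P. \<Prod>j=1..n. \<phi> (\<sigma> j) (s j))"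
    unfolding sum_product sum.cartesian_product by (rule sum.cong) auto
  finally show ?thesis unfolding \<theta>_def \<sigma>_def .
qed

lemma sum_colourings:
  assumes P: "P \<in> partitions n"
  shows "(\<Sum>c\<in>colourings N n P. \<Prod>j=1..n. \<psi> j (c j)) = (\<Prod>S\<in>P. \<Sum>w=1..N. \<Prod>j\<in>S. \<psi> j w :: complex)"
proof -
  have finP: "finite P" using partitionsD(6)[OF P] .
  have "(\<Prod>S\<in>P. \<Sum>w=1..N. \<Prod>j\<in>S. \<psi> j w) = (\<Sum>g\<in>P \<rightarrow>\<^sub>E {1..N}. \<Prod>S\<in>P. \<Prod>j\<in>S. \<psi> j (g S))"
    by (rule prod_sum_PiE[OF finP]) simp
  also have "\<dots> = (\<Sum>c\<in>colourings N n P. \<Prod>j=1..n. \<psi> j (c j))"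
  proof (rule sum.reindex_bij_witness[where
        i = "\<lambda>c. restrict (\<lambda>S. c (SOME j. j \<in> S)) P" and j = "\<lambda>g. restrict (\<lambda>j. g (block P j)) {1..n}"])
    have some: "(SOME j. j \<in> S) \<in> S" "(SOME j. j \<in> S) \<in> {1..n}" if S: "S \<in> P" for S
    proof -
      show "(SOME j. j \<in> S) \<in> S" using partitionsD(3)[OF P S] some_in_eq by blast
      then show "(SOME j. j \<in> S) \<in> {1..n}" using partitionsD(1)[OF P S] by blast
    qed
    {
      fix g assume g: "g \<in> P \<rightarrow>\<^sub>E {1..N}"
      show "restrict (\<lambda>S. (restrict (\<lambda>j. g (block P j)) {1..n}) (SOME j. j \<in> S)) P = g"
      proof
        fix S show "restrict (\<lambda>S. (restrict (\<lambda>j. g (block P j)) {1..n}) (SOME j. j \<in> S)) P S = g S"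
          using some[of S] block_eq[OF P, of S "SOME j. j \<in> S"] PiE_arb[OF g, of S] by (cases "S \<in> P") simp_all
      qed
      have b: "restrict (\<lambda>j. g (block P j)) {1..n} j = g S" if "S \<in> P" "j \<in> S" for S j
        using block_eq[OF P that] partitionsD(1)[OF P that(1)] that(2) by auto
      show "restrict (\<lambda>j. g (block P j)) {1..n} \<in> colourings N n P"
        unfolding colourings_def using b PiE_mem[OF g] block_in(1)[OF P] by (auto simp: PiE_def Pi_def)
      show "(\<Prod>j=1..n. \<psi> j ((restrict (\<lambda>j. g (block P j)) {1..n}) j)) = (\<Prod>S\<in>P. \<Prod>j\<in>S. \<psi> j (g S))"
      proof -
        have "{1..n} = \<Union>P" using P by (simp add: partitions_def partition_on_def)
        then have "(\<Prod>j=1..n. \<psi> j ((restrict (\<lambda>j. g (block P j)) {1..n}) j)) =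
          (\<Prod>j\<in>\<Union>P. \<psi> j ((restrict (\<lambda>j. g (block P j)) {1..n}) j))" by simp
        also have "\<dots> = (\<Prod>S\<in>P. \<Prod>j\<in>S. \<psi> j ((restrict (\<lambda>j. g (block P j)) {1..n}) j))"
          by (rule prod.Union_disjoint[unfolded comp_def]) (use partitionsD(2,4)[OF P] in blast)+
        also have "\<dots> = (\<Prod>S\<in>P. \<Prod>j\<in>S. \<psi> j (g S))"
          by (intro prod.cong HOL.refl) (simp only: b)
        finally show ?thesis .
      qed
    }
    fix c assume "c \<in> colourings N n P"
    then have c: "c \<in> {1..n} \<rightarrow>\<^sub>E {1..N}" "\<And>S a b. S \<in> P \<Longrightarrow> a \<in> S \<Longrightarrow> b \<in> S \<Longrightarrow> c a = c b"
      unfolding colourings_def by blast+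
    show "restrict (\<lambda>j. (restrict (\<lambda>S. c (SOME j. j \<in> S)) P) (block P j)) {1..n} = c"
    proof
      fix x show "restrict (\<lambda>j. (restrict (\<lambda>S. c (SOME j. j \<in> S)) P) (block P j)) {1..n} x = c x"
        using block_in[OF P, of x] some(1)[of "block P x"] c(2)[of "block P x" "SOME j. j \<in> block P x" x] PiE_arb[OF c(1), of x]
        by (cases "x \<in> {1..n}") simp_all
    qed
    show "restrict (\<lambda>S. c (SOME j. j \<in> S)) P \<in> P \<rightarrow>\<^sub>E {1..N}"
      using some(2) PiE_mem[OF c(1)] by (auto simp: PiE_def Pi_def)
  qed
  finally show ?thesis by simp
qed

lemma I_set_step:
  assumes P: "P \<in> partitions n" and j: "j \<in> {1..n}"
  shows "j \<in> J_set P \<Longrightarrow> I_set P j = insert j (I_set P (j - 1))"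
    and "j \<notin> J_set P \<Longrightarrow> I_set P (j - 1) = I_set P j \<union> (block P j - {j})"
    and "j \<notin> J_set P \<Longrightarrow> I_set P j \<inter> (block P j - {j}) = {}"
    and "j \<notin> I_set P (j - 1)"
proof -
  have bj: "block P j \<in> P" "j \<in> block P j" using block_in[OF P j] .
  have bsub: "block P i \<in> P" "i \<in> block P i" if "i \<in> {1..j}" for i
    using block_in[OF P, of i] that j by auto
  have same: "block P i = block P j" if "i \<in> {1..j}" "j \<in> block P i" for i
    using block_eq[OF P bsub(1)[OF that(1)] that(2)] by simp
  have prev: "block P i \<subseteq> {1..j} \<and> \<not> block P i \<subseteq> {1..j-1} \<longleftrightarrow> block P i = block P j \<and> block P j \<subseteq> {1..j}"
    if i: "i \<in> {1..j}" for i
  proof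
    assume a: "block P i \<subseteq> {1..j} \<and> \<not> block P i \<subseteq> {1..j-1}"
    then obtain x where x: "x \<in> block P i" "x \<notin> {1..j-1}" by blast
    then have "x \<in> {1..j}" using a by blast
    then have "x = j" using x(2) by auto
    then have "block P i = block P j" using same[OF i] x by simp
    then show "block P i = block P j \<and> block P j \<subseteq> {1..j}" using a by simp
  next
    assume a: "block P i = block P j \<and> block P j \<subseteq> {1..j}"
    have "j \<notin> {1..j-1}" by auto
    then show "block P i \<subseteq> {1..j} \<and> \<not> block P i \<subseteq> {1..j-1}" using a bj(2) by auto
  qed
  have mono: "block P i \<subseteq> {1..j-1} \<Longrightarrow> block P i \<subseteq> {1..j}" for i
    by (rule order_trans, assumption) auto
  have rng: "i \<in> {1..j-1} \<longleftrightarrow> i \<in> {1..j} \<and> i \<noteq> j" for i by auto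
  have jJ: "j \<in> J_set P \<longleftrightarrow> \<not> block P j \<subseteq> {1..j}" using J_set_iff[OF P] j by simp
  have I1: "i \<in> I_set P (j - 1) \<longleftrightarrow> i \<in> {1..j} \<and> i \<noteq> j \<and> \<not> block P i \<subseteq> {1..j-1}" for i
    unfolding I_set_def mem_Collect_eq rng by blast
  have I2: "i \<in> I_set P j \<longleftrightarrow> i \<in> {1..j} \<and> \<not> block P i \<subseteq> {1..j}" for i
    unfolding I_set_def mem_Collect_eq by blast
  have jj: "j \<in> {1..j}" using j by simp
  show "I_set P j = insert j (I_set P (j - 1))" if a: "j \<in> J_set P"
  proof (rule set_eqI)
    fix i show "i \<in> I_set P j \<longleftrightarrow> i \<in> insert j (I_set P (j - 1))"
      using I1[of i] I2[of i] prev[of i] mono[of i] a jJ jj by blast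
  qed
  show "I_set P (j - 1) = I_set P j \<union> (block P j - {j})" if a: "j \<notin> J_set P"
  proof (rule set_eqI)
    have sub: "block P j \<subseteq> {1..j}" using a jJ by blast
    fix i
    have "i \<in> block P j \<longleftrightarrow> i \<in> {1..j} \<and> block P i = block P j"
      using sub bsub(2)[of i] block_eq[OF P bj(1), of i] by blast
    then show "i \<in> I_set P (j - 1) \<longleftrightarrow> i \<in> I_set P j \<union> (block P j - {j})"
      using I1[of i] I2[of i] prev[of i] mono[of i] sub jj by blast
  qed
  show "I_set P j \<inter> (block P j - {j}) = {}" if a: "j \<notin> J_set P"
  proof -
    have sub: "block P j \<subseteq> {1..j}" using a jJ by blast
    have "i \<notin> I_set P j" if "i \<in> block P j" for i
      using I2[of i] block_eq[OF P bj(1) that] sub by simp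
    then show ?thesis by blast
  qed
  show "j \<notin> I_set P (j - 1)" using I1 by blast
qed

lemma sum_J_block:
  assumes P: "P \<in> partitions n" and S: "S \<in> P"
  shows "Max S \<in> S" "Max S \<notin> J_set P" "j \<in> S \<Longrightarrow> j \<noteq> Max S \<Longrightarrow> j \<in> J_set P"
proof -
  show m: "Max S \<in> S" using partitionsD(2,3)[OF P S] by simp
  show "j \<in> S \<Longrightarrow> j \<noteq> Max S \<Longrightarrow> j \<in> J_set P" using S by (auto simp: J_set_def)
  have "S \<subseteq> {1..Max S}" using partitionsD(1,2)[OF P S] by auto
  then show "Max S \<notin> J_set P" using J_set_iff[OF P] block_eq[OF P S m] by simp
qed

lemma I_set_ends:
  assumes P: "P \<in> partitions n"
  shows "I_set P 0 = {}" "I_set P n = {}"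
proof -
  show "I_set P 0 = {}" by (simp add: I_set_def)
  have "block P j \<subseteq> {1..n}" if "j \<in> {1..n}" for j
    using partitionsD(1)[OF P block_in(1)[OF P that]] .
  then show "I_set P n = {}" unfolding I_set_def by blast
qed

lemma finite_I_set: "finite (I_set P p)" by (simp add: I_set_def)

text \<open>
  Increments over completed blocks cancel, so that only the blocks still open at time
  \<open>p\<close> contribute; their members up to \<open>p\<close> form \<open>I_set P
  p\<close>.
\<close>

lemma loop_path:
  assumes P: "P \<in> partitions n" and p: "p \<le> n"
    and bal: "\<And>S. S \<in> P \<Longrightarrow> (\<Sum>j\<in>S. d j) = (0::int)"
  shows "(\<Sum>j=1..p. d j) = (\<Sum>j\<in>I_set P p. d j)"
proof -
  define Q where "Q = {S \<in> P. S \<subseteq> {1..p}}"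
  have dec: "{1..p} = I_set P p \<union> \<Union>Q" "I_set P p \<inter> \<Union>Q = {}"
  proof -
    have b: "block P j \<in> P" "j \<in> block P j" if "j \<in> {1..p}" for j
      using block_in[OF P, of j] that p by auto
    show "{1..p} = I_set P p \<union> \<Union>Q" unfolding I_set_def Q_def using b by blast
    show "I_set P p \<inter> \<Union>Q = {}" unfolding I_set_def Q_def using block_eq[OF P] by blast
  qed
  have finQ: "finite Q" using partitionsD(6)[OF P] by (simp add: Q_def)
  have finS: "\<forall>S\<in>Q. finite S" using partitionsD(2)[OF P] by (simp add: Q_def)
  have "(\<Sum>j=1..p. d j) = (\<Sum>j\<in>I_set P p. d j) + (\<Sum>j\<in>\<Union>Q. d j)"
    by (subst dec(1), rule sum.union_disjoint) (use finite_I_set finQ finS dec(2) in auto)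
  also have "(\<Sum>j\<in>\<Union>Q. d j) = (\<Sum>S\<in>Q. \<Sum>j\<in>S. d j)"
    by (rule sum.Union_disjoint[unfolded comp_def]) (use finS partitionsD(4)[OF P] in \<open>auto simp: Q_def\<close>)
  also have "\<dots> = 0" using bal by (simp add: Q_def)
  finally show ?thesis by simp
qed

text \<open>
  A loop based at \<open>v\<close> is determined by its increments at the elements of
  \<open>J_set P\<close>, because the increment at the maximum of a block is minus the sum of
  the other ones.
\<close>

lemma sum_loops:
  fixes \<psi> :: "nat \<Rightarrow> nat \<Rightarrow> complex"
  assumes P: "P \<in> partitions n" and n: "1 \<le> n" and v: "v \<in> {1..N}"
  shows "(\<Sum>s | s \<in> loops N n P \<and> s n = v. \<Prod>p\<in>{1..n-1}. \<psi> p (s p)) = loop_sum (J_set P) {1..n-1} (I_set P) N \<psi> v"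
proof -
  let ?J = "J_set P" and ?Q = "{1..n-1}"
  define pos where "pos = (\<lambda>(z::nat \<Rightarrow> int) p. int v + (\<Sum>j\<in>I_set P p. z j))"
  define Z where "Z = {z \<in> ?J \<rightarrow>\<^sub>E {- int N..int N}. \<forall>p\<in>?Q. 1 \<le> pos z p \<and> pos z p \<le> int N}"
  have sub: "I_set P p \<subseteq> ?J" if "p \<le> n" for p by (rule I_set_sub_J_set[OF P that])
  have posn: "pos z n = int v" "pos z 0 = int v" for z using I_set_ends[OF P] by (simp_all add: pos_def)
  have J1: "j \<in> {1..n}" "j \<in> ?Q" if "j \<in> ?J" for j
  proof -
    show "j \<in> {1..n}" using that J_set_iff[OF P] by blast
    then show "j \<in> ?Q" using I_set_ends(2)[OF P] I_set_step(1)[OF P _ that] by (cases "j = n") auto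
  qed
  have posr: "1 \<le> pos z p \<and> pos z p \<le> int N" if "z \<in> Z" "p \<le> n" for z p
  proof (cases "p \<in> ?Q")
    case False
    then have "p = 0 \<or> p = n" using that by auto
    then show ?thesis using posn v by auto
  qed (use that in \<open>simp add: Z_def\<close>)
  have dstep: "pos z j - pos z (j - 1) = (if j \<in> ?J then z j else - (\<Sum>i\<in>block P j - {j}. z i))"
    if j: "j \<in> {1..n}" for z j
  proof (cases "j \<in> ?J")
    case True
    then show ?thesis using I_set_step(1,4)[OF P j] finite_I_set by (simp add: pos_def)
  next
    case False
    have "finite (block P j - {j})" using partitionsD(2)[OF P block_in(1)[OF P j]] by simp
    then show ?thesis using False I_set_step(2,3)[OF P j False] finite_I_set
      by (simp add: pos_def sum.union_disjoint)
  qed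
  have "loop_sum ?J ?Q (I_set P) N \<psi> v = (\<Sum>z\<in>Z. \<Prod>p\<in>?Q. \<psi> p (nat (pos z p)))"
  proof -
    have "loop_sum ?J ?Q (I_set P) N \<psi> v = (\<Sum>z\<in>?J \<rightarrow>\<^sub>E {- int N..int N}. \<Prod>p\<in>?Q. grid_ext (\<psi> p) N (pos z p))"
      by (simp add: loop_sum_def pos_def)
    also have "\<dots> = (\<Sum>z\<in>Z. \<Prod>p\<in>?Q. grid_ext (\<psi> p) N (pos z p))"
    proof (rule sum.mono_neutral_right)
      show "finite (?J \<rightarrow>\<^sub>E {- int N..int N})" using finite_J_set[OF P] by (intro finite_PiE) auto
      show "\<forall>z\<in>(?J \<rightarrow>\<^sub>E {- int N..int N}) - Z. (\<Prod>p\<in>?Q. grid_ext (\<psi> p) N (pos z p)) = 0"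
      proof
        fix z assume "z \<in> (?J \<rightarrow>\<^sub>E {- int N..int N}) - Z"
        then obtain p where "p \<in> ?Q" "\<not> (1 \<le> pos z p \<and> pos z p \<le> int N)" by (auto simp: Z_def)
        then show "(\<Prod>p\<in>?Q. grid_ext (\<psi> p) N (pos z p)) = 0"
          by (intro prod_zero) (auto simp: grid_ext_def)
      qed
    qed (auto simp: Z_def)
    also have "\<dots> = (\<Sum>z\<in>Z. \<Prod>p\<in>?Q. \<psi> p (nat (pos z p)))"
      by (intro sum.cong prod.cong HOL.refl) (simp add: Z_def grid_ext_def)
    finally show ?thesis .
  qed
  also have "\<dots> = (\<Sum>s | s \<in> loops N n P \<and> s n = v. \<Prod>p\<in>?Q. \<psi> p (s p))"
  proof (rule sum.reindex_bij_witness[where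
        j = "\<lambda>z. restrict (\<lambda>p. nat (pos z p)) {1..n}" and
        i = "\<lambda>s. restrict (\<lambda>j. int (s j) - int (s (pred_cyc n j))) ?J"])
    fix z assume z: "z \<in> Z"
    let ?s = "restrict (\<lambda>p. nat (pos z p)) {1..n}"
    have posI: "int (?s p) = pos z p" if "p \<in> {1..n}" for p using posr[OF z, of p] that by simp
    have isp: "int (?s (pred_cyc n j)) = pos z (j - 1)" if "j \<in> {1..n}" for j
      using posI[of "pred_cyc n j"] that posn n by (auto simp: pred_cyc_def)
    have d: "int (?s j) - int (?s (pred_cyc n j)) = (if j \<in> ?J then z j else - (\<Sum>i\<in>block P j - {j}. z i))"
      if "j \<in> {1..n}" for j
      unfolding posI[OF that] isp[OF that] by (rule dstep[OF that])
    show "restrict (\<lambda>j. int (?s j) - int (?s (pred_cyc n j))) ?J = z"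
    proof
      fix j
      have zE: "z \<in> ?J \<rightarrow>\<^sub>E {- int N..int N}" using z by (simp add: Z_def)
      show "restrict (\<lambda>j. int (?s j) - int (?s (pred_cyc n j))) ?J j = z j"
      proof (cases "j \<in> ?J")
        case True
        then show ?thesis using d[OF J1(1)[OF True]] by (simp only: restrict_apply if_True)
      next
        case False
        then show ?thesis using PiE_arb[OF zE False] by simp
      qed
    qed
    have "(\<Sum>j\<in>S. int (?s j) - int (?s (pred_cyc n j))) = 0" if S: "S \<in> P" for S
    proof -
      have Sn: "S \<subseteq> {1..n}" "finite S" using partitionsD(1,2)[OF P S] .
      note M = sum_J_block[OF P S]
      have "(\<Sum>j\<in>S. int (?s j) - int (?s (pred_cyc n j))) =
        (int (?s (Max S)) - int (?s (pred_cyc n (Max S)))) + (\<Sum>j\<in>S - {Max S}. int (?s j) - int (?s (pred_cyc n j)))"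
        by (rule sum.remove[OF Sn(2) M(1)])
      also have "int (?s (Max S)) - int (?s (pred_cyc n (Max S))) = - (\<Sum>i\<in>S - {Max S}. z i)"
        using d[of "Max S"] M(1,2) Sn(1) block_eq[OF P S M(1)] by (auto simp del: restrict_apply)
      also have "(\<Sum>j\<in>S - {Max S}. int (?s j) - int (?s (pred_cyc n j))) = (\<Sum>j\<in>S - {Max S}. z j)"
      proof (rule sum.cong[OF HOL.refl])
        fix j assume "j \<in> S - {Max S}"
        then have "j \<in> {1..n}" "j \<in> ?J" using M(3) Sn(1) by auto
        then show "int (?s j) - int (?s (pred_cyc n j)) = z j" using d[of j] by (simp del: restrict_apply)
      qed
      finally show ?thesis by simp
    qed
    moreover have "?s \<in> {1..n} \<rightarrow>\<^sub>E {1..N}"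
    proof (rule PiE_I)
      fix p assume p: "p \<in> {1..n}"
      then have "1 \<le> pos z p \<and> pos z p \<le> int N" using posr[OF z] by simp
      then show "?s p \<in> {1..N}" using p by auto
    qed (simp only: restrict_apply if_False)
    ultimately have "?s \<in> loops N n P" unfolding loops_def by blast
    moreover have "?s n = v" using n posn by simp
    ultimately show "?s \<in> {s. s \<in> loops N n P \<and> s n = v}" by blast
    show "(\<Prod>p\<in>?Q. \<psi> p (?s p)) = (\<Prod>p\<in>?Q. \<psi> p (nat (pos z p)))"
      by (rule prod.cong) auto
  next
    fix s assume "s \<in> {s. s \<in> loops N n P \<and> s n = v}"
    then have sE: "s \<in> {1..n} \<rightarrow>\<^sub>E {1..N}" and sn: "s n = v"
      and bal: "\<And>S. S \<in> P \<Longrightarrow> (\<Sum>j\<in>S. int (s j) - int (s (pred_cyc n j))) = 0"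
      unfolding loops_def by blast+
    define d where "d = (\<lambda>j. int (s j) - int (s (pred_cyc n j)))"
    let ?z = "restrict d ?J"
    have tele: "int v + (\<Sum>j=1..p. d j) = int (if p = 0 then v else s p)" if "p \<le> n" for p
      using that
    proof (induction p)
      case (Suc p)
      then show ?case using sn by (cases "p = 0") (auto simp: d_def pred_cyc_def)
    qed simp
    have pos: "pos ?z p = int (s p)" if "p \<in> {1..n}" for p
    proof -
      have "(\<Sum>j\<in>I_set P p. ?z j) = (\<Sum>j\<in>I_set P p. d j)"
        by (rule sum.cong) (use sub[of p] that in auto)
      also have "\<dots> = (\<Sum>j=1..p. d j)"
        by (rule loop_path[OF P, symmetric]) (use that bal in \<open>auto simp: d_def\<close>)
      finally show ?thesis using tele[of p] that by (simp add: pos_def del: restrict_apply)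
    qed
    have rng: "s p \<in> {1..N}" if "p \<in> {1..n}" for p using PiE_mem[OF sE that] .
    have pr: "pred_cyc n j \<in> {1..n}" if "j \<in> {1..n}" for j using that by (auto simp: pred_cyc_def)
    show "restrict (\<lambda>p. nat (pos (restrict (\<lambda>j. int (s j) - int (s (pred_cyc n j))) ?J) p)) {1..n} = s"
    proof
      fix p show "restrict (\<lambda>p. nat (pos (restrict (\<lambda>j. int (s j) - int (s (pred_cyc n j))) ?J) p)) {1..n} p = s p"
        using pos[of p] PiE_arb[OF sE, of p] unfolding d_def[symmetric] by (cases "p \<in> {1..n}") simp_all
    qed
    have "?z \<in> ?J \<rightarrow>\<^sub>E {- int N..int N}"
    proof (rule PiE_I)
      fix j assume "j \<in> ?J"
      then have "j \<in> {1..n}" using J1 by blast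
      then show "?z j \<in> {- int N..int N}"
        using rng[of j] rng[OF pr, of j] \<open>j \<in> ?J\<close> by (auto simp: d_def)
    qed simp
    moreover have "1 \<le> pos ?z p \<and> pos ?z p \<le> int N" if "p \<in> ?Q" for p
      using pos[of p] rng[of p] that by auto
    ultimately have "?z \<in> Z" by (simp add: Z_def)
    then show "restrict (\<lambda>j. int (s j) - int (s (pred_cyc n j))) ?J \<in> Z" unfolding d_def .
  qed
  finally show ?thesis by simp
qed

definition parity_of :: "idx \<Rightarrow> nat" where
  "parity_of i = (case i of Plain \<Rightarrow> 0 | Star \<Rightarrow> 1)"

text \<open>
  The summand of \<open>P\<close> in the moment formulas for \<open>X b\<^sub>1 X\<^sup>*
  \<dots>\<close> and \<open>X\<^sup>* b\<^sub>1 X \<dots>\<close>, with the coefficient in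
  front of the word equal to \<open>1\<close>.
\<close>

definition partition_term :: "idx \<Rightarrow> nat \<Rightarrow> nat set set \<Rightarrow> (nat \<Rightarrow> C01) \<Rightarrow> C01" where
  "partition_term i n P b = (case i of
     Plain \<Rightarrow> tau (Lambda_map P (map (\<lambda>k. b (2*k-1)) [1..<n]) * b (2*n-1)) *\<^sub>C
              Gamma_map P (1 # map (\<lambda>k. b (2*k)) [1..<n])
   | Star \<Rightarrow> tau (Gamma_map P (map (\<lambda>k. b (2*k-1)) [1..<n+1])) *\<^sub>C
              Lambda_map P (map (\<lambda>k. b (2*k)) [1..<n]))"

definition scaled_grid_sum :: "idx \<Rightarrow> nat \<Rightarrow> (nat \<times> nat) set \<Rightarrow> (nat \<Rightarrow> nat \<Rightarrow> nat \<Rightarrow> complex) \<Rightarrow> nat \<Rightarrow> nat \<Rightarrow> complex" where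
  "scaled_grid_sum i n r \<phi> N v =
     grid_sum (Suc N) (parity_of i) (2 * n) r (\<lambda>k. \<phi> k N) v / of_nat (Suc N) ^ n"

lemma parity_of_simps [simp]: "parity_of Plain = 0" "parity_of Star = 1" "parity_of i < 2"
  by (auto simp: parity_of_def split: idx.split)

lemma tau_scale: "tau (c *\<^sub>C f) = c * tau f"
proof -
  have "(LINT t:{0..1}|lborel. c * apply_C01 f t) = c * (LINT t:{0..1}|lborel. apply_C01 f t)"
    by (rule set_integral_mult_right)
  then show ?thesis by (simp add: tau_def)
qed

lemma tau_Gamma_map:
  assumes P: "P \<in> partitions n" and n: "1 \<le> n"
  shows "tau (Gamma_map P gs) = (\<Prod>S\<in>P. tau (\<Prod>j\<in>S. gs ! (j - 1)))"
proof -
  have "block P 1 \<in> P" using block_in[OF P, of 1] n by simp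
  then show ?thesis
    using prod.remove[OF partitionsD(6)[OF P], of "block P 1" "\<lambda>S. tau (\<Prod>j\<in>S. gs ! (j - 1))"]
    by (simp add: Gamma_map_def tau_scale)
qed

text \<open>
  Together with the number of blocks this accounts for the exponent \<open>n\<close> in the
  normalisation of grid sums.
\<close>

lemma card_J_set:
  assumes P: "P \<in> partitions n"
  shows "card P + card (J_set P) = n"
proof -
  have "card (J_set P) = (\<Sum>S\<in>P. card (S - {Max S}))"
    unfolding J_set_def
  proof (rule card_UN_disjoint)
    show "finite P" by (rule partitionsD(6)[OF P])
    show "\<forall>S\<in>P. finite (S - {Max S})" using partitionsD(2)[OF P] by simp
    show "\<forall>S\<in>P. \<forall>T\<in>P. S \<noteq> T \<longrightarrow> (S - {Max S}) \<inter> (T - {Max T}) = {}"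
    proof (intro ballI impI)
      fix S T assume ST: "S \<in> P" "T \<in> P" "S \<noteq> T"
      have "S \<inter> T = {}" using partitionsD(4)[OF P ST(1,2)] ST(3) by blast
      then show "(S - {Max S}) \<inter> (T - {Max T}) = {}" by blast
    qed
  qed
  moreover have "card (S - {Max S}) + 1 = card S" if S: "S \<in> P" for S
    using sum_J_block(1)[OF P S] partitionsD(2)[OF P S]
    by (metis Suc_eq_plus1 card_Suc_Diff1)
  then have "(\<Sum>S\<in>P. card (S - {Max S})) + card P = (\<Sum>S\<in>P. card S)"
    by (simp add: sum.distrib[symmetric] sum_Suc[symmetric])
  moreover have "(\<Sum>S\<in>P. card S) = n"
    using sum_partition[OF P, of "\<lambda>_. 1::nat"] by simp
  ultimately show ?thesis by simp
qed

lemma grid_limit_cong: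
  assumes "grid_limit \<phi> f" "\<And>N v. v \<in> {1..Suc N} \<Longrightarrow> \<psi> N v = \<phi> N v"
  shows "grid_limit \<psi> f"
proof -
  obtain B where "0 \<le> B" and B: "\<And>N v. v \<in> {1..Suc N} \<Longrightarrow> norm (\<phi> N v) \<le> B"
    using grid_limit_bound[OF assms(1)] by blast
  show ?thesis
  proof (rule grid_limitI)
    show "norm (\<psi> N v) \<le> B" if "v \<in> {1..Suc N}" for N v using B[OF that] assms(2)[OF that] by simp
    fix v t assume v: "\<And>N. v N \<in> {1..Suc N}" "(\<lambda>N. real (v N) / real (Suc N)) \<longlonglongrightarrow> t"
    have eq: "\<psi> N (v N) = \<phi> N (v N)" for N by (rule assms(2), rule v(1))
    show "(\<lambda>N. \<psi> N (v N)) \<longlonglongrightarrow> apply_C01 f t"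
      unfolding eq by (rule grid_limit_lim[OF assms(1) v])
  qed
qed

lemma tendsto_block_average:
  assumes P: "P \<in> partitions n" and Q: "Q \<subseteq> P"
    and \<phi>: "\<And>S j. S \<in> Q \<Longrightarrow> j \<in> S \<Longrightarrow> grid_limit (\<phi> j) (c j)"
  shows "(\<lambda>N. (\<Prod>S\<in>Q. \<Sum>w=1..Suc N. \<Prod>j\<in>S. \<phi> j N w) / of_nat (Suc N) ^ card Q)
     \<longlonglongrightarrow> (\<Prod>S\<in>Q. tau (\<Prod>j\<in>S. c j))"
proof -
  have "(\<lambda>N. \<Prod>S\<in>Q. (\<Sum>w=1..Suc N. \<Prod>j\<in>S. \<phi> j N w) / of_nat (Suc N)) \<longlonglongrightarrow> (\<Prod>S\<in>Q. tau (\<Prod>j\<in>S. c j))"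
  proof (rule tendsto_prod)
    fix S assume S: "S \<in> Q"
    show "(\<lambda>N. (\<Sum>w=1..Suc N. \<Prod>j\<in>S. \<phi> j N w) / of_nat (Suc N)) \<longlonglongrightarrow> tau (\<Prod>j\<in>S. c j)"
      by (rule grid_limit_tau[OF grid_limit_prod]) (use partitionsD(2)[OF P] Q S \<phi> in auto)
  qed
  then show ?thesis by (simp only: prod_dividef prod_constant)
qed

lemma grid_sum_Star:
  assumes P: "P \<in> partitions n" and n: "1 \<le> n" and v: "v \<in> {1..N}"
  shows "grid_sum N 1 (2 * n) (slot_rel_of 1 P) \<phi> v =
    (\<Prod>S\<in>P. \<Sum>w=1..N. \<Prod>j\<in>S. \<phi> (2 * j - 1) w) *
    loop_sum (J_set P) {1..n-1} (I_set P) N (\<lambda>p. \<phi> (2 * p)) v"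
proof -
  define \<phi>' where "\<phi>' = \<phi>(0 := (\<lambda>w. if w = v then 1 else 0))"
  have \<phi>': "\<phi>' k = \<phi> k" if "0 < k" for k using that by (simp add: \<phi>'_def)
  have "grid_sum N 1 (2 * n) (slot_rel_of 1 P) \<phi> v = full_sum N 1 (2 * n) (slot_rel_of 1 P) \<phi>'"
    using full_sum_point[of "2 * n" \<phi>' \<phi> v 1 N 1 "slot_rel_of 1 P"] n \<phi>' by (simp add: \<phi>'_def)
  also have "\<dots> = (\<Sum>c\<in>colourings N n P. \<Prod>j=1..n. \<phi>' (2 * j - 2 + 1) (c j)) *
    (\<Sum>s\<in>loops N n P. \<Prod>j=1..n. \<phi>' ((2 * j - 1 + 1) mod (2 * n)) (s j))"
    by (rule full_sum_factor[OF P _ n]) simp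
  also have "(\<Sum>c\<in>colourings N n P. \<Prod>j=1..n. \<phi>' (2 * j - 2 + 1) (c j)) =
      (\<Prod>S\<in>P. \<Sum>w=1..N. \<Prod>j\<in>S. \<phi>' (2 * j - 2 + 1) w)"
    using sum_colourings[OF P, where N = N and \<psi> = "\<lambda>j. \<phi>' (2 * j - 2 + 1)"] .
  also have "\<dots> = (\<Prod>S\<in>P. \<Sum>w=1..N. \<Prod>j\<in>S. \<phi> (2 * j - 1) w)"
  proof (intro prod.cong sum.cong HOL.refl)
    fix S j w assume "S \<in> P" "j \<in> S"
    then have "1 \<le> j" using partitionsD(1)[OF P, of S] by auto
    then have "2 * j - 2 + 1 = 2 * j - 1" by simp
    then show "\<phi>' (2 * j - 2 + 1) w = \<phi> (2 * j - 1) w" using \<open>1 \<le> j\<close> by (simp add: \<phi>')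
  qed
  also have "(\<Sum>s\<in>loops N n P. \<Prod>j=1..n. \<phi>' ((2 * j - 1 + 1) mod (2 * n)) (s j)) =
     (\<Sum>s\<in>loops N n P. if s n = v then \<Prod>p\<in>{1..n-1}. \<phi> (2 * p) (s p) else 0)"
  proof (rule sum.cong[OF HOL.refl])
    fix s
    have "{1..n} = insert n {1..n-1}" using n by auto
    then have "(\<Prod>j=1..n. \<phi>' ((2 * j - 1 + 1) mod (2 * n)) (s j)) =
       \<phi>' ((2 * n - 1 + 1) mod (2 * n)) (s n) * (\<Prod>j\<in>{1..n-1}. \<phi>' ((2 * j - 1 + 1) mod (2 * n)) (s j))"
      using n by simp
    also have "(\<Prod>j\<in>{1..n-1}. \<phi>' ((2 * j - 1 + 1) mod (2 * n)) (s j)) = (\<Prod>j\<in>{1..n-1}. \<phi> (2 * j) (s j))"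
    proof (rule prod.cong[OF HOL.refl])
      fix j assume "j \<in> {1..n-1}"
      then have "(2 * j - 1 + 1) mod (2 * n) = 2 * j" "0 < 2 * j" by auto
      then show "\<phi>' ((2 * j - 1 + 1) mod (2 * n)) (s j) = \<phi> (2 * j) (s j)" by (simp only: \<phi>')
    qed
    also have "(2 * n - 1 + 1) mod (2 * n) = 0" using n by simp
    finally show "(\<Prod>j=1..n. \<phi>' ((2 * j - 1 + 1) mod (2 * n)) (s j)) =
      (if s n = v then \<Prod>p\<in>{1..n-1}. \<phi> (2 * p) (s p) else 0)" by (simp add: \<phi>'_def)
  qed
  also have "\<dots> = (\<Sum>s | s \<in> loops N n P \<and> s n = v. \<Prod>p\<in>{1..n-1}. \<phi> (2 * p) (s p))"
  proof -
    have "finite (loops N n P)"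
      by (rule finite_subset[of _ "{1..n} \<rightarrow>\<^sub>E {1..N}"]) (auto simp: loops_def intro: finite_PiE)
    then show ?thesis by (rule sum.inter_filter[symmetric])
  qed
  also have "\<dots> = loop_sum (J_set P) {1..n-1} (I_set P) N (\<lambda>p. \<phi> (2 * p)) v"
    by (rule sum_loops[OF P n v])
  finally show ?thesis .
qed

lemma grid_sum_Plain:
  assumes P: "P \<in> partitions n" and n: "1 \<le> n" and v: "v \<in> {1..N}"
  shows "grid_sum N 0 (2 * n) (slot_rel_of 0 P) \<phi> v =
    (\<Prod>S\<in>P - {block P 1}. \<Sum>w=1..N. \<Prod>j\<in>S. \<phi> (2 * j - 2) w) *
    (\<Prod>j\<in>block P 1 - {1}. \<phi> (2 * j - 2) v) *
    (\<Sum>w=1..N. \<phi> (2 * n - 1) w * loop_sum (J_set P) {1..n-1} (I_set P) N (\<lambda>p. \<phi> (2 * p - 1)) w)"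
proof -
  define \<phi>' where "\<phi>' = \<phi>(0 := (\<lambda>w. if w = v then 1 else 0))"
  have \<phi>': "\<phi>' k = \<phi> k" if "0 < k" for k using that by (simp add: \<phi>'_def)
  have b1: "block P 1 \<in> P" "1 \<in> block P 1" using block_in[OF P, of 1] n by simp_all
  have "grid_sum N 0 (2 * n) (slot_rel_of 0 P) \<phi> v = full_sum N 0 (2 * n) (slot_rel_of 0 P) \<phi>'"
    using full_sum_point[of "2 * n" \<phi>' \<phi> v 1 N 0 "slot_rel_of 0 P"] n \<phi>' by (simp add: \<phi>'_def)
  also have "\<dots> = (\<Sum>c\<in>colourings N n P. \<Prod>j=1..n. \<phi>' (2 * j - 2 + 0) (c j)) *
    (\<Sum>s\<in>loops N n P. \<Prod>j=1..n. \<phi>' ((2 * j - 1 + 0) mod (2 * n)) (s j))"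
    by (rule full_sum_factor[OF P _ n]) simp
  also have "(\<Sum>c\<in>colourings N n P. \<Prod>j=1..n. \<phi>' (2 * j - 2 + 0) (c j)) =
      (\<Prod>S\<in>P. \<Sum>w=1..N. \<Prod>j\<in>S. \<phi>' (2 * j - 2) w)"
    using sum_colourings[OF P, where N = N and \<psi> = "\<lambda>j. \<phi>' (2 * j - 2)"] by simp
  also have "\<dots> = (\<Sum>w=1..N. \<Prod>j\<in>block P 1. \<phi>' (2 * j - 2) w) *
      (\<Prod>S\<in>P - {block P 1}. \<Sum>w=1..N. \<Prod>j\<in>S. \<phi>' (2 * j - 2) w)"
    by (rule prod.remove[OF partitionsD(6)[OF P] b1(1)])
  also have "(\<Prod>S\<in>P - {block P 1}. \<Sum>w=1..N. \<Prod>j\<in>S. \<phi>' (2 * j - 2) w) =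
     (\<Prod>S\<in>P - {block P 1}. \<Sum>w=1..N. \<Prod>j\<in>S. \<phi> (2 * j - 2) w)"
  proof (intro prod.cong sum.cong HOL.refl)
    fix S j w assume S: "S \<in> P - {block P 1}" "j \<in> S"
    then have "1 \<le> j" using partitionsD(1)[OF P, of S] by auto
    moreover have "j \<noteq> 1" using S block_eq[OF P, of S 1] by auto
    ultimately have "0 < 2 * j - 2" by simp
    then show "\<phi>' (2 * j - 2) w = \<phi> (2 * j - 2) w" by (simp only: \<phi>')
  qed
  also have "(\<Sum>w=1..N. \<Prod>j\<in>block P 1. \<phi>' (2 * j - 2) w) = (\<Prod>j\<in>block P 1 - {1}. \<phi> (2 * j - 2) v)"
  proof -
    have "(\<Prod>j\<in>block P 1. \<phi>' (2 * j - 2) w) = (if w = v then \<Prod>j\<in>block P 1 - {1}. \<phi> (2 * j - 2) v else 0)" for w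
    proof -
      have "(\<Prod>j\<in>block P 1. \<phi>' (2 * j - 2) w) = \<phi>' (2 * 1 - 2) w * (\<Prod>j\<in>block P 1 - {1}. \<phi>' (2 * j - 2) w)"
        by (rule prod.remove[OF partitionsD(2)[OF P b1(1)] b1(2)])
      also have "(\<Prod>j\<in>block P 1 - {1}. \<phi>' (2 * j - 2) w) = (\<Prod>j\<in>block P 1 - {1}. \<phi> (2 * j - 2) w)"
      proof (rule prod.cong[OF HOL.refl])
        fix j assume "j \<in> block P 1 - {1}"
        then have "0 < 2 * j - 2" using partitionsD(1)[OF P b1(1)] by fastforce
        then show "\<phi>' (2 * j - 2) w = \<phi> (2 * j - 2) w" by (simp only: \<phi>')
      qed
      finally show ?thesis by (simp add: \<phi>'_def)
    qed
    then show ?thesis using v by simp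
  qed
  also have "(\<Sum>s\<in>loops N n P. \<Prod>j=1..n. \<phi>' ((2 * j - 1 + 0) mod (2 * n)) (s j)) =
     (\<Sum>s\<in>loops N n P. \<phi> (2 * n - 1) (s n) * (\<Prod>p\<in>{1..n-1}. \<phi> (2 * p - 1) (s p)))"
  proof (rule sum.cong[OF HOL.refl])
    fix s
    have "{1..n} = insert n {1..n-1}" using n by auto
    then have "(\<Prod>j=1..n. \<phi> (2 * j - 1) (s j)) = \<phi> (2 * n - 1) (s n) * (\<Prod>p\<in>{1..n-1}. \<phi> (2 * p - 1) (s p))"
      using n by simp
    moreover have "(\<Prod>j=1..n. \<phi>' ((2 * j - 1 + 0) mod (2 * n)) (s j)) = (\<Prod>j=1..n. \<phi> (2 * j - 1) (s j))"
    proof (rule prod.cong[OF HOL.refl])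
      fix j assume "j \<in> {1..n}"
      then have "(2 * j - 1 + 0) mod (2 * n) = 2 * j - 1" "0 < 2 * j - 1" by auto
      then show "\<phi>' ((2 * j - 1 + 0) mod (2 * n)) (s j) = \<phi> (2 * j - 1) (s j)" by (simp only: \<phi>')
    qed
    ultimately show "(\<Prod>j=1..n. \<phi>' ((2 * j - 1 + 0) mod (2 * n)) (s j)) =
      \<phi> (2 * n - 1) (s n) * (\<Prod>p\<in>{1..n-1}. \<phi> (2 * p - 1) (s p))" by simp
  qed
  also have "\<dots> = (\<Sum>w=1..N. \<Sum>s | s \<in> loops N n P \<and> s n = w. \<phi> (2 * n - 1) (s n) * (\<Prod>p\<in>{1..n-1}. \<phi> (2 * p - 1) (s p)))"
  proof -
    have fin: "finite (loops N n P)"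
      by (rule finite_subset[of _ "{1..n} \<rightarrow>\<^sub>E {1..N}"]) (auto simp: loops_def intro: finite_PiE)
    have img: "(\<lambda>s. s n) ` loops N n P \<subseteq> {1..N}" using n by (auto simp: loops_def PiE_iff)
    show ?thesis by (rule sum.group[symmetric, OF fin _ img]) simp
  qed
  also have "\<dots> = (\<Sum>w=1..N. \<phi> (2 * n - 1) w * loop_sum (J_set P) {1..n-1} (I_set P) N (\<lambda>p. \<phi> (2 * p - 1)) w)"
  proof (rule sum.cong[OF HOL.refl])
    fix w assume w: "w \<in> {1..N}"
    show "(\<Sum>s | s \<in> loops N n P \<and> s n = w. \<phi> (2 * n - 1) (s n) * (\<Prod>p\<in>{1..n-1}. \<phi> (2 * p - 1) (s p))) =
      \<phi> (2 * n - 1) w * loop_sum (J_set P) {1..n-1} (I_set P) N (\<lambda>p. \<phi> (2 * p - 1)) w"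
      unfolding sum_loops[OF P n w, symmetric] sum_distrib_left by (rule sum.cong) auto
  qed
  finally show ?thesis by (simp only: mult_ac)
qed

text \<open>
  Fixing the value at the point \<open>0\<close> fixes the colour of the first block if this
  point is a slot, and the base point of the loop otherwise; the other blocks, or all of them,
  turn into factors \<open>\<tau>\<close>.
\<close>

lemma grid_limit_partition_term:
  assumes P: "P \<in> partitions n" and n: "1 \<le> n"
    and \<phi>: "\<And>k. 1 \<le> k \<Longrightarrow> k < 2 * n \<Longrightarrow> grid_limit (\<phi> k) (b k)"
  shows "grid_limit (scaled_grid_sum i n (slot_rel_of (parity_of i) P) \<phi>) (partition_term i n P b)"
proof -
  have cJ: "card P + card (J_set P) = n" by (rule card_J_set[OF P])
  have nth: "map f [1..<k] ! (p - 1) = f p" if "p \<in> {1..k-1}" for f :: "nat \<Rightarrow> C01" and k p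
    using that by (subst nth_map) (auto simp: nth_upt)
  have b1: "block P 1 \<in> P" "1 \<in> block P 1" using block_in[OF P, of 1] n by simp_all
  have Sn: "1 \<le> j" "j \<le> n" if "S \<in> P" "j \<in> S" for S j using partitionsD(1)[OF P that(1)] that(2) by auto
  show ?thesis
  proof (cases i)
    case Star
    define L where "L = (\<lambda>N v. loop_sum (J_set P) {1..n-1} (I_set P) (Suc N) (\<lambda>p. \<phi> (2 * p) N) v / of_nat (Suc N) ^ card (J_set P))"
    define c where "c = (\<lambda>N. (\<Prod>S\<in>P. \<Sum>w=1..Suc N. \<Prod>j\<in>S. \<phi> (2 * j - 1) N w) / of_nat (Suc N) ^ card P)"
    have L: "grid_limit L (Lambda_map P (map (\<lambda>k. b (2*k)) [1..<n]))"
      unfolding L_def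
    proof (rule grid_limit_Lambda[OF P _ n, of _ "\<lambda>p. \<phi> (2 * p)"])
      fix p assume p: "p \<in> {1..n-1}"
      show "grid_limit (\<phi> (2 * p)) (map (\<lambda>k. b (2*k)) [1..<n] ! (p - 1))"
        unfolding nth[OF p] by (rule \<phi>) (use p in auto)
    qed simp
    have c: "c \<longlonglongrightarrow> tau (Gamma_map P (map (\<lambda>k. b (2*k-1)) [1..<n+1]))"
    proof -
      have "c \<longlonglongrightarrow> (\<Prod>S\<in>P. tau (\<Prod>j\<in>S. b (2 * j - 1)))"
        unfolding c_def
        by (rule tendsto_block_average[OF P subset_refl, of "\<lambda>j. \<phi> (2 * j - 1)"], rule \<phi>) (use Sn in fastforce)+
      moreover have "(\<Prod>j\<in>S. map (\<lambda>k. b (2*k-1)) [1..<n+1] ! (j - 1)) = (\<Prod>j\<in>S. b (2 * j - 1))" if "S \<in> P" for S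
        by (rule prod.cong[OF HOL.refl], rule nth) (use Sn[OF that] in auto)
      ultimately show ?thesis unfolding tau_Gamma_map[OF P n] by simp
    qed
    have "grid_limit (\<lambda>N v. c N * L N v) (partition_term i n P b)"
      using grid_limit_scalar[OF c L] by (simp add: partition_term_def Star)
    then show ?thesis
    proof (rule grid_limit_cong)
      fix N v assume v: "v \<in> {1..Suc N}"
      have pw: "of_nat (Suc N) ^ n = (of_nat (Suc N) ^ card P * of_nat (Suc N) ^ card (J_set P) :: complex)"
        unfolding power_add[symmetric] cJ ..
      show "scaled_grid_sum i n (slot_rel_of (parity_of i) P) \<phi> N v = c N * L N v"
        unfolding scaled_grid_sum_def Star parity_of_simps grid_sum_Star[OF P n v] c_def L_def pw
        by (simp only: times_divide_times_eq)
    qed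
  next
    case Plain
    let ?Q = "P - {block P 1}"
    define L where "L = (\<lambda>N v. loop_sum (J_set P) {1..n-1} (I_set P) (Suc N) (\<lambda>p. \<phi> (2 * p - 1) N) v / of_nat (Suc N) ^ card (J_set P))"
    define c where "c = (\<lambda>N. (\<Prod>S\<in>?Q. \<Sum>w=1..Suc N. \<Prod>j\<in>S. \<phi> (2 * j - 2) N w) / of_nat (Suc N) ^ card ?Q)"
    define d where "d = (\<lambda>N. (\<Sum>w=1..Suc N. L N w * \<phi> (2 * n - 1) N w) / of_nat (Suc N))"
    define g where "g = (\<lambda>N v. \<Prod>j\<in>block P 1 - {1}. \<phi> (2 * j - 2) N v)"
    have L: "grid_limit L (Lambda_map P (map (\<lambda>k. b (2*k-1)) [1..<n]))"
      unfolding L_def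
    proof (rule grid_limit_Lambda[OF P _ n, of _ "\<lambda>p. \<phi> (2 * p - 1)"])
      fix p assume p: "p \<in> {1..n-1}"
      show "grid_limit (\<phi> (2 * p - 1)) (map (\<lambda>k. b (2*k-1)) [1..<n] ! (p - 1))"
        unfolding nth[OF p] by (rule \<phi>) (use p in auto)
    qed simp
    have d: "d \<longlonglongrightarrow> tau (Lambda_map P (map (\<lambda>k. b (2*k-1)) [1..<n]) * b (2*n-1))"
      unfolding d_def by (rule grid_limit_tau[OF grid_limit_mult[OF L \<phi>]]) (use n in auto)
    have n1: "1 \<notin> S" if "S \<in> ?Q" for S using that block_eq[OF P, of S 1] by auto
    have gs: "(1 # map (\<lambda>k. b (2*k)) [1..<n]) ! (j - 1) = b (2 * j - 2)" if j: "j \<in> {1..n}" "j \<noteq> 1" for j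
    proof -
      have "j - 1 \<in> {1..n-1}" using j by auto
      from nth[OF this, of "\<lambda>k. b (2*k)"] have "map (\<lambda>k. b (2*k)) [1..<n] ! (j - 1 - 1) = b (2 * j - 2)"
        by (simp add: diff_mult_distrib2)
      then show ?thesis using j by (simp add: nth_Cons')
    qed
    have c: "c \<longlonglongrightarrow> (\<Prod>S\<in>?Q. tau (\<Prod>j\<in>S. (1 # map (\<lambda>k. b (2*k)) [1..<n]) ! (j - 1)))"
    proof -
      have gl: "grid_limit (\<phi> (2 * j - 2)) (b (2 * j - 2))" if "S \<in> ?Q" "j \<in> S" for S j
      proof (rule \<phi>)
        have "1 \<le> j" "j \<le> n" "j \<noteq> 1" using Sn[of S j] n1[of S] that by auto
        then show "1 \<le> 2 * j - 2" "2 * j - 2 < 2 * n" by auto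
      qed
      have "c \<longlonglongrightarrow> (\<Prod>S\<in>?Q. tau (\<Prod>j\<in>S. b (2 * j - 2)))"
        unfolding c_def by (rule tendsto_block_average[OF P, of _ "\<lambda>j. \<phi> (2 * j - 2)"]) (use gl in auto)
      moreover have "(\<Prod>j\<in>S. (1 # map (\<lambda>k. b (2*k)) [1..<n]) ! (j - 1)) = (\<Prod>j\<in>S. b (2 * j - 2))" if "S \<in> ?Q" for S
      proof (rule prod.cong[OF HOL.refl], rule gs)
        fix j assume "j \<in> S"
        then show "j \<in> {1..n}" "j \<noteq> 1" using Sn[of S j] n1[OF that] that by auto
      qed
      ultimately show ?thesis by simp
    qed
    have g: "grid_limit g (\<Prod>j\<in>block P 1. (1 # map (\<lambda>k. b (2*k)) [1..<n]) ! (j - 1))"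
    proof -
      have "grid_limit g (\<Prod>j\<in>block P 1 - {1}. b (2 * j - 2))"
        unfolding g_def
      proof (rule grid_limit_prod)
        show "finite (block P 1 - {1})" using partitionsD(2)[OF P b1(1)] by simp
        fix j assume "j \<in> block P 1 - {1}"
        then have "1 \<le> j" "j \<le> n" "j \<noteq> 1" using Sn[OF b1(1)] by auto
        then show "grid_limit (\<phi> (2 * j - 2)) (b (2 * j - 2))" by (intro \<phi>) auto
      qed
      moreover have "(\<Prod>j\<in>block P 1. (1 # map (\<lambda>k. b (2*k)) [1..<n]) ! (j - 1)) = (\<Prod>j\<in>block P 1 - {1}. b (2 * j - 2))"
      proof -
        have "(\<Prod>j\<in>block P 1. (1 # map (\<lambda>k. b (2*k)) [1..<n]) ! (j - 1)) =
          (1 # map (\<lambda>k. b (2*k)) [1..<n]) ! (1 - 1) * (\<Prod>j\<in>block P 1 - {1}. (1 # map (\<lambda>k. b (2*k)) [1..<n]) ! (j - 1))"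
          by (rule prod.remove[OF partitionsD(2)[OF P b1(1)] b1(2)])
        also have "(\<Prod>j\<in>block P 1 - {1}. (1 # map (\<lambda>k. b (2*k)) [1..<n]) ! (j - 1)) = (\<Prod>j\<in>block P 1 - {1}. b (2 * j - 2))"
          by (rule prod.cong[OF HOL.refl], rule gs) (use Sn[OF b1(1)] in auto)
        finally show ?thesis by simp
      qed
      ultimately show ?thesis by simp
    qed
    have "grid_limit (\<lambda>N v. d N * (c N * g N v)) (partition_term i n P b)"
      using grid_limit_scalar[OF d grid_limit_scalar[OF c g]] by (simp add: partition_term_def Plain Gamma_map_def)
    then show ?thesis
    proof (rule grid_limit_cong)
      fix N v assume v: "v \<in> {1..Suc N}"
      have "card ?Q + 1 = card P" using b1(1) partitionsD(6)[OF P] by (metis Suc_eq_plus1 card_Suc_Diff1)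
      then have "n = card ?Q + 1 + card (J_set P)" using cJ by simp
      then have pw: "of_nat (Suc N) ^ n = (of_nat (Suc N) ^ card ?Q * of_nat (Suc N) * of_nat (Suc N) ^ card (J_set P) :: complex)"
        by (metis power_add power_one_right)
      have "(\<Sum>w=1..Suc N. \<phi> (2 * n - 1) N w * loop_sum (J_set P) {1..n-1} (I_set P) (Suc N) (\<lambda>p. \<phi> (2 * p - 1) N) w) / of_nat (Suc N) ^ card (J_set P)
        = (\<Sum>w=1..Suc N. L N w * \<phi> (2 * n - 1) N w)"
        unfolding L_def sum_divide_distrib by (rule sum.cong) (auto simp: mult_ac)
      then show "scaled_grid_sum i n (slot_rel_of (parity_of i) P) \<phi> N v = d N * (c N * g N v)"
        unfolding scaled_grid_sum_def Plain parity_of_simps grid_sum_Plain[OF P n v] c_def d_def g_def pw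
        by (simp add: field_simps del: of_nat_Suc)
    qed
  qed
qed

section \<open>Factorisation at a closed arc\<close>

definition rel_term :: "idx \<Rightarrow> nat \<Rightarrow> (nat \<times> nat) set \<Rightarrow> (nat \<Rightarrow> C01) \<Rightarrow> C01" where
  "rel_term i n r b = partition_term i n (inv_into (partitions n) (slot_rel_of (parity_of i)) r) b"

lemma rel_term_slot_rel_of:
  assumes "P \<in> partitions n"
  shows "rel_term i n (slot_rel_of (parity_of i) P) b = partition_term i n P b"
  using inv_into_f_f[OF bij_betw_imp_inj_on[OF bij_slot_rel_of[of "parity_of i" n]] assms]
  by (simp add: rel_term_def)

lemma grid_limit_rel_term:
  assumes r: "slot_rel (parity_of i) (2 * n) r" and n: "1 \<le> n"
    and \<phi>: "\<And>k. 1 \<le> k \<Longrightarrow> k < 2 * n \<Longrightarrow> grid_limit (\<phi> k) (b k)"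
  shows "grid_limit (scaled_grid_sum i n r \<phi>) (rel_term i n r b)"
proof -
  have "r \<in> slot_rel_of (parity_of i) ` partitions n"
    using bij_betw_imp_surj_on[OF bij_slot_rel_of[of "parity_of i" n]] r by simp
  then obtain P where P: "P \<in> partitions n" "r = slot_rel_of (parity_of i) P" by blast
  show ?thesis unfolding P(2) rel_term_slot_rel_of[OF P(1)]
    by (rule grid_limit_partition_term[OF P(1) n \<phi>])
qed

lemma grid_sum_cong:
  assumes "\<And>k w. 1 \<le> k \<Longrightarrow> k < m \<Longrightarrow> w \<in> {1..N} \<Longrightarrow> \<phi> k w = \<psi> k w"
  shows "grid_sum N e m r \<phi> v = grid_sum N e m r \<psi> v"
  unfolding grid_sum_def
proof (intro sum.cong prod.cong HOL.refl)
  fix y k assume "y \<in> {y. y \<in> {..<m} \<rightarrow>\<^sub>E {1..N} \<and> solves e m r y \<and> y 0 = v}" "k \<in> {1..<m}"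
  then have "y k \<in> {1..N}" "1 \<le> k" "k < m" by (auto simp: PiE_iff)
  then show "\<phi> k (y k) = \<psi> k (y k)" using assms by blast
qed

lemma grid_sum_linear:
  assumes A: "finite A" and p: "1 \<le> p" "p < m" and eq: "\<And>w. w \<in> {1..N} \<Longrightarrow> \<phi> p w = (\<Sum>a\<in>A. c a * \<psi> a w)"
  shows "grid_sum N e m r \<phi> v = (\<Sum>a\<in>A. c a * grid_sum N e m r (\<phi>(p := \<psi> a)) v)"
proof -
  define Y where "Y = {y. y \<in> {..<m} \<rightarrow>\<^sub>E {1..N} \<and> solves e m r y \<and> y 0 = v}"
  have split: "(\<Prod>k=1..<m. h k (y k)) = h p (y p) * (\<Prod>k\<in>{1..<m} - {p}. h k (y k))" for h :: "nat \<Rightarrow> nat \<Rightarrow> complex" and y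
    by (rule prod.remove) (use p in auto)
  have rest: "(\<Prod>k\<in>{1..<m} - {p}. (\<phi>(p := \<psi> a)) k (y k)) = (\<Prod>k\<in>{1..<m} - {p}. \<phi> k (y k))" for a y
    by (rule prod.cong) auto
  have "grid_sum N e m r \<phi> v = (\<Sum>y\<in>Y. \<Sum>a\<in>A. c a * (\<psi> a (y p) * (\<Prod>k\<in>{1..<m} - {p}. \<phi> k (y k))))"
    unfolding grid_sum_def Y_def[symmetric]
  proof (rule sum.cong[OF HOL.refl])
    fix y assume "y \<in> Y"
    then have "y p \<in> {1..N}" using p by (auto simp: Y_def PiE_iff)
    then show "(\<Prod>k=1..<m. \<phi> k (y k)) = (\<Sum>a\<in>A. c a * (\<psi> a (y p) * (\<Prod>k\<in>{1..<m} - {p}. \<phi> k (y k))))"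
      unfolding split[of \<phi>] eq[OF \<open>y p \<in> {1..N}\<close>] sum_distrib_right by (simp add: mult_ac)
  qed
  also have "\<dots> = (\<Sum>a\<in>A. \<Sum>y\<in>Y. c a * (\<psi> a (y p) * (\<Prod>k\<in>{1..<m} - {p}. \<phi> k (y k))))"
    by (rule sum.swap)
  also have "\<dots> = (\<Sum>a\<in>A. c a * grid_sum N e m r (\<phi>(p := \<psi> a)) v)"
    unfolding grid_sum_def Y_def[symmetric] sum_distrib_left split[of "\<phi>(p := \<psi> _)"] rest by simp
  finally show ?thesis .
qed

definition sampled :: "(nat \<Rightarrow> C01) \<Rightarrow> nat \<Rightarrow> nat \<Rightarrow> nat \<Rightarrow> complex" where
  "sampled b k N v = apply_C01 (b k) (real v / real (Suc N))"

lemma grid_limit_sampled: "grid_limit (sampled b k) (b k)"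
  unfolding sampled_def[abs_def] by (rule grid_limit_sample)

lemma apply_C01_sum: "apply_C01 (sum g A) t = (\<Sum>a\<in>A. apply_C01 (g a) t)"
  by (induction A rule: infinite_finite_induct) auto

text \<open>
  Additivity in each coefficient is inherited from the grid sums, where it is evident.
\<close>

lemma rel_term_sum:
  assumes r: "slot_rel (parity_of i) (2 * n) r" and n: "1 \<le> n" and A: "finite A" and k: "1 \<le> k" "k < 2 * n"
  shows "rel_term i n r (b(k := \<Sum>a\<in>A. g a)) = (\<Sum>a\<in>A. rel_term i n r (b(k := g a)))"
proof (rule grid_limit_unique)
  show "grid_limit (scaled_grid_sum i n r (sampled (b(k := \<Sum>a\<in>A. g a)))) (rel_term i n r (b(k := \<Sum>a\<in>A. g a)))"
    by (rule grid_limit_rel_term[OF r n grid_limit_sampled])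
  show "grid_limit (\<lambda>N v. \<Sum>a\<in>A. scaled_grid_sum i n r (sampled (b(k := g a))) N v) (\<Sum>a\<in>A. rel_term i n r (b(k := g a)))"
    by (intro grid_limit_sum A grid_limit_rel_term[OF r n grid_limit_sampled])
  fix N v
  let ?\<phi> = "\<lambda>b k. sampled b k N"
  have "grid_sum (Suc N) (parity_of i) (2 * n) r (?\<phi> (b(k := \<Sum>a\<in>A. g a))) v =
     (\<Sum>a\<in>A. 1 * grid_sum (Suc N) (parity_of i) (2 * n) r ((?\<phi> (b(k := \<Sum>a\<in>A. g a)))(k := \<lambda>w. apply_C01 (g a) (real w / real (Suc N)))) v)"
    by (rule grid_sum_linear[OF A k]) (simp add: sampled_def apply_C01_sum)
  also have "\<dots> = (\<Sum>a\<in>A. grid_sum (Suc N) (parity_of i) (2 * n) r (?\<phi> (b(k := g a))) v)"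
    unfolding mult_1 by (rule sum.cong[OF HOL.refl], rule grid_sum_cong) (auto simp: sampled_def)
  finally show "scaled_grid_sum i n r (sampled (b(k := \<Sum>a\<in>A. g a))) N v = (\<Sum>a\<in>A. scaled_grid_sum i n r (sampled (b(k := g a))) N v)"
    unfolding scaled_grid_sum_def by (simp only: sum_divide_distrib)
qed

definition shift_idx :: "idx \<Rightarrow> nat \<Rightarrow> idx" where
  "shift_idx i p = (if even p then i else flip i)"

lemma parity_of_shift: "parity_of (shift_idx i p) = (parity_of i + p) mod 2"
  by (cases i; cases "even p") (simp_all add: shift_idx_def parity_of_def, presburger+)

lemma power_split:
  assumes "k \<le> n"
  shows "(of_nat N ^ n :: complex) = of_nat N ^ (n - k) * of_nat N ^ k"
  using assms by (simp add: power_add[symmetric])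

text \<open>
  Here \<open>2 * k\<close> is the length of the arc. Three factorisation rules result from the
  exact splittings of grid sums, according to whether the arc begins at the point
  \<open>0\<close>, ends there, or avoids it; they have the shape of the three cases in the
  definition of nested cumulants.
\<close>

locale closed_arc =
  fixes i :: idx and n k p :: nat and r :: "(nat \<times> nat) set"
  assumes r: "slot_rel (parity_of i) (2 * n) r" and k: "0 < k" "k < n"
    and c: "closes (2 * n) r p (p + 2 * k)"
begin

sublocale slot_rel "parity_of i" "2 * n" r by (rule r)

lemma p_le: "p + 2 * k \<le> 2 * n" using closesD(2)[OF c] .

lemma inner_rel: "slot_rel (parity_of (shift_idx i p)) (2 * k) (inner r p (2 * k))"
  unfolding parity_of_shift by (rule slot_rel_inner[OF p_le]) simp

lemma outer_rel: "slot_rel (parity_of i) (2 * (n - k)) (outer r p (2 * k))"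
  using slot_rel_outer[OF p_le] by (simp add: diff_mult_distrib2)

lemma rel_term_left:
  assumes "p = 0"
  shows "rel_term i n r b = rel_term i k (inner r 0 (2 * k)) b * b (2 * k) *
    rel_term i (n - k) (outer r 0 (2 * k)) (\<lambda>j. b (j + 2 * k))"
proof (rule grid_limit_unique)
  have s: "shift_idx i 0 = i" by (simp add: shift_idx_def)
  have c0: "closes (2 * n) r 0 (2 * k)" using c assms by simp
  show "grid_limit (scaled_grid_sum i n r (sampled b)) (rel_term i n r b)"
    by (rule grid_limit_rel_term[OF r _ grid_limit_sampled]) (use k in simp)
  show "grid_limit (\<lambda>N v. scaled_grid_sum i k (inner r 0 (2 * k)) (sampled b) N v * sampled b (2 * k) N v *
      scaled_grid_sum i (n - k) (outer r 0 (2 * k)) (\<lambda>j. sampled b (j + 2 * k)) N v)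
    (rel_term i k (inner r 0 (2 * k)) b * b (2 * k) * rel_term i (n - k) (outer r 0 (2 * k)) (\<lambda>j. b (j + 2 * k)))"
    using inner_rel outer_rel k unfolding assms s
    by (intro grid_limit_mult grid_limit_sampled grid_limit_rel_term) auto
  fix N v
  have "grid_sum (Suc N) (parity_of i) (2 * n) r (\<lambda>j. sampled b j N) v =
    grid_sum (Suc N) (parity_of i) (2 * k) (inner r 0 (2 * k)) (\<lambda>j. sampled b j N) v * sampled b (2 * k) N v *
    grid_sum (Suc N) (parity_of i) (2 * (n - k)) (outer r 0 (2 * k)) (\<lambda>j. sampled b (j + 2 * k) N) v"
    using grid_sum_split_left[OF c0, of "Suc N" "\<lambda>j. sampled b j N" v] k by (simp add: diff_mult_distrib2)
  then show "scaled_grid_sum i n r (sampled b) N v =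
    scaled_grid_sum i k (inner r 0 (2 * k)) (sampled b) N v * sampled b (2 * k) N v *
      scaled_grid_sum i (n - k) (outer r 0 (2 * k)) (\<lambda>j. sampled b (j + 2 * k)) N v"
    unfolding scaled_grid_sum_def power_split[OF less_imp_le[OF k(2)], of "Suc N"] by (simp add: field_simps)
qed

lemma rel_term_right:
  assumes "p + 2 * k = 2 * n"
  shows "rel_term i n r b = rel_term i (n - k) (outer r p (2 * k)) b * b p *
    rel_term i k (inner r p (2 * k)) (\<lambda>l. b (p + l))"
proof (rule grid_limit_unique)
  have "p = 2 * (n - k)" using assms by simp
  then have s: "shift_idx i p = i" and p0: "0 < p" and pe: "(parity_of i + p) mod 2 = parity_of i"
    using k by (auto simp: shift_idx_def)
  have c0: "closes (2 * n) r p (2 * n)" using c assms by simp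
  have e: "2 * n - p = 2 * k" using assms by simp
  show "grid_limit (scaled_grid_sum i n r (sampled b)) (rel_term i n r b)"
    by (rule grid_limit_rel_term[OF r _ grid_limit_sampled]) (use k in simp)
  show "grid_limit (\<lambda>N v. scaled_grid_sum i (n - k) (outer r p (2 * k)) (sampled b) N v * sampled b p N v *
      scaled_grid_sum i k (inner r p (2 * k)) (\<lambda>l. sampled b (p + l)) N v)
    (rel_term i (n - k) (outer r p (2 * k)) b * b p * rel_term i k (inner r p (2 * k)) (\<lambda>l. b (p + l)))"
    using inner_rel outer_rel k unfolding s
    by (intro grid_limit_mult grid_limit_sampled grid_limit_rel_term) auto
  fix N v
  have "grid_sum (Suc N) (parity_of i) (2 * n) r (\<lambda>j. sampled b j N) v =
    grid_sum (Suc N) (parity_of i) (2 * (n - k)) (outer r p (2 * k)) (\<lambda>j. sampled b j N) v * sampled b p N v *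
    grid_sum (Suc N) (parity_of i) (2 * k) (inner r p (2 * k)) (\<lambda>l. sampled b (p + l) N) v"
    using grid_sum_split_right[OF c0 p0, of "Suc N" "\<lambda>j. sampled b j N" v] unfolding e pe \<open>p = 2 * (n - k)\<close>[symmetric] .
  then show "scaled_grid_sum i n r (sampled b) N v =
    scaled_grid_sum i (n - k) (outer r p (2 * k)) (sampled b) N v * sampled b p N v *
      scaled_grid_sum i k (inner r p (2 * k)) (\<lambda>l. sampled b (p + l)) N v"
    unfolding scaled_grid_sum_def power_split[OF less_imp_le[OF k(2)], of "Suc N"] by (simp add: field_simps)
qed

lemma rel_term_mid:
  assumes p: "0 < p" "p + 2 * k < 2 * n"
  shows "rel_term i n r b = rel_term i (n - k) (outer r p (2 * k))
    (\<lambda>j. if j = p then b p * rel_term (shift_idx i p) k (inner r p (2 * k)) (\<lambda>l. b (p + l)) * b (p + 2 * k)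
         else b (skip p (2 * k) j))"
proof (rule grid_limit_unique)
  let ?in = "\<lambda>N v. scaled_grid_sum (shift_idx i p) k (inner r p (2 * k)) (\<lambda>l. sampled b (p + l)) N v"
  let ?\<phi> = "\<lambda>j. if j = p then (\<lambda>N v. sampled b p N v * ?in N v * sampled b (p + 2 * k) N v) else sampled b (skip p (2 * k) j)"
  show "grid_limit (scaled_grid_sum i n r (sampled b)) (rel_term i n r b)"
    by (rule grid_limit_rel_term[OF r _ grid_limit_sampled]) (use k in simp)
  have "grid_limit (?\<phi> j) (if j = p then b p * rel_term (shift_idx i p) k (inner r p (2 * k)) (\<lambda>l. b (p + l)) * b (p + 2 * k)
         else b (skip p (2 * k) j))" for j
  proof (cases "j = p")
    case True
    have "grid_limit (\<lambda>N v. sampled b p N v * ?in N v * sampled b (p + 2 * k) N v)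
      (b p * rel_term (shift_idx i p) k (inner r p (2 * k)) (\<lambda>l. b (p + l)) * b (p + 2 * k))"
      by (intro grid_limit_mult grid_limit_sampled grid_limit_rel_term inner_rel) (use k in auto)
    then show ?thesis using True by simp
  next
    case False
    then show ?thesis using grid_limit_sampled by simp
  qed
  then show "grid_limit (scaled_grid_sum i (n - k) (outer r p (2 * k)) ?\<phi>)
    (rel_term i (n - k) (outer r p (2 * k))
      (\<lambda>j. if j = p then b p * rel_term (shift_idx i p) k (inner r p (2 * k)) (\<lambda>l. b (p + l)) * b (p + 2 * k)
         else b (skip p (2 * k) j)))"
    by (intro grid_limit_rel_term outer_rel) (use k in auto)
  fix N v
  define M where "M = (of_nat (Suc N) :: complex)"
  have M: "M \<noteq> 0" by (simp add: M_def del: of_nat_Suc)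
  have pw: "M ^ n = M ^ (n - k) * M ^ k" unfolding M_def by (rule power_split) (use k in simp)
  define g where "g = (\<lambda>w. sampled b p N w * grid_sum (Suc N) (parity_of (shift_idx i p)) (2 * k) (inner r p (2 * k)) (\<lambda>l. sampled b (p + l) N) w * sampled b (p + 2 * k) N w)"
  define \<psi> where "\<psi> = (\<lambda>j. if j = p then g else sampled b (skip p (2 * k) j) N)"
  have m: "2 * n - 2 * k = 2 * (n - k)" by (simp add: diff_mult_distrib2)
  have "grid_sum (Suc N) (parity_of i) (2 * (n - k)) (outer r p (2 * k)) (\<lambda>j. ?\<phi> j N) v =
    (\<Sum>a\<in>{()}. inverse (M ^ k) * grid_sum (Suc N) (parity_of i) (2 * (n - k)) (outer r p (2 * k)) ((\<lambda>j. ?\<phi> j N)(p := g)) v)"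
    by (rule grid_sum_linear) (use p in \<open>auto simp: g_def scaled_grid_sum_def M_def[symmetric] field_simps simp del: of_nat_Suc\<close>)
  also have "(\<lambda>j. ?\<phi> j N)(p := g) = \<psi>" by (auto simp: \<psi>_def fun_eq_iff)
  finally have 1: "grid_sum (Suc N) (parity_of i) (2 * (n - k)) (outer r p (2 * k)) (\<lambda>j. ?\<phi> j N) v =
    inverse (M ^ k) * grid_sum (Suc N) (parity_of i) (2 * (n - k)) (outer r p (2 * k)) \<psi> v" by simp
  have 2: "grid_sum (Suc N) (parity_of i) (2 * n) r (\<lambda>j. sampled b j N) v =
    grid_sum (Suc N) (parity_of i) (2 * (n - k)) (outer r p (2 * k)) \<psi> v"
    using grid_sum_split[OF c p, of "Suc N" "\<lambda>j. sampled b j N" v]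
    unfolding m parity_of_shift[symmetric] \<psi>_def g_def .
  show "scaled_grid_sum i n r (sampled b) N v = scaled_grid_sum i (n - k) (outer r p (2 * k)) ?\<phi> N v"
    unfolding scaled_grid_sum_def[of i n r] scaled_grid_sum_def[of i "n - k" "outer r p (2 * k)"]
      1 2 M_def[symmetric] pw
    using M by (simp add: field_simps)
qed

end

section \<open>Cumulants of alternating words\<close>

definition alt_word :: "idx \<Rightarrow> nat \<Rightarrow> idx list" where
  "alt_word i m = map (alternating i) [1..<m+1]"

lemma length_alt_word [simp]: "length (alt_word i m) = m"
  by (simp add: alt_word_def)

lemma alt_word_nth: "j < m \<Longrightarrow> alt_word i m ! j = alternating i (j + 1)"
  unfolding alt_word_def by (subst nth_map) (auto simp: nth_upt simp del: upt_Suc)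

lemma flip_flip [simp]: "flip (flip i) = i" by (cases i) auto

lemma alternating_shift: "alternating i (p + j) = alternating (shift_idx i p) j"
  by (auto simp: alternating_def shift_idx_def)

lemma alt_word_window: "p + q \<le> m \<Longrightarrow> take q (drop p (alt_word i m)) = alt_word (shift_idx i p) q"
  by (rule nth_equalityI) (auto simp: alt_word_nth alternating_shift[symmetric] add.assoc)

lemma alt_word_remove:
  assumes "p + q \<le> m" "even q"
  shows "take p (alt_word i m) @ drop (p + q) (alt_word i m) = alt_word i (m - q)"
proof (rule nth_equalityI)
  show "length (take p (alt_word i m) @ drop (p + q) (alt_word i m)) = length (alt_word i (m - q))"
    using assms by simp
  fix j assume "j < length (take p (alt_word i m) @ drop (p + q) (alt_word i m))"
  then have j: "j < m - q" using assms by simp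
  have "alternating i (j + q + 1) = alternating i (j + 1)"
    using assms(2) by (simp add: alternating_def)
  then show "(take p (alt_word i m) @ drop (p + q) (alt_word i m)) ! j = alt_word i (m - q) ! j"
    using j assms(1) by (auto simp: nth_append alt_word_nth min_def add.commute add.left_commute)
qed

lemma nest_one: "nest \<alpha> ix {{1..length ix}} bs = \<alpha> ix bs"
  by (simp add: nest.simps)

lemma nest_step:
  assumes "P \<noteq> {{1..length ix}}" and "\<exists>pq. interval_block (length ix) P pq"
  obtains p q where "interval_block (length ix) P (p, q)"
    and "nest \<alpha> ix P bs = (let c = \<alpha> (take q (drop p ix)) (take (q - 1) (drop p bs));
            P' = remove_interval P p q;
            ix' = take p ix @ drop (p + q) ix
        in if p = 0 then c * bs ! (q - 1) * nest \<alpha> ix' P' (drop q bs)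
           else if p + q = length ix then nest \<alpha> ix' P' (take (p - 1) bs) * bs ! (p - 1) * c
           else nest \<alpha> ix' P' (take (p - 1) bs @ [bs ! (p - 1) * c * bs ! (p + q - 1)] @ drop (p + q) bs))"
proof -
  define pq where "pq = (SOME pq. interval_block (length ix) P pq)"
  have ib: "interval_block (length ix) P pq" unfolding pq_def by (rule someI_ex[OF assms(2)])
  show ?thesis
  proof (rule that)
    show "interval_block (length ix) P (fst pq, snd pq)" using ib by simp
    show "nest \<alpha> ix P bs = (let c = \<alpha> (take (snd pq) (drop (fst pq) ix)) (take (snd pq - 1) (drop (fst pq) bs));
            P' = remove_interval P (fst pq) (snd pq);
            ix' = take (fst pq) ix @ drop (fst pq + snd pq) ix
        in if fst pq = 0 then c * bs ! (snd pq - 1) * nest \<alpha> ix' P' (drop (snd pq) bs)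
           else if fst pq + snd pq = length ix then nest \<alpha> ix' P' (take (fst pq - 1) bs) * bs ! (fst pq - 1) * c
           else nest \<alpha> ix' P' (take (fst pq - 1) bs @ [bs ! (fst pq - 1) * c * bs ! (fst pq + snd pq - 1)] @ drop (fst pq + snd pq) bs))"
      unfolding pq_def using assms by (subst nest.simps) (simp add: Let_def)
  qed
qed

lemma cscale_zero [simp]: "0 *\<^sub>C f = 0" "z *\<^sub>C 0 = 0"
  by (transfer; auto)+

lemma cumulant_zero:
  assumes "is_cumulant_family E \<alpha>" "ix \<noteq> []" "length bs = length ix - 1" "0 \<in> set bs"
  shows "\<alpha> ix bs = 0"
proof -
  obtain k where k: "k < length bs" "bs ! k = 0" using assms(4) by (metis in_set_conv_nth)
  have "multilinear (length ix - 1) (\<alpha> ix)" using assms(1,2) by (simp add: is_cumulant_family_def)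
  then have "\<alpha> ix (bs[k := 0 *\<^sub>C 0]) = 0 *\<^sub>C \<alpha> ix (bs[k := 0])"
    using k assms(3) unfolding multilinear_def by metis
  moreover have "bs[k := 0] = bs" using k by (metis list_update_id)
  ultimately show ?thesis by simp
qed

text \<open>
  Nesting is linear in each argument because cumulants are, so an inner cumulant which vanishes
  annihilates the entire term.
\<close>

lemma nest_zero:
  assumes "is_cumulant_family E \<alpha>"
  shows "ix \<noteq> [] \<Longrightarrow> length bs = length ix - 1 \<Longrightarrow> 0 \<in> set bs \<Longrightarrow> nest \<alpha> ix P bs = 0"
proof (induction "length ix" arbitrary: ix P bs rule: less_induct)
  case less
  show ?case
  proof (cases "P = {{1..length ix}}")
    case True
    show ?thesis unfolding True nest_one by (rule cumulant_zero[OF assms less.prems])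
  next
    case F: False
    show ?thesis
    proof (cases "\<exists>pq. interval_block (length ix) P pq")
      case False
      then show ?thesis using F by (simp add: nest.simps)
    next
      case True
      obtain p q where ib: "interval_block (length ix) P (p, q)"
        and n: "nest \<alpha> ix P bs = (let c = \<alpha> (take q (drop p ix)) (take (q - 1) (drop p bs));
            P' = remove_interval P p q;
            ix' = take p ix @ drop (p + q) ix
        in if p = 0 then c * bs ! (q - 1) * nest \<alpha> ix' P' (drop q bs)
           else if p + q = length ix then nest \<alpha> ix' P' (take (p - 1) bs) * bs ! (p - 1) * c
           else nest \<alpha> ix' P' (take (p - 1) bs @ [bs ! (p - 1) * c * bs ! (p + q - 1)] @ drop (p + q) bs))"
        using nest_step[OF F True] by blast
      define c where "c = \<alpha> (take q (drop p ix)) (take (q - 1) (drop p bs))"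
      define ix' where "ix' = take p ix @ drop (p + q) ix"
      have pq: "0 < q" "q < length ix" "p + q \<le> length ix" using ib by (auto simp: interval_block_def)
      have lix: "length ix' = length ix - q" using pq by (simp add: ix'_def)
      then have lt: "length ix' < length ix" "ix' \<noteq> []" using pq by auto
      have c0: "0 \<in> set (take (q - 1) (drop p bs)) \<Longrightarrow> c = 0"
        unfolding c_def using pq less.prems by (intro cumulant_zero[OF assms]) auto
      obtain k where k: "k < length bs" "bs ! k = 0" using less.prems(3) by (metis in_set_conv_nth)
      have mid: "p \<le> k \<Longrightarrow> k < p + q - 1 \<Longrightarrow> c = 0"
      proof (rule c0)
        assume "p \<le> k" "k < p + q - 1"
        then have "take (q - 1) (drop p bs) ! (k - p) = 0" "k - p < length (take (q - 1) (drop p bs))"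
          using k by auto
        then show "0 \<in> set (take (q - 1) (drop p bs))" by (metis nth_mem)
      qed
      have lo: "0 \<in> set (take (p - 1) bs)" if "k < p - 1"
      proof -
        have "take (p - 1) bs ! k = 0" "k < length (take (p - 1) bs)" using k that by auto
        then show ?thesis by (metis nth_mem)
      qed
      have hi: "0 \<in> set (drop (p + q) bs)" if "p + q \<le> k"
      proof -
        have "drop (p + q) bs ! (k - (p + q)) = 0" "k - (p + q) < length (drop (p + q) bs)" using k that by auto
        then show ?thesis by (metis nth_mem)
      qed
      have IH: "nest \<alpha> ix' P' bs' = 0" if "length bs' = length ix' - 1" "0 \<in> set bs'" for P' bs'
        using less.hyps[OF lt that] .
      consider "p = 0" | "0 < p" "p + q = length ix" | "0 < p" "p + q < length ix" using pq by linarith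
      then show ?thesis
      proof cases
        case 1
        have "c * bs ! (q - 1) * nest \<alpha> ix' (remove_interval P p q) (drop q bs) = 0"
        proof -
          consider "k < q - 1" | "k = q - 1" | "q \<le> k" by linarith
          then show ?thesis
          proof cases
            case 1 then show ?thesis using mid \<open>p = 0\<close> by simp
          next
            case 2 then show ?thesis using k by simp
          next
            case 3
            have "nest \<alpha> ix' (remove_interval P p q) (drop q bs) = 0"
              by (rule IH) (use hi 3 \<open>p = 0\<close> lix less.prems in auto)
            then show ?thesis by simp
          qed
        qed
        then show ?thesis unfolding n Let_def c_def[symmetric] ix'_def[symmetric] using 1 by simp
      next
        case 2
        have "nest \<alpha> ix' (remove_interval P p q) (take (p - 1) bs) * bs ! (p - 1) * c = 0"
        proof -
          consider "k < p - 1" | "k = p - 1" | "p \<le> k" by linarith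
          then show ?thesis
          proof cases
            case 1
            have "nest \<alpha> ix' (remove_interval P p q) (take (p - 1) bs) = 0"
              by (rule IH) (use lo 1 2 lix less.prems in auto)
            then show ?thesis by simp
          next
            case 2 then show ?thesis using k by simp
          next
            case 3 then show ?thesis using mid k 2 less.prems by simp
          qed
        qed
        then show ?thesis unfolding n Let_def c_def[symmetric] ix'_def[symmetric] using 2 by simp
      next
        case 3
        have "nest \<alpha> ix' (remove_interval P p q)
          (take (p - 1) bs @ [bs ! (p - 1) * c * bs ! (p + q - 1)] @ drop (p + q) bs) = 0"
        proof (rule IH)
          show "length (take (p - 1) bs @ [bs ! (p - 1) * c * bs ! (p + q - 1)] @ drop (p + q) bs) = length ix' - 1"
            using 3 lix less.prems by auto
          consider "k < p - 1" | "k = p - 1" | "p \<le> k" "k < p + q - 1" | "k = p + q - 1" | "p + q \<le> k" by linarith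
          then have "0 \<in> set (take (p - 1) bs) \<or> bs ! (p - 1) * c * bs ! (p + q - 1) = 0 \<or> 0 \<in> set (drop (p + q) bs)"
            by cases (use lo mid hi k in auto)
          then show "0 \<in> set (take (p - 1) bs @ [bs ! (p - 1) * c * bs ! (p + q - 1)] @ drop (p + q) bs)" by auto
        qed
        then show ?thesis unfolding n Let_def c_def[symmetric] ix'_def[symmetric] using 3 by simp
      qed
    qed
  qed
qed

lemma coef_one: "coef 1 = 1"
  by (simp add: coef_def one_ncpoly_def coef.abs_eq one_ncpoly.abs_eq)

lemma word_Cons: "word \<epsilon> b (j # js) = coef (b j) * gen (\<epsilon> j) * word \<epsilon> b js"
  by (simp add: word_def)

lemma word_Nil [simp]: "word \<epsilon> b [] = 1"
  by (simp add: word_def)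

lemma word_append: "word \<epsilon> b (js @ ks) = word \<epsilon> b js * word \<epsilon> b ks"
  by (simp add: word_def)

lemma word_shift: "word \<epsilon> b [Suc k..<Suc l] = word (\<lambda>j. \<epsilon> (Suc j)) (\<lambda>j. b (Suc j)) [k..<l]"
  unfolding word_def map_Suc_upt[symmetric] by (simp add: o_def)

lemma word_cong: "(\<And>j. j \<in> set js \<Longrightarrow> \<epsilon> j = \<epsilon>' j \<and> b j = b' j) \<Longrightarrow> word \<epsilon> b js = word \<epsilon>' b' js"
  by (auto simp: word_def intro!: arg_cong[of _ _ prod_list])

lemma star_mult: "star (p * q) = star q * star p"
  by transfer (simp add: expr_eq.refl)

lemma star_coef: "star (coef b) = coef (conj_C01 b)"
  by transfer (simp add: expr_eq.refl)

lemma star_gen: "star (gen i) = gen (flip i)"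
  by transfer (simp add: expr_eq.refl)

lemma star_word:
  "star (gen (\<epsilon> 0) * word \<epsilon> b [1..<m+1]) =
   gen (flip (\<epsilon> m)) * word (\<lambda>j. flip (\<epsilon> (m - j))) (\<lambda>j. conj_C01 (b (m + 1 - j))) [1..<m+1]"
proof (induction m)
  case 0
  then show ?case by (simp add: star_gen)
next
  case (Suc m)
  have "star (gen (\<epsilon> 0) * word \<epsilon> b [1..<Suc m + 1]) =
    star ((gen (\<epsilon> 0) * word \<epsilon> b [1..<m+1]) * (coef (b (Suc m)) * gen (\<epsilon> (Suc m))))"
    by (simp add: word_append word_Cons mult.assoc)
  also have "\<dots> = gen (flip (\<epsilon> (Suc m))) * (coef (conj_C01 (b (Suc m))) * star (gen (\<epsilon> 0) * word \<epsilon> b [1..<m+1]))"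
    by (simp only: star_mult star_coef star_gen mult.assoc)
  also have "\<dots> = gen (flip (\<epsilon> (Suc m))) * (coef (conj_C01 (b (Suc m))) * gen (flip (\<epsilon> m)) *
      word (\<lambda>j. flip (\<epsilon> (m - j))) (\<lambda>j. conj_C01 (b (m + 1 - j))) [1..<m+1])"
    unfolding Suc.IH by (simp add: mult.assoc)
  also have "coef (conj_C01 (b (Suc m))) * gen (flip (\<epsilon> m)) *
      word (\<lambda>j. flip (\<epsilon> (m - j))) (\<lambda>j. conj_C01 (b (m + 1 - j))) [1..<m+1] =
      word (\<lambda>j. flip (\<epsilon> (Suc m - j))) (\<lambda>j. conj_C01 (b (Suc m + 1 - j))) [1..<Suc m+1]"
  proof -
    have "[1..<Suc m + 1] = 1 # [Suc 1..<Suc (m + 1)]" by (subst upt_conv_Cons) auto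
    then show ?thesis by (simp only: word_Cons word_shift) simp
  qed
  finally show ?case .
qed

text \<open>
  The relations which contribute to a given noncrossing partition. As cyclic closedness of
  subwords cuts each relation along a well-defined noncrossing partition, these sets decompose
  all relations.
\<close>

definition rels_of_type :: "idx \<Rightarrow> nat \<Rightarrow> nat set set \<Rightarrow> (nat \<times> nat) set set" where
  "rels_of_type i n P = {r. slot_rel (parity_of i) (2 * n) r \<and> atoms (2 * n) (closes (2 * n) r) = P}"

lemma finite_slot_rels: "finite {r. slot_rel (parity_of i) (2 * n) r}"
  using bij_betw_finite[OF bij_slot_rel_of[of "parity_of i" n]] by simp

lemma finite_rels_of_type [simp]: "finite (rels_of_type i n P)"
  by (rule finite_subset[OF _ finite_slot_rels[of i n]]) (auto simp: rels_of_type_def)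

lemma closes_bounds: "closes m r u v \<Longrightarrow> u < v \<and> v \<le> m"
  by (simp add: closes_def)

lemma (in closed_arc) atoms_iff_parts:
  assumes P: "partition_on {1..2 * n} P" and W: "{p + 1..p + 2 * k} \<in> P"
  shows "atoms (2 * n) (closes (2 * n) r) = P \<longleftrightarrow>
    atoms (2 * k) (closes (2 * k) (inner r p (2 * k))) = {{1..2 * k}} \<and>
    atoms (2 * (n - k)) (closes (2 * (n - k)) (outer r p (2 * k))) = remove_interval P p (2 * k)"
proof -
  interpret I: slot_rel "parity_of (shift_idx i p)" "2 * k" "inner r p (2 * k)" by (rule inner_rel)
  have m: "2 * (n - k) = 2 * n - 2 * k" by (simp add: diff_mult_distrib2)
  have "atoms (2 * n) (closes (2 * n) r) = P \<longleftrightarrow>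
    (\<forall>u v. closes (2 * k) (inner r p (2 * k)) u v \<longrightarrow> u = 0 \<and> v = 2 * k) \<and>
    atoms (2 * n - 2 * k) (closes (2 * n - 2 * k) (outer r p (2 * k))) = remove_interval P p (2 * k)"
  proof (rule atoms_eq_iff_remove[OF P W c])
    show "0 < 2 * k" "2 * k < 2 * n" using k by auto
    show "closes (2 * n - 2 * k) (outer r p (2 * k)) u v \<longleftrightarrow>
      closes (2 * n) r (if u < p then u else u + 2 * k) (if v \<le> p then v else v + 2 * k)"
      if "u < v" "v \<le> 2 * n - 2 * k" for u v
      by (rule closes_outer[OF c _ that]) (use k in simp)
    show "closes (2 * k) (inner r p (2 * k)) u v \<longleftrightarrow> closes (2 * n) r (p + u) (p + v)" if "u < v" "v \<le> 2 * k" for u v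
      by (rule closes_inner[OF c that])
  qed (use closes_bounds in blast)+
  moreover have "(\<forall>u v. closes (2 * k) (inner r p (2 * k)) u v \<longrightarrow> u = 0 \<and> v = 2 * k) \<longleftrightarrow>
    atoms (2 * k) (closes (2 * k) (inner r p (2 * k))) = {{1..2 * k}}"
    by (rule atoms_trivial_iff[symmetric, OF I.arcs_axioms]) (use k in simp)
  ultimately show ?thesis unfolding m by simp
qed

text \<open>
  Summation over relations of given type follows the recursion for the type: the inner part
  ranges over the irreducible relations of the window, the outer part over the relations of the
  remaining type.
\<close>

lemma sum_rels_of_type_split:
  fixes f :: "(nat \<times> nat) set \<Rightarrow> 'a::comm_monoid_add"
  assumes P: "P \<in> noncrossing (2 * n)" and W: "{p + 1..p + 2 * k} \<in> P" and k: "0 < k" "k < n"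
    and f: "\<And>r. closed_arc i n k p r \<Longrightarrow> f r = g (outer r p (2 * k)) (inner r p (2 * k))"
  shows "(\<Sum>r\<in>rels_of_type i n P. f r) =
    (\<Sum>r'\<in>rels_of_type i (n - k) (remove_interval P p (2 * k)).
       \<Sum>r''\<in>rels_of_type (shift_idx i p) k {{1..2 * k}}. g r' r'')"
proof -
  have part: "partition_on {1..2 * n} P" using P by (simp add: noncrossing_def partitions_def)
  have "p + 2 * k \<in> {p + 1..p + 2 * k}" using k by simp
  then have le: "p + 2 * k \<le> 2 * n" using partition_onD1[OF part] W by fastforce
  have ca: "closed_arc i n k p r" if "r \<in> rels_of_type i n P" for r
  proof -
    interpret slot_rel "parity_of i" "2 * n" r using that by (simp add: rels_of_type_def)
    have "{p + 1..p + 2 * k} \<in> atoms (2 * n) (closes (2 * n) r)" using that W by (simp add: rels_of_type_def)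
    then have "closes (2 * n) r p (p + 2 * k)" using arc_of_interval_atom k by simp
    then show ?thesis using k slot_rel_axioms by unfold_locales
  qed
  have m: "2 * (n - k) = 2 * n - 2 * k" by (simp add: diff_mult_distrib2)
  have "(\<Sum>r\<in>rels_of_type i n P. f r) =
    (\<Sum>z\<in>rels_of_type i (n - k) (remove_interval P p (2 * k)) \<times> rels_of_type (shift_idx i p) k {{1..2 * k}}. g (fst z) (snd z))"
  proof (rule sum.reindex_bij_witness[where j = "\<lambda>r. (outer r p (2 * k), inner r p (2 * k))"
        and i = "\<lambda>z. glue (2 * n) p (2 * k) (fst z) (snd z)"])
    fix r assume rP: "r \<in> rels_of_type i n P"
    interpret closed_arc i n k p r by (rule ca[OF rP])
    show "glue (2 * n) p (2 * k) (fst (outer r p (2 * k), inner r p (2 * k))) (snd (outer r p (2 * k), inner r p (2 * k))) = r"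
      using glue_outer_inner[OF c] k by simp
    show "(outer r p (2 * k), inner r p (2 * k)) \<in> rels_of_type i (n - k) (remove_interval P p (2 * k)) \<times> rels_of_type (shift_idx i p) k {{1..2 * k}}"
    proof -
      have "atoms (2 * n) (closes (2 * n) r) = P" using rP by (simp add: rels_of_type_def)
      from iffD1[OF atoms_iff_parts[OF part W] this] show ?thesis
        using inner_rel outer_rel by (simp add: rels_of_type_def)
    qed
    show "g (fst (outer r p (2 * k), inner r p (2 * k))) (snd (outer r p (2 * k), inner r p (2 * k))) = f r"
      using f[OF ca[OF rP]] by simp
  next
    fix z assume z: "z \<in> rels_of_type i (n - k) (remove_interval P p (2 * k)) \<times> rels_of_type (shift_idx i p) k {{1..2 * k}}"
    obtain r1 r2 where zz: "z = (r1, r2)" by (cases z)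
    define r where "r = glue (2 * n) p (2 * k) r1 r2"
    have r1: "slot_rel (parity_of i) (2 * n - 2 * k) r1" and r2: "slot_rel ((parity_of i + p) mod 2) (2 * k) r2"
      using z zz by (auto simp: rels_of_type_def m parity_of_shift)
    note G = glue_props[OF r1 r2 _ _ le, folded r_def]
    have sr: "slot_rel (parity_of i) (2 * n) r" and cl: "closes (2 * n) r p (p + 2 * k)"
      and out: "outer r p (2 * k) = r1" and inn: "inner r p (2 * k) = r2"
      using G k by auto
    have ca': "closed_arc i n k p r" by (rule closed_arc.intro[OF sr]) (use cl k in simp_all)
    interpret closed_arc i n k p r by (rule ca')
    show "(outer (glue (2 * n) p (2 * k) (fst z) (snd z)) p (2 * k), inner (glue (2 * n) p (2 * k) (fst z) (snd z)) p (2 * k)) = z"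
      using out inn by (simp add: zz r_def)
    have "r \<in> rels_of_type i n P"
      using z zz atoms_iff_parts[OF part W] sr by (simp add: rels_of_type_def out inn)
    then show "glue (2 * n) p (2 * k) (fst z) (snd z) \<in> rels_of_type i n P" by (simp add: zz r_def)
  qed
  then show ?thesis by (simp add: sum.cartesian_product split_beta)
qed

locale vandermonde_cumulants =
  fixes E :: "ncpoly \<Rightarrow> C01" and \<alpha> :: cumulant_family
  assumes dist: "is_distribution E" and cumu: "is_cumulant_family E \<alpha>"
begin

definition moment :: "idx \<Rightarrow> nat \<Rightarrow> (nat \<Rightarrow> C01) \<Rightarrow> C01" where
  "moment i m b = E (gen i * word (alternating (flip i)) b [1..<m])"

lemma moment_cumulant:
  assumes "1 \<le> m"
  shows "moment i m b = (\<Sum>P\<in>noncrossing m. nest \<alpha> (alt_word i m) P (map b [1..<m]))"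
proof -
  have ne: "alt_word i m \<noteq> []" using assms by (metis length_alt_word list.size(3) not_one_le_zero)
  have hd: "hd (alt_word i m) = i" using assms ne by (simp add: hd_conv_nth alt_word_nth alternating_def)
  have "map2 (\<lambda>b i. coef b * gen i) (map b [1..<m]) (tl (alt_word i m)) =
    map (\<lambda>j. coef (b j) * gen (alternating (flip i) j)) [1..<m]"
    by (rule nth_equalityI) (auto simp: nth_tl alt_word_nth alternating_def)
  then have "moment i m b = E (gen (hd (alt_word i m)) *
      prod_list (map2 (\<lambda>b i. coef b * gen i) (map b [1..<m]) (tl (alt_word i m))))"
    unfolding moment_def word_def hd by simp
  also have "\<dots> = (\<Sum>P\<in>noncrossing (length (alt_word i m)). nest \<alpha> (alt_word i m) P (map b [1..<m]))"
    using cumu ne unfolding is_cumulant_family_def by simp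
  finally show ?thesis by simp
qed

text \<open>
  For \<open>X b\<^sub>1 X\<^sup>* \<dots> X\<close> this is part of R-diagonality, and the
  remaining case is its image under the involution.
\<close>

lemma odd_moment: "odd m \<Longrightarrow> moment i m b = 0"
proof -
  assume "odd m"
  then obtain k where m: "m = 2 * k + 1" by (rule oddE)
  have R: "E (gen Plain * word (alternating Star) b [1..<2*k+1]) = 0" for b
    using dist unfolding is_distribution_def R_diagonal_def by blast
  show ?thesis
  proof (cases i)
    case Plain
    then show ?thesis using R by (simp add: moment_def m)
  next
    case Star
    define \<epsilon> where "\<epsilon> = (\<lambda>j. if j = 0 then Star else alternating Plain j)"
    have "E (star (gen (\<epsilon> 0) * word \<epsilon> b [1..<2*k+1])) = 0"
    proof -
      have "gen (flip (\<epsilon> (2*k))) * word (\<lambda>j. flip (\<epsilon> (2*k - j))) (\<lambda>j. conj_C01 (b (2*k + 1 - j))) [1..<2*k+1]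
        = gen Plain * word (alternating Star) (\<lambda>j. conj_C01 (b (2*k + 1 - j))) [1..<2*k+1]"
      proof (rule arg_cong2[of _ _ _ _ "(*)"])
        show "gen (flip (\<epsilon> (2*k))) = gen Plain" by (simp add: \<epsilon>_def alternating_def)
        show "word (\<lambda>j. flip (\<epsilon> (2*k - j))) (\<lambda>j. conj_C01 (b (2*k + 1 - j))) [1..<2*k+1] =
          word (alternating Star) (\<lambda>j. conj_C01 (b (2*k + 1 - j))) [1..<2*k+1]"
          by (rule word_cong) (auto simp: \<epsilon>_def alternating_def)
      qed
      then show ?thesis unfolding star_word using R by simp
    qed
    then have "conj_C01 (E (gen (\<epsilon> 0) * word \<epsilon> b [1..<2*k+1])) = 0"
      using dist by (simp add: is_distribution_def)
    moreover have "conj_C01 (conj_C01 f) = f" for f by transfer simp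
    ultimately have "E (gen (\<epsilon> 0) * word \<epsilon> b [1..<2*k+1]) = 0" using conj_C01_simps(1) by metis
    moreover have "word \<epsilon> b [1..<2*k+1] = word (alternating Plain) b [1..<2*k+1]"
      by (rule word_cong) (auto simp: \<epsilon>_def)
    ultimately show ?thesis by (simp add: moment_def m Star \<epsilon>_def)
  qed
qed

lemma even_moment:
  assumes n: "1 \<le> n"
  shows "moment i (2 * n) b = (\<Sum>P\<in>partitions n. partition_term i n P b)"
proof -
  define b0 where "b0 = (\<lambda>j. if j = 1 then 1 else b (j - 1))"
  have l: "[1..<2*n+1] = 1 # [Suc 1..<Suc (2*n)]" using n by (subst upt_conv_Cons) auto
  have "word (alternating i) b0 [1..<2*n+1] = gen i * word (alternating (flip i)) b [1..<2*n]"
  proof -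
    have "word (\<lambda>j. alternating i (Suc j)) (\<lambda>j. b0 (Suc j)) [1..<2*n] = word (alternating (flip i)) b [1..<2*n]"
      by (rule word_cong) (auto simp: b0_def alternating_def)
    then show ?thesis unfolding l word_Cons word_shift by (simp add: b0_def coef_one alternating_def)
  qed
  then have m: "moment i (2 * n) b = E (word (alternating i) b0 [1..<2*n+1])" by (simp add: moment_def)
  show ?thesis
  proof (cases i)
    case Star
    have "moment i (2 * n) b = (\<Sum>P\<in>partitions n. tau (Gamma_map P (map (\<lambda>k. b0 (2*k)) [1..<n+1])) *\<^sub>C
             (b0 1 * Lambda_map P (map (\<lambda>k. b0 (2*k+1)) [1..<n])))"
    proof -
      have "E (word (alternating Star) b0 [1..<2*n+1]) = (\<Sum>P\<in>partitions n. tau (Gamma_map P (map (\<lambda>k. b0 (2*k)) [1..<n+1])) *\<^sub>C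
             (b0 1 * Lambda_map P (map (\<lambda>k. b0 (2*k+1)) [1..<n])))"
        using dist n unfolding is_distribution_def by blast
      then show ?thesis using m unfolding Star by (rule HOL.trans[rotated])
    qed
    also have "map (\<lambda>k. b0 (2*k)) [1..<n+1] = map (\<lambda>k. b (2*k-1)) [1..<n+1]" by (auto simp: b0_def)
    also have "map (\<lambda>k. b0 (2*k+1)) [1..<n] = map (\<lambda>k. b (2*k)) [1..<n]" by (auto simp: b0_def)
    finally show ?thesis by (simp add: partition_term_def Star b0_def)
  next
    case Plain
    have "moment i (2 * n) b = (\<Sum>P\<in>partitions n. tau (Lambda_map P (map (\<lambda>k. b0 (2*k)) [1..<n]) * b0 (2*n)) *\<^sub>C
             Gamma_map P (map (\<lambda>k. b0 (2*k-1)) [1..<n+1]))"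
    proof -
      have "E (word (alternating Plain) b0 [1..<2*n+1]) = (\<Sum>P\<in>partitions n. tau (Lambda_map P (map (\<lambda>k. b0 (2*k)) [1..<n]) * b0 (2*n)) *\<^sub>C
             Gamma_map P (map (\<lambda>k. b0 (2*k-1)) [1..<n+1]))"
        using dist n unfolding is_distribution_def by blast
      then show ?thesis using m unfolding Plain by (rule HOL.trans[rotated])
    qed
    also have "map (\<lambda>k. b0 (2*k)) [1..<n] = map (\<lambda>k. b (2*k-1)) [1..<n]" by (auto simp: b0_def)
    also have "b0 (2*n) = b (2*n-1)" using n by (auto simp: b0_def)
    also have "map (\<lambda>k. b0 (2*k-1)) [1..<n+1] = 1 # map (\<lambda>k. b (2*k)) [1..<n]"
    proof -
      have "[1..<n+1] = 1 # map Suc [1..<n]" using n by (subst upt_conv_Cons) (auto simp: map_Suc_upt)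
      then show ?thesis by (auto simp: b0_def)
    qed
    finally show ?thesis by (simp add: partition_term_def Plain)
  qed
qed

lemma one_in_noncrossing: "1 \<le> m \<Longrightarrow> {{1..m}} \<in> noncrossing m"
  by (auto simp: noncrossing_def partitions_def partition_on_def)

lemma finite_noncrossing: "finite (noncrossing m)"
  by (rule finite_subset[OF _ finite_partitions[of m]]) (auto simp: noncrossing_def)

lemma cumulant_eq:
  assumes m: "1 \<le> m"
  shows "\<alpha> (alt_word i m) (map b [1..<m]) = moment i m b -
    (\<Sum>P\<in>noncrossing m - {{{1..m}}}. nest \<alpha> (alt_word i m) P (map b [1..<m]))"
proof -
  have "nest \<alpha> (alt_word i m) {{1..m}} bs = \<alpha> (alt_word i m) bs" for bs
    using nest_one[of \<alpha> "alt_word i m" bs] unfolding length_alt_word .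
  then show ?thesis
    unfolding moment_cumulant[OF m] sum.remove[OF finite_noncrossing one_in_noncrossing[OF m]] by simp
qed

text \<open>
  A partition of a set of odd size has a block of odd size. In terms of the recursion: either
  the removed interval block or the remaining word has odd length.
\<close>

lemma odd_nest_aux:
  assumes small: "\<And>k i bs. odd k \<Longrightarrow> k < M \<Longrightarrow> length bs = k - 1 \<Longrightarrow> \<alpha> (alt_word i k) bs = 0"
  shows "odd m \<Longrightarrow> m \<le> M \<Longrightarrow> length bs = m - 1 \<Longrightarrow> P \<noteq> {{1..m}} \<or> m < M \<Longrightarrow> nest \<alpha> (alt_word i m) P bs = 0"
proof (induction m arbitrary: P bs rule: less_induct)
  case (less m)
  show ?case
  proof (cases "P = {{1..m}}")
    case True
    have "nest \<alpha> (alt_word i m) {{1..m}} bs = \<alpha> (alt_word i m) bs"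
      using nest_one[of \<alpha> "alt_word i m" bs] unfolding length_alt_word .
    then show ?thesis using small[of m bs i] less.prems True by simp
  next
    case F: False
    show ?thesis
    proof (cases "\<exists>pq. interval_block m P pq")
      case False
      then show ?thesis using F by (simp add: nest.simps)
    next
      case True
      obtain p q where ib: "interval_block m P (p, q)"
        and n: "nest \<alpha> (alt_word i m) P bs = (let c = \<alpha> (take q (drop p (alt_word i m))) (take (q - 1) (drop p bs));
            P' = remove_interval P p q;
            ix' = take p (alt_word i m) @ drop (p + q) (alt_word i m)
        in if p = 0 then c * bs ! (q - 1) * nest \<alpha> ix' P' (drop q bs)
           else if p + q = m then nest \<alpha> ix' P' (take (p - 1) bs) * bs ! (p - 1) * c
           else nest \<alpha> ix' P' (take (p - 1) bs @ [bs ! (p - 1) * c * bs ! (p + q - 1)] @ drop (p + q) bs))"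
        using nest_step[of P "alt_word i m" \<alpha> bs, unfolded length_alt_word, OF F True] by blast
      have pq: "0 < q" "q < m" "p + q \<le> m" using ib by (auto simp: interval_block_def)
      show ?thesis
      proof (cases "odd q")
        case True
        have c: "\<alpha> (take q (drop p (alt_word i m))) (take (q - 1) (drop p bs)) = 0"
          unfolding alt_word_window[OF pq(3)] by (rule small) (use True pq less.prems in auto)
        have z: "nest \<alpha> (take p (alt_word i m) @ drop (p + q) (alt_word i m)) (remove_interval P p q)
          (take (p - 1) bs @ [0] @ drop (p + q) bs) = 0" if "0 < p" "p + q < m"
          by (rule nest_zero[OF cumu]) (use that pq less.prems in auto)
        show ?thesis unfolding n Let_def c using z pq by auto
      next
        case False
        then have ev: "even q" by simp
        have IH: "nest \<alpha> (alt_word i (m - q)) P' bs' = 0" if "length bs' = m - q - 1" for P' bs'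
          by (rule less.IH) (use that pq ev less.prems in auto)
        show ?thesis unfolding n Let_def alt_word_remove[OF pq(3) ev] length_alt_word
          using pq less.prems by (auto simp: IH)
      qed
    qed
  qed
qed

text \<open>
  Hence only interval blocks of even length matter, and those are the ones to which an arc can
  belong.
\<close>

lemma odd_cumulant: "odd m \<Longrightarrow> length bs = m - 1 \<Longrightarrow> \<alpha> (alt_word i m) bs = 0"
proof (induction m arbitrary: i bs rule: less_induct)
  case (less m)
  have m1: "1 \<le> m" using less.prems by (cases m) auto
  define b where "b = (\<lambda>j. bs ! (j - 1))"
  have bs: "bs = map b [1..<m]"
    by (rule nth_equalityI) (use less.prems in \<open>auto simp: b_def\<close>)
  have "nest \<alpha> (alt_word i m) P (map b [1..<m]) = 0" if "P \<noteq> {{1..m}}" for P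
    by (rule odd_nest_aux[of m]) (use less that in auto)
  then have "\<alpha> (alt_word i m) (map b [1..<m]) = 0"
    unfolding cumulant_eq[OF m1] odd_moment[OF less.prems(1)] by simp
  then show ?case unfolding bs .
qed

text \<open>
  The nested cumulant of a noncrossing partition collects the relations of this type. The inner
  cumulant is, by induction, a sum over irreducible relations of the window; the nesting
  recursion and the factorisation rules then agree term by term.
\<close>

lemma nest_even:
  assumes A: "\<And>k i b. 1 \<le> k \<Longrightarrow> k < M \<Longrightarrow>
    \<alpha> (alt_word i (2 * k)) (map b [1..<2*k]) = (\<Sum>r\<in>rels_of_type i k {{1..2*k}}. rel_term i k r b)"
  shows "1 \<le> n \<Longrightarrow> n \<le> M \<Longrightarrow> P \<in> noncrossing (2 * n) \<Longrightarrow> P \<noteq> {{1..2*n}} \<or> n < M \<Longrightarrow>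
    nest \<alpha> (alt_word i (2 * n)) P (map b [1..<2*n]) = (\<Sum>r\<in>rels_of_type i n P. rel_term i n r b)"
proof (induction n arbitrary: P b rule: less_induct)
  case (less n)
  note n1 = less.prems(1)
  show ?case
  proof (cases "P = {{1..2*n}}")
    case True
    have "nest \<alpha> (alt_word i (2 * n)) {{1..2*n}} (map b [1..<2*n]) = \<alpha> (alt_word i (2 * n)) (map b [1..<2*n])"
      using nest_one[of \<alpha> "alt_word i (2 * n)" "map b [1..<2*n]"] unfolding length_alt_word .
    then show ?thesis using A[of n i b] less.prems True by simp
  next
    case F: False
    let ?bs = "map b [1..<2*n]"
    have ex: "\<exists>pq. interval_block (2 * n) P pq"
      by (rule noncrossing_has_interval_block[OF less.prems(3) F]) (use n1 in simp)
    obtain p q where ib: "interval_block (2 * n) P (p, q)"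
        and nst: "nest \<alpha> (alt_word i (2 * n)) P ?bs = (let c = \<alpha> (take q (drop p (alt_word i (2 * n)))) (take (q - 1) (drop p ?bs));
            P' = remove_interval P p q;
            ix' = take p (alt_word i (2 * n)) @ drop (p + q) (alt_word i (2 * n))
        in if p = 0 then c * ?bs ! (q - 1) * nest \<alpha> ix' P' (drop q ?bs)
           else if p + q = 2 * n then nest \<alpha> ix' P' (take (p - 1) ?bs) * ?bs ! (p - 1) * c
           else nest \<alpha> ix' P' (take (p - 1) ?bs @ [?bs ! (p - 1) * c * ?bs ! (p + q - 1)] @ drop (p + q) ?bs))"
      using nest_step[of P "alt_word i (2 * n)" \<alpha> ?bs, unfolded length_alt_word, OF F ex] by blast
    have pq: "0 < q" "q < 2 * n" "p + q \<le> 2 * n" and W: "{p+1..p+q} \<in> P"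
      using ib by (auto simp: interval_block_def)
    define c where "c = \<alpha> (take q (drop p (alt_word i (2 * n)))) (take (q - 1) (drop p ?bs))"
    show ?thesis
    proof (cases "odd q")
      case True
      have c0: "c = 0"
        unfolding c_def alt_word_window[OF pq(3)] by (rule odd_cumulant) (use True pq in auto)
      have z: "nest \<alpha> (take p (alt_word i (2 * n)) @ drop (p + q) (alt_word i (2 * n))) (remove_interval P p q)
          (take (p - 1) ?bs @ [0] @ drop (p + q) ?bs) = 0" if "0 < p" "p + q < 2 * n"
        by (rule nest_zero[OF cumu]) (use that pq in auto)
      have "nest \<alpha> (alt_word i (2 * n)) P ?bs = 0"
        unfolding nst Let_def c_def[symmetric] c0 using z pq by auto
      moreover have "rels_of_type i n P = {}"
      proof (rule ccontr)
        assume "rels_of_type i n P \<noteq> {}"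
        then obtain r where r: "slot_rel (parity_of i) (2 * n) r" "atoms (2 * n) (closes (2 * n) r) = P"
          by (auto simp: rels_of_type_def)
        interpret slot_rel "parity_of i" "2 * n" r by (rule r(1))
        have "closes (2 * n) r p (p + q)" using arc_of_interval_atom[of p q] r(2) W pq by simp
        from closesD(3)[OF this] show False using True by simp
      qed
      ultimately show ?thesis by simp
    next
      case False
      then obtain k where q: "q = 2 * k" by auto
      have k: "0 < k" "k < n" using pq q by auto
      have W': "{p + 1..p + 2 * k} \<in> P" using W q by simp
      let ?P' = "remove_interval P p q" and ?i'' = "shift_idx i p"
      have m: "2 * (n - k) = 2 * n - q" by (simp add: q diff_mult_distrib2)
      have ix': "take p (alt_word i (2 * n)) @ drop (p + q) (alt_word i (2 * n)) = alt_word i (2 * (n - k))"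
        unfolding m by (rule alt_word_remove[OF pq(3)]) (simp add: q)
      have P': "?P' \<in> noncrossing (2 * (n - k))"
        unfolding m by (rule remove_interval_noncrossing[OF less.prems(3) W pq(3)])
      have IH: "nest \<alpha> (alt_word i (2 * (n - k))) ?P' (map b' [1..<2*(n-k)]) = (\<Sum>r\<in>rels_of_type i (n - k) ?P'. rel_term i (n - k) r b')" for b'
        by (rule less.IH[OF _ _ _ P']) (use k less.prems in auto)
      have win: "take (q - 1) (drop p ?bs) = map (\<lambda>l. b (p + l)) [1..<2*k]"
        by (rule nth_equalityI) (use pq q in \<open>auto simp: add_ac\<close>)
      have c: "c = (\<Sum>r\<in>rels_of_type ?i'' k {{1..2*k}}. rel_term ?i'' k r (\<lambda>l. b (p + l)))"
        unfolding c_def alt_word_window[OF pq(3)] win unfolding q by (rule A) (use k less.prems in auto)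
      have bn: "?bs ! (j - 1) = b j" if "1 \<le> j" "j < 2 * n" for j using that by simp
      consider "p = 0" | "0 < p" "p + q = 2 * n" | "0 < p" "p + q < 2 * n" using pq by linarith
      then show ?thesis
      proof cases
        case 1
        have s: "?i'' = i" using 1 by (simp add: shift_idx_def)
        have dr: "drop q ?bs = map (\<lambda>j. b (j + 2 * k)) [1..<2*(n-k)]"
          by (rule nth_equalityI) (use pq q k in \<open>auto simp: add_ac diff_mult_distrib2\<close>)
        have "nest \<alpha> (alt_word i (2 * n)) P ?bs = c * b q * nest \<alpha> (alt_word i (2 * (n - k))) ?P' (map (\<lambda>j. b (j + 2 * k)) [1..<2*(n-k)])"
          unfolding nst Let_def c_def[symmetric] ix' dr using 1 bn[of q] pq by simp
        also have "\<dots> = (\<Sum>r'\<in>rels_of_type i (n - k) ?P'. \<Sum>r''\<in>rels_of_type ?i'' k {{1..2*k}}.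
            rel_term i k r'' b * b (2 * k) * rel_term i (n - k) r' (\<lambda>j. b (j + 2 * k)))"
          unfolding IH c s using 1 by (simp add: sum_distrib_left sum_distrib_right q)
        also have "\<dots> = (\<Sum>r\<in>rels_of_type i n P. rel_term i n r b)"
          unfolding q
        proof (rule sum_rels_of_type_split[OF less.prems(3) W' k, symmetric])
          fix r assume "closed_arc i n k p r"
          then interpret closed_arc i n k p r .
          show "rel_term i n r b = rel_term i k (inner r p (2 * k)) b * b (2 * k) * rel_term i (n - k) (outer r p (2 * k)) (\<lambda>j. b (j + 2 * k))"
            using rel_term_left[OF 1, of b] 1 by simp
        qed
        finally show ?thesis .
      next
        case 2
        have "p = 2 * (n - k)" using 2 q by simp
        then have s: "?i'' = i" by (simp add: shift_idx_def)
        have tk: "take (p - 1) ?bs = map b [1..<2*(n-k)]"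
          by (rule nth_equalityI) (use 2 q in auto)
        have "nest \<alpha> (alt_word i (2 * n)) P ?bs = nest \<alpha> (alt_word i (2 * (n - k))) ?P' (map b [1..<2*(n-k)]) * b p * c"
          unfolding nst Let_def c_def[symmetric] ix' tk using 2 bn[of p] pq by simp
        also have "\<dots> = (\<Sum>r'\<in>rels_of_type i (n - k) ?P'. \<Sum>r''\<in>rels_of_type ?i'' k {{1..2*k}}.
            rel_term i (n - k) r' b * b p * rel_term i k r'' (\<lambda>l. b (p + l)))"
          unfolding IH c s sum_distrib_right[of _ _ "b p"] sum_product ..
        also have "\<dots> = (\<Sum>r\<in>rels_of_type i n P. rel_term i n r b)"
          unfolding q
        proof (rule sum_rels_of_type_split[OF less.prems(3) W' k, symmetric])
          fix r assume "closed_arc i n k p r"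
          then interpret closed_arc i n k p r .
          show "rel_term i n r b = rel_term i (n - k) (outer r p (2 * k)) b * b p * rel_term i k (inner r p (2 * k)) (\<lambda>l. b (p + l))"
            by (rule rel_term_right) (use 2 q in simp)
        qed
        finally show ?thesis .
      next
        case 3
        \<comment> \<open>The coefficient list of the outer word, in which \<open>x\<close>
          stands for the value of the inner cumulant.\<close>
        define B where "B = (\<lambda>x j. if j = p then b p * x * b (p + 2 * k) else b (skip p (2 * k) j))"
        have ls: "take (p - 1) ?bs @ [?bs ! (p - 1) * c * ?bs ! (p + q - 1)] @ drop (p + q) ?bs = map (B c) [1..<2*(n-k)]"
        proof (rule nth_equalityI)
          show len: "length (take (p - 1) ?bs @ [?bs ! (p - 1) * c * ?bs ! (p + q - 1)] @ drop (p + q) ?bs) = length (map (B c) [1..<2*(n-k)])"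
            using 3 q by auto
          fix j assume "j < length (take (p - 1) ?bs @ [?bs ! (p - 1) * c * ?bs ! (p + q - 1)] @ drop (p + q) ?bs)"
          then have j: "j < 2 * (n - k) - 1" by (simp only: len length_map length_upt)
          consider "j < p - 1" | "j = p - 1" | "p \<le> j" by linarith
          then show "(take (p - 1) ?bs @ [?bs ! (p - 1) * c * ?bs ! (p + q - 1)] @ drop (p + q) ?bs) ! j = map (B c) [1..<2*(n-k)] ! j"
          proof cases
            case 1
            then have "Suc j < p" "j < p - Suc 0" by simp_all
            then show ?thesis using j 3 q by (simp add: nth_append B_def skip_def)
          next
            case 2
            then show ?thesis using j 3 q by (simp add: nth_append B_def)
          next
            case jp: 3
            have "(take (p - 1) ?bs @ [?bs ! (p - 1) * c * ?bs ! (p + q - 1)] @ drop (p + q) ?bs) ! j = drop (p + q) ?bs ! (j - p)"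
            proof -
              have "\<not> j < p - Suc 0" "p + q < 2 * n" "0 < p" using jp 3 by simp_all
              then show ?thesis using jp q by (simp add: nth_append nth_Cons')
            qed
            also have "\<dots> = b (j + 1 + 2 * k)" using jp j 3 q by (simp add: add_ac)
            also have "\<dots> = map (B c) [1..<2*(n-k)] ! j" using jp j by (simp add: B_def skip_def)
            finally show ?thesis .
          qed
        qed
        have Bsum: "rel_term i (n - k) r' (B (\<Sum>a\<in>Q. x a)) = (\<Sum>a\<in>Q. rel_term i (n - k) r' (B (x a)))"
          if "slot_rel (parity_of i) (2 * (n - k)) r'" "finite Q" for r' x and Q :: "(nat \<times> nat) set set"
        proof -
          have upd: "B y = (B 0)(p := b p * y * b (p + 2 * k))" for y by (auto simp: B_def fun_eq_iff)
          have "B (\<Sum>a\<in>Q. x a) = (B 0)(p := \<Sum>a\<in>Q. b p * x a * b (p + 2 * k))"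
            unfolding upd[of "\<Sum>a\<in>Q. x a"] by (simp add: sum_distrib_left sum_distrib_right)
          then have "rel_term i (n - k) r' (B (\<Sum>a\<in>Q. x a)) = (\<Sum>a\<in>Q. rel_term i (n - k) r' ((B 0)(p := b p * x a * b (p + 2 * k))))"
            using rel_term_sum[OF that(1) _ that(2), of p "B 0" "\<lambda>a. b p * x a * b (p + 2 * k)"] 3 k q by simp
          then show ?thesis by (simp only: upd[symmetric])
        qed
        have "nest \<alpha> (alt_word i (2 * n)) P ?bs = nest \<alpha> (alt_word i (2 * (n - k))) ?P' (map (B c) [1..<2*(n-k)])"
          unfolding nst Let_def c_def[symmetric] ix' ls using 3 by simp
        also have "\<dots> = (\<Sum>r'\<in>rels_of_type i (n - k) ?P'. rel_term i (n - k) r' (B c))" by (rule IH)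
        also have "\<dots> = (\<Sum>r'\<in>rels_of_type i (n - k) ?P'. \<Sum>r''\<in>rels_of_type ?i'' k {{1..2*k}}.
            rel_term i (n - k) r' (B (rel_term ?i'' k r'' (\<lambda>l. b (p + l)))))"
          by (rule sum.cong[OF HOL.refl], unfold c, rule Bsum) (simp_all add: rels_of_type_def[of i "n - k"])
        also have "\<dots> = (\<Sum>r\<in>rels_of_type i n P. rel_term i n r b)"
          unfolding q
        proof (rule sum_rels_of_type_split[OF less.prems(3) W' k, symmetric])
          fix r assume "closed_arc i n k p r"
          then interpret closed_arc i n k p r .
          show "rel_term i n r b = rel_term i (n - k) (outer r p (2 * k)) (B (rel_term ?i'' k (inner r p (2 * k)) (\<lambda>l. b (p + l))))"
            unfolding B_def by (rule rel_term_mid) (use 3 q in auto)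
        qed
        finally show ?thesis .
      qed
    qed
  qed
qed

text \<open>
  The moment is the sum over all relations. Those of nontrivial type are accounted for by the
  nested cumulants of that type, and what remains for the cumulant are the irreducible ones.
\<close>

theorem even_cumulant:
  assumes "1 \<le> n"
  shows "\<alpha> (alt_word i (2 * n)) (map b [1..<2*n]) = (\<Sum>r\<in>rels_of_type i n {{1..2*n}}. rel_term i n r b)"
  using assms
proof (induction n arbitrary: i b rule: less_induct)
  case (less n)
  have n2: "1 \<le> 2 * n" using less.prems by simp
  have nest: "nest \<alpha> (alt_word i (2 * n)) P (map b [1..<2*n]) = (\<Sum>r\<in>rels_of_type i n P. rel_term i n r b)"
    if "P \<in> noncrossing (2 * n) - {{{1..2*n}}}" for P
    by (rule nest_even[of n]) (use less that in auto)
  have "moment i (2 * n) b = (\<Sum>P\<in>partitions n. partition_term i n P b)"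
    by (rule even_moment[OF less.prems])
  also have "\<dots> = (\<Sum>r | slot_rel (parity_of i) (2 * n) r. rel_term i n r b)"
    by (rule sum.reindex_bij_betw[OF bij_slot_rel_of[of "parity_of i" n], THEN HOL.trans[rotated]])
      (auto simp: rel_term_slot_rel_of intro!: sum.cong)
  also have "\<dots> = (\<Sum>P\<in>noncrossing (2 * n). \<Sum>r | r \<in> {r. slot_rel (parity_of i) (2 * n) r} \<and> atoms (2 * n) (closes (2 * n) r) = P. rel_term i n r b)"
    by (rule sum.group[symmetric, OF finite_slot_rels finite_noncrossing]) (use atoms_noncrossing in blast)
  also have "\<dots> = (\<Sum>P\<in>noncrossing (2 * n). \<Sum>r\<in>rels_of_type i n P. rel_term i n r b)"
    by (simp add: rels_of_type_def)
  also have "\<dots> = (\<Sum>r\<in>rels_of_type i n {{1..2*n}}. rel_term i n r b) +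
      (\<Sum>P\<in>noncrossing (2 * n) - {{{1..2*n}}}. \<Sum>r\<in>rels_of_type i n P. rel_term i n r b)"
    by (rule sum.remove[OF finite_noncrossing one_in_noncrossing[OF n2]])
  also have "(\<Sum>P\<in>noncrossing (2 * n) - {{{1..2*n}}}. \<Sum>r\<in>rels_of_type i n P. rel_term i n r b) =
      (\<Sum>P\<in>noncrossing (2 * n) - {{{1..2*n}}}. nest \<alpha> (alt_word i (2 * n)) P (map b [1..<2*n]))"
    by (rule sum.cong[OF HOL.refl]) (simp only: nest)
  finally show ?case unfolding cumulant_eq[OF n2] by simp
qed

end

section \<open>Purely crossing partitions\<close>

text \<open>
  Closed arcs between points which are not slots are the subintervals that split the partition,
  and closed arcs between slots of length \<open>2\<close> or \<open>m - 2\<close> join cyclic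
  neighbours. So this is pure crossing in terms of arcs. In contrast to irreducibility it
  tolerates arcs between slots of intermediate length.
\<close>

definition pure :: "nat \<Rightarrow> (nat \<times> nat) set \<Rightarrow> bool" where
  "pure m r \<longleftrightarrow> (\<forall>u v. closes m r u v \<longrightarrow> u = 0 \<and> v = m \<or> (u, u) \<in> r \<and> v - u \<noteq> 2 \<and> v - u \<noteq> m - 2)"

lemma pureD:
  assumes "pure m r" "closes m r u v" "\<not> (u = 0 \<and> v = m)"
  shows "(u, u) \<in> r" "v - u \<noteq> 2" "v - u \<noteq> m - 2"
  using assms unfolding pure_def by blast+

lemma splits_iff:
  assumes P: "P \<in> partitions n" and A: "A \<subseteq> {1..n}"
  shows "splits A P \<longleftrightarrow> (\<forall>S\<in>P. \<forall>a\<in>S. \<forall>b\<in>S. a \<in> A \<longrightarrow> b \<in> A)"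
proof
  assume "splits A P"
  then obtain Q where Q: "Q \<subseteq> P" "A = \<Union>Q" by (auto simp: splits_def)
  show "\<forall>S\<in>P. \<forall>a\<in>S. \<forall>b\<in>S. a \<in> A \<longrightarrow> b \<in> A"
  proof (intro ballI impI)
    fix S a b assume S: "S \<in> P" "a \<in> S" "b \<in> S" "a \<in> A"
    then obtain T where "T \<in> Q" "a \<in> T" using Q by blast
    then have "T = S" using partitionsD(4)[OF P, of T S a] Q(1) S by blast
    then show "b \<in> A" using Q \<open>T \<in> Q\<close> S by blast
  qed
next
  assume R: "\<forall>S\<in>P. \<forall>a\<in>S. \<forall>b\<in>S. a \<in> A \<longrightarrow> b \<in> A"
  have eq: "A = \<Union>{S \<in> P. S \<inter> A \<noteq> {}}"
    using R partitionsD(5)[OF P] A by blast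
  show "splits A P"
    unfolding splits_def by (rule exI[of _ "{S \<in> P. S \<inter> A \<noteq> {}}"], rule conjI, blast, rule eq)
qed

lemma purely_crossingD:
  assumes "P \<in> purely_crossing n"
  shows "P \<in> partitions n"
    and "p < p + q \<Longrightarrow> p + q \<le> n \<Longrightarrow> q < n \<Longrightarrow> \<not> splits {p+1..p+q} P"
    and "S \<in> P \<Longrightarrow> k \<in> {1..n-1} \<Longrightarrow> \<not> (k \<in> S \<and> k + 1 \<in> S)"
    and "S \<in> P \<Longrightarrow> \<not> (1 \<in> S \<and> n \<in> S)"
proof -
  note d = assms[unfolded purely_crossing_def mem_Collect_eq]
  show "P \<in> partitions n" by (rule conjunct1[OF d])
  show "p < p + q \<Longrightarrow> p + q \<le> n \<Longrightarrow> q < n \<Longrightarrow> \<not> splits {p+1..p+q} P"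
    using conjunct1[OF conjunct2[OF d]] by simp
  show "S \<in> P \<Longrightarrow> k \<in> {1..n-1} \<Longrightarrow> \<not> (k \<in> S \<and> k + 1 \<in> S)" "S \<in> P \<Longrightarrow> \<not> (1 \<in> S \<and> n \<in> S)"
    using conjunct2[OF conjunct2[OF d]] by (simp, blast)
qed

lemma purely_crossingI:
  assumes "P \<in> partitions n"
    and "\<And>p q. p < p + q \<Longrightarrow> p + q \<le> n \<Longrightarrow> q < n \<Longrightarrow> \<not> splits {p+1..p+q} P"
    and "\<And>S k. S \<in> P \<Longrightarrow> k \<in> {1..n-1} \<Longrightarrow> \<not> (k \<in> S \<and> k + 1 \<in> S)"
    and "\<And>S. S \<in> P \<Longrightarrow> \<not> (1 \<in> S \<and> n \<in> S)"
  shows "P \<in> purely_crossing n"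
  unfolding purely_crossing_def mem_Collect_eq
  by (intro conjI allI ballI impI assms(1) assms(2) assms(3) assms(4)) (elim conjE, assumption)+

locale partition_slots =
  fixes i :: idx and n :: nat and P :: "nat set set"
  assumes P: "P \<in> partitions n" and n1: "1 \<le> n"
begin

abbreviation "e \<equiv> parity_of i"
abbreviation "r \<equiv> slot_rel_of e P"
abbreviation "\<theta> j \<equiv> 2 * j - 2 + e"

sublocale slot_rel e "2 * n" r by (rule slot_rel_slot_rel_of[OF P]) simp

lemma e01: "e = 0 \<or> e = 1" by (cases i) auto

lemma theta_of: "(x, x) \<in> r \<Longrightarrow> \<exists>a\<in>{1..n}. x = \<theta> a"
  using refl_r[of x] slots_theta[of e n] by (auto simp: slots_def set_eq_iff image_iff)

lemma r_iff: "a \<in> {1..n} \<Longrightarrow> b \<in> {1..n} \<Longrightarrow> (\<theta> a, \<theta> b) \<in> r \<longleftrightarrow> (\<exists>S\<in>P. a \<in> S \<and> b \<in> S)"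
  by (rule slot_rel_of_iff[OF P])

lemma mem_theta: "(x, y) \<in> r \<Longrightarrow> \<exists>a\<in>{1..n}. \<exists>b\<in>{1..n}. x = \<theta> a \<and> y = \<theta> b \<and> (\<exists>S\<in>P. a \<in> S \<and> b \<in> S)"
proof -
  assume xy: "(x, y) \<in> r"
  then have "(x, x) \<in> r" "(y, y) \<in> r" using trans_r[OF xy sym_r[OF xy]] trans_r[OF sym_r[OF xy] xy] by simp_all
  then obtain a b where a: "a \<in> {1..n}" "x = \<theta> a" and b: "b \<in> {1..n}" "y = \<theta> b"
    using theta_of[of x] theta_of[of y] by blast
  have "\<exists>S\<in>P. a \<in> S \<and> b \<in> S" using r_iff[OF a(1) b(1)] xy unfolding a(2) b(2) by (rule iffD1)
  then show ?thesis using a b by blast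
qed

text \<open>
  The arc from \<open>w\<close> covers exactly the slots of \<open>a+1, \<dots>, b\<close>. Its
  ends are not slots, and it is closed if and only if no block leaves the window.
\<close>

lemma closes_interval:
  assumes ab: "a < b" "b \<le> n" and a: "e = 0 \<Longrightarrow> 0 < a" and w: "w + 1 = 2 * a + e"
  shows "closes (2 * n) r w (w + 2 * (b - a)) \<longleftrightarrow> splits {a+1..b} P"
proof -
  have win: "\<theta> j \<in> {w..<w + 2 * (b - a)} \<longleftrightarrow> j \<in> {a+1..b}" if "1 \<le> j" for j
    using that ab w e01 by auto
  have notin: "(w, w) \<notin> r"
  proof
    assume "(w, w) \<in> r"
    then have "w mod 2 = e" using mem_r by blast
    then show False using w e01 by presburger
  qed
  have sub: "{a+1..b} \<subseteq> {1..n}" using ab by auto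
  show ?thesis
  proof
    assume c: "closes (2 * n) r w (w + 2 * (b - a))"
    show "splits {a+1..b} P"
      unfolding splits_iff[OF P sub]
    proof (intro ballI impI, rule ccontr)
      fix S x y assume S: "S \<in> P" "x \<in> S" "y \<in> S" "x \<in> {a+1..b}" "y \<notin> {a+1..b}"
      have xy: "x \<in> {1..n}" "y \<in> {1..n}" using partitionsD(1)[OF P S(1)] S by auto
      then have xyr: "(\<theta> x, \<theta> y) \<in> r" using r_iff S by blast
      have xi: "\<theta> x \<in> {w..<w + 2 * (b - a)}" "\<theta> y \<notin> {w..<w + 2 * (b - a)}"
        using win xy S by auto
      have x: "w \<le> \<theta> x" "\<theta> x < w + 2 * (b - a)"
        using xi(1) by (simp_all only: atLeastLessThan_iff)
      have y: "\<theta> y < w \<or> w + 2 * (b - a) \<le> \<theta> y"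
        using xi(2) by (simp only: atLeastLessThan_iff de_Morgan_conj not_le not_less)
      have "(\<theta> x, w) \<in> r" by (rule closesD(5)[OF c xyr x y])
      then show False using notin trans_r[OF sym_r] by blast
    qed
  next
    assume sp: "splits {a+1..b} P"
    show "closes (2 * n) r w (w + 2 * (b - a))"
    proof (rule closesI)
      show "w < w + 2 * (b - a)" "even (w + 2 * (b - a) - w)" using ab by auto
      show "w + 2 * (b - a) \<le> 2 * n" using ab w e01 by auto
      show "(w, (w + 2 * (b - a)) mod (2 * n)) \<in> r" if "(w, w) \<in> r" using that notin by blast
      fix x y assume xy: "(x, y) \<in> r" "w \<le> x" "x < w + 2 * (b - a)" "y < w \<or> w + 2 * (b - a) \<le> y"
      obtain c d S where cd: "c \<in> {1..n}" "d \<in> {1..n}" "x = \<theta> c" "y = \<theta> d" "S \<in> P" "c \<in> S" "d \<in> S"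
        using mem_theta[OF xy(1)] by (elim bexE conjE)
      have xw: "x \<in> {w..<w + 2 * (b - a)}" "y \<notin> {w..<w + 2 * (b - a)}" using xy by auto
      have cd1: "1 \<le> c" "1 \<le> d" using cd by simp_all
      have "c \<in> {a+1..b}" "d \<notin> {a+1..b}"
        using xw unfolding cd(3,4) win[OF cd1(1)] win[OF cd1(2)] by simp_all
      then have False using sp[unfolded splits_iff[OF P sub]] cd(5,6,7) by blast
      then show "(x, w) \<in> r" ..
    qed
  qed
qed

lemma closes_neighbours:
  assumes a: "a \<in> {1..n}" and n: "2 \<le> n" and S: "S \<in> P" "a \<in> S" "(if a = n then 1 else a + 1) \<in> S"
    and w: "e = 1 \<Longrightarrow> a < n"
  shows "closes (2 * n) r (\<theta> a) (\<theta> a + 2)"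
proof (rule closesI)
  show "\<theta> a < \<theta> a + 2" "even (\<theta> a + 2 - \<theta> a)" by auto
  show "\<theta> a + 2 \<le> 2 * n" using a w e01 by auto
  show "(\<theta> a, (\<theta> a + 2) mod (2 * n)) \<in> r"
  proof (cases "a = n")
    case True
    then have "e = 0" using w e01 by auto
    then have "\<theta> a + 2 = 2 * n" "\<theta> 1 = 0" using True n by auto
    then have "(\<theta> a + 2) mod (2 * n) = \<theta> 1" by (simp only: mod_self)
    moreover have "(\<theta> a, \<theta> 1) \<in> r" using r_iff[OF a, of 1] S True n by auto
    ultimately show ?thesis by simp
  next
    case False
    then have "\<theta> a + 2 = \<theta> (a + 1)" "\<theta> (a + 1) < 2 * n" using a e01 by auto
    then have "(\<theta> a + 2) mod (2 * n) = \<theta> (a + 1)" by (simp only: mod_less)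
    moreover have "(\<theta> a, \<theta> (a + 1)) \<in> r" using r_iff[OF a, of "a + 1"] S False a by auto
    ultimately show ?thesis by (simp only:)
  qed
  fix x y assume xy: "(x, y) \<in> r" "\<theta> a \<le> x" "x < \<theta> a + 2"
  obtain c where c: "c \<in> {1..n}" "x = \<theta> c" using mem_theta[OF xy(1)] by blast
  then have "c = a" using xy a by auto
  then show "(x, \<theta> a) \<in> r" using c(2) trans_r[OF xy(1) sym_r[OF xy(1)]] by simp
qed

lemma closes_ends:
  assumes n: "2 \<le> n" and S: "S \<in> P" "1 \<in> S" "n \<in> S"
  shows "closes (2 * n) r (\<theta> 1) (\<theta> n)"
proof (rule closesI)
  have m: "\<theta> n < 2 * n" using n e01 by auto
  have r1n: "(\<theta> 1, \<theta> n) \<in> r" using r_iff[of 1 n] S n by auto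
  show "\<theta> 1 < \<theta> n" "\<theta> n \<le> 2 * n" "even (\<theta> n - \<theta> 1)" using n m by auto
  show "(\<theta> 1, \<theta> n mod (2 * n)) \<in> r" using r1n m by simp
  fix x y assume xy: "(x, y) \<in> r" "\<theta> 1 \<le> x" "x < \<theta> n" "y < \<theta> 1 \<or> \<theta> n \<le> y"
  obtain c d where cd: "c \<in> {1..n}" "d \<in> {1..n}" "x = \<theta> c" "y = \<theta> d" using mem_theta[OF xy(1)] by blast
  then have "d = n" using xy(4) by auto
  then have "(x, \<theta> n) \<in> r" using xy(1) cd by simp
  then show "(x, \<theta> 1) \<in> r" by (rule trans_r[OF _ sym_r[OF r1n]])
qed

lemma pure_if_purely_crossing:
  assumes pc: "P \<in> purely_crossing n" and n: "2 \<le> n"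
  shows "pure (2 * n) r"
  unfolding pure_def
proof (intro allI impI)
  fix u v assume c: "closes (2 * n) r u v"
  note a = purely_crossingD(2)[OF pc] and b = purely_crossingD(3)[OF pc] and b' = purely_crossingD(4)[OF pc]
  note C = closesD[OF c]
  show "u = 0 \<and> v = 2 * n \<or> (u, u) \<in> r \<and> v - u \<noteq> 2 \<and> v - u \<noteq> 2 * n - 2"
  proof (cases "u = 0 \<and> v = 2 * n")
    case nt: False
    have th: "(u, u) \<in> r"
    proof (rule ccontr)
      assume "(u, u) \<notin> r"
      then have "u mod 2 \<noteq> e" using refl_r C by auto
      then obtain x where x: "u + 1 = 2 * x + e" using e01
        by (metis (no_types) add.commute add_0 even_Suc_div_two even_add even_mult_iff mod2_eq_if oddE one_add_one plus_1_eq_Suc dvd_mult_div_cancel evenE)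
      obtain q where q: "v = u + 2 * q" using C(1,3) by (metis dvdE le_add_diff_inverse less_imp_le)
      have q0: "0 < q" using q C(1) by simp
      have xq: "x + q \<le> n" using q C(2) x e01 by auto
      have x0: "e = 0 \<Longrightarrow> 0 < x" using x by auto
      have "splits {x+1..x+q} P"
        using closes_interval[of x "x + q" u] c q q0 xq x x0 by simp
      moreover have "q < n" using nt q x xq x0 e01 by (cases "q = n") auto
      ultimately show False using a q0 xq by simp
    qed
    then obtain x where x: "x \<in> {1..n}" "u = \<theta> x" using theta_of by blast
    have uv: "(u, v mod (2 * n)) \<in> r" using C(4)[OF th] .
    have "v - u \<noteq> 2"
    proof
      assume "v - u = 2"
      then have v: "v = \<theta> x + 2" using x(2) C(1) by linarith
      show False
      proof (cases "x = n")
        case True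
        then have "e = 0" using v C(2) x e01 by auto
        then have "v = 2 * n" "\<theta> 1 = 0" using v True n by auto
        then have "v mod (2 * n) = \<theta> 1" by (simp only: mod_self)
        then obtain S where "S \<in> P" "n \<in> S" "1 \<in> S" using uv r_iff[of n 1] x True n by auto
        then show False using b' by blast
      next
        case False
        then have "v = \<theta> (x + 1)" "\<theta> (x + 1) < 2 * n" and xn: "x \<in> {1..n-1}" using v x e01 by auto
        then have "v mod (2 * n) = \<theta> (x + 1)" by (simp only: mod_less)
        then have "(\<theta> x, \<theta> (x + 1)) \<in> r" using uv x by simp
        then obtain S where "S \<in> P" "x \<in> S" "x + 1 \<in> S" using r_iff[of x "x + 1"] x False by auto
        then show False using b[of S x] xn by blast
      qed
    qed
    moreover have "v - u \<noteq> 2 * n - 2"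
    proof
      assume d: "v - u = 2 * n - 2"
      have "u = 0 \<or> u = 1 \<or> u = 2" using d C(2) C(1) by linarith
      then have "x = 1 \<or> x = 2 \<and> e = 0" using x e01 by auto
      then show False
      proof
        assume "x = 1"
        then have "v = \<theta> n" "\<theta> n < 2 * n" using x d C(1) n e01 by auto
        then have "v mod (2 * n) = \<theta> n" by (simp only: mod_less)
        then have "(\<theta> 1, \<theta> n) \<in> r" using uv x \<open>x = 1\<close> by simp
        then obtain S where "S \<in> P" "1 \<in> S" "n \<in> S" using r_iff[of 1 n] n by auto
        then show False using b' by blast
      next
        assume x2: "x = 2 \<and> e = 0"
        then have "v = 2 * n" using x d C(1) n by auto
        then have "(\<theta> 2, \<theta> 1) \<in> r" using uv x x2 by simp
        then obtain S where "S \<in> P" "2 \<in> S" "1 \<in> S" using r_iff[of 2 1] n by auto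
        moreover have "1 \<in> {1..n-1}" using n by auto
        ultimately have "\<not> (1 \<in> S \<and> 1 + 1 \<in> S)" by (intro b)
        then show False using \<open>1 \<in> S\<close> \<open>2 \<in> S\<close> by (simp only: one_add_one simp_thms)
      qed
    qed
    ultimately show ?thesis using th by blast
  qed simp
qed

text \<open>
  An arc cannot pass through the point \<open>0\<close>. For even slots, a splitting interval
  \<open>{1..q}\<close> has to be replaced by its complement, which splits as well.
\<close>

lemma purely_crossing_if_pure:
  assumes pu: "pure (2 * n) r" and n: "2 \<le> n"
  shows "P \<in> purely_crossing n"
proof -
  have spl: "\<not> splits {a+1..b} P" if "a < b" "b \<le> n" "b - a < n" "e = 0 \<Longrightarrow> 0 < a" for a b
  proof
    assume sp: "splits {a+1..b} P"
    have "0 < 2 * a + e" using that(4) e01 by auto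
    then obtain w where w: "w + 1 = 2 * a + e" by (metis Suc_eq_plus1 gr0_implies_Suc)
    have c: "closes (2 * n) r w (w + 2 * (b - a))"
      using closes_interval[OF that(1,2,4) w] sp by simp
    have nt: "\<not> (w = 0 \<and> w + 2 * (b - a) = 2 * n)" using that(3) by auto
    have "w mod 2 = e" using pureD(1)[OF pu c nt] mem_r by blast
    then show False using w e01 by presburger
  qed
  have "\<not> splits {p+1..p+q} P" if pq: "p < p + q" "p + q \<le> n" "q < n" for p q
  proof (cases "e = 0 \<and> p = 0")
    case False
    then show ?thesis using spl[of p "p + q"] pq by auto
  next
    case True
    have "\<not> splits {q+1..n} P" using spl[of q n] pq True by auto
    moreover have "splits {1..q} P \<Longrightarrow> splits {q+1..n} P"
    proof -
      assume s: "splits {1..q} P"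
      have sub: "{1..q} \<subseteq> {1..n}" "{q+1..n} \<subseteq> {1..n}" using pq by auto
      have comp: "x \<in> {q+1..n} \<longleftrightarrow> x \<notin> {1..q}" if "x \<in> {1..n}" for x using that by auto
      show ?thesis unfolding splits_iff[OF P sub(2)]
      proof (intro ballI impI)
        fix S x y assume S: "S \<in> P" "x \<in> S" "y \<in> S" "x \<in> {q+1..n}"
        have "x \<in> {1..n}" "y \<in> {1..n}" using partitionsD(1)[OF P S(1)] S by auto
        then show "y \<in> {q+1..n}" using s S comp unfolding splits_iff[OF P sub(1)] by blast
      qed
    qed
    ultimately show ?thesis using True by auto
  qed
  moreover have "\<not> (k \<in> S \<and> k + 1 \<in> S)" if S: "S \<in> P" and k: "k \<in> {1..n-1}" for S k
  proof
    assume "k \<in> S \<and> k + 1 \<in> S"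
    then have "k \<in> {1..n}" "k \<in> S" "(if k = n then 1 else k + 1) \<in> S" "e = 1 \<Longrightarrow> k < n" using k by auto
    then have c: "closes (2 * n) r (\<theta> k) (\<theta> k + 2)"
      by (intro closes_neighbours[OF _ n S])
    have "\<not> (\<theta> k = 0 \<and> \<theta> k + 2 = 2 * n)" using n by auto
    from pureD(2)[OF pu c this] show False by simp
  qed
  moreover have "\<not> (1 \<in> S \<and> n \<in> S)" if S: "S \<in> P" for S
  proof
    assume "1 \<in> S \<and> n \<in> S"
    then have c: "closes (2 * n) r (\<theta> 1) (\<theta> n)" using closes_ends[OF n S] by blast
    have "\<not> (\<theta> 1 = 0 \<and> \<theta> n = 2 * n)" using n e01 by auto
    from pureD(3)[OF pu c this] show False using n by auto
  qed
  ultimately show ?thesis by (intro purely_crossingI P)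
qed

lemma purely_crossing_iff: "2 \<le> n \<Longrightarrow> P \<in> purely_crossing n \<longleftrightarrow> pure (2 * n) r"
  using pure_if_purely_crossing purely_crossing_if_pure by blast

end

lemma purely_crossing_no_singleton:
  assumes "P \<in> purely_crossing n" "2 \<le> n" "S \<in> P" "a \<in> S"
  shows "\<exists>b\<in>S. b \<noteq> a"
proof (rule ccontr)
  assume "\<not> ?thesis"
  then have S: "S = {a}" using assms by blast
  have P: "P \<in> partitions n" using assms by (simp add: purely_crossing_def)
  have a: "a \<in> {1..n}" using partitionsD(1)[OF P assms(3)] assms(4) by blast
  have "\<not> splits {(a-1)+1..(a-1)+1} P"
    by (rule purely_crossingD(2)[OF assms(1)]) (use a assms(2) in auto)
  moreover have "{(a-1)+1..(a-1)+1} = {a}" using a by auto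
  moreover have "splits {a} P"
    unfolding splits_def by (rule exI[of _ "{S}"]) (use S assms(3) in simp)
  ultimately show False by simp
qed

text \<open>
  There are no singletons, as they would be splitting intervals, and no two cyclic neighbours in
  one block.
\<close>

lemma purely_crossing_small:
  shows "purely_crossing 2 = {}" "purely_crossing 3 = {}" "purely_crossing 5 = {}" "purely_crossing 4 \<subseteq> {pi4}"
proof -
  have D: "P \<in> partitions n" "\<And>S k. S \<in> P \<Longrightarrow> k \<in> {1..n-1} \<Longrightarrow> k \<in> S \<Longrightarrow> k + 1 \<notin> S"
    "\<And>S. S \<in> P \<Longrightarrow> 1 \<in> S \<Longrightarrow> n \<notin> S" "\<And>S. S \<in> P \<Longrightarrow> S \<subseteq> {1..n}" if "P \<in> purely_crossing n" for P n
  proof -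
    show "P \<in> partitions n" by (rule purely_crossingD(1)[OF that])
    then show "\<And>S. S \<in> P \<Longrightarrow> S \<subseteq> {1..n}" by (rule partitionsD(1))
    show "\<And>S k. S \<in> P \<Longrightarrow> k \<in> {1..n-1} \<Longrightarrow> k \<in> S \<Longrightarrow> k + 1 \<notin> S" using purely_crossingD(3)[OF that] by blast
    show "\<And>S. S \<in> P \<Longrightarrow> 1 \<in> S \<Longrightarrow> n \<notin> S" using purely_crossingD(4)[OF that] by blast
  qed
  show "purely_crossing 2 = {}"
  proof (rule ccontr)
    assume "purely_crossing 2 \<noteq> {}"
    then obtain P where P: "P \<in> purely_crossing 2" by blast
    obtain S where S: "S \<in> P" "1 \<in> S" using partitionsD(5)[OF D(1)[OF P], of 1] by auto
    obtain b where "b \<in> S" "b \<noteq> 1" using purely_crossing_no_singleton[OF P _ S] by auto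
    then have "b \<in> {1..2}" using D(4)[OF P S(1)] by blast
    then have "b = 2" using \<open>b \<noteq> 1\<close> by auto
    then show False using D(3)[OF P S] \<open>b \<in> S\<close> by simp
  qed
  show "purely_crossing 3 = {}"
  proof (rule ccontr)
    assume "purely_crossing 3 \<noteq> {}"
    then obtain P where P: "P \<in> purely_crossing 3" by blast
    obtain S where S: "S \<in> P" "1 \<in> S" using partitionsD(5)[OF D(1)[OF P], of 1] by auto
    obtain b where b: "b \<in> S" "b \<noteq> 1" using purely_crossing_no_singleton[OF P _ S] by auto
    have "b \<in> {1..3}" using D(4)[OF P S(1)] b by blast
    then have "b = 2 \<or> b = 3" using b by auto
    then show False using D(3)[OF P S] D(2)[OF P S(1), of 1] S(2) b by (auto simp: numeral_2_eq_2)
  qed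
  have ex: "\<exists>S\<in>P. \<exists>b\<in>{1..n}. a \<in> S \<and> b \<in> S \<and> b \<noteq> a" if P: "P \<in> purely_crossing n" "2 \<le> n" and a: "a \<in> {1..n}" for P n a
  proof -
    obtain S where S: "S \<in> P" "a \<in> S" using partitionsD(5)[OF D(1)[OF P(1)] a] by auto
    then show ?thesis using purely_crossing_no_singleton[OF P S] D(4)[OF P(1) S(1)] by blast
  qed
  show "purely_crossing 5 = {}"
  proof (rule ccontr)
    assume "purely_crossing 5 \<noteq> {}"
    then obtain P where P: "P \<in> purely_crossing 5" by blast
    define R where "R = (\<lambda>a b. \<exists>S\<in>P. a \<in> S \<and> b \<in> S)"
    have sym: "R a b \<Longrightarrow> R b a" for a b unfolding R_def by blast
    have tr: "R a b \<Longrightarrow> R b c \<Longrightarrow> R a c" for a b c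
      unfolding R_def using partitionsD(4)[OF D(1)[OF P]] by blast
    have n1: "\<not> R 1 2" using D(2)[OF P, of _ 1] unfolding R_def by (auto simp: numeral_2_eq_2)
    have n2: "\<not> R 2 3" using D(2)[OF P, of _ 2] unfolding R_def by auto
    have n3: "\<not> R 3 4" using D(2)[OF P, of _ 3] unfolding R_def by auto
    have n4: "\<not> R 4 5" using D(2)[OF P, of _ 4] unfolding R_def by auto
    have n5: "\<not> R 1 5" using D(3)[OF P] unfolding R_def by auto
    have pr: "R a 1 \<and> 1 \<noteq> a \<or> R a 2 \<and> 2 \<noteq> a \<or> R a 3 \<and> 3 \<noteq> a \<or> R a 4 \<and> 4 \<noteq> a \<or> R a 5 \<and> 5 \<noteq> a"
      if a: "a \<in> {1..5}" for a
    proof -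
      obtain S b where S: "S \<in> P" "a \<in> S" "b \<in> S" "b \<noteq> a" and b: "b \<in> {1..5}" using ex[OF P _ a] by auto
      have "R a b" unfolding R_def using S by blast
      moreover have "b = 1 \<or> b = 2 \<or> b = 3 \<or> b = 4 \<or> b = 5" using b by auto
      ultimately show ?thesis using S(4) by blast
    qed
    \<comment> \<open>The admissible pairs form a cycle of length five, in which two neighbours
      of a vertex are themselves forbidden as a pair. So the blocks would be a perfect matching of
      five elements.\<close>
    note nn = n1 n2 n3 n4 n5 sym[of 2 1] sym[of 3 2] sym[of 4 3] sym[of 5 4] sym[of 5 1]
    have "R 1 3 \<or> R 1 4" using pr[of 1] nn by auto
    moreover have "R 2 4 \<or> R 2 5" using pr[of 2] nn by auto
    moreover have "R 3 1 \<or> R 3 5" using pr[of 3] nn by auto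
    moreover have "R 4 1 \<or> R 4 2" using pr[of 4] nn by auto
    moreover have "R 5 2 \<or> R 5 3" using pr[of 5] nn by auto
    moreover have "\<not> (R 1 3 \<and> R 1 4)" "\<not> (R 2 4 \<and> R 2 5)" "\<not> (R 3 1 \<and> R 3 5)" "\<not> (R 4 1 \<and> R 4 2)" "\<not> (R 5 2 \<and> R 5 3)"
      using nn tr[OF sym, of 1 3 4] tr[OF sym, of 2 4 5] tr[OF sym, of 3 1 5] tr[OF sym, of 4 1 2] tr[OF sym, of 5 2 3] by argo+
    ultimately show False
      using sym[of 1 3] sym[of 3 1] sym[of 1 4] sym[of 4 1] sym[of 2 4] sym[of 4 2] sym[of 2 5] sym[of 5 2] sym[of 3 5] sym[of 5 3]
      by argo
  qed
  show "purely_crossing 4 \<subseteq> {pi4}"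
  proof
    fix P assume P: "P \<in> purely_crossing 4"
    define R where "R = (\<lambda>a b. \<exists>S\<in>P. a \<in> S \<and> b \<in> S)"
    have sym: "R 2 1 = R 1 2" "R 3 1 = R 1 3" "R 4 1 = R 1 4" "R 3 2 = R 2 3" "R 4 2 = R 2 4" "R 4 3 = R 3 4"
      unfolding R_def by blast+
    have rf: "R a a" if "a \<in> {1..4}" for a using partitionsD(5)[OF D(1)[OF P] that] unfolding R_def by blast
    have n1: "\<not> R 1 2" using D(2)[OF P, of _ 1] unfolding R_def by (auto simp: numeral_2_eq_2)
    have n2: "\<not> R 2 3" using D(2)[OF P, of _ 2] unfolding R_def by auto
    have n3: "\<not> R 3 4" using D(2)[OF P, of _ 3] unfolding R_def by auto
    have n4: "\<not> R 1 4" using D(3)[OF P] unfolding R_def by auto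
    have four: "{1..4} = {1,2,3,4::nat}" by auto
    have pr: "R a 1 \<and> 1 \<noteq> a \<or> R a 2 \<and> 2 \<noteq> a \<or> R a 3 \<and> 3 \<noteq> a \<or> R a 4 \<and> 4 \<noteq> a" if a: "a \<in> {1..4}" for a
    proof -
      obtain S b where S: "S \<in> P" "a \<in> S" "b \<in> S" "b \<noteq> a" and b: "b \<in> {1..4}" using ex[OF P _ a] by auto
      have "R a b" unfolding R_def using S by blast
      moreover have "b = 1 \<or> b = 2 \<or> b = 3 \<or> b = 4" using b by auto
      ultimately show ?thesis using S(4) by blast
    qed
    have p1: "R 1 3" using pr[of 1] n1 n4 by auto
    have p2: "R 2 4" using pr[of 2] n1 n2 sym by auto
    have "P = pi4"
    proof (rule partition_on_eq_iff_rel[of "{1..4}"])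
      show "partition_on {1..4} P" using D(1)[OF P] by (simp add: partitions_def)
      show "partition_on {1..4} pi4" unfolding pi4_def four by (auto simp: partition_on_def disjoint_def)
      fix x y :: nat assume xy: "x \<in> {1..4}" "y \<in> {1..4}"
      have "R x y \<longleftrightarrow> (\<exists>S\<in>pi4. x \<in> S \<and> y \<in> S)"
      proof -
        have rr: "R 1 1" "R 2 2" "R 3 3" "R 4 4" by (rule rf, simp)+
        have x: "x = 1 \<or> x = 2 \<or> x = 3 \<or> x = 4" and y: "y = 1 \<or> y = 2 \<or> y = 3 \<or> y = 4"
          using xy by auto
        show ?thesis
          using x y by (elim disjE; simp add: pi4_def rr n1 n2 n3 n4 p1 p2 sym del: One_nat_def)
      qed
      then show "(\<exists>S\<in>P. x \<in> S \<and> y \<in> S) \<longleftrightarrow> (\<exists>S\<in>pi4. x \<in> S \<and> y \<in> S)" unfolding R_def .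
    qed
    then show "P \<in> {pi4}" by simp
  qed
qed

lemma pi4_purely_crossing: "pi4 \<in> purely_crossing 4"
proof -
  have four: "{1..4} = {1,2,3,4::nat}" by auto
  have P: "pi4 \<in> partitions 4"
    unfolding partitions_def pi4_def four by (auto simp: partition_on_def disjoint_def)
  have "\<not> splits {p+1..p+q} pi4" if pq: "p < p + q" "p + q \<le> 4" "q < 4" for p q
  proof
    assume s: "splits {p+1..p+q} pi4"
    have sub: "{p+1..p+q} \<subseteq> {1..4}" using pq by auto
    have c: "1 \<in> {p+1..p+q} \<longleftrightarrow> 3 \<in> {p+1..p+q}" "2 \<in> {p+1..p+q} \<longleftrightarrow> 4 \<in> {p+1..p+q}"
      using s[unfolded splits_iff[OF P sub]] unfolding pi4_def by auto
    then show False using pq by auto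
  qed
  moreover have "\<forall>S\<in>pi4. (\<forall>k\<in>{1..4-1}. \<not> (k \<in> S \<and> k + 1 \<in> S)) \<and> \<not> (1 \<in> S \<and> 4 \<in> S)"
    unfolding pi4_def by auto
  ultimately show ?thesis by (intro purely_crossingI P) auto
qed

text \<open>
  Arcs of the two parts are arcs of the whole word. An arc of a part which misses only two
  letters of that part has a complement of length two within it, or would extend to an arc of
  the whole word that misses two letters; either is excluded.
\<close>

lemma (in closed_arc) pure_parts:
  assumes pu: "pure (2 * n) r" and pp: "(p, p) \<in> r"
  shows "pure (2 * k) (inner r p (2 * k))" and "pure (2 * (n - k)) (outer r p (2 * k))"
proof -
  have p2: "p mod 2 = parity_of i" using refl_r pp by blast
  have m: "2 * n - 2 * k = 2 * (n - k)" by (simp add: diff_mult_distrib2)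
  interpret I: slot_rel "parity_of (shift_idx i p)" "2 * k" "inner r p (2 * k)" by (rule inner_rel)
  interpret O: slot_rel "parity_of i" "2 * (n - k)" "outer r p (2 * k)" by (rule outer_rel)
  have cin: "closes (2 * n) r (p + u) (p + v)" if "closes (2 * k) (inner r p (2 * k)) u v" for u v
    using closes_inner[OF c, of u v] closes_bounds[OF that] that by simp
  have in0: "(0, 0) \<in> inner r p (2 * k)" using pp k by (simp add: inner_def)
  have inT: "(u, u) \<in> inner r p (2 * k)" and in2: "v - u \<noteq> 2"
    if a: "closes (2 * k) (inner r p (2 * k)) u v" "\<not> (u = 0 \<and> v = 2 * k)" for u v
  proof -
    have nt: "\<not> (p + u = 0 \<and> p + v = 2 * n)" using closes_bounds[OF a(1)] k by auto
    show "(u, u) \<in> inner r p (2 * k)"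
      using pureD(1)[OF pu cin[OF a(1)] nt] closes_bounds[OF a(1)] by (simp add: inner_def)
    show "v - u \<noteq> 2" using pureD(2)[OF pu cin[OF a(1)] nt] by simp
  qed
  have c2: "\<not> closes (2 * k) (inner r p (2 * k)) u (u + 2)" if "2 < 2 * k" for u
  proof
    assume "closes (2 * k) (inner r p (2 * k)) u (u + 2)"
    moreover have "\<not> (u = 0 \<and> u + 2 = 2 * k)" using that by auto
    ultimately show False using in2[of u "u + 2"] by simp
  qed
  show "pure (2 * k) (inner r p (2 * k))"
    unfolding pure_def
  proof (intro allI impI)
    fix u v assume a: "closes (2 * k) (inner r p (2 * k)) u v"
    show "u = 0 \<and> v = 2 * k \<or> (u, u) \<in> inner r p (2 * k) \<and> v - u \<noteq> 2 \<and> v - u \<noteq> 2 * k - 2"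
    proof (cases "u = 0 \<and> v = 2 * k")
      case nt: False
      have b: "u < v" "v \<le> 2 * k" using closes_bounds[OF a] by auto
      have "v - u \<noteq> 2 * k - 2"
      proof
        assume d: "v - u = 2 * k - 2"
        then have k2: "2 < 2 * k" using b by auto
        have "u mod 2 = 0" using I.refl_r[of u] I.refl_r[of 0] inT[OF a nt] in0 by auto
        then have "u = 0 \<or> u = 2" using d b by presburger
        then show False
        proof
          assume "u = 0"
          then have "v = 2 * k - 2" using d by simp
          then have "closes (2 * k) (inner r p (2 * k)) (2 * k - 2) (2 * k)"
            using I.arc_left[OF I.arc_full, of v] a \<open>u = 0\<close> k2 by simp
          moreover have "2 * k - 2 + 2 = 2 * k" using k2 by simp
          ultimately show False using c2[OF k2, of "2 * k - 2"] by (simp only: not_True_eq_False)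
        next
          assume "u = 2"
          then have "v = 2 * k" using d b by simp
          then have "closes (2 * k) (inner r p (2 * k)) 0 2"
            using I.arc_right[OF I.arc_full, of u] a \<open>u = 2\<close> k2 by simp
          then show False using c2[OF k2, of 0] by (simp only: add_0 not_True_eq_False)
        qed
      qed
      then show ?thesis using inT[OF a nt] in2[OF a nt] by blast
    qed simp
  qed
  define lu lv where "lu = (\<lambda>u. if u < p then u else u + 2 * k)" and "lv = (\<lambda>v. if v \<le> p then v else v + 2 * k)"
  have cout: "closes (2 * n) r (lu u) (lv v)" if "closes (2 * (n - k)) (outer r p (2 * k)) u v" for u v
    using closes_outer[OF c, of u v] closes_bounds[OF that] that k unfolding m lu_def lv_def by simp
  have ont: "\<not> (lu u = 0 \<and> lv v = 2 * n)" if "\<not> (u = 0 \<and> v = 2 * (n - k))" "closes (2 * (n - k)) (outer r p (2 * k)) u v" for u v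
    using that closes_bounds[OF that(2)] k p_le by (auto simp: lu_def lv_def split: if_splits)
  have outT: "(u, u) \<in> outer r p (2 * k)" and out2: "v - u \<noteq> 2"
    if a: "closes (2 * (n - k)) (outer r p (2 * k)) u v" "\<not> (u = 0 \<and> v = 2 * (n - k))" for u v
  proof -
    have lus: "lu u = skip p (2 * k) u" by (simp add: lu_def skip_def)
    show t: "(u, u) \<in> outer r p (2 * k)"
      using pureD(1)[OF pu cout[OF a(1)] ont[OF a(2,1)]] unfolding lus by (simp add: outer_def)
    have u2: "u mod 2 = parity_of i" using O.refl_r t by blast
    show "v - u \<noteq> 2"
    proof
      assume d: "v - u = 2"
      have "\<not> (u < p \<and> p < v)"
      proof
        assume "u < p \<and> p < v"
        then have "p = u + 1" using d by auto
        then show False using u2 p2 by presburger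
      qed
      then have "lv v - lu u = 2" using d closes_bounds[OF a(1)] by (auto simp: lu_def lv_def)
      then show False using pureD(2)[OF pu cout[OF a(1)] ont[OF a(2,1)]] by simp
    qed
  qed
  have c2': "\<not> closes (2 * (n - k)) (outer r p (2 * k)) u (u + 2)" if "2 < 2 * (n - k)" for u
  proof
    assume "closes (2 * (n - k)) (outer r p (2 * k)) u (u + 2)"
    moreover have "\<not> (u = 0 \<and> u + 2 = 2 * (n - k))" using that by auto
    ultimately show False using out2[of u "u + 2"] by simp
  qed
  show "pure (2 * (n - k)) (outer r p (2 * k))"
    unfolding pure_def
  proof (intro allI impI)
    fix u v assume a: "closes (2 * (n - k)) (outer r p (2 * k)) u v"
    let ?M = "2 * (n - k)"
    show "u = 0 \<and> v = ?M \<or> (u, u) \<in> outer r p (2 * k) \<and> v - u \<noteq> 2 \<and> v - u \<noteq> ?M - 2"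
    proof (cases "u = 0 \<and> v = ?M")
      case nt: False
      have b: "u < v" "v \<le> ?M" using closes_bounds[OF a] by auto
      have u2: "u mod 2 = parity_of i" using O.refl_r outT[OF a nt] by blast
      have "v - u \<noteq> ?M - 2"
      proof
        assume d: "v - u = ?M - 2"
        then have k2: "2 < ?M" using b by auto
        have pM: "p \<le> ?M" using p_le by (simp add: diff_mult_distrib2)
        have "u = 0 \<or> u = 1 \<or> u = 2" using d b by linarith
        then consider "u = 0" | "u = 1" | "u = 2" by blast
        then show False
        proof cases
          case 1
          then have "closes ?M (outer r p (2 * k)) (?M - 2) ?M"
            using O.arc_left[OF O.arc_full, of v] a d b k2 by simp
          moreover have "?M - 2 + 2 = ?M" using k2 by simp
          ultimately show False using c2'[OF k2, of "?M - 2"] by (simp only: not_True_eq_False)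
        next
          case 3
          then have "v = ?M" using d b by simp
          then have "closes ?M (outer r p (2 * k)) 0 2"
            using O.arc_right[OF O.arc_full, of u] a 3 k2 by simp
          then show False using c2'[OF k2, of 0] by (simp only: add_0 not_True_eq_False)
        next
          case 2
          then have v: "v = ?M - 1" using d b by simp
          have podd: "p mod 2 = 1" using p2 u2 2 by simp
          consider "u < p" "p < v" | "v \<le> p" | "p \<le> u" by linarith
          then show False
          proof cases
            case 1
            then have "lv v - lu u = 2 * n - 2" using v \<open>u = 1\<close> k by (auto simp: lu_def lv_def)
            then show False using pureD(3)[OF pu cout[OF a] ont[OF nt a]] by simp
          next
            case vp: 2
            have "p \<noteq> ?M" using podd by presburger
            then have pv: "p = v" using vp v pM by simp
            then have "closes (2 * n) r 1 p" using cout[OF a] \<open>u = 1\<close> b by (simp add: lu_def lv_def)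
            then have "closes (2 * n) r 1 (p + 2 * k)" using arc_join c by blast
            from pureD(3)[OF pu this] show False using pv v k k2 by auto
          next
            case pu': 3
            then have p1: "p = 1" using podd \<open>u = 1\<close> by (cases "p = 0") auto
            then have "closes (2 * n) r (p + 2 * k) (v + 2 * k)" using cout[OF a] \<open>u = 1\<close> b by (simp add: lu_def lv_def)
            then have "closes (2 * n) r p (v + 2 * k)" using arc_join c by blast
            from pureD(3)[OF pu this] show False using p1 v k k2 by auto
          qed
        qed
      qed
      then show ?thesis using outT[OF a nt] out2[OF a nt] by blast
    qed simp
  qed
qed

lemma cscale_algebra:
  "(c *\<^sub>C f) * g = c *\<^sub>C (f * g)" "f * (c *\<^sub>C g) = c *\<^sub>C (f * g)"
  "c *\<^sub>C (d *\<^sub>C f) = (c * d) *\<^sub>C f" "1 *\<^sub>C f = f"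
  by (transfer; force simp: algebra_simps)+

section \<open>Irreducible and purely crossing partitions of small size\<close>

definition irreducible :: "nat \<Rightarrow> (nat \<times> nat) set \<Rightarrow> bool" where
  "irreducible m r \<longleftrightarrow> (\<forall>u v. closes m r u v \<longrightarrow> u = 0 \<and> v = m)"

lemma irreducible_pure: "irreducible m r \<Longrightarrow> pure m r"
  unfolding irreducible_def pure_def by blast

lemma rels_irreducible:
  assumes n: "1 \<le> n"
  shows "rels_of_type i n {{1..2*n}} = {r. slot_rel (parity_of i) (2*n) r \<and> irreducible (2*n) r}"
proof -
  have eq: "atoms (2*n) (closes (2*n) r) = {{1..2*n}} \<longleftrightarrow> irreducible (2*n) r"
    if sr: "slot_rel (parity_of i) (2*n) r" for r
  proof -
    interpret L: slot_rel "parity_of i" "2*n" r by (rule sr)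
    show ?thesis unfolding irreducible_def by (rule atoms_trivial_iff[OF L.arcs_axioms]) (use n in simp)
  qed
  show ?thesis unfolding rels_of_type_def by (rule Collect_cong, rule conj_cong, rule HOL.refl, rule eq)
qed

lemma slot_rel_partition:
  assumes "slot_rel (parity_of i) (2*n) r"
  obtains P where "P \<in> partitions n" "r = slot_rel_of (parity_of i) P"
proof -
  have "r \<in> slot_rel_of (parity_of i) ` partitions n"
    unfolding bij_betw_imp_surj_on[OF bij_slot_rel_of[of "parity_of i" n, OF parity_of_simps(3)]]
    using assms by (rule CollectI)
  then show thesis using that by (elim imageE) 
qed

lemma sum_purely_crossing:
  assumes n: "2 \<le> n"
  shows "(\<Sum>P\<in>purely_crossing n. partition_term i n P b) =
    (\<Sum>r | slot_rel (parity_of i) (2*n) r \<and> pure (2*n) r. rel_term i n r b)"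
proof -
  let ?g = "slot_rel_of (parity_of i)"
  note bij = bij_slot_rel_of[of "parity_of i" n, OF parity_of_simps(3)]
  have iff: "P \<in> purely_crossing n \<longleftrightarrow> pure (2*n) (?g P)" and sr: "slot_rel (parity_of i) (2*n) (?g P)"
    if PP: "P \<in> partitions n" for P
  proof -
    interpret L: partition_slots i n P by (rule partition_slots.intro[OF PP]) (use n in simp)
    show "P \<in> purely_crossing n \<longleftrightarrow> pure (2*n) (?g P)" by (rule L.purely_crossing_iff[OF n])
    show "slot_rel (parity_of i) (2*n) (?g P)" by (rule L.slot_rel_axioms)
  qed
  have im: "?g ` purely_crossing n = {r. slot_rel (parity_of i) (2*n) r \<and> pure (2*n) r}"
  proof (intro set_eqI iffI)
    fix r assume "r \<in> ?g ` purely_crossing n"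
    then obtain P where P: "r = ?g P" "P \<in> purely_crossing n" by (rule imageE)
    note PP = purely_crossingD(1)[OF P(2)]
    show "r \<in> {r. slot_rel (parity_of i) (2*n) r \<and> pure (2*n) r}"
      unfolding P(1) mem_Collect_eq by (rule conjI[OF sr[OF PP] iffD1[OF iff[OF PP] P(2)]])
  next
    fix r assume r: "r \<in> {r. slot_rel (parity_of i) (2*n) r \<and> pure (2*n) r}"
    then have srr: "slot_rel (parity_of i) (2*n) r" and pu: "pure (2*n) r" by simp_all
    obtain P where P: "P \<in> partitions n" "r = ?g P" by (rule slot_rel_partition[OF srr])
    have "P \<in> purely_crossing n" using iff[OF P(1)] pu unfolding P(2) by (rule iffD2)
    then show "r \<in> ?g ` purely_crossing n" unfolding P(2) by (rule imageI)
  qed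
  have inj: "inj_on ?g (purely_crossing n)"
    by (rule inj_on_subset[OF bij_betw_imp_inj_on[OF bij]], rule subsetI, rule purely_crossingD(1))
  show ?thesis
    unfolding im[symmetric] sum.reindex[OF inj] o_def
    by (rule sum.cong[OF HOL.refl], rule rel_term_slot_rel_of[symmetric], rule purely_crossingD(1))
qed

text \<open>
  \<open>PC(2)\<close> and \<open>PC(3)\<close> are empty, and \<open>PC(4)\<close> consists of
  \<open>{{1,3},{2,4}}\<close> only.
\<close>

lemma pure_size:
  assumes sr: "slot_rel (parity_of i) (2*n) r" and pu: "pure (2*n) r" and n: "2 \<le> n"
  shows "4 \<le> n" and "n = 4 \<Longrightarrow> r = slot_rel_of (parity_of i) pi4"
proof -
  obtain P where P: "P \<in> partitions n" "r = slot_rel_of (parity_of i) P" by (rule slot_rel_partition[OF sr])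
  interpret L: partition_slots i n P by (rule partition_slots.intro[OF P(1)]) (use n in simp)
  have pc: "P \<in> purely_crossing n" using L.purely_crossing_iff[OF n] pu unfolding P(2) by (rule iffD2)
  show "4 \<le> n"
  proof (rule ccontr)
    assume "\<not> 4 \<le> n"
    then have "n = 2 \<or> n = 3" using n by linarith
    then show False
    proof
      assume "n = 2"
      then show False using pc purely_crossing_small(1) by simp
    next
      assume "n = 3"
      then show False using pc purely_crossing_small(2) by simp
    qed
  qed
  show "r = slot_rel_of (parity_of i) pi4" if n4: "n = 4"
  proof -
    have "P \<in> {pi4}" by (rule subsetD[OF purely_crossing_small(4)]) (use pc n4 in simp)
    then show ?thesis using P(2) by simp
  qed
qed

text \<open>
  Both parts at an arc between slots are purely crossing and of size at least two, hence of size
  at least four. This is where the bound in the theorem comes from: arcs of this kind need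
  \<open>n \<ge> 8\<close>.
\<close>

lemma pure_arc:
  assumes sr: "slot_rel (parity_of i) (2*n) r" and pu: "pure (2*n) r" and n: "2 \<le> n"
    and c: "closes (2*n) r u v" and nt: "\<not> (u = 0 \<and> v = 2*n)"
  obtains k where "closed_arc i n k u r" "v = u + 2*k" "4 \<le> k" "4 \<le> n - k"
    "pure (2*k) (inner r u (2*k))" "pure (2*(n-k)) (outer r u (2*k))" "u mod 2 = parity_of i"
proof -
  interpret L: slot_rel "parity_of i" "2*n" r by (rule sr)
  note C = L.closesD[OF c]
  define k where "k = (v - u) div 2"
  have d: "v - u = 2 * k" using C(3) by (simp add: k_def)
  then have v: "v = u + 2*k" using C(1) by simp
  have uu: "(u, u) \<in> r" by (rule pureD(1)[OF pu c nt])
  have kn: "0 < k" "u + 2 * k \<le> 2 * n" using v C(1,2) by simp_all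
  have "k \<noteq> n" using nt v kn by auto
  moreover have "k \<noteq> 1" using pureD(2)[OF pu c nt] d by auto
  moreover have "k \<noteq> n - 1" using pureD(3)[OF pu c nt] d by (auto simp: diff_mult_distrib2)
  ultimately have k2: "2 \<le> k" "2 \<le> n - k" "k < n" using kn by linarith+
  have ca: "closed_arc i n k u r" by (rule closed_arc.intro[OF sr kn(1) k2(3)]) (use c v in simp)
  note ii = closed_arc.pure_parts[OF ca pu uu]
  have k4: "4 \<le> k" by (rule pure_size(1)[OF closed_arc.inner_rel[OF ca] ii(1) k2(1)])
  have nk4: "4 \<le> n - k" by (rule pure_size(1)[OF closed_arc.outer_rel[OF ca] ii(2) k2(2)])
  have "u mod 2 = parity_of i" using L.mem_r[OF uu] by simp
  then show thesis by (rule that[OF ca v k4 nk4 ii])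
qed

lemma pure_irreducible:
  assumes sr: "slot_rel (parity_of i) (2*n) r" and pu: "pure (2*n) r" and n: "2 \<le> n" "n \<le> 7"
  shows "irreducible (2*n) r"
  unfolding irreducible_def
proof (intro allI impI, rule ccontr)
  fix u v assume c: "closes (2*n) r u v" and nt: "\<not> (u = 0 \<and> v = 2*n)"
  obtain k where "closed_arc i n k u r" "v = u + 2*k" "4 \<le> k" "4 \<le> n - k"
    "pure (2*k) (inner r u (2*k))" "pure (2*(n-k)) (outer r u (2*k))" "u mod 2 = parity_of i"
    by (rule pure_arc[OF sr pu n(1) c nt])
  then show False using n(2) by linarith
qed

lemma sum_irreducible_small:
  assumes n: "2 \<le> n" "n \<le> 7"
  shows "(\<Sum>r\<in>rels_of_type i n {{1..2*n}}. rel_term i n r b) = (\<Sum>P\<in>purely_crossing n. partition_term i n P b)"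
proof -
  have n1: "1 \<le> n" using n by simp
  have "irreducible (2*n) r \<longleftrightarrow> pure (2*n) r" if "slot_rel (parity_of i) (2*n) r" for r
    using irreducible_pure pure_irreducible[OF that _ n] by (rule iffI)
  then have "{r. slot_rel (parity_of i) (2*n) r \<and> irreducible (2*n) r} = {r. slot_rel (parity_of i) (2*n) r \<and> pure (2*n) r}"
    by (intro Collect_cong conj_cong HOL.refl)
  then show ?thesis unfolding rels_irreducible[OF n1] sum_purely_crossing[OF n(1)] by (simp only:)
qed

lemma sum_irreducible_1: "(\<Sum>r\<in>rels_of_type i 1 {{1..2*1}}. rel_term i 1 r b) = tau (b 1) *\<^sub>C 1"
proof -
  have one: "partitions 1 = {{{1}}}"
  proof (intro set_eqI iffI)
    fix P assume P: "P \<in> partitions 1"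
    have S: "S = {1}" if s: "S \<in> P" for S
      using partitionsD(1)[OF P s] partitionsD(3)[OF P s] by (auto simp: subset_singleton_iff)
    obtain S where "S \<in> P" using partitionsD(5)[OF P, of 1] by auto
    then show "P \<in> {{{1}}}" using S by blast
  qed (auto simp: partitions_def partition_on_def disjoint_def)
  have irr: "irreducible (2*1) r" for r
    unfolding irreducible_def
  proof (intro allI impI)
    fix u v assume "closes (2*1) r u v"
    then have "u < v" "v \<le> 2*1" "even (v - u)" unfolding closes_def by blast+
    then show "u = 0 \<and> v = 2*1" by presburger
  qed
  have eq: "rels_of_type i 1 {{1..2*1}} = slot_rel_of (parity_of i) ` partitions 1"
    unfolding rels_irreducible[OF order_refl]
      bij_betw_imp_surj_on[OF bij_slot_rel_of[of "parity_of i" 1, OF parity_of_simps(3)]]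
    by (simp only: irr simp_thms)
  have m: "{{1}} \<in> partitions 1" unfolding one by simp
  have "(\<Sum>r\<in>rels_of_type i 1 {{1..2*1}}. rel_term i 1 r b) = partition_term i 1 {{1}} b"
    unfolding eq unfolding one using rel_term_slot_rel_of[OF m, of i b] by simp
  also have "\<dots> = tau (b 1) *\<^sub>C 1"
  proof -
    have bl: "block {{Suc 0}} (Suc 0) = {Suc 0}" unfolding block_def by (rule the_equality) auto
    have J: "J_set {{Suc 0}} = {}" by (simp add: J_set_def)
    show ?thesis by (cases i) (simp_all add: partition_term_def Lambda_map_def Gamma_map_def J bl cscale_algebra)
  qed
  finally show ?thesis .
qed

lemma pi4_slots:
  "slot_rel (parity_of i) (2*4) (slot_rel_of (parity_of i) pi4)"
  "irreducible (2*4) (slot_rel_of (parity_of i) pi4)"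
proof -
  interpret L: partition_slots i 4 pi4
    by (rule partition_slots.intro[OF purely_crossingD(1)[OF pi4_purely_crossing]]) simp
  show sr: "slot_rel (parity_of i) (2*4) (slot_rel_of (parity_of i) pi4)" by (rule L.slot_rel_axioms)
  have "pure (2*4) (slot_rel_of (parity_of i) pi4)"
    by (rule iffD1[OF L.purely_crossing_iff pi4_purely_crossing]) simp
  then show "irreducible (2*4) (slot_rel_of (parity_of i) pi4)" by (rule pure_irreducible[OF sr]) simp_all
qed

text \<open>
  The four ways to insert the crossing \<open>{{1,3},{2,4}}\<close> into itself at a slot. The
  inner word starts at a slot, whence its slots are the even points.
\<close>

definition nested_crossing :: "idx \<Rightarrow> nat \<Rightarrow> (nat \<times> nat) set" where
  "nested_crossing i w =
     glue (2*8) (2*w - 2 + parity_of i) (2*4) (slot_rel_of (parity_of i) pi4) (slot_rel_of 0 pi4)"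

lemma nested_position:
  assumes "w \<in> {1..4}" "p = 2*w - 2 + parity_of i"
  shows "p \<le> 7" "p mod 2 = parity_of i" "(parity_of i + p) mod 2 = 0" "shift_idx i p = Plain"
proof -
  obtain w' where "w = Suc w'" using assms(1) by (cases w) auto
  then have "p = 2 * w' + parity_of i" "w' \<le> 3" using assms by simp_all
  then show "p \<le> 7" "p mod 2 = parity_of i" "(parity_of i + p) mod 2 = 0" "shift_idx i p = Plain"
    by (cases i; simp add: shift_idx_def)+
qed

lemma nested_crossing:
  assumes w: "w \<in> {1..4}" and p: "p = 2*w - 2 + parity_of i"
  shows "closed_arc i 8 4 p (nested_crossing i w)"
    and "inner (nested_crossing i w) p (2*4) = slot_rel_of 0 pi4"
    and "outer (nested_crossing i w) p (2*4) = slot_rel_of (parity_of i) pi4"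
proof -
  note pos = nested_position[OF w p]
  have p8: "p + 2*4 \<le> 2*8" using pos(1) by simp
  have r1: "slot_rel (parity_of i) (2*8 - 2*4) (slot_rel_of (parity_of i) pi4)"
    using pi4_slots(1)[of i] by simp
  have r2: "slot_rel ((parity_of i + p) mod 2) (2*4) (slot_rel_of 0 pi4)"
    unfolding pos(3) using pi4_slots(1)[of Plain] by (simp only: parity_of_simps)
  have G: "even (2*8 :: nat)" "0 < (2*4 :: nat)" "2*4 < (2*8 :: nat)" by simp_all
  note gp = glue_props[OF r1 r2 parity_of_simps(3) G(1) p8 G(2,3)]
  show "closed_arc i 8 4 p (nested_crossing i w)"
    unfolding nested_crossing_def p[symmetric] by (rule closed_arc.intro[OF gp(1) _ _ gp(2)]) simp_all
  show "inner (nested_crossing i w) p (2*4) = slot_rel_of 0 pi4"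
    unfolding nested_crossing_def p[symmetric] by (rule gp(4))
  show "outer (nested_crossing i w) p (2*4) = slot_rel_of (parity_of i) pi4"
    unfolding nested_crossing_def p[symmetric] by (rule gp(3))
qed

text \<open>
  An arc inside the window or outside of it is an arc of one of the irreducible parts. All other
  positions relative to the window of length \<open>8\<close> reduce to these by the exchange
  rules. If the window begins at the point \<open>0\<close>, its complement is an arc, too.
\<close>

lemma nested_crossing_arcs:
  assumes w: "w \<in> {1..4}" and p: "p = 2*w - 2 + parity_of i"
    and a: "closes (2*8) (nested_crossing i w) u v"
  shows "u = 0 \<and> v = 16 \<or> u = p \<and> v = p + 8 \<or> p = 0 \<and> u = 8 \<and> v = 16"
proof -
  let ?R = "nested_crossing i w"
  note N = nested_crossing[OF w p]
  interpret L: closed_arc i 8 4 p ?R by (rule N(1))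
  have p7: "p \<le> 7" by (rule nested_position(1)[OF w p])
  have c: "closes (2*8) ?R p (p + 2*4)" by (rule L.c)
  then have c8: "closes (2*8) ?R p (p + 8)" by simp
  have irrI: "irreducible (2*4) (slot_rel_of 0 pi4)" using pi4_slots(2)[of Plain] by (simp only: parity_of_simps)
  have ins: "u = p \<and> v = p + 8" if uv: "closes (2*8) ?R u v" "p \<le> u" "v \<le> p + 8" for u v
  proof -
    have b: "u < v" using closes_bounds[OF uv(1)] by simp
    have h: "u - p < v - p" "v - p \<le> 2*4" "p + (u - p) = u" "p + (v - p) = v" using uv(2,3) b by simp_all
    have "closes (2*4) (inner ?R p (2*4)) (u - p) (v - p)"
      by (rule iffD2[OF L.closes_inner[OF c h(1,2)]]) (simp only: h(3,4) uv(1))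
    then have "u - p = 0 \<and> v - p = 2*4" using irrI unfolding irreducible_def N(2) by blast
    then show ?thesis using h(3,4) by simp
  qed
  have out: "v = 16 \<and> (if p = 0 then u = 8 else u = 0)"
    if uv: "closes (2*8) ?R u v" "u < p \<or> p + 8 \<le> u" "v \<le> p \<or> p + 8 < v" for u v
  proof -
    define u' v' where "u' = (if u < p then u else u - 8)" and "v' = (if v \<le> p then v else v - 8)"
    have b: "u < v" "v \<le> 16" using closes_bounds[OF uv(1)] by simp_all
    have h: "u' < v'" "v' \<le> 2*8 - 2*4" using b uv(2,3) p7 by (auto simp: u'_def v'_def)
    have lift: "(if u' < p then u' else u' + 2*4) = u" "(if v' \<le> p then v' else v' + 2*4) = v"
      using uv(2,3) p7 by (auto simp: u'_def v'_def)
    have "closes (2*8 - 2*4) (outer ?R p (2*4)) u' v'"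
      by (rule iffD2[OF L.closes_outer[OF c _ h]]) (simp, simp only: lift uv(1))
    moreover have "2*8 - 2*4 = (2*4 :: nat)" by simp
    ultimately have "closes (2*4) (slot_rel_of (parity_of i) pi4) u' v'" unfolding N(3) by (simp only:)
    then have "u' = 0 \<and> v' = 2*4" using pi4_slots(2)[of i] unfolding irreducible_def by blast
    then show ?thesis using uv(2,3) b p7 by (auto simp: u'_def v'_def split: if_splits)
  qed
  have b: "u < v" "v \<le> 16" using closes_bounds[OF a] by simp_all
  \<comment> \<open>Inside, outside, sharing the left end, crossing on the right, sharing the
    right end, crossing on the left.\<close>
  have "p \<le> u \<and> v \<le> p + 8 \<or> (u < p \<or> p + 8 \<le> u) \<and> (v \<le> p \<or> p + 8 < v) \<or> u = p \<and> p + 8 < v \<or>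
    (p < u \<and> u < p + 8 \<and> p + 8 < v) \<or> u < p \<and> v = p + 8 \<or> (u < p \<and> p < v \<and> v < p + 8)"
    using b by linarith
  then consider "p \<le> u" "v \<le> p + 8" | "u < p \<or> p + 8 \<le> u" "v \<le> p \<or> p + 8 < v" | "u = p" "p + 8 < v"
    | "p < u" "u < p + 8" "p + 8 < v" | "u < p" "v = p + 8" | "u < p" "p < v" "v < p + 8" by blast
  then show ?thesis
  proof cases
    case 1
    then show ?thesis using ins[OF a] by blast
  next
    case 2
    then show ?thesis using out[OF a 2] by (cases "p = 0") simp_all
  next
    case 3
    have "closes (2*8) ?R (p + 8) v" by (rule L.arc_left[OF _ c8 3(2)]) (use a 3(1) in simp)
    from out[OF this] have "v = 16 \<and> (if p = 0 then p + 8 = 8 else p + 8 = 0)" using 3(2) by simp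
    then show ?thesis using 3(1) by (cases "p = 0") simp_all
  next
    case 4
    have "closes (2*8) ?R p u" by (rule L.arc_cross[OF c8 a 4])
    from ins[OF this] show ?thesis using 4 by simp
  next
    case 5
    have "closes (2*8) ?R u p" by (rule L.arc_right[OF _ c8 5(1)]) (use a 5(2) in simp)
    from out[OF this] show ?thesis using 5(1) p7 by simp
  next
    case 6
    have "closes (2*8) ?R u p" by (rule L.arc_cross[OF a c8 6])
    from out[OF this] show ?thesis using 6(1) p7 by simp
  qed
qed

lemma nested_crossing_pure:
  assumes w: "w \<in> {1..4}"
  shows "pure (2*8) (nested_crossing i w)"
  unfolding pure_def
proof (intro allI impI)
  fix u v assume a: "closes (2*8) (nested_crossing i w) u v"
  define p where p: "p = 2*w - 2 + parity_of i"
  interpret L: closed_arc i 8 4 p "nested_crossing i w" by (rule nested_crossing(1)[OF w p])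
  note pos = nested_position[OF w p]
  have A: "(x, x) \<in> nested_crossing i w" if "x mod 2 = parity_of i" "x < 2*8" for x
    using L.refl_r that by simp
  have pp: "(p, p) \<in> nested_crossing i w" by (rule A) (use pos in simp_all)
  have p0: "(8, 8) \<in> nested_crossing i w" if "p = 0" by (rule A) (use pos(2) that in simp_all)
  show "u = 0 \<and> v = 2*8 \<or> (u, u) \<in> nested_crossing i w \<and> v - u \<noteq> 2 \<and> v - u \<noteq> 2*8 - 2"
    using nested_crossing_arcs[OF w p a] pp p0 by auto
qed

lemma nested_crossing_arc:
  assumes w: "w \<in> {1..4}"
  shows "closes (2*8) (nested_crossing i w) (2*w - 2 + parity_of i) (2*w - 2 + parity_of i + 8)"
  using closed_arc.c[OF nested_crossing(1)[OF w HOL.refl, of i]] by simp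

lemma nested_crossing_reducible:
  assumes w: "w \<in> {1..4}"
  shows "\<not> irreducible (2*8) (nested_crossing i w)"
proof
  assume "irreducible (2*8) (nested_crossing i w)"
  then have "2*w - 2 + parity_of i = 0 \<and> 2*w - 2 + parity_of i + 8 = 2*8"
    using nested_crossing_arc[OF w, of i] unfolding irreducible_def by blast
  then show False by linarith
qed

text \<open>
  The start of the window can be read off from the arcs: it is the only arc of length
  \<open>8\<close> which starts before the point \<open>8\<close>.
\<close>

lemma inj_nested_crossing: "inj_on (nested_crossing i) {1..4}"
proof (rule inj_onI)
  fix w w' assume w: "w \<in> {1..4}" "w' \<in> {1..4}" and eq: "nested_crossing i w = nested_crossing i w'"
  have "2*w' - 2 + parity_of i \<le> 7" by (rule nested_position(1)[OF w(2) HOL.refl])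
  moreover note nested_crossing_arcs[OF w(1) HOL.refl, of i, unfolded eq, OF nested_crossing_arc[OF w(2)]]
  ultimately have "2*w' - 2 + parity_of i = 2*w - 2 + parity_of i" by linarith
  then show "w = w'" using w by auto
qed

lemma pure_arc_nested:
  assumes sr: "slot_rel (parity_of i) (2*8) r" and pu: "pure (2*8) r"
    and c: "closes (2*8) r u v" and nt: "\<not> (u = 0 \<and> v = 2*8)" and u: "u \<le> 7"
  shows "\<exists>w\<in>{1..4}. r = nested_crossing i w"
proof -
  have two8: "2 \<le> (8::nat)" by simp
  obtain k where K: "closed_arc i 8 k u r" "v = u + 2*k" "4 \<le> k" "4 \<le> 8 - k"
    "pure (2*k) (inner r u (2*k))" "pure (2*(8-k)) (outer r u (2*k))" "u mod 2 = parity_of i"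
    by (rule pure_arc[OF sr pu two8 c nt])
  have k4: "k = 4" using K(3,4) by linarith
  interpret L: closed_arc i 8 4 u r using K(1) unfolding k4 .
  have e: "(parity_of i + u) mod 2 = 0" unfolding K(7)[symmetric] by presburger
  have in4: "inner r u (2*4) = slot_rel_of 0 pi4"
  proof -
    have "inner r u (2*4) = slot_rel_of (parity_of (shift_idx i u)) pi4"
      by (rule pure_size(2)[OF L.inner_rel _ _ HOL.refl]) (use K(5) k4 in simp_all)
    then show ?thesis by (simp only: parity_of_shift e)
  qed
  have out4: "outer r u (2*4) = slot_rel_of (parity_of i) pi4"
  proof -
    have s: "slot_rel (parity_of i) (2*4) (outer r u (2*4))" using L.outer_rel by simp
    show ?thesis by (rule pure_size(2)[OF s _ _ HOL.refl]) (use K(6) k4 in simp_all)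
  qed
  \<comment> \<open>The slots before the point \<open>8\<close> are numbered by
    \<open>w\<close>.\<close>
  define w where "w = u div 2 + 1"
  have wu: "2*w - 2 + parity_of i = u" unfolding w_def K(7)[symmetric] by presburger
  have "w \<le> 4" "1 \<le> w" using u unfolding w_def by presburger+
  then have w4: "w \<in> {1..4}" by simp
  have "glue (2*8) u (2*4) (outer r u (2*4)) (inner r u (2*4)) = r" by (rule L.glue_outer_inner[OF L.c]) simp
  then have "nested_crossing i w = r" unfolding nested_crossing_def wu in4 out4 .
  then show ?thesis using w4 by blast
qed

lemma pure_reducible_nested:
  assumes sr: "slot_rel (parity_of i) (2*8) r" and pu: "pure (2*8) r" and red: "\<not> irreducible (2*8) r"
  shows "\<exists>w\<in>{1..4}. r = nested_crossing i w"
proof -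
  interpret L: slot_rel "parity_of i" "2*8" r by (rule sr)
  obtain u v where c: "closes (2*8) r u v" and nt: "\<not> (u = 0 \<and> v = 2*8)"
    using red unfolding irreducible_def by blast
  show ?thesis
  proof (cases "u \<le> 7")
    case True
    show ?thesis by (rule pure_arc_nested[OF sr pu c nt True])
  next
    case False
    have two8: "2 \<le> (8::nat)" by simp
    obtain k where K: "closed_arc i 8 k u r" "v = u + 2*k" "4 \<le> k" "4 \<le> 8 - k"
      "pure (2*k) (inner r u (2*k))" "pure (2*(8-k)) (outer r u (2*k))" "u mod 2 = parity_of i"
      by (rule pure_arc[OF sr pu two8 c nt])
    have uv: "u = 8" "v = 2*8" using K(2,3) False closes_bounds[OF c] by linarith+
    \<comment> \<open>The arc from \<open>8\<close> to \<open>16\<close> is exchanged for its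
      complement, which begins before the point \<open>8\<close>.\<close>
    have full: "closes (2*8) r 0 (2*8)" by (rule L.arc_full) simp
    have "closes (2*8) r 0 8" by (rule L.arc_right[OF full c[unfolded uv]]) simp
    then show ?thesis by (rule pure_arc_nested[OF sr pu]) simp_all
  qed
qed

text \<open>
  The purely crossing partitions of size eight are the irreducible ones and the four
  self-insertions of the crossing.
\<close>

lemma sum_irreducible_8:
  "(\<Sum>r\<in>rels_of_type i 8 {{1..2*8}}. rel_term i 8 r b) =
   (\<Sum>P\<in>purely_crossing 8. partition_term i 8 P b) - (\<Sum>w\<in>{1..4}. rel_term i 8 (nested_crossing i w) b)"
proof -
  let ?I = "{r. slot_rel (parity_of i) (2*8) r \<and> irreducible (2*8) r}"
    and ?P = "{r. slot_rel (parity_of i) (2*8) r \<and> pure (2*8) r}"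
    and ?N = "nested_crossing i ` {1..4}"
  have srN: "slot_rel (parity_of i) (2*8) (nested_crossing i w)" if "w \<in> {1..4}" for w
    by (rule closed_arc.r[OF nested_crossing(1)[OF that HOL.refl]])
  have un: "?P = ?I \<union> ?N"
  proof (intro subset_antisym subsetI)
    fix r assume r: "r \<in> ?P"
    show "r \<in> ?I \<union> ?N"
    proof (cases "irreducible (2*8) r")
      case False
      then have "\<exists>w\<in>{1..4}. r = nested_crossing i w" using r by (intro pure_reducible_nested) simp_all
      then show ?thesis by blast
    qed (use r in simp)
  next
    fix r assume "r \<in> ?I \<union> ?N"
    then show "r \<in> ?P"
    proof
      assume "r \<in> ?I"
      then show ?thesis using irreducible_pure by blast
    next
      assume "r \<in> ?N"
      then obtain w where w: "r = nested_crossing i w" "w \<in> {1..4}" by (rule imageE)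
      show ?thesis unfolding w(1) mem_Collect_eq by (rule conjI[OF srN[OF w(2)] nested_crossing_pure[OF w(2)]])
    qed
  qed
  have dis: "?I \<inter> ?N = {}" using nested_crossing_reducible[of _ i] by blast
  have fin: "finite ?I" by (rule finite_subset[OF _ finite_slot_rels[of i 8]]) blast
  have "(\<Sum>r\<in>?P. rel_term i 8 r b) = (\<Sum>r\<in>?I. rel_term i 8 r b) + (\<Sum>r\<in>?N. rel_term i 8 r b)"
    unfolding un by (rule sum.union_disjoint[OF fin _ dis]) simp
  moreover have "(\<Sum>r\<in>?N. rel_term i 8 r b) = (\<Sum>w\<in>{1..4}. rel_term i 8 (nested_crossing i w) b)"
    unfolding sum.reindex[OF inj_nested_crossing] o_def ..
  moreover have "(\<Sum>P\<in>purely_crossing 8. partition_term i 8 P b) = (\<Sum>r\<in>?P. rel_term i 8 r b)"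
    by (rule sum_purely_crossing) simp
  moreover have "rels_of_type i 8 {{1..2*8}} = ?I" by (rule rels_irreducible) simp
  ultimately show ?thesis by (simp only: add_diff_cancel_right')
qed

lemma partition_term_pi4:
  "partition_term Star 4 pi4 b = (tau (b 1 * b 5) * tau (b 3 * b 7)) *\<^sub>C Lambda_map pi4 [b 2, b 4, b 6]"
  "partition_term Plain 4 pi4 b = (tau (Lambda_map pi4 [b 1, b 3, b 5] * b 7) * tau (b 2 * b 6)) *\<^sub>C b 4"
proof -
  have m3: "map f [1..<4] = [f 1, f 2, f 3]" and m4: "map f [1..<4+1] = [f 1, f 2, f 3, f 4]" for f :: "nat \<Rightarrow> C01"
    by (simp_all add: eval_nat_numeral)
  have P: "pi4 \<in> partitions 4" by (rule purely_crossingD(1)[OF pi4_purely_crossing])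
  have pr: "(\<Prod>S\<in>pi4. f S) = f {1, 3} * f {2, 4}" for f :: "nat set \<Rightarrow> complex"
    unfolding pi4_def by (simp add: doubleton_eq_iff)
  have one4: "1 \<le> (4::nat)" by simp
  show "partition_term Star 4 pi4 b = (tau (b 1 * b 5) * tau (b 3 * b 7)) *\<^sub>C Lambda_map pi4 [b 2, b 4, b 6]"
    unfolding partition_term_def idx.case m3 m4 tau_Gamma_map[OF P one4] pr by simp
  have bl: "block pi4 1 = {1, 3}" unfolding block_def pi4_def by (rule the_equality) auto
  have d: "pi4 - {{1, 3}} = {{2, 4}}" unfolding pi4_def by (auto simp: doubleton_eq_iff)
  show "partition_term Plain 4 pi4 b = (tau (Lambda_map pi4 [b 1, b 3, b 5] * b 7) * tau (b 2 * b 6)) *\<^sub>C b 4"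
    unfolding partition_term_def idx.case m3 Gamma_map_def bl d by (simp add: cscale_algebra)
qed

lemma rel_term_nested_parts:
  assumes w: "w \<in> {1..4}" and p: "p = 2*w - 2 + parity_of i"
  shows "rel_term (shift_idx i p) 4 (inner (nested_crossing i w) p (2*4)) c = partition_term Plain 4 pi4 c"
    and "rel_term i (8 - 4) (outer (nested_crossing i w) p (2*4)) c = partition_term i 4 pi4 c"
proof -
  note N = nested_crossing[OF w p]
  have P: "pi4 \<in> partitions 4" by (rule purely_crossingD(1)[OF pi4_purely_crossing])
  show "rel_term (shift_idx i p) 4 (inner (nested_crossing i w) p (2*4)) c = partition_term Plain 4 pi4 c"
    unfolding N(2) nested_position(4)[OF w p] using rel_term_slot_rel_of[OF P, of Plain c] by (simp only: parity_of_simps)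
  show "rel_term i (8 - 4) (outer (nested_crossing i w) p (2*4)) c = partition_term i 4 pi4 c"
    unfolding N(3) using rel_term_slot_rel_of[OF P, of i c] by simp
qed

text \<open>
  Inserting the inner value at the point \<open>p\<close> of the outer crossing; only for
  \<open>X b\<^sub>1 X\<^sup>* \<dots>\<close> can the window begin at the point
  \<open>0\<close>, where the inner value becomes a factor in front.
\<close>

lemma rel_term_nested_mid:
  assumes w: "w \<in> {1..4}" and p: "p = 2*w - 2 + parity_of i" and p0: "0 < p"
  shows "rel_term i 8 (nested_crossing i w) b =
    partition_term i 4 pi4 (\<lambda>j. if j = p then b p * partition_term Plain 4 pi4 (\<lambda>l. b (p + l)) * b (p + 8)
      else b (skip p 8 j))"
proof -
  interpret L: closed_arc i 8 4 p "nested_crossing i w" by (rule nested_crossing(1)[OF w p])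
  have p8: "p + 2*4 < 2*8" using nested_position(1)[OF w p] by simp
  have e8: "2*4 = (8::nat)" by simp
  show ?thesis unfolding L.rel_term_mid[OF p0 p8] rel_term_nested_parts[OF w p] unfolding e8 ..
qed

lemma rel_term_nested_left:
  "rel_term Plain 8 (nested_crossing Plain 1) b =
    partition_term Plain 4 pi4 b * b 8 * partition_term Plain 4 pi4 (\<lambda>j. b (j + 8))"
proof -
  have w: "(1::nat) \<in> {1..4}" and p: "0 = 2*1 - 2 + parity_of Plain" by simp_all
  interpret L: closed_arc Plain 8 4 0 "nested_crossing Plain 1" by (rule nested_crossing(1)[OF w p])
  have s: "shift_idx Plain 0 = Plain" by (simp add: shift_idx_def)
  show ?thesis
    unfolding L.rel_term_left[OF HOL.refl] rel_term_nested_parts[OF w p, unfolded s] by simp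
qed

lemma rel_term_nested_Star:
  "rel_term Star 8 (nested_crossing Star 1) b =
    (tau (b 1 * b 5 * b 9 * b 13) * tau (b 3 * b 7) * tau (b 11 * b 15)
       * tau (Lambda_map pi4 [b 2, b 4, b 6] * b 8)) *\<^sub>C Lambda_map pi4 [b 10, b 12, b 14]"
  "rel_term Star 8 (nested_crossing Star 2) b =
    (tau (b 1 * b 13) * tau (b 3 * b 7 * b 11 * b 15) * tau (b 5 * b 9)
       * tau (Lambda_map pi4 [b 4, b 6, b 8] * b 10)) *\<^sub>C Lambda_map pi4 [b 2, b 12, b 14]"
  "rel_term Star 8 (nested_crossing Star 3) b =
    (tau (b 1 * b 5 * b 9 * b 13) * tau (b 3 * b 15) * tau (b 7 * b 11)
       * tau (Lambda_map pi4 [b 6, b 8, b 10] * b 12)) *\<^sub>C Lambda_map pi4 [b 2, b 4, b 14]"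
  "rel_term Star 8 (nested_crossing Star 4) b =
    (tau (b 1 * b 5) * tau (b 3 * b 7 * b 11 * b 15) * tau (b 9 * b 13)
       * tau (Lambda_map pi4 [b 8, b 10, b 12] * b 14)) *\<^sub>C Lambda_map pi4 [b 2, b 4, b 6]"
proof (goal_cases)
  case 1
  show ?case by (subst rel_term_nested_mid[where p = 1])
    (simp_all add: partition_term_pi4 skip_def cscale_algebra tau_scale mult_ac
      flip: numeral_2_eq_2)
next
  case 2
  show ?case by (subst rel_term_nested_mid[where p = 3])
    (simp_all add: partition_term_pi4 skip_def cscale_algebra tau_scale mult_ac
      flip: numeral_2_eq_2)
next
  case 3
  show ?case by (subst rel_term_nested_mid[where p = 5])
    (simp_all add: partition_term_pi4 skip_def cscale_algebra tau_scale mult_ac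
      flip: numeral_2_eq_2)
next
  case 4
  show ?case by (subst rel_term_nested_mid[where p = 7])
    (simp_all add: partition_term_pi4 skip_def cscale_algebra tau_scale mult_ac
      flip: numeral_2_eq_2)
qed

lemma rel_term_nested_Plain:
  "rel_term Plain 8 (nested_crossing Plain 1) b =
    (tau (b 2 * b 6) * tau (b 10 * b 14) * tau (Lambda_map pi4 [b 1, b 3, b 5] * b 7)
       * tau (Lambda_map pi4 [b 9, b 11, b 13] * b 15)) *\<^sub>C (b 4 * b 8 * b 12)"
  "rel_term Plain 8 (nested_crossing Plain 2) b =
    (tau (b 2 * b 6 * b 10 * b 14) * tau (b 4 * b 8) * tau (Lambda_map pi4 [b 1, b 11, b 13] * b 15)
       * tau (Lambda_map pi4 [b 3, b 5, b 7] * b 9)) *\<^sub>C b 12"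
  "rel_term Plain 8 (nested_crossing Plain 3) b =
    (tau (b 2 * b 14) * tau (b 6 * b 10) * tau (Lambda_map pi4 [b 1, b 3, b 13] * b 15)
       * tau (Lambda_map pi4 [b 5, b 7, b 9] * b 11)) *\<^sub>C (b 4 * b 8 * b 12)"
  "rel_term Plain 8 (nested_crossing Plain 4) b =
    (tau (b 2 * b 6 * b 10 * b 14) * tau (b 8 * b 12) * tau (Lambda_map pi4 [b 1, b 3, b 5] * b 15)
       * tau (Lambda_map pi4 [b 7, b 9, b 11] * b 13)) *\<^sub>C b 4"
proof (goal_cases)
  case 1
  show ?case unfolding rel_term_nested_left by (simp add: partition_term_pi4 cscale_algebra mult_ac)
next
  case 2
  show ?case by (subst rel_term_nested_mid[where p = 2])
    (simp_all add: partition_term_pi4 skip_def cscale_algebra tau_scale mult_ac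
      flip: numeral_2_eq_2)
next
  case 3
  show ?case by (subst rel_term_nested_mid[where p = 4])
    (simp_all add: partition_term_pi4 skip_def cscale_algebra tau_scale mult_ac
      flip: numeral_2_eq_2)
next
  case 4
  show ?case by (subst rel_term_nested_mid[where p = 6])
    (simp_all add: partition_term_pi4 skip_def cscale_algebra tau_scale mult_ac
      flip: numeral_2_eq_2)
qed

theorem proposition4p14:
  fixes E :: "ncpoly \<Rightarrow> C01" and \<alpha> :: cumulant_family
  assumes "is_distribution E" and "is_cumulant_family E \<alpha>"
  shows
    "(\<forall>b. alpha1 \<alpha> 1 b = tau (b 1) *\<^sub>C 1 \<and> alpha2 \<alpha> 1 b = tau (b 1) *\<^sub>C 1) \<and>
     (\<forall>n\<in>{2,3,4,5,6,7}. \<forall>b.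
        alpha1 \<alpha> n b =
          (\<Sum>P\<in>purely_crossing n.
             tau (Lambda_map P (map (\<lambda>k. b (2*k-1)) [1..<n]) * b (2*n-1)) *\<^sub>C
             Gamma_map P (1 # map (\<lambda>k. b (2*k)) [1..<n])) \<and>
        alpha2 \<alpha> n b =
          (\<Sum>P\<in>purely_crossing n.
             tau (Gamma_map P (map (\<lambda>k. b (2*k-1)) [1..<n+1])) *\<^sub>C
             Lambda_map P (map (\<lambda>k. b (2*k)) [1..<n]))) \<and>
     (\<forall>n\<in>{2,3,5}. \<forall>b. alpha1 \<alpha> n b = 0 \<and> alpha2 \<alpha> n b = 0) \<and>
     (\<forall>b.
        alpha1 \<alpha> 8 b =
          (\<Sum>P\<in>purely_crossing 8.
             tau (Lambda_map P (map (\<lambda>k. b (2*k-1)) [1..<8]) * b 15) *\<^sub>C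
             Gamma_map P (1 # map (\<lambda>k. b (2*k)) [1..<8]))
          - (tau (b 2 * b 6) * tau (b 10 * b 14) * tau (Lambda_map pi4 [b 1, b 3, b 5] * b 7)
               * tau (Lambda_map pi4 [b 9, b 11, b 13] * b 15)) *\<^sub>C (b 4 * b 8 * b 12)
          - (tau (b 2 * b 6 * b 10 * b 14) * tau (b 8 * b 12) * tau (Lambda_map pi4 [b 1, b 3, b 5] * b 15)
               * tau (Lambda_map pi4 [b 7, b 9, b 11] * b 13)) *\<^sub>C b 4
          - (tau (b 2 * b 14) * tau (b 6 * b 10) * tau (Lambda_map pi4 [b 1, b 3, b 13] * b 15)
               * tau (Lambda_map pi4 [b 5, b 7, b 9] * b 11)) *\<^sub>C (b 4 * b 8 * b 12)
          - (tau (b 2 * b 6 * b 10 * b 14) * tau (b 4 * b 8) * tau (Lambda_map pi4 [b 1, b 11, b 13] * b 15)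
               * tau (Lambda_map pi4 [b 3, b 5, b 7] * b 9)) *\<^sub>C b 12 \<and>
        alpha2 \<alpha> 8 b =
          (\<Sum>P\<in>purely_crossing 8.
             tau (Gamma_map P (map (\<lambda>k. b (2*k-1)) [1..<9])) *\<^sub>C
             Lambda_map P (map (\<lambda>k. b (2*k)) [1..<8]))
          - (tau (b 1 * b 5 * b 9 * b 13) * tau (b 3 * b 7) * tau (b 11 * b 15)
               * tau (Lambda_map pi4 [b 2, b 4, b 6] * b 8)) *\<^sub>C Lambda_map pi4 [b 10, b 12, b 14]
          - (tau (b 1 * b 13) * tau (b 3 * b 7 * b 11 * b 15) * tau (b 5 * b 9)
               * tau (Lambda_map pi4 [b 4, b 6, b 8] * b 10)) *\<^sub>C Lambda_map pi4 [b 2, b 12, b 14]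
          - (tau (b 1 * b 5 * b 9 * b 13) * tau (b 3 * b 15) * tau (b 7 * b 11)
               * tau (Lambda_map pi4 [b 6, b 8, b 10] * b 12)) *\<^sub>C Lambda_map pi4 [b 2, b 4, b 14]
          - (tau (b 1 * b 5) * tau (b 3 * b 7 * b 11 * b 15) * tau (b 9 * b 13)
               * tau (Lambda_map pi4 [b 8, b 10, b 12] * b 14)) *\<^sub>C Lambda_map pi4 [b 2, b 4, b 6])"
proof -
  interpret vandermonde_cumulants E \<alpha> by (rule vandermonde_cumulants.intro) (fact assms)+
  have alt: "alternating_cumulant \<alpha> i n b = \<alpha> (alt_word i (2*n)) (map b [1..<2*n])" for i n b
    by (simp only: alternating_cumulant_def alt_word_def)
  have one: "alternating_cumulant \<alpha> i 1 b = tau (b 1) *\<^sub>C 1" for i b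
    by (simp only: alt even_cumulant[OF order_refl] sum_irreducible_1)
  have small: "alternating_cumulant \<alpha> i n b = (\<Sum>P\<in>purely_crossing n. partition_term i n P b)"
    if n: "2 \<le> n" "n \<le> 7" for i n b
  proof -
    have n1: "1 \<le> n" using n by simp
    show ?thesis unfolding alt even_cumulant[OF n1] by (rule sum_irreducible_small[OF n])
  qed
  have n8: "1 \<le> (8::nat)" by simp
  have four: "(\<Sum>w\<in>{1..4}. f w) = f 1 + f 2 + f 3 + f 4" for f :: "nat \<Rightarrow> C01"
  proof -
    have "{1..4} = {1, 2, 3, 4 :: nat}" by auto
    then show ?thesis by (simp add: add.assoc)
  qed
  let ?T = "\<lambda>i w b. rel_term i 8 (nested_crossing i w) b"
  have eight: "alternating_cumulant \<alpha> i 8 b =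
    (\<Sum>P\<in>purely_crossing 8. partition_term i 8 P b) - (?T i 1 b + ?T i 2 b + ?T i 3 b + ?T i 4 b)" for i b
    unfolding alt even_cumulant[OF n8] sum_irreducible_8 four ..
  have diff: "s - (x + y + z + w) = s - x - y - z - w" "s - (x + y + z + w) = s - x - w - z - y" for s x y z w :: C01
    by (simp_all add: algebra_simps)
  have eightP: "alpha1 \<alpha> 8 b = (\<Sum>P\<in>purely_crossing 8. partition_term Plain 8 P b)
      - ?T Plain 1 b - ?T Plain 4 b - ?T Plain 3 b - ?T Plain 2 b" for b
    unfolding eight by (rule diff(2))
  have eightS: "alpha2 \<alpha> 8 b = (\<Sum>P\<in>purely_crossing 8. partition_term Star 8 P b)
      - ?T Star 1 b - ?T Star 2 b - ?T Star 3 b - ?T Star 4 b" for b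
    unfolding eight by (rule diff(1))
  have pt: "(\<Sum>P\<in>purely_crossing 8. partition_term Plain 8 P b) = (\<Sum>P\<in>purely_crossing 8.
             tau (Lambda_map P (map (\<lambda>k. b (2*k-1)) [1..<8]) * b 15) *\<^sub>C
             Gamma_map P (1 # map (\<lambda>k. b (2*k)) [1..<8]))"
    "(\<Sum>P\<in>purely_crossing 8. partition_term Star 8 P b) = (\<Sum>P\<in>purely_crossing 8.
             tau (Gamma_map P (map (\<lambda>k. b (2*k-1)) [1..<9])) *\<^sub>C
             Lambda_map P (map (\<lambda>k. b (2*k)) [1..<8]))" for b
    by (simp_all add: partition_term_def)
  show ?thesis
  proof (intro conjI allI ballI)
    fix b
    show "alpha1 \<alpha> 1 b = tau (b 1) *\<^sub>C 1" "alpha2 \<alpha> 1 b = tau (b 1) *\<^sub>C 1" by (rule one)+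
  next
    fix n :: nat and b assume "n \<in> {2,3,4,5,6,7}"
    then have n: "2 \<le> n" "n \<le> 7" by auto
    show "alpha1 \<alpha> n b =
          (\<Sum>P\<in>purely_crossing n.
             tau (Lambda_map P (map (\<lambda>k. b (2*k-1)) [1..<n]) * b (2*n-1)) *\<^sub>C
             Gamma_map P (1 # map (\<lambda>k. b (2*k)) [1..<n]))"
      "alpha2 \<alpha> n b =
          (\<Sum>P\<in>purely_crossing n.
             tau (Gamma_map P (map (\<lambda>k. b (2*k-1)) [1..<n+1])) *\<^sub>C
             Lambda_map P (map (\<lambda>k. b (2*k)) [1..<n]))"
      by (simp_all only: small[OF n] partition_term_def idx.case)
  next
    fix n :: nat and b assume n: "n \<in> {2,3,5}"
    then have n27: "2 \<le> n" "n \<le> 7" by auto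
    have "purely_crossing n = {}" using n purely_crossing_small(1,2,3) by auto
    then show "alpha1 \<alpha> n b = 0" "alpha2 \<alpha> n b = 0" by (simp_all only: small[OF n27] sum.empty)
  qed (simp_all only: eightP eightS pt rel_term_nested_Plain rel_term_nested_Star)
qed

end
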